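(* Let $n\in\omega$ and let $U$ be a theory in the language $\mathcal L_{\mathrm{PA}}$ which is consistent with $B\Sigma_n+\neg I\Sigma_n+\exp$. Then $\mathrm{USB}_{id}(\mathcal L_{\mathrm{PA}})$ does not semantically define $\mathrm{US}_{id}(\mathcal L_{\mathrm{PA}})$ modulo $\mathcal L_{\mathrm{PA}}$.
   Context: $\mathcal L_{\mathrm{PA}}=\{0,1,+,\times,<\}$. $I\Sigma_n$ is the usual fragment of $\mathrm{PA}$ with induction for $\Sigma_n$ formulae (standard arithmetical hierarchy; $\Sigma_0=\Delta_0$ are the bounded formulae), $B\Sigma_n$ is $I\Delta_0$ plus collection for $\Sigma_n$ formulae, and $\exp$ says that exponentiation is total. As throughout the paper's treatment of such theories, $U$ is assumed to be a sequential theory (i.e. it directly and parameter-freely interprets adjunctive set theory $\exists x\forall y\,(y\notin x)$, $\forall x\forall y\exists z\forall w\,(w\in z\leftrightarrow w\in x\vee w=y)$, with identity translated as identity and unrelativized quantifiers) for which the identity interpretation $id$ of Buss's arithmetic $S^1_2$ is an interpretation in $U$; syntax is coded by it in the usual way, $\underline{\ulcorner\phi\urcorner}$ being the binary numeral of the Gödel number of $\phi$. $\mathrm{USB}_{id}(\mathcal L_{\mathrm{PA}})$ is $U$ plus $\forall x\,(S(\underline{\ulcorner\phi\urcorner},x)\leftrightarrow\phi(x))$ for all $\mathcal L_{\mathrm{PA}}$-formulae $\phi(x)$, where $S$ is a fresh binary predicate. $\mathrm{US}_{id}(\mathcal L_{\mathrm{PA}})$ is $U$ plus $\forall y\,(\exists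 x\,\phi(x,y)\rightarrow\phi(H(\underline{\ulcorner\phi\urcorner},y),y))$ for all $\mathcal L_{\mathrm{PA}}$-formulae $\phi(x,y)$ with at most $x,y$ free, where $H$ is a fresh binary function symbol. No induction for formulae containing $S$ or $H$ is assumed. A theory $W$ syntactically defines $V$ modulo $\mathcal L$ if $W$ interprets $V$ via a direct (one-dimensional, unrelativized, identity to identity), parameter-free translation which translates every $\mathcal L$-formula to itself (a function symbol is interpreted by a formula defining its graph). $W$ semantically defines $V$ modulo $\mathcal L$ if for every $\mathcal M\models W$ the elementary diagram $\mathrm{ElDiag}(\mathcal M)$ syntactically defines $V$ modulo $\mathcal L_M$ ($\mathcal L$ with constants for all elements of $\mathcal M$); so formulae with parameters from $\mathcal M$ are allowed and may depend on $\mathcal M$. *)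

theory Defs
  imports Main
begin

section \<open>First-order syntax\<close>

text \<open>
  All languages that occur are sublanguages of one universe of symbols.  Bound variables are
  de Bruijn indices.  \<open>Par a\<close> is the constant that names the element \<open>a\<close> of a model; formulae
  of a language without constants for elements contain no \<open>Par\<close>.
\<close>

datatype fsym = Zero | One | Plus | Times | Succ | Half | Len | Smash | HSym
datatype rsym = Less | Leq | Mem | SSym

fun far :: "fsym \<Rightarrow> nat" where
  "far Zero = 0" | "far One = 0" | "far Plus = 2" | "far Times = 2"
| "far Succ = 1" | "far Half = 1" | "far Len = 1" | "far Smash = 2"
| "far HSym = 2"

fun rar :: "rsym \<Rightarrow> nat" where
  "rar Less = 2" | "rar Leq = 2" | "rar Mem = 2" | "rar SSym = 2"

datatype 'a tm = Var nat | Par 'a | Fn fsym "'a tm list"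

datatype 'a fm = Bot | Eq "'a tm" "'a tm" | Rel rsym "'a tm list" | Imp "'a fm" "'a fm" | All "'a fm"

abbreviation Neg :: "'a fm \<Rightarrow> 'a fm" ("\<^bold>\<not> _" [80] 80) where "\<^bold>\<not> p \<equiv> Imp p Bot"
abbreviation Imp_infix :: "'a fm \<Rightarrow> 'a fm \<Rightarrow> 'a fm" (infixr "\<^bold>\<rightarrow>" 55) where "p \<^bold>\<rightarrow> q \<equiv> Imp p q"
abbreviation And :: "'a fm \<Rightarrow> 'a fm \<Rightarrow> 'a fm" (infixr "\<^bold>\<and>" 65) where "p \<^bold>\<and> q \<equiv> \<^bold>\<not> (p \<^bold>\<rightarrow> \<^bold>\<not> q)"
abbreviation Or :: "'a fm \<Rightarrow> 'a fm \<Rightarrow> 'a fm" (infixr "\<^bold>\<or>" 60) where "p \<^bold>\<or> q \<equiv> \<^bold>\<not> p \<^bold>\<rightarrow> q"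
abbreviation Iff :: "'a fm \<Rightarrow> 'a fm \<Rightarrow> 'a fm" (infix "\<^bold>\<leftrightarrow>" 54)
  where "p \<^bold>\<leftrightarrow> q \<equiv> (p \<^bold>\<rightarrow> q) \<^bold>\<and> (q \<^bold>\<rightarrow> p)"
abbreviation Ex :: "'a fm \<Rightarrow> 'a fm" where "Ex p \<equiv> \<^bold>\<not> (All (\<^bold>\<not> p))"
abbreviation Eq_infix :: "'a tm \<Rightarrow> 'a tm \<Rightarrow> 'a fm" (infix "\<doteq>" 75) where "s \<doteq> t \<equiv> Eq s t"
abbreviation less_fm :: "'a tm \<Rightarrow> 'a tm \<Rightarrow> 'a fm" (infix "\<prec>" 75) where "s \<prec> t \<equiv> Rel Less [s, t]"
abbreviation leq_fm :: "'a tm \<Rightarrow> 'a tm \<Rightarrow> 'a fm" (infix "\<preceq>" 75) where "s \<preceq> t \<equiv> Rel Leq [s, t]"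
abbreviation zero_tm :: "'a tm" ("\<zero>") where "\<zero> \<equiv> Fn Zero []"
abbreviation one_tm :: "'a tm" ("\<one>") where "\<one> \<equiv> Fn One []"
abbreviation plus_tm :: "'a tm \<Rightarrow> 'a tm \<Rightarrow> 'a tm" (infixl "\<oplus>" 85) where "s \<oplus> t \<equiv> Fn Plus [s, t]"
abbreviation times_tm :: "'a tm \<Rightarrow> 'a tm \<Rightarrow> 'a tm" (infixl "\<otimes>" 90) where "s \<otimes> t \<equiv> Fn Times [s, t]"

primrec subst_tm :: "(nat \<Rightarrow> 'a tm) \<Rightarrow> 'a tm \<Rightarrow> 'a tm" where
  "subst_tm \<sigma> (Var n) = \<sigma> n"
| "subst_tm \<sigma> (Par a) = Par a"
| "subst_tm \<sigma> (Fn f ts) = Fn f (map (subst_tm \<sigma>) ts)"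

abbreviation lift_tm :: "'a tm \<Rightarrow> 'a tm" where
  "lift_tm \<equiv> subst_tm (\<lambda>n. Var (Suc n))"

primrec subst :: "(nat \<Rightarrow> 'a tm) \<Rightarrow> 'a fm \<Rightarrow> 'a fm" where
  "subst \<sigma> Bot = Bot"
| "subst \<sigma> (Eq s t) = Eq (subst_tm \<sigma> s) (subst_tm \<sigma> t)"
| "subst \<sigma> (Rel r ts) = Rel r (map (subst_tm \<sigma>) ts)"
| "subst \<sigma> (Imp p q) = Imp (subst \<sigma> p) (subst \<sigma> q)"
| "subst \<sigma> (All p) = All (subst (case_nat (Var 0) (\<lambda>n. lift_tm (\<sigma> n))) p)"

definition ren :: "(nat \<Rightarrow> nat) \<Rightarrow> 'a fm \<Rightarrow> 'a fm" where
  "ren \<rho> = subst (\<lambda>n. Var (\<rho> n))"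

text \<open>
  \<open>inst t p\<close> is \<open>p(t)\<close> outside the scope of the variable with index \<open>0\<close> (the other indices drop
  by one); \<open>repl t p\<close> is \<open>p(t)\<close> inside that scope (the other indices stay).
\<close>

definition inst :: "'a tm \<Rightarrow> 'a fm \<Rightarrow> 'a fm" where
  "inst t = subst (case_nat t Var)"

definition repl :: "'a tm \<Rightarrow> 'a fm \<Rightarrow> 'a fm" where
  "repl t = subst (case_nat t (\<lambda>n. Var (Suc n)))"

text \<open>The least \<open>k\<close> such that all free variables have an index below \<open>k\<close>.\<close>

primrec fvb_tm :: "'a tm \<Rightarrow> nat" where
  "fvb_tm (Var n) = Suc n"
| "fvb_tm (Par a) = 0"
| "fvb_tm (Fn f ts) = foldr max (map fvb_tm ts) 0"

primrec fvb :: "'a fm \<Rightarrow> nat" where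
  "fvb Bot = 0"
| "fvb (Eq s t) = max (fvb_tm s) (fvb_tm t)"
| "fvb (Rel r ts) = foldr max (map fvb_tm ts) 0"
| "fvb (Imp p q) = max (fvb p) (fvb q)"
| "fvb (All p) = fvb p - 1"

definition univ_closure :: "'a fm \<Rightarrow> 'a fm" where
  "univ_closure p = (All ^^ fvb p) p"

record 'a lang =
  funs :: "fsym set"
  rels :: "rsym set"
  pars :: "'a set"

primrec tm_in :: "'a lang \<Rightarrow> 'a tm \<Rightarrow> bool" where
  "tm_in L (Var n) \<longleftrightarrow> True"
| "tm_in L (Par a) \<longleftrightarrow> a \<in> pars L"
| "tm_in L (Fn f ts) \<longleftrightarrow> f \<in> funs L \<and> length ts = far f \<and> list_all (tm_in L) ts"

primrec fm_in :: "'a lang \<Rightarrow> 'a fm \<Rightarrow> bool" where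
  "fm_in L Bot \<longleftrightarrow> True"
| "fm_in L (Eq s t) \<longleftrightarrow> tm_in L s \<and> tm_in L t"
| "fm_in L (Rel r ts) \<longleftrightarrow> r \<in> rels L \<and> length ts = rar r \<and> list_all (tm_in L) ts"
| "fm_in L (Imp p q) \<longleftrightarrow> fm_in L p \<and> fm_in L q"
| "fm_in L (All p) \<longleftrightarrow> fm_in L p"

definition sentence_in :: "'a lang \<Rightarrow> 'a fm \<Rightarrow> bool" where
  "sentence_in L p \<longleftrightarrow> fm_in L p \<and> fvb p = 0"

definition theory_in :: "'a lang \<Rightarrow> 'a fm set \<Rightarrow> bool" where
  "theory_in L T \<longleftrightarrow> (\<forall>p\<in>T. sentence_in L p)"


section \<open>Provability and truth\<close>

text \<open>
  A Hilbert calculus for classical logic with equality, used for sets \<open>T\<close> of sentences only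
  (so that the rule \<open>Gen\<close> is sound).
\<close>

inductive provable :: "'a fm set \<Rightarrow> 'a fm \<Rightarrow> bool" (infix "\<turnstile>" 50) for T where
  Ax: "p \<in> T \<Longrightarrow> T \<turnstile> p"
| K: "T \<turnstile> p \<^bold>\<rightarrow> q \<^bold>\<rightarrow> p"
| S: "T \<turnstile> (p \<^bold>\<rightarrow> q \<^bold>\<rightarrow> r) \<^bold>\<rightarrow> (p \<^bold>\<rightarrow> q) \<^bold>\<rightarrow> p \<^bold>\<rightarrow> r"
| DN: "T \<turnstile> \<^bold>\<not> (\<^bold>\<not> p) \<^bold>\<rightarrow> p"
| All_inst: "T \<turnstile> All p \<^bold>\<rightarrow> inst t p"
| All_dist: "T \<turnstile> All (p \<^bold>\<rightarrow> q) \<^bold>\<rightarrow> All p \<^bold>\<rightarrow> All q"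
| All_vac: "T \<turnstile> p \<^bold>\<rightarrow> All (ren Suc p)"
| Refl: "T \<turnstile> t \<doteq> t"
| Leibniz: "T \<turnstile> s \<doteq> t \<^bold>\<rightarrow> inst s p \<^bold>\<rightarrow> inst t p"
| MP: "T \<turnstile> p \<^bold>\<rightarrow> q \<Longrightarrow> T \<turnstile> p \<Longrightarrow> T \<turnstile> q"
| Gen: "T \<turnstile> p \<Longrightarrow> T \<turnstile> All p"

definition consistent :: "'a fm set \<Rightarrow> bool" where
  "consistent T \<longleftrightarrow> \<not> T \<turnstile> Bot"

record 'a model =
  univ :: "'a set"
  fint :: "fsym \<Rightarrow> 'a list \<Rightarrow> 'a"
  rint :: "rsym \<Rightarrow> 'a list \<Rightarrow> bool"

definition model_of_lang :: "'a lang \<Rightarrow> 'a model \<Rightarrow> bool" where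
  "model_of_lang L M \<longleftrightarrow> univ M \<noteq> {} \<and>
     (\<forall>f\<in>funs L. \<forall>as. set as \<subseteq> univ M \<and> length as = far f \<longrightarrow> fint M f as \<in> univ M)"

primrec eval :: "'a model \<Rightarrow> (nat \<Rightarrow> 'a) \<Rightarrow> 'a tm \<Rightarrow> 'a" where
  "eval M e (Var n) = e n"
| "eval M e (Par a) = a"
| "eval M e (Fn f ts) = fint M f (map (eval M e) ts)"

primrec sat :: "'a model \<Rightarrow> (nat \<Rightarrow> 'a) \<Rightarrow> 'a fm \<Rightarrow> bool" where
  "sat M e Bot \<longleftrightarrow> False"
| "sat M e (Eq s t) \<longleftrightarrow> eval M e s = eval M e t"
| "sat M e (Rel r ts) \<longleftrightarrow> rint M r (map (eval M e) ts)"
| "sat M e (Imp p q) \<longleftrightarrow> (sat M e p \<longrightarrow> sat M e q)"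
| "sat M e (All p) \<longleftrightarrow> (\<forall>a\<in>univ M. sat M (case_nat a e) p)"

definition true_in :: "'a model \<Rightarrow> 'a fm \<Rightarrow> bool" where
  "true_in M p \<longleftrightarrow> (\<forall>e. range e \<subseteq> univ M \<longrightarrow> sat M e p)"

definition models :: "'a lang \<Rightarrow> 'a model \<Rightarrow> 'a fm set \<Rightarrow> bool" where
  "models L M T \<longleftrightarrow> model_of_lang L M \<and> (\<forall>p\<in>T. true_in M p)"

definition with_pars :: "'a lang \<Rightarrow> 'a model \<Rightarrow> 'a lang" where
  "with_pars L M = L\<lparr>pars := univ M\<rparr>"

definition ElDiag :: "'a lang \<Rightarrow> 'a model \<Rightarrow> 'a fm set" where
  "ElDiag L M = {p. sentence_in (with_pars L M) p \<and> true_in M p}"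


section \<open>Direct parameter-free translations and definability\<close>

text \<open>
  A translation assigns to a relation symbol a formula with the \<open>i\<close>-th argument as variable \<open>i\<close>,
  and to a function symbol a formula for its graph, with the value as variable \<open>0\<close> and the
  \<open>i\<close>-th argument as variable \<open>i + 1\<close>.
\<close>

record 'a translation =
  tfun :: "fsym \<Rightarrow> 'a fm"
  trel :: "rsym \<Rightarrow> 'a fm"

definition conj_list :: "'a fm list \<Rightarrow> 'a fm" where
  "conj_list ps = foldr And ps (\<^bold>\<not> Bot)"

text \<open>
  \<open>tr_tm L \<tau> t\<close> translates the graph formula \<open>v = t\<close>, where \<open>v\<close> is variable \<open>0\<close> and
  variable \<open>n\<close> of \<open>t\<close> becomes \<open>n + 1\<close>.  Terms and atomic formulae of \<open>L\<close> are left alone; all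
  others are unnested, with fresh variables \<open>0, \<dots>, k - 1\<close> for the values of the \<open>k\<close> arguments.
\<close>

definition unnest :: "nat \<Rightarrow> 'a fm list \<Rightarrow> 'a fm \<Rightarrow> 'a fm" where
  "unnest d gs p = (let k = length gs in
     (Ex ^^ k) (conj_list (map2 (\<lambda>i g. ren (case_nat i (\<lambda>n. n + k + d)) g) [0..<k] gs) \<^bold>\<and> p))"

primrec tr_tm :: "'a lang \<Rightarrow> 'a translation \<Rightarrow> 'a tm \<Rightarrow> 'a fm" where
  "tr_tm L \<tau> (Var n) = Var 0 \<doteq> Var (Suc n)"
| "tr_tm L \<tau> (Par a) = Var 0 \<doteq> Par a"
| "tr_tm L \<tau> (Fn f ts) = (let k = length ts in
     if tm_in L (Fn f ts) then Var 0 \<doteq> lift_tm (Fn f ts)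
     else unnest 1 (map (tr_tm L \<tau>) ts)
       (if f \<in> funs L then Var k \<doteq> Fn f (map Var [0..<k])
        else ren (case_nat k (\<lambda>i. i)) (tfun \<tau> f)))"

primrec tr :: "'a lang \<Rightarrow> 'a translation \<Rightarrow> 'a fm \<Rightarrow> 'a fm" where
  "tr L \<tau> Bot = Bot"
| "tr L \<tau> (Eq s t) =
     (if fm_in L (Eq s t) then Eq s t
      else unnest 0 [tr_tm L \<tau> s, tr_tm L \<tau> t] (Var 0 \<doteq> Var 1))"
| "tr L \<tau> (Rel r ts) =
     (if fm_in L (Rel r ts) then Rel r ts
      else unnest 0 (map (tr_tm L \<tau>) ts)
        (if r \<in> rels L then Rel r (map Var [0..<length ts]) else trel \<tau> r))"
| "tr L \<tau> (Imp p q) = Imp (tr L \<tau> p) (tr L \<tau> q)"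
| "tr L \<tau> (All p) = All (tr L \<tau> p)"

lemma tr_identity: "fm_in L p \<Longrightarrow> tr L \<tau> p = p"
  by (induction p) auto

definition total_functional :: "nat \<Rightarrow> 'a fm \<Rightarrow> 'a fm" where
  "total_functional k g = (All ^^ k)
     (Ex g \<^bold>\<and>
      All (All (ren (case_nat 1 (\<lambda>i. i + 2)) g \<^bold>\<and> ren (case_nat 0 (\<lambda>i. i + 2)) g
        \<^bold>\<rightarrow> Var 1 \<doteq> Var 0)))"

text \<open>
  \<open>syntactically_defines LW W LV V L\<close>: the theory \<open>W\<close> in the language \<open>LW\<close> syntactically defines
  the theory \<open>V\<close> in the language \<open>LV\<close> modulo \<open>L\<close>.
\<close>

definition translation_into :: "'a lang \<Rightarrow> 'a lang \<Rightarrow> 'a lang \<Rightarrow> 'a translation \<Rightarrow> bool" where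
  "translation_into LW LV L \<tau> \<longleftrightarrow>
     (\<forall>f \<in> funs LV - funs L. fm_in LW (tfun \<tau> f) \<and> fvb (tfun \<tau> f) \<le> far f + 1) \<and>
     (\<forall>r \<in> rels LV - rels L. fm_in LW (trel \<tau> r) \<and> fvb (trel \<tau> r) \<le> rar r)"

definition syntactically_defines ::
    "'a lang \<Rightarrow> 'a fm set \<Rightarrow> 'a lang \<Rightarrow> 'a fm set \<Rightarrow> 'a lang \<Rightarrow> bool" where
  "syntactically_defines LW W LV V L \<longleftrightarrow> (\<exists>\<tau>. translation_into LW LV L \<tau> \<and>
     (\<forall>f \<in> funs LV - funs L. W \<turnstile> total_functional (far f) (tfun \<tau> f)) \<and>
     (\<forall>p\<in>V. W \<turnstile> tr L \<tau> p))"

text \<open>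
  The models range over all models whose universe is a subset of the type \<open>'a\<close>.  All languages
  here are countable, so by the downward Loewenheim-Skolem theorem the choice of an infinite type
  \<open>'a\<close> is immaterial: a translation that works for \<open>ElDiag(N)\<close>, where \<open>N\<close> is a countable
  elementary submodel of \<open>M\<close>, also works for \<open>ElDiag(M)\<close>.
\<close>

definition semantically_defines ::
    "'a lang \<Rightarrow> 'a fm set \<Rightarrow> 'a lang \<Rightarrow> 'a fm set \<Rightarrow> 'a lang \<Rightarrow> bool" where
  "semantically_defines LW W LV V L \<longleftrightarrow> (\<forall>M. models LW M W \<longrightarrow>
     syntactically_defines (with_pars LW M) (ElDiag LW M) LV V (with_pars L M))"


section \<open>Arithmetic\<close>

definition L_PA :: "'a lang" where
  "L_PA = \<lparr>funs = {Zero, One, Plus, Times}, rels = {Less}, pars = {}\<rparr>"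

inductive Delta0 :: "'a fm \<Rightarrow> bool" where
  "fm_in L_PA (Eq s t) \<Longrightarrow> Delta0 (Eq s t)"
| "fm_in L_PA (Rel r ts) \<Longrightarrow> Delta0 (Rel r ts)"
| "Delta0 Bot"
| "Delta0 p \<Longrightarrow> Delta0 q \<Longrightarrow> Delta0 (Imp p q)"
| "tm_in L_PA t \<Longrightarrow> Delta0 p \<Longrightarrow> Delta0 (All (Var 0 \<prec> lift_tm t \<^bold>\<rightarrow> p))"
| "tm_in L_PA t \<Longrightarrow> Delta0 p \<Longrightarrow> Delta0 (Ex (Var 0 \<prec> lift_tm t \<^bold>\<and> p))"

inductive Sigma_fm :: "nat \<Rightarrow> 'a fm \<Rightarrow> bool" and Pi_fm :: "nat \<Rightarrow> 'a fm \<Rightarrow> bool" where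
  "Delta0 p \<Longrightarrow> Sigma_fm 0 p"
| "Delta0 p \<Longrightarrow> Pi_fm 0 p"
| "Pi_fm n p \<Longrightarrow> Sigma_fm (Suc n) p"
| "Sigma_fm n p \<Longrightarrow> Pi_fm (Suc n) p"
| "Sigma_fm (Suc n) p \<Longrightarrow> Sigma_fm (Suc n) (Ex p)"
| "Pi_fm (Suc n) p \<Longrightarrow> Pi_fm (Suc n) (All p)"

text \<open>The discretely ordered semiring axioms.\<close>

definition PA_minus :: "'a fm set" where
  "PA_minus = (let x = Var 0; y = Var 1; z = Var 2 in univ_closure `
    {(x \<oplus> y) \<oplus> z \<doteq> x \<oplus> (y \<oplus> z),
     x \<oplus> y \<doteq> y \<oplus> x,
     (x \<otimes> y) \<otimes> z \<doteq> x \<otimes> (y \<otimes> z),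
     x \<otimes> y \<doteq> y \<otimes> x,
     x \<otimes> (y \<oplus> z) \<doteq> x \<otimes> y \<oplus> x \<otimes> z,
     x \<oplus> \<zero> \<doteq> x,
     x \<otimes> \<zero> \<doteq> \<zero>,
     x \<otimes> \<one> \<doteq> x,
     x \<prec> y \<^bold>\<and> y \<prec> z \<^bold>\<rightarrow> x \<prec> z,
     \<^bold>\<not> (x \<prec> x),
     x \<prec> y \<^bold>\<or> x \<doteq> y \<^bold>\<or> y \<prec> x,
     x \<prec> y \<^bold>\<rightarrow> x \<oplus> z \<prec> y \<oplus> z,
     \<zero> \<prec> z \<^bold>\<and> x \<prec> y \<^bold>\<rightarrow> x \<otimes> z \<prec> y \<otimes> z,
     x \<prec> y \<^bold>\<rightarrow> Ex (Var 1 \<oplus> Var 0 \<doteq> Var 2),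
     \<zero> \<prec> \<one>,
     \<zero> \<prec> x \<^bold>\<rightarrow> \<one> \<prec> x \<^bold>\<or> \<one> \<doteq> x,
     \<zero> \<prec> x \<^bold>\<or> \<zero> \<doteq> x})"

definition induction_axiom :: "'a fm \<Rightarrow> 'a fm" where
  "induction_axiom p =
     univ_closure (inst \<zero> p \<^bold>\<and> All (p \<^bold>\<rightarrow> repl (Var 0 \<oplus> \<one>) p) \<^bold>\<rightarrow> All p)"

definition I_Sigma :: "nat \<Rightarrow> 'a fm set" where
  "I_Sigma n = PA_minus \<union> {induction_axiom p | p. Sigma_fm n p}"

text \<open>
  For \<open>p(y, x, \<dots>)\<close> with \<open>y\<close> as variable \<open>0\<close> and \<open>x\<close> as variable \<open>1\<close>, the closure of
  \<open>\<forall>a ((\<forall>x<a) \<exists>y p \<longrightarrow> \<exists>b (\<forall>x<a) (\<exists>y<b) p)\<close>; the renamings make room for \<open>a\<close> and \<open>b\<close>.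
\<close>

definition collection_axiom :: "'a fm \<Rightarrow> 'a fm" where
  "collection_axiom p = univ_closure (All (
     All (Var 0 \<prec> Var 1 \<^bold>\<rightarrow> Ex (ren (\<lambda>n. if n < 2 then n else n + 1) p))
     \<^bold>\<rightarrow> Ex (All (Var 0 \<prec> Var 2 \<^bold>\<rightarrow>
           Ex (Var 0 \<prec> Var 2 \<^bold>\<and> ren (\<lambda>n. if n < 2 then n else n + 2) p)))))"

definition B_Sigma :: "nat \<Rightarrow> 'a fm set" where
  "B_Sigma n = I_Sigma 0 \<union> {collection_axiom p | p. Sigma_fm n p}"

text \<open>Goedel's beta function: \<open>w\<close> is the remainder of \<open>u\<close> modulo \<open>1 + (i + 1) v\<close>.\<close>

definition beta_fm :: "'a tm \<Rightarrow> 'a tm \<Rightarrow> 'a tm \<Rightarrow> 'a tm \<Rightarrow> 'a fm" where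
  "beta_fm u v i w = (let m = \<one> \<oplus> (i \<oplus> \<one>) \<otimes> v in
     w \<prec> m \<^bold>\<and> Ex (lift_tm u \<doteq> Var 0 \<otimes> lift_tm m \<oplus> lift_tm w))"

text \<open>
  \<open>\<forall>x \<forall>y \<exists>z z = x\<^sup>y\<close>, the graph being given by a \<open>beta\<close>-coded sequence
  \<open>x\<^sup>0, \<dots>, x\<^sup>y\<close> with code \<open>(u, v)\<close>.
\<close>

definition exp_axiom :: "'a fm" where
  "exp_axiom = All (All (Ex (
     let y = Var 3; z = Var 2; u = Var 1; v = Var 0 in
     Ex (Ex (beta_fm u v \<zero> \<one> \<^bold>\<and> beta_fm u v y z \<^bold>\<and>
       All (let y = Var 4; i = Var 0 in
         i \<prec> y \<^bold>\<rightarrow>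
         Ex (let x = Var 6; u = Var 3; v = Var 2; i = Var 1; w = Var 0 in
           beta_fm u v i w \<^bold>\<and> beta_fm u v (i \<oplus> \<one>) (w \<otimes> x))))))))"


section \<open>Buss's arithmetic and sequentiality\<close>

definition L_Buss :: "'a lang" where
  "L_Buss = \<lparr>funs = {Zero, Succ, Plus, Times, Half, Len, Smash}, rels = {Leq}, pars = {}\<rparr>"

inductive sharply_bounded :: "'a fm \<Rightarrow> bool" where
  "fm_in L_Buss (Eq s t) \<Longrightarrow> sharply_bounded (Eq s t)"
| "fm_in L_Buss (Rel r ts) \<Longrightarrow> sharply_bounded (Rel r ts)"
| "sharply_bounded Bot"
| "sharply_bounded p \<Longrightarrow> sharply_bounded q \<Longrightarrow> sharply_bounded (Imp p q)"
| "tm_in L_Buss t \<Longrightarrow> sharply_bounded p \<Longrightarrow>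
     sharply_bounded (All (Var 0 \<preceq> Fn Len [lift_tm t] \<^bold>\<rightarrow> p))"
| "tm_in L_Buss t \<Longrightarrow> sharply_bounded p \<Longrightarrow>
     sharply_bounded (Ex (Var 0 \<preceq> Fn Len [lift_tm t] \<^bold>\<and> p))"

inductive Sigma_b1 :: "'a fm \<Rightarrow> bool" and Pi_b1 :: "'a fm \<Rightarrow> bool" where
  "sharply_bounded p \<Longrightarrow> Sigma_b1 p"
| "sharply_bounded p \<Longrightarrow> Pi_b1 p"
| "Pi_b1 p \<Longrightarrow> Sigma_b1 q \<Longrightarrow> Sigma_b1 (Imp p q)"
| "Sigma_b1 p \<Longrightarrow> Pi_b1 q \<Longrightarrow> Pi_b1 (Imp p q)"
| "tm_in L_Buss t \<Longrightarrow> Sigma_b1 p \<Longrightarrow> Sigma_b1 (Ex (Var 0 \<preceq> lift_tm t \<^bold>\<and> p))"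
| "tm_in L_Buss t \<Longrightarrow> Sigma_b1 p \<Longrightarrow> Sigma_b1 (All (Var 0 \<preceq> Fn Len [lift_tm t] \<^bold>\<rightarrow> p))"
| "tm_in L_Buss t \<Longrightarrow> Pi_b1 p \<Longrightarrow> Pi_b1 (All (Var 0 \<preceq> lift_tm t \<^bold>\<rightarrow> p))"
| "tm_in L_Buss t \<Longrightarrow> Pi_b1 p \<Longrightarrow> Pi_b1 (Ex (Var 0 \<preceq> Fn Len [lift_tm t] \<^bold>\<and> p))"

text \<open>Buss's 32 axioms, in his order.\<close>

definition BASIC :: "'a fm set" where
  "BASIC = (let x = Var 0; y = Var 1; z = Var 2; u = Var 3; S = (\<lambda>t. Fn Succ [t]);
     len = (\<lambda>t. Fn Len [t]); half = (\<lambda>t. Fn Half [t]); smash = (\<lambda>s t. Fn Smash [s, t]);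
     dbl = (\<lambda>t. S (S \<zero>) \<otimes> t) in univ_closure `
    {y \<preceq> x \<^bold>\<rightarrow> y \<preceq> S x,
     \<^bold>\<not> (x \<doteq> S x),
     \<zero> \<preceq> x,
     x \<preceq> y \<^bold>\<and> \<^bold>\<not> (x \<doteq> y) \<^bold>\<leftrightarrow> S x \<preceq> y,
     \<^bold>\<not> (x \<doteq> \<zero>) \<^bold>\<rightarrow> \<^bold>\<not> (dbl x \<doteq> \<zero>),
     y \<preceq> x \<^bold>\<or> x \<preceq> y,
     x \<preceq> y \<^bold>\<and> y \<preceq> x \<^bold>\<rightarrow> x \<doteq> y,
     x \<preceq> y \<^bold>\<and> y \<preceq> z \<^bold>\<rightarrow> x \<preceq> z,
     len \<zero> \<doteq> \<zero>,
     \<^bold>\<not> (x \<doteq> \<zero>) \<^bold>\<rightarrow> len (dbl x) \<doteq> S (len x) \<^bold>\<and> len (S (dbl x)) \<doteq> S (len x),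
     len (S \<zero>) \<doteq> S \<zero>,
     x \<preceq> y \<^bold>\<rightarrow> len x \<preceq> len y,
     len (smash x y) \<doteq> S (len x \<otimes> len y),
     smash \<zero> y \<doteq> S \<zero>,
     \<^bold>\<not> (x \<doteq> \<zero>) \<^bold>\<rightarrow> smash (S \<zero>) (dbl x) \<doteq> dbl (smash (S \<zero>) x) \<^bold>\<and>
       smash (S \<zero>) (S (dbl x)) \<doteq> dbl (smash (S \<zero>) x),
     smash x y \<doteq> smash y x,
     len x \<doteq> len y \<^bold>\<rightarrow> smash x z \<doteq> smash y z,
     len x \<doteq> len u \<oplus> len y \<^bold>\<rightarrow> smash x z \<doteq> smash u z \<otimes> smash y z,
     x \<preceq> x \<oplus> y,
     x \<preceq> y \<^bold>\<and> \<^bold>\<not> (x \<doteq> y) \<^bold>\<rightarrow> S (dbl x) \<preceq> dbl y \<^bold>\<and> \<^bold>\<not> (S (dbl x) \<doteq> dbl y),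
     x \<oplus> y \<doteq> y \<oplus> x,
     x \<oplus> \<zero> \<doteq> x,
     x \<oplus> S y \<doteq> S (x \<oplus> y),
     (x \<oplus> y) \<oplus> z \<doteq> x \<oplus> (y \<oplus> z),
     x \<oplus> y \<preceq> x \<oplus> z \<^bold>\<leftrightarrow> y \<preceq> z,
     x \<otimes> \<zero> \<doteq> \<zero>,
     x \<otimes> S y \<doteq> x \<otimes> y \<oplus> x,
     x \<otimes> y \<doteq> y \<otimes> x,
     x \<otimes> (y \<oplus> z) \<doteq> x \<otimes> y \<oplus> x \<otimes> z,
     S \<zero> \<preceq> x \<^bold>\<rightarrow> (x \<otimes> y \<preceq> x \<otimes> z \<^bold>\<leftrightarrow> y \<preceq> z),
     \<^bold>\<not> (x \<doteq> \<zero>) \<^bold>\<rightarrow> len x \<doteq> S (len (half x)),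
     x \<doteq> half y \<^bold>\<leftrightarrow> dbl x \<doteq> y \<^bold>\<or> S (dbl x) \<doteq> y})"

definition PIND_axiom :: "'a fm \<Rightarrow> 'a fm" where
  "PIND_axiom p =
     univ_closure (inst \<zero> p \<^bold>\<and> All (repl (Fn Half [Var 0]) p \<^bold>\<rightarrow> p) \<^bold>\<rightarrow> All p)"

definition S12 :: "'a fm set" where
  "S12 = BASIC \<union> {PIND_axiom p | p. Sigma_b1 p}"

text \<open>
  To compare \<open>S12\<close> with theories in \<open>L_PA\<close> it is extended by explicit definitions of the \<open>L_PA\<close>
  symbols that its own language lacks.  That the identity interpretation of \<open>S12\<close> is an
  interpretation in \<open>U\<close> then means that \<open>U\<close> interprets the extension by a translation that is
  the identity on \<open>L_PA\<close>.  Successor and \<open>\<le>\<close> thereby become \<open>x + 1\<close> and \<open>x < y \<or> x = y\<close>;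
  the graphs of the remaining functions of Buss's language are given by \<open>L_PA\<close>-formulae.
\<close>

definition L_Buss_PA :: "'a lang" where
  "L_Buss_PA = \<lparr>funs = {Zero, One, Plus, Times, Succ, Half, Len, Smash}, rels = {Less, Leq}, pars = {}\<rparr>"

definition S12_PA :: "'a fm set" where
  "S12_PA = S12 \<union> univ_closure `
    {\<one> \<doteq> Fn Succ [\<zero>],
     Var 0 \<prec> Var 1 \<^bold>\<leftrightarrow> Var 0 \<preceq> Var 1 \<^bold>\<and> \<^bold>\<not> (Var 0 \<doteq> Var 1)}"

definition interprets_S12_by_id :: "'a fm set \<Rightarrow> bool" where
  "interprets_S12_by_id U \<longleftrightarrow> syntactically_defines L_PA U L_Buss_PA S12_PA L_PA"

definition L_empty :: "'a lang" where
  "L_empty = \<lparr>funs = {}, rels = {}, pars = {}\<rparr>"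

definition L_AS :: "'a lang" where
  "L_AS = \<lparr>funs = {}, rels = {Mem}, pars = {}\<rparr>"

definition AS :: "'a fm set" where
  "AS = {Ex (All (\<^bold>\<not> Rel Mem [Var 0, Var 1])),
     All (All (Ex (All (Rel Mem [Var 0, Var 1] \<^bold>\<leftrightarrow>
       Rel Mem [Var 0, Var 3] \<^bold>\<or> Var 0 \<doteq> Var 2))))}"

definition sequential :: "'a lang \<Rightarrow> 'a fm set \<Rightarrow> bool" where
  "sequential L U \<longleftrightarrow> syntactically_defines L U L_AS AS L_empty"


section \<open>Satisfaction and Skolem extensions\<close>

text \<open>
  A formula is written in prefix notation as a string over an alphabet of nonzero codes (variable
  indices in binary), and the string is read as a number in base 32; so the length of the Goedel
  number is linear in the length of the formula.  \<open>Par\<close> only gets a dummy code: Goedel numbers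
  are used for \<open>L_PA\<close>-formulae alone.
\<close>

fun fcode :: "fsym \<Rightarrow> nat" where
  "fcode Zero = 1" | "fcode One = 2" | "fcode Plus = 3" | "fcode Times = 4"
| "fcode Succ = 5" | "fcode Half = 6" | "fcode Len = 7" | "fcode Smash = 8"
| "fcode HSym = 9"

fun rcode :: "rsym \<Rightarrow> nat" where
  "rcode Less = 10" | "rcode Leq = 11" | "rcode Mem = 12" | "rcode SSym = 13"

fun bits :: "nat \<Rightarrow> nat list" where
  "bits n = (if n = 0 then [] else (if even n then 20 else 21) # bits (n div 2))"

declare bits.simps [simp del]

primrec tm_string :: "'a tm \<Rightarrow> nat list" where
  "tm_string (Var n) = 14 # bits n"
| "tm_string (Par a) = [15]"
| "tm_string (Fn f ts) = fcode f # concat (map tm_string ts)"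

primrec fm_string :: "'a fm \<Rightarrow> nat list" where
  "fm_string Bot = [16]"
| "fm_string (Eq s t) = 17 # tm_string s @ tm_string t"
| "fm_string (Rel r ts) = rcode r # concat (map tm_string ts)"
| "fm_string (Imp p q) = 18 # fm_string p @ fm_string q"
| "fm_string (All p) = 19 # fm_string p"

definition goedel :: "'a fm \<Rightarrow> nat" where
  "goedel p = horner_sum id 32 (fm_string p)"

fun bin_numeral :: "nat \<Rightarrow> 'a tm" where
  "bin_numeral n =
     (if n = 0 then \<zero> else if n = 1 then \<one>
      else if even n then (\<one> \<oplus> \<one>) \<otimes> bin_numeral (n div 2)
      else (\<one> \<oplus> \<one>) \<otimes> bin_numeral (n div 2) \<oplus> \<one>)"

declare bin_numeral.simps [simp del]

definition L_PA_S :: "'a lang" where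
  "L_PA_S = \<lparr>funs = {Zero, One, Plus, Times}, rels = {Less, SSym}, pars = {}\<rparr>"

definition L_PA_H :: "'a lang" where
  "L_PA_H = \<lparr>funs = {Zero, One, Plus, Times, HSym}, rels = {Less}, pars = {}\<rparr>"

definition USB :: "'a fm set \<Rightarrow> 'a fm set" where
  "USB U = U \<union>
     {All (Rel SSym [bin_numeral (goedel p), Var 0] \<^bold>\<leftrightarrow> p) | p. fm_in L_PA p \<and> fvb p \<le> 1}"

text \<open>In \<open>p(x, y)\<close> the variable \<open>x\<close> has index \<open>0\<close> and \<open>y\<close> has index \<open>1\<close>.\<close>

definition US :: "'a fm set \<Rightarrow> 'a fm set" where
  "US U = U \<union>
     {All (Ex p \<^bold>\<rightarrow> inst (Fn HSym [bin_numeral (goedel p), Var 0]) p)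
       | p. fm_in L_PA p \<and> fvb p \<le> 2}"

end

theory Submission
  imports Defs "HOL-Library.Infinite_Set"
begin

text \<open>
  In a model of \<open>U + B\<Sigma>\<^sub>n + exp\<close> without \<open>I\<Sigma>\<^sub>n\<close>, let \<open>\<Sigma>\<^sub>m\<^sub>+\<^sub>1\<close> induction be the first to fail.  The failure
  yields a cofinal sequence with a \<open>\<Delta>\<^sub>m\<^sub>+\<^sub>1\<close> graph that is indexed by a proper cut.  With moves bounded along this
  sequence, back-and-forth games on finite sets of pairs become definable: there is a definable \<open>G(c, q)\<close> such that a
  position \<open>q\<close> with \<open>c + 1\<close> moves left can be extended to answer any move, with \<open>c\<close> moves left, and such that \<open>q\<close>
  preserves atomic formulae.  For every standard \<open>k\<close> and every \<open>a\<close>, counting the \<open>k\<close>-types of pairs \<open>(x, a)\<close>, which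
  are fewer than the elements \<open>x\<close>, yields a position with \<open>k\<close> moves left that fixes \<open>a\<close> and moves some element.

  By compactness, some model of \<open>U\<close> has such a game with a nonstandard number \<open>\<gamma>\<close> of moves.  There the
  positions with nonstandardly many moves left form a back-and-forth system, which preserves all formulae, and also
  \<open>S\<close> if it is interpreted as satisfaction of standard formulae.  Let \<open>\<chi>(x, y)\<close> say that a position with \<open>\<gamma>\<close> moves
  left fixes \<open>y\<close> and moves \<open>x\<close>, and suppose that \<open>H\<close> is definable.  Let \<open>a\<close> code the parameters of its definition and
  of the game.  The position that witnesses \<open>\<chi>(H(\<chi>, a), a)\<close> fixes \<open>a\<close>, hence these parameters, hence \<open>H(\<chi>, a)\<close>,
  which it was supposed to move.
\<close>

text \<open>Equivalence under \<open>k\<close> moves is expressed by formulae that grow with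
  \<open>k\<close>; a single formula needs bounded moves. When all bounds are listed in one number
  \<open>s\<close>, a winning strategy is itself a number below \<open>bet s\<close>, and
  \<open>E s c q\<close>, that \<open>q\<close> is won with \<open>c\<close> moves left, is a
  \<Delta> predicate. \<open>G\<close> asks for this at all late \<open>s\<close>. An answer that is
  good for all late \<open>s\<close> comes from collection: if every candidate were refuted, the
  refuting \<open>s\<close> would have a common bound, and the game of a later \<open>s\<close>
  would contradict one of them. The failure of induction is used through the indices. The bounds are
  cofinal, yet their indices lie below the fixed \<open>d0\<close>, so a type may record the index
  of a move in place of its bound, and the number of types stays fixed while the bounds grow. This
  count works only for standard \<open>k\<close>, since tuples and types are built by recursion
  outside the model, and there is no induction for \<open>G\<close> by which to overspill; hence the
  compactness step. It changes the model, and with it the parameters of the game, which is why they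
  are quantified away there and handed to the Skolem formula inside \<open>y\<close>.\<close>

section \<open>Semantics with a full carrier type\<close>

text \<open>The elements named by \<open>Par\<close> are given by \<open>k\<close>, so that a formula can be evaluated in structures
  whose universe is not a subset of \<open>'a\<close>.\<close>

primrec ev :: "(fsym \<Rightarrow> 'u list \<Rightarrow> 'u) \<Rightarrow> ('a \<Rightarrow> 'u) \<Rightarrow> (nat \<Rightarrow> 'u) \<Rightarrow> 'a tm \<Rightarrow> 'u" where
  "ev F k e (Var n) = e n"
| "ev F k e (Par a) = k a"
| "ev F k e (Fn f ts) = F f (map (ev F k e) ts)"

primrec gs :: "'u set \<Rightarrow> (fsym \<Rightarrow> 'u list \<Rightarrow> 'u) \<Rightarrow> (rsym \<Rightarrow> 'u list \<Rightarrow> bool) \<Rightarrow> ('a \<Rightarrow> 'u) \<Rightarrow>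
    (nat \<Rightarrow> 'u) \<Rightarrow> 'a fm \<Rightarrow> bool" where
  "gs D F R k e Bot \<longleftrightarrow> False"
| "gs D F R k e (Eq s t) \<longleftrightarrow> ev F k e s = ev F k e t"
| "gs D F R k e (Rel r ts) \<longleftrightarrow> R r (map (ev F k e) ts)"
| "gs D F R k e (Imp p q) \<longleftrightarrow> (gs D F R k e p \<longrightarrow> gs D F R k e q)"
| "gs D F R k e (All p) \<longleftrightarrow> (\<forall>a\<in>D. gs D F R k (case_nat a e) p)"

lemma ev_subst: "ev F k e (subst_tm \<sigma> t) = ev F k (\<lambda>n. ev F k e (\<sigma> n)) t"
  by (induction t) (auto simp: comp_def cong: map_cong)

lemma case_nat_ev_lift:
  "(\<lambda>n. ev F k (case_nat a e) (case_nat (Var 0) (\<lambda>n. lift_tm (\<sigma> n)) n)) = case_nat a (\<lambda>n. ev F k e (\<sigma> n))"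
  by (auto simp: fun_eq_iff ev_subst split: nat.split)

lemma gs_subst: "gs D F R k e (subst \<sigma> p) = gs D F R k (\<lambda>n. ev F k e (\<sigma> n)) p"
  by (induction p arbitrary: e \<sigma>) (simp_all add: ev_subst comp_def case_nat_ev_lift)

lemma gs_ren: "gs D F R k e (ren \<rho> p) = gs D F R k (\<lambda>n. e (\<rho> n)) p"
  by (simp add: ren_def gs_subst)

lemma gs_inst: "gs D F R k e (inst t p) = gs D F R k (case_nat (ev F k e t) e) p"
  unfolding inst_def gs_subst by (rule arg_cong[where f = "\<lambda>e. gs D F R k e p"]) (auto split: nat.split)

lemma gs_repl: "gs D F R k e (repl t p) = gs D F R k (case_nat (ev F k e t) (\<lambda>n. e (Suc n))) p"
  unfolding repl_def gs_subst by (rule arg_cong[where f = "\<lambda>e. gs D F R k e p"]) (auto split: nat.split)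

lemma foldr_max_le: "x \<in> set ts \<Longrightarrow> f x \<le> foldr max (map f ts) (0::nat)"
  by (induction ts) auto

lemma ev_cong: "(\<And>n. n < fvb_tm t \<Longrightarrow> e n = e' n) \<Longrightarrow> ev F k e t = ev F k e' t"
proof (induction t)
  case (Fn f ts)
  have "map (ev F k e) ts = map (ev F k e') ts"
    using Fn foldr_max_le[of _ ts fvb_tm] by (intro map_cong) (auto intro!: Fn(1) simp: order.strict_trans2)
  then show ?case by (simp only: ev.simps)
qed auto

lemma gs_cong: "(\<And>n. n < fvb p \<Longrightarrow> e n = e' n) \<Longrightarrow> gs D F R k e p = gs D F R k e' p"
proof (induction p arbitrary: e e')
  case (Eq s t) then show ?case using ev_cong[of s e e' F k] ev_cong[of t e e' F k] by simp
next
  case (Rel r ts)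
  have "map (ev F k e) ts = map (ev F k e') ts"
    using Rel foldr_max_le[of _ ts fvb_tm] by (intro map_cong ev_cong) (auto simp: order.strict_trans2)
  then show ?case by (metis gs.simps(3))
next
  case (Imp p q) then show ?case by (metis fvb.simps(4) gs.simps(4) max.strict_coboundedI1 max.strict_coboundedI2)
next
  case (All p)
  have "gs D F R k (case_nat a e) p = gs D F R k (case_nat a e') p" for a
    using All(2) by (intro All(1)) (auto split: nat.split)
  then show ?case by simp
qed simp

text \<open>\<open>Gen\<close> forces the axioms to hold under every assignment, so the induction on
  derivations generalizes over \<open>e\<close>. The full carrier makes the value of any term a
  legal instance in \<open>All_inst\<close>.\<close>

theorem soundness:
  assumes "T \<turnstile> p" "\<And>q e. q \<in> T \<Longrightarrow> gs UNIV F R k e q"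
  shows "gs UNIV F R k e p"
  using assms(1) by (induction arbitrary: e rule: provable.induct) (auto simp: gs_inst gs_ren assms(2))

text \<open>A block of quantifiers becomes one assignment \<open>e'\<close> that extends
  \<open>e\<close> on the left. Closures, translations and tuple codes all use such blocks, for
  which nested \<open>case_nat\<close> would be unwieldy.\<close>

lemma gs_All_pow:
  "gs D F R k e ((All ^^ r) p) \<longleftrightarrow>
    (\<forall>e'. (\<forall>n<r. e' n \<in> D) \<and> (\<forall>n. e' (n + r) = e n) \<longrightarrow> gs D F R k e' p)"
proof (induction r arbitrary: e p)
  case 0
  have "e' = e" if "\<forall>n. e' n = e n" for e' :: "nat \<Rightarrow> 'a" using that by auto
  then show ?case by auto
next
  case (Suc r)
  have *: "(All ^^ Suc r) p = (All ^^ r) (All p)" by (simp add: funpow_swap1)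
  show ?case unfolding * Suc
  proof safe
    fix e' assume a: "\<forall>e'. (\<forall>n<r. e' n \<in> D) \<and> (\<forall>n. e' (n + r) = e n) \<longrightarrow> gs D F R k e' (All p)"
      "\<forall>n<Suc r. e' n \<in> D" "\<forall>n. e' (n + Suc r) = e n"
    from a(1)[rule_format, of "\<lambda>n. e' (Suc n)"] a(2,3)
    have "gs D F R k (case_nat (e' 0) (\<lambda>n. e' (Suc n))) p" by auto
    moreover have "case_nat (e' 0) (\<lambda>n. e' (Suc n)) = e'" by (auto split: nat.split)
    ultimately show "gs D F R k e' p" by simp
  next
    fix e' assume a: "\<forall>e'. (\<forall>n<Suc r. e' n \<in> D) \<and> (\<forall>n. e' (n + Suc r) = e n) \<longrightarrow> gs D F R k e' p"
      "\<forall>n<r. e' n \<in> D" "\<forall>n. e' (n + r) = e n"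
    show "gs D F R k e' (All p)"
      using a by (auto intro!: a(1)[rule_format] simp: less_Suc_eq_0_disj)
  qed
qed

lemma gs_Ex_pow:
  "gs D F R k e ((Ex ^^ r) p) \<longleftrightarrow>
    (\<exists>e'. (\<forall>n<r. e' n \<in> D) \<and> (\<forall>n. e' (n + r) = e n) \<and> gs D F R k e' p)"
proof -
  have "gs D F R k e ((Ex ^^ r) p) \<longleftrightarrow> gs D F R k e (\<^bold>\<not> ((All ^^ r) (\<^bold>\<not> p)))"
    by (induction r arbitrary: e) auto
  then show ?thesis by (auto simp: gs_All_pow)
qed

lemma gs_univ_closure:
  "(\<forall>e. gs UNIV F R k e (univ_closure p)) \<longleftrightarrow> (\<forall>e. gs UNIV F R k e p)"
proof safe
  fix e assume *: "\<forall>e. gs UNIV F R k e (univ_closure p)"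
  show "gs UNIV F R k e p"
    \<comment> \<open>The tail of \<open>e\<close> from \<open>fvb p\<close> on is chosen because
      prepending suitable values to the shifted assignment gives back \<open>e\<close>
      itself.\<close>
    using *[rule_format, of "\<lambda>n. e (n + fvb p)"] by (auto simp: univ_closure_def gs_All_pow)
qed (auto simp: univ_closure_def gs_All_pow)

section \<open>Free variables and languages of compound formulae\<close>

lemma fvb_All_pow: "fvb ((All ^^ r) p) = fvb p - r"
  by (induction r) auto

lemma fvb_univ_closure [simp]: "fvb (univ_closure p) = 0"
  by (simp add: univ_closure_def fvb_All_pow)

lemma fm_in_All_pow [simp]: "fm_in L ((All ^^ r) p) = fm_in L p"
  by (induction r) auto

lemma fm_in_Ex_pow [simp]: "fm_in L ((Ex ^^ r) p) = fm_in L p"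
  by (induction r) auto

lemma fvb_Ex_pow: "fvb ((Ex ^^ r) p) = fvb p - r"
  by (induction r) auto

lemma fm_in_univ_closure [simp]: "fm_in L (univ_closure p) = fm_in L p"
  by (simp add: univ_closure_def)

lemma tm_in_subst: "tm_in L t \<Longrightarrow> (\<And>n. tm_in L (\<sigma> n)) \<Longrightarrow> tm_in L (subst_tm \<sigma> t)"
  by (induction t) (auto simp: list_all_iff)

lemma fm_in_subst: "fm_in L p \<Longrightarrow> (\<And>n. tm_in L (\<sigma> n)) \<Longrightarrow> fm_in L (subst \<sigma> p)"
proof (induction p arbitrary: \<sigma>)
  case (All p)
  have "tm_in L (case n of 0 \<Rightarrow> Var 0 | Suc n \<Rightarrow> lift_tm (\<sigma> n))" for n
    using All(3) by (auto split: nat.split intro: tm_in_subst)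
  then show ?case using All by simp
qed (auto simp: list_all_iff tm_in_subst)

lemma fm_in_ren [simp]: "fm_in L p \<Longrightarrow> fm_in L (ren \<rho> p)"
  by (auto simp: ren_def intro: fm_in_subst)

lemma fm_in_inst: "fm_in L p \<Longrightarrow> tm_in L t \<Longrightarrow> fm_in L (inst t p)"
  by (auto simp: inst_def split: nat.split intro!: fm_in_subst)

lemma fm_in_repl: "fm_in L p \<Longrightarrow> tm_in L t \<Longrightarrow> fm_in L (repl t p)"
  by (auto simp: repl_def split: nat.split intro!: fm_in_subst)

section \<open>Substitution\<close>

lemma subst_tm_comp: "subst_tm \<sigma> (subst_tm \<tau> t) = subst_tm (\<lambda>n. subst_tm \<sigma> (\<tau> n)) t"
  by (induction t) auto

abbreviation up :: "(nat \<Rightarrow> 'a tm) \<Rightarrow> nat \<Rightarrow> 'a tm" where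
  "up \<sigma> \<equiv> case_nat (Var 0) (\<lambda>n. lift_tm (\<sigma> n))"

lemma up_comp: "(\<lambda>n. subst_tm (up \<sigma>) (up \<tau> n)) = up (\<lambda>n. subst_tm \<sigma> (\<tau> n))"
  by (auto simp: fun_eq_iff subst_tm_comp split: nat.split)

lemma subst_comp: "subst \<sigma> (subst \<tau> p) = subst (\<lambda>n. subst_tm \<sigma> (\<tau> n)) p"
  by (induction p arbitrary: \<sigma> \<tau>) (auto simp: subst_tm_comp up_comp)

lemma subst_tm_cong: "(\<And>n. n < fvb_tm t \<Longrightarrow> \<sigma> n = \<tau> n) \<Longrightarrow> subst_tm \<sigma> t = subst_tm \<tau> t"
proof (induction t)
  case (Fn f ts)
  have "map (subst_tm \<sigma>) ts = map (subst_tm \<tau>) ts"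
    using Fn foldr_max_le[of _ ts fvb_tm] by (intro map_cong) (auto intro!: Fn(1) simp: order.strict_trans2)
  then show ?case by simp
qed auto

lemma subst_cong: "(\<And>n. n < fvb p \<Longrightarrow> \<sigma> n = \<tau> n) \<Longrightarrow> subst \<sigma> p = subst \<tau> p"
proof (induction p arbitrary: \<sigma> \<tau>)
  case (Eq s t) then show ?case using subst_tm_cong[of s \<sigma> \<tau>] subst_tm_cong[of t \<sigma> \<tau>] by simp
next
  case (Rel r ts)
  have "map (subst_tm \<sigma>) ts = map (subst_tm \<tau>) ts"
    using Rel foldr_max_le[of _ ts fvb_tm] by (intro map_cong subst_tm_cong) (auto simp: order.strict_trans2)
  then show ?case by simp
next
  case (Imp p q)
  from Imp(1)[of \<sigma> \<tau>] Imp(2)[of \<sigma> \<tau>] Imp(3) show ?case by simp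
next
  case (All p)
  have "subst (up \<sigma>) p = subst (up \<tau>) p"
    using All(2) by (intro All(1)) (auto split: nat.split)
  then show ?case by simp
qed simp

lemma subst_tm_Var [simp]: "subst_tm Var t = t"
  by (induction t) (auto simp: map_idI)

lemma up_Var [simp]: "case_nat (Var 0) (\<lambda>n. Var (Suc n)) = Var"
  by (auto simp: fun_eq_iff split: nat.split)

lemma subst_Var [simp]: "subst Var p = p"
  by (induction p) (auto simp: map_idI)

lemma subst_id: "(\<And>n. n < fvb p \<Longrightarrow> \<sigma> n = Var n) \<Longrightarrow> subst \<sigma> p = p"
  using subst_cong[of p \<sigma> Var] by simp

lemma subst_inst: "subst \<sigma> (inst t p) = inst (subst_tm \<sigma> t) (subst (up \<sigma>) p)"
  unfolding inst_def subst_comp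
  by (rule arg_cong[where f = "\<lambda>s. subst s p"])
     (auto simp: fun_eq_iff subst_tm_comp split: nat.split)

lemma subst_up_ren_Suc: "subst (up \<sigma>) (ren Suc p) = ren Suc (subst \<sigma> p)"
  by (simp add: ren_def subst_comp)

text \<open>Axioms are sentences, hence untouched by \<sigma>, and the logical schemes are closed
  under substitution. In \<open>dv_Gen\<close> this turns a free variable that serves as a Henkin
  constant into a bound one.\<close>

lemma provable_subst:
  assumes "\<And>q. q \<in> T \<Longrightarrow> fvb q = 0" "T \<turnstile> p"
  shows "T \<turnstile> subst \<sigma> p"
  using assms(2)
proof (induction arbitrary: \<sigma> rule: provable.induct)
  case (Ax p)
  then show ?case using assms(1)[of p] subst_id[of p \<sigma>] by (simp add: provable.Ax)
next
  case (All_inst p t)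
  then show ?case using provable.All_inst by (simp add: subst_inst)
next
  case (All_vac p)
  then show ?case using provable.All_vac by (simp add: subst_up_ren_Suc)
next
  case (Leibniz s t p)
  then show ?case using provable.Leibniz by (simp add: subst_inst)
qed (auto intro: provable.intros)

section \<open>Derivability from open hypotheses\<close>

text \<open>The rule \<open>Gen\<close> makes every variable of an axiom general.  Hypotheses with free variables, which the
  completeness theorem needs as Henkin constants, are therefore kept apart in \<open>G\<close>.\<close>

inductive dv :: "'a fm set \<Rightarrow> 'a fm set \<Rightarrow> 'a fm \<Rightarrow> bool" for T G where
  hyp: "p \<in> G \<Longrightarrow> dv T G p"
| base: "T \<turnstile> p \<Longrightarrow> dv T G p"
| dmp: "dv T G (p \<^bold>\<rightarrow> q) \<Longrightarrow> dv T G p \<Longrightarrow> dv T G q"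

lemma dv_mono: "dv T G p \<Longrightarrow> G \<subseteq> H \<Longrightarrow> dv T H p"
  by (induction rule: dv.induct) (auto intro: dv.intros)

lemma dv_empty: "dv T {} p \<longleftrightarrow> T \<turnstile> p"
proof
  show "dv T {} p \<Longrightarrow> T \<turnstile> p" by (induction rule: dv.induct) (auto intro: provable.MP)
qed (rule dv.base)

lemma dv_K: "dv T G q \<Longrightarrow> dv T G (p \<^bold>\<rightarrow> q)"
  by (metis dv.dmp dv.base provable.K)

lemma provable_id: "T \<turnstile> p \<^bold>\<rightarrow> p"
  by (metis provable.K provable.S provable.MP)

text \<open>There is no side condition on variables because \<open>Gen\<close> acts only inside
  derivations from \<open>T\<close>, never on the hypotheses in \<open>G\<close>.\<close>

lemma dv_ded: "dv T (insert p G) q \<Longrightarrow> dv T G (p \<^bold>\<rightarrow> q)"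
proof (induction rule: dv.induct)
  case (hyp q)
  then show ?case using provable_id[of T p] by (auto intro: dv_K dv.intros)
next
  case (base q) then show ?case by (auto intro: dv_K dv.intros)
next
  case (dmp q r)
  then show ?case by (metis dv.dmp dv.base provable.S)
qed

text \<open>The source of compactness: open hypotheses become antecedents of one theorem of
  \<open>T\<close>. It serves the Henkin construction as well as the passage to a nonstandard number
  of moves.\<close>

lemma dv_finite: "dv T G p \<Longrightarrow> \<exists>qs. set qs \<subseteq> G \<and> T \<turnstile> foldr Imp qs p"
proof -
  have ex: "\<exists>H. finite H \<and> H \<subseteq> G \<and> dv T H p" if "dv T G p"
    using that
  proof (induction rule: dv.induct)
    case (hyp p) then show ?case by (intro exI[of _ "{p}"]) (auto intro: dv.intros)
  next
    case (base p) then show ?case by (intro exI[of _ "{}"]) (auto intro: dv.intros)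
  next
    case (dmp p q)
    then obtain H1 H2 where "finite H1" "H1 \<subseteq> G" "dv T H1 (p \<^bold>\<rightarrow> q)" "finite H2" "H2 \<subseteq> G" "dv T H2 p"
      by blast
    then show ?case
      by (intro exI[of _ "H1 \<union> H2"]) (auto intro: dv.dmp dv_mono)
  qed
  have "\<exists>qs. set qs \<subseteq> H \<and> T \<turnstile> foldr Imp qs p" if "finite H" "dv T H p" for H p
    using that
  proof (induction H arbitrary: p rule: finite_induct)
    case empty then show ?case by (intro exI[of _ "[]"]) (auto simp: dv_empty)
  next
    case (insert q H)
    from insert(3)[OF dv_ded[OF insert(4)]] obtain qs where
      "set qs \<subseteq> H" "T \<turnstile> foldr Imp qs (q \<^bold>\<rightarrow> p)" by blast
    then show ?case by (intro exI[of _ "qs @ [q]"]) auto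
  qed
  then show "dv T G p \<Longrightarrow> \<exists>qs. set qs \<subseteq> G \<and> T \<turnstile> foldr Imp qs p"
    using ex by (meson order_trans)
qed

lemma dv_foldr: "set qs \<subseteq> G \<Longrightarrow> dv T G (foldr Imp qs p) \<Longrightarrow> dv T G p"
proof (induction qs arbitrary: p)
  case (Cons q qs)
  then show ?case by (metis dv.hyp dv.dmp foldr.simps(2) o_apply insert_subset list.set(2))
qed simp

lemma dv_cut: "dv T G p \<Longrightarrow> dv T (insert p G) q \<Longrightarrow> dv T G q"
  by (metis dv.dmp dv_ded)

lemma dv_bot: "dv T G Bot \<Longrightarrow> dv T G p"
  by (metis dv.dmp dv.base dv_K provable.DN)

lemma dv_DN: "dv T (insert (\<^bold>\<not> p) G) Bot \<Longrightarrow> dv T G p"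
  by (metis dv.dmp dv.base dv_ded provable.DN)

text \<open>\<open>ren Suc\<close> expresses that the antecedents do not contain the quantified
  variable; \<open>All_vac\<close> quantifies them vacuously and \<open>All_dist\<close> peels them
  off one by one.\<close>

lemma provable_foldr_All: "T \<turnstile> All (foldr Imp (map (ren Suc) qs) p) \<Longrightarrow> T \<turnstile> foldr Imp qs (All p)"
proof -
  have "dv T G (foldr Imp qs (All p))" if "dv T G (All (foldr Imp (map (ren Suc) qs) p))" for G
    using that
  proof (induction qs arbitrary: G)
    case (Cons q qs)
    have "dv T (insert q G) (All (ren Suc q))"
      by (metis dv.hyp dv.dmp dv.base insertI1 provable.All_vac)
    moreover have "dv T (insert q G) (All (ren Suc q) \<^bold>\<rightarrow> All (foldr Imp (map (ren Suc) qs) p))"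
      using Cons(2) dv_mono[OF Cons(2), of "insert q G"]
      by (auto intro: dv.dmp dv.base provable.All_dist)
    ultimately have "dv T (insert q G) (foldr Imp qs (All p))"
      using Cons(1) dv.dmp by blast
    then show ?case using dv_ded by auto
  qed simp
  from this[of "{}"] show "T \<turnstile> All (foldr Imp (map (ren Suc) qs) p) \<Longrightarrow> T \<turnstile> foldr Imp qs (All p)"
    by (simp add: dv_empty)
qed

lemma subst_foldr_Imp: "subst \<sigma> (foldr Imp qs p) = foldr Imp (map (subst \<sigma>) qs) (subst \<sigma> p)"
  by (induction qs) auto

lemma dv_Gen:
  assumes T: "\<And>q. q \<in> T \<Longrightarrow> fvb q = 0" and G: "\<And>q. q \<in> G \<Longrightarrow> fvb q \<le> N" and p: "fvb p \<le> Suc N"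
    and d: "dv T G (inst (Var N) p)"
  shows "dv T G (All p)"
proof -
  obtain qs where qs: "set qs \<subseteq> G" "T \<turnstile> foldr Imp qs (inst (Var N) p)"
    using dv_finite[OF d] by blast
  \<comment> \<open>\<open>N\<close> becomes the bound variable and every other index makes room for
    it. The hypotheses have indices below \<open>N\<close> and turn into \<open>ren Suc q\<close>,
    while the instance at \<open>Var N\<close> turns back into \<open>p\<close>.\<close>
  define \<sigma> :: "nat \<Rightarrow> 'a tm" where "\<sigma> n = (if n = N then Var 0 else Var (Suc n))" for n
  have "T \<turnstile> subst \<sigma> (foldr Imp qs (inst (Var N) p))"
    using provable_subst[OF T qs(2)] by blast
  moreover have "subst \<sigma> q = ren Suc q" if "q \<in> set qs" for q
    unfolding ren_def using that qs(1) G[of q] by (intro subst_cong) (auto simp: \<sigma>_def)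
  moreover have "subst \<sigma> (inst (Var N) p) = p"
    unfolding inst_def subst_comp using p by (intro subst_id) (auto simp: \<sigma>_def split: nat.split)
  ultimately have "T \<turnstile> foldr Imp (map (ren Suc) qs) p"
    by (simp add: subst_foldr_Imp cong: map_cong)
  then have "T \<turnstile> foldr Imp qs (All p)"
    by (intro provable_foldr_All provable.Gen)
  then show ?thesis using dv_foldr[OF qs(1)] dv.base by blast
qed

section \<open>Goedel numbers are injective on arithmetical formulae\<close>

abbreviation nobit :: "nat list \<Rightarrow> bool" where
  "nobit r \<equiv> r = [] \<or> hd r \<notin> {20, 21}"

lemma bits_set: "set (bits n) \<subseteq> {20, 21}"
proof (induction n rule: bits.induct)
  case (1 n) then show ?case by (subst bits.simps) auto
qed

lemma bits_0: "bits 0 = []"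
  by (simp add: bits.simps)

lemma bits_pos: "n \<noteq> 0 \<Longrightarrow> bits n = (if even n then 20 else 21) # bits (n div 2)"
  by (subst bits.simps) simp

lemma bits_inj: "bits m = bits n \<Longrightarrow> m = n"
proof (induction m arbitrary: n rule: bits.induct)
  case (1 m)
  show ?case
  proof (cases "m = 0")
    case True then show ?thesis using 1(2) bits_pos[of n] by (auto simp: bits_0)
  next
    case False
    then have "n \<noteq> 0" using 1(2) bits_pos[of m] by (intro notI) (simp add: bits_0 split: if_splits)
    with 1(2) False have "bits (m div 2) = bits (n div 2)" "even m = even n" using bits_pos[of m] bits_pos[of n]
      by (auto split: if_splits)
    then show ?thesis using 1(1)[OF False] by (metis dvd_mult_div_cancel odd_two_times_div_two_succ)
  qed
qed

text \<open>No term or formula starts with the digits 20 or 21, so the maximal run of them ends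
  exactly where the index of a variable ends.\<close>

lemma bits_append: "bits m @ r = bits n @ r' \<Longrightarrow> nobit r \<Longrightarrow> nobit r' \<Longrightarrow> m = n \<and> r = r'"
proof -
  assume a: "bits m @ r = bits n @ r'" "nobit r" "nobit r'"
  have *: "takeWhile (\<lambda>x. x \<in> {20, 21}) (bits k @ s) = bits k" if "nobit s" for k s
    using bits_set[of k] that by (subst takeWhile_append2) (auto simp: takeWhile_eq_Nil_iff)
  show ?thesis using *[OF a(2), of m] *[OF a(3), of n] a(1) bits_inj[of m n] by auto
qed

lemma length_2: "length ts = 2 \<longleftrightarrow> (\<exists>s t. ts = [s, t])"
  by (auto simp: numeral_2_eq_2 length_Suc_conv)

lemma L_PA_simps [simp]: "funs L_PA = {Zero, One, Plus, Times}" "rels L_PA = {Less}" "pars L_PA = {}"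
  by (auto simp: L_PA_def)

lemma L_PA_tm_induct [consumes 1, case_names Var Zero One Plus Times]:
  assumes "tm_in L_PA t" "\<And>n. P (Var n)" "P \<zero>" "P \<one>"
    "\<And>s t. tm_in L_PA s \<Longrightarrow> tm_in L_PA t \<Longrightarrow> P s \<Longrightarrow> P t \<Longrightarrow> P (s \<oplus> t)"
    "\<And>s t. tm_in L_PA s \<Longrightarrow> tm_in L_PA t \<Longrightarrow> P s \<Longrightarrow> P t \<Longrightarrow> P (s \<otimes> t)"
  shows "P t"
  using assms(1)
proof (induction t)
  case (Fn f ts)
  then show ?case using assms(2-) by (auto simp: length_2)
qed (use assms in auto)

lemma L_PA_tm_cases:
  "tm_in L_PA t \<Longrightarrow> (\<And>n. t = Var n \<Longrightarrow> P) \<Longrightarrow> (t = \<zero> \<Longrightarrow> P) \<Longrightarrow> (t = \<one> \<Longrightarrow> P) \<Longrightarrow>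
    (\<And>s u. t = s \<oplus> u \<Longrightarrow> tm_in L_PA s \<Longrightarrow> tm_in L_PA u \<Longrightarrow> P) \<Longrightarrow>
    (\<And>s u. t = s \<otimes> u \<Longrightarrow> tm_in L_PA s \<Longrightarrow> tm_in L_PA u \<Longrightarrow> P) \<Longrightarrow> P"
  by (cases t) (auto simp: length_2)

lemma nobit_tm: "tm_in L_PA t \<Longrightarrow> nobit (tm_string t @ r)"
  by (erule L_PA_tm_cases) auto

lemma tm_string_append:
  assumes "tm_in L_PA t" "tm_in L_PA t'" "tm_string t @ r = tm_string t' @ r'" "nobit r" "nobit r'"
  shows "t = t' \<and> r = r'"
  using assms
proof (induction t arbitrary: t' r r' rule: L_PA_tm_induct)
  case (Var n)
  then obtain n' where "t' = Var n'" by (elim L_PA_tm_cases[of t']) auto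
  with Var show ?case using bits_append[of n r n' r'] by auto
next
  case (Plus s u)
  from Plus(5,6) obtain s' u' where t': "t' = s' \<oplus> u'" "tm_in L_PA s'" "tm_in L_PA u'"
    by (elim L_PA_tm_cases[of t']) auto
  show ?case
    using Plus(3)[of s' "tm_string u @ r" "tm_string u' @ r'"] Plus(4)[of u' r r'] Plus(1,2,6-) t'
      nobit_tm[of u r] nobit_tm[of u' r'] by auto
next
  case (Times s u)
  from Times(5,6) obtain s' u' where t': "t' = s' \<otimes> u'" "tm_in L_PA s'" "tm_in L_PA u'"
    by (elim L_PA_tm_cases[of t']) auto
  show ?case
    using Times(3)[of s' "tm_string u @ r" "tm_string u' @ r'"] Times(4)[of u' r r'] Times(1,2,6-) t'
      nobit_tm[of u r] nobit_tm[of u' r'] by auto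
next
  case Zero then show ?case by (elim L_PA_tm_cases[of t']) auto
next
  case One then show ?case by (elim L_PA_tm_cases[of t']) auto
qed

lemma nobit_fm: "fm_in L_PA p \<Longrightarrow> nobit (fm_string p @ r)"
  by (cases p) (auto simp: length_2)

lemma fm_string_append:
  assumes "fm_in L_PA p" "fm_in L_PA p'" "fm_string p @ r = fm_string p' @ r'" "nobit r" "nobit r'"
  shows "p = p' \<and> r = r'"
  using assms
proof (induction p arbitrary: p' r r')
  case Bot then show ?case by (cases p') (auto simp: length_2)
next
  case (Eq s t)
  from Eq(2,3) obtain s' t' where p': "p' = Eq s' t'" by (cases p') (auto simp: length_2)
  have t: "tm_in L_PA s" "tm_in L_PA t" "tm_in L_PA s'" "tm_in L_PA t'" using Eq(1,2) p' by auto
  have e: "tm_string s @ tm_string t @ r = tm_string s' @ tm_string t' @ r'" using Eq(3) p' by simp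
  from tm_string_append[OF t(1,3) e nobit_tm[OF t(2)] nobit_tm[OF t(4)]]
  have "s = s'" "tm_string t @ r = tm_string t' @ r'" by blast+
  with tm_string_append[OF t(2,4) _ Eq(4,5)] p' show ?case by blast
next
  case (Rel x ts)
  from Rel(1) obtain s t where x: "x = Less" "ts = [s, t]" by (auto simp: length_2)
  with Rel(2,3) obtain s' t' where p': "p' = Rel Less [s', t']" by (cases p') (auto simp: length_2)
  have t: "tm_in L_PA s" "tm_in L_PA t" "tm_in L_PA s'" "tm_in L_PA t'" using Rel(1,2) p' x by auto
  have e: "tm_string s @ tm_string t @ r = tm_string s' @ tm_string t' @ r'" using Rel(3) p' x by simp
  from tm_string_append[OF t(1,3) e nobit_tm[OF t(2)] nobit_tm[OF t(4)]]
  have "s = s'" "tm_string t @ r = tm_string t' @ r'" by blast+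
  with tm_string_append[OF t(2,4) _ Rel(4,5)] p' x show ?case by blast
next
  case (Imp p q)
  from Imp(4,5) obtain p1 q1 where p': "p' = Imp p1 q1" by (cases p') (auto simp: length_2)
  have t: "fm_in L_PA p" "fm_in L_PA q" "fm_in L_PA p1" "fm_in L_PA q1" using Imp(3,4) p' by auto
  have e: "fm_string p @ fm_string q @ r = fm_string p1 @ fm_string q1 @ r'" using Imp(5) p' by simp
  from Imp(1)[OF t(1,3) e nobit_fm[OF t(2)] nobit_fm[OF t(4)]]
  have "p = p1" "fm_string q @ r = fm_string q1 @ r'" by blast+
  with Imp(2)[OF t(2,4) _ Imp(6,7)] p' show ?case by blast
next
  case (All p)
  from All(3,4) obtain p1 where p': "p' = All p1" by (cases p') (auto simp: length_2)
  have t: "fm_in L_PA p" "fm_in L_PA p1" using All(2,3) p' by auto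
  have e: "fm_string p @ r = fm_string p1 @ r'" using All(4) p' by simp
  from All(1)[OF t e All(5,6)] p' show ?case by blast
qed

lemma tm_string_digits: "x \<in> set (tm_string t) \<Longrightarrow> 0 < x \<and> x < 32"
proof (induction t)
  case (Var n) then show ?case using bits_set[of n] by auto
next
  case (Fn f ts) then show ?case by (cases f) auto
qed auto

lemma fm_string_digits: "x \<in> set (fm_string p) \<Longrightarrow> 0 < x \<and> x < 32"
proof (induction p)
  case (Rel r ts) then show ?case by (cases r) (auto dest: tm_string_digits)
qed (auto dest: tm_string_digits)

text \<open>As all digits are nonzero, leading zeros cannot hide the length of the string.\<close>

lemma horner_inj:
  "(\<And>x. x \<in> set xs \<union> set ys \<Longrightarrow> 0 < x \<and> x < 32) \<Longrightarrow>
    horner_sum id (32::nat) xs = horner_sum id 32 ys \<Longrightarrow> xs = ys"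
proof (induction xs arbitrary: ys)
  case Nil then show ?case by (cases ys) auto
next
  case (Cons x xs)
  from Cons(3) obtain y zs where ys: "ys = y # zs" using Cons(2)[of x] by (cases ys) auto
  have "x < 32" "y < 32" using Cons(2) ys by auto
  have e: "x + 32 * horner_sum id 32 xs = y + 32 * horner_sum id 32 zs"
    using Cons(3) unfolding ys horner_sum_simps by (simp only: id_apply[of x] id_apply[of y])
  have "x = y" using arg_cong[OF e, of "\<lambda>k. k mod 32"] \<open>x < 32\<close> \<open>y < 32\<close> by simp
  have "horner_sum id 32 xs = horner_sum id 32 zs" using e \<open>x = y\<close> by arith
  moreover have "\<And>z. z \<in> set xs \<union> set zs \<Longrightarrow> 0 < z \<and> z < 32" using Cons(2) ys by auto
  ultimately have "xs = zs" by (rule Cons(1)[rotated])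
  with ys \<open>x = y\<close> show ?case by simp
qed

text \<open>It has two uses: Goedel numbers enumerate the formulae in the Henkin construction, and
  they let \<open>S\<close> recover a formula from its code.\<close>

theorem goedel_inj: "fm_in L_PA p \<Longrightarrow> fm_in L_PA q \<Longrightarrow> goedel p = goedel q \<Longrightarrow> p = q"
  using horner_inj[of "fm_string p" "fm_string q"] fm_string_digits fm_string_append[of p q "[]" "[]"]
  by (auto simp: goedel_def)

section \<open>A completeness theorem\<close>

definition con :: "'a fm set \<Rightarrow> 'a fm set \<Rightarrow> bool" where "con T G \<longleftrightarrow> \<not> dv T G Bot"

text \<open>Meaningful only for sets with a common bound on free variables; every stage of the
  construction retains such a bound.\<close>

definition fresh :: "'a fm set \<Rightarrow> nat" where "fresh G = (SOME N. \<forall>q\<in>G. fvb q \<le> N)"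

definition wit :: "'a fm set \<Rightarrow> 'a fm \<Rightarrow> 'a fm set" where
  "wit G p = {\<^bold>\<not> (inst (Var (fresh (insert p G))) r) | r. p = \<^bold>\<not> (All r)}"

definition stp :: "'a fm set \<Rightarrow> 'a fm set \<Rightarrow> 'a fm \<Rightarrow> 'a fm set" where
  "stp T G p = (if con T (insert p G) then insert p G \<union> wit G p else G)"

text \<open>Stage \<open>k\<close> treats the formula with Goedel number \<open>k\<close>, if there
  is one. \<open>L_PA\<close>-formulae contain no \<open>Par\<close>, so this reaches all of them
  however large the type \<open>'a\<close> is.\<close>

primrec chain :: "'a fm set \<Rightarrow> 'a fm set \<Rightarrow> nat \<Rightarrow> 'a fm set" where
  "chain T G 0 = G"
| "chain T G (Suc k) = (if \<exists>p::'a fm. fm_in L_PA p \<and> goedel p = k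
    then stp T (chain T G k) (THE p. fm_in L_PA p \<and> goedel p = k) else chain T G k)"

lemma fresh: "\<forall>q\<in>G. fvb q \<le> N \<Longrightarrow> q \<in> G \<Longrightarrow> fvb q \<le> fresh G"
  unfolding fresh_def by (rule someI2[of _ N]) auto

lemma foldr_max_iff: "foldr max xs 0 \<le> (M::nat) \<longleftrightarrow> (\<forall>x\<in>set xs. x \<le> M)"
  by (induction xs) auto

lemma fvb_subst_tm: "fvb_tm t \<le> K \<Longrightarrow> (\<And>n. n < K \<Longrightarrow> fvb_tm (\<sigma> n) \<le> M) \<Longrightarrow> fvb_tm (subst_tm \<sigma> t) \<le> M"
  by (induction t) (auto simp: foldr_max_iff)

lemma fvb_subst: "fvb p \<le> K \<Longrightarrow> (\<And>n. n < K \<Longrightarrow> fvb_tm (\<sigma> n) \<le> M) \<Longrightarrow> fvb (subst \<sigma> p) \<le> M"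
proof (induction p arbitrary: \<sigma> K M)
  case (All p)
  have l: "fvb_tm (up \<sigma> n) \<le> Suc M" if "n < Suc K" for n
  proof (cases n)
    case (Suc m)
    have "fvb_tm (lift_tm (\<sigma> m)) \<le> Suc M"
      using All(3)[of m] that Suc by (intro fvb_subst_tm[of _ M]) auto
    then show ?thesis using Suc by simp
  qed simp
  have "fvb (subst (up \<sigma>) p) \<le> Suc M" using All(2) by (intro All(1)[OF _ l]) auto
  then show ?case by simp
qed (auto simp: foldr_max_iff intro: fvb_subst_tm)

lemma fvb_ren: "fvb p \<le> K \<Longrightarrow> (\<And>n. n < K \<Longrightarrow> \<rho> n < M) \<Longrightarrow> fvb (ren \<rho> p) \<le> M"
  unfolding ren_def by (rule fvb_subst[of p K]) (auto simp: Suc_le_eq)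

lemma fvb_inst_Var: "fvb (inst (Var N) p) \<le> max (fvb p) (Suc N)"
  unfolding inst_def by (rule fvb_subst[of p "fvb p"]) (auto split: nat.split)

context
  fixes T G :: "'a fm set"
  assumes T: "\<And>q. q \<in> T \<Longrightarrow> fvb q = 0"
begin

text \<open>If the witness caused an inconsistency, \<open>dv_Gen\<close> at the fresh variable
  would derive the quantified formula whose negation is being added. The bound on free variables is
  carried along to leave a fresh variable for the next stage.\<close>

lemma con_stp:
  assumes "con T H" "\<forall>q\<in>H. fvb q \<le> N"
  shows "con T (stp T H p)" "\<exists>N. \<forall>q\<in>stp T H p. fvb q \<le> N"
proof -
  let ?N = "fresh (insert p H)"
  have b: "\<forall>q\<in>insert p H. fvb q \<le> max N (fvb p)" using assms(2) by auto
  show "\<exists>N. \<forall>q\<in>stp T H p. fvb q \<le> N"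
  proof (cases "\<exists>r. p = \<^bold>\<not> (All r)")
    case True
    then obtain r where "p = \<^bold>\<not> (All r)" by blast
    then show ?thesis using b fvb_inst_Var[of ?N r]
      by (intro exI[of _ "max (max N (fvb p)) (max (fvb r) (Suc ?N))"])
         (auto simp: stp_def wit_def le_max_iff_disj)
  next
    case False
    then show ?thesis using b by (intro exI[of _ "max N (fvb p)"]) (auto simp: stp_def wit_def)
  qed
  show "con T (stp T H p)"
  proof (cases "con T (insert p H) \<and> (\<exists>r. p = \<^bold>\<not> (All r))")
    case True
    then obtain r where r: "p = \<^bold>\<not> (All r)" and c: "con T (insert p H)" by blast
    show ?thesis unfolding con_def
    proof
      assume "dv T (stp T H p) Bot"
      moreover have "stp T H p = insert (\<^bold>\<not> (inst (Var ?N) r)) (insert p H)"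
        using c r by (auto simp: stp_def wit_def)
      ultimately have "dv T (insert p H) (inst (Var ?N) r)" using dv_DN by metis
      moreover have f: "fvb q \<le> ?N" if "q \<in> insert p H" for q
        using fresh[OF b that] .
      moreover have "fvb r \<le> Suc ?N" using f[of p] r by auto
      ultimately have "dv T (insert p H) (All r)"
        by (intro dv_Gen[OF T]) auto
      then have "dv T (insert p H) Bot" using dv.dmp[OF dv.hyp] r by blast
      then show False using c by (simp add: con_def)
    qed
  next
    case False then show ?thesis using assms(1) by (auto simp: stp_def wit_def)
  qed
qed

lemma chain_con:
  assumes "con T G" "\<forall>q\<in>G. fvb q \<le> N"
  shows "con T (chain T G k) \<and> (\<exists>N. \<forall>q\<in>chain T G k. fvb q \<le> N)"
proof (induction k)
  case (Suc k)
  then obtain N where "con T (chain T G k)" "\<forall>q\<in>chain T G k. fvb q \<le> N" by blast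
  from con_stp[OF this] show ?case using Suc by simp
qed (use assms in auto)

lemma chain_mono: "i \<le> j \<Longrightarrow> chain T G i \<subseteq> chain T G j"
proof (rule lift_Suc_mono_le[of "chain T G"])
  show "chain T G n \<subseteq> chain T G (Suc n)" for n by (auto simp: stp_def)
qed

text \<open>A formula is rejected only when it is inconsistent with an earlier stage, hence with the
  union; a formula that gets in brings its witness along.\<close>

lemma henkin_set:
  assumes "con T G" "\<forall>q\<in>G. fvb q \<le> N"
  obtains H where "G \<subseteq> H" "con T H" "\<And>p. fm_in L_PA p \<Longrightarrow> p \<in> H \<or> \<not> con T (insert p H)"
    "\<And>r. fm_in L_PA r \<Longrightarrow> \<^bold>\<not> (All r) \<in> H \<Longrightarrow> \<exists>N. \<^bold>\<not> (inst (Var N) r) \<in> H"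
proof
  let ?H = "\<Union>k. chain T G k"
  show "G \<subseteq> ?H" by (metis UN_upper UNIV_I chain.simps(1))
  have the: "chain T G (Suc (goedel p)) = stp T (chain T G (goedel p)) p" if "fm_in L_PA p" for p
  proof -
    have "(THE q. fm_in L_PA q \<and> goedel q = goedel p) = p"
      using that goedel_inj by blast
    then show ?thesis using that by (subst chain.simps) (simp only:, metis)
  qed
  have fin: "\<exists>k. set qs \<subseteq> chain T G k" if "set qs \<subseteq> ?H" for qs
    using that
  proof (induction qs)
    case (Cons q qs)
    from Cons obtain k where k: "set qs \<subseteq> chain T G k" by auto
    from Cons(2) obtain l where l: "q \<in> chain T G l" by auto
    have "set (q # qs) \<subseteq> chain T G (max k l)"
      using k l chain_mono[of k "max k l"] chain_mono[of l "max k l"] by auto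
    then show ?case by blast
  qed simp
  show c: "con T ?H" unfolding con_def
  proof
    assume "dv T ?H Bot"
    from dv_finite[OF this] obtain qs where qs: "set qs \<subseteq> ?H" "T \<turnstile> foldr Imp qs Bot" by (elim exE conjE)
    from fin[OF qs(1)] obtain k where k: "set qs \<subseteq> chain T G k" by (elim exE)
    have "dv T (chain T G k) Bot" by (rule dv_foldr[OF k dv.base[OF qs(2)]])
    then show False using chain_con[OF assms, of k] by (simp add: con_def)
  qed
  show "p \<in> ?H \<or> \<not> con T (insert p ?H)" if "fm_in L_PA p" for p
  proof (cases "con T (insert p (chain T G (goedel p)))")
    case True
    then have "p \<in> chain T G (Suc (goedel p))" using the[OF that] by (simp only: stp_def if_True) simp
    then have "p \<in> ?H" by (rule UN_I[OF UNIV_I])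
    then show ?thesis by (rule disjI1)
  next
    case False
    have "insert p (chain T G (goedel p)) \<subseteq> insert p ?H" by (intro insert_mono UN_upper UNIV_I)
    with False have "\<not> con T (insert p ?H)" unfolding con_def using dv_mono by metis
    then show ?thesis by (rule disjI2)
  qed
  show "\<exists>N. \<^bold>\<not> (inst (Var N) r) \<in> ?H" if "fm_in L_PA r" "\<^bold>\<not> (All r) \<in> ?H" for r
  proof -
    let ?p = "\<^bold>\<not> (All r)"
    have L: "fm_in L_PA ?p" using that(1) by simp
    have sub: "insert ?p (chain T G (goedel ?p)) \<subseteq> ?H" using that(2) by (intro insert_subsetI UN_upper UNIV_I)
    have "con T (insert ?p (chain T G (goedel ?p)))"
      using c dv_mono[OF _ sub] unfolding con_def by metis
    then have "wit (chain T G (goedel ?p)) ?p \<subseteq> chain T G (Suc (goedel ?p))"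
      unfolding the[OF L] stp_def by (simp, blast)
    moreover have "\<^bold>\<not> (inst (Var (fresh (insert ?p (chain T G (goedel ?p))))) r) \<in> wit (chain T G (goedel ?p)) ?p"
      unfolding wit_def by (rule CollectI) (rule exI[of _ r], simp)
    ultimately have "\<^bold>\<not> (inst (Var (fresh (insert ?p (chain T G (goedel ?p))))) r) \<in> ?H"
      by (intro UN_I[of "Suc (goedel ?p)"]) (auto simp del: chain.simps)
    then show ?thesis by (rule exI)
  qed
qed

end

section \<open>Provable equality is a congruence\<close>

lemma dv_Leibniz: "dv T G (s \<doteq> t) \<Longrightarrow> dv T G (inst s p) \<Longrightarrow> dv T G (inst t p)"
  by (metis dv.base dv.dmp provable.Leibniz)

lemma dv_refl [simp]: "dv T G (t \<doteq> t)"
  by (rule dv.base[OF provable.Refl])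

lemma inst_lift: "subst_tm (case_nat s Var) (lift_tm t) = t"
  by (simp add: subst_tm_comp)

lemma dv_sym: "dv T G (s \<doteq> t) \<Longrightarrow> dv T G (t \<doteq> s)"
  using dv_Leibniz[of T G s t "Var 0 \<doteq> lift_tm s"]
  by (simp add: inst_def inst_lift)

lemma dv_trans: "dv T G (s \<doteq> t) \<Longrightarrow> dv T G (t \<doteq> u) \<Longrightarrow> dv T G (s \<doteq> u)"
  using dv_Leibniz[of T G t u "lift_tm s \<doteq> Var 0"] by (simp add: inst_def inst_lift)

text \<open>The arguments are exchanged from left to right; \<open>us\<close> holds those that are
  already exchanged.\<close>

lemma dv_fun_cong:
  assumes "list_all2 (\<lambda>s t. dv T G (s \<doteq> t)) ss ts"
  shows "dv T G (Fn f (us @ ss) \<doteq> Fn f (us @ ts))"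
  using assms
proof (induction arbitrary: us rule: list_all2_induct)
  case Nil then show ?case by (auto intro: dv.base provable.Refl)
next
  case (Cons s ss t ts)
  have "dv T G (Fn f (us @ s # ss) \<doteq> Fn f (us @ t # ss))"
    using dv_Leibniz[OF Cons(1), of "Fn f (map lift_tm (us @ s # ss)) \<doteq> Fn f (map lift_tm us @ Var 0 # map lift_tm ss)"]
      by (simp add: inst_def inst_lift comp_def)
  then show ?case using Cons(3)[of "us @ [t]"] dv_trans by fastforce
qed

lemma dv_rel_cong:
  assumes "list_all2 (\<lambda>s t. dv T G (s \<doteq> t)) ss ts" "dv T G (Rel r (us @ ss))"
  shows "dv T G (Rel r (us @ ts))"
  using assms
proof (induction arbitrary: us rule: list_all2_induct)
  case (Cons s ss t ts)
  have "dv T G (Rel r (us @ t # ss))"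
    using dv_Leibniz[OF Cons(1), of "Rel r (map lift_tm us @ Var 0 # map lift_tm ss)"] Cons(4)
    by (simp add: inst_def inst_lift comp_def)
  then show ?case using Cons(3)[of "us @ [t]"] by simp
qed simp

lemma tm_in_ren: "tm_in L t \<Longrightarrow> tm_in L (subst_tm (\<lambda>n. Var (\<rho> n)) t)"
  by (simp add: tm_in_subst)

text \<open>The elements of the Henkin model are indices of variables, which keeps the carrier
  inside \<open>nat\<close> whatever the type \<open>'a\<close> is. \<kappa> may be arbitrary
  because no \<open>Par\<close> is ever evaluated.\<close>

theorem completeness:
  fixes T G :: "'a fm set" and \<kappa> :: "'a \<Rightarrow> nat"
  assumes T: "\<And>q. q \<in> T \<Longrightarrow> fm_in L_PA q \<and> fvb q = 0"
    and G: "\<And>q. q \<in> G \<Longrightarrow> fm_in L_PA q \<and> fvb q \<le> 1"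
    and con: "\<not> dv T G Bot"
  obtains D :: "nat set" and F R e where "range e \<subseteq> D" "\<And>f xs. F f xs \<in> D"
    "\<And>q. q \<in> T \<union> G \<Longrightarrow> gs D F R \<kappa> e q"
proof -
  have Ts: "\<And>q. q \<in> T \<Longrightarrow> fvb q = 0" using T by blast
  obtain H where H: "G \<subseteq> H" "con T H" "\<And>p. fm_in L_PA p \<Longrightarrow> p \<in> H \<or> \<not> con T (insert p H)"
    "\<And>r. fm_in L_PA r \<Longrightarrow> \<^bold>\<not> (All r) \<in> H \<Longrightarrow> \<exists>N. \<^bold>\<not> (inst (Var N) r) \<in> H"
  proof (rule henkin_set[of T G 1])
    show "con T G" using con by (simp add: con_def)
  qed (use G Ts in \<open>blast intro: that\<close>)+
  have cl: "p \<in> H" if "fm_in L_PA p" "dv T H p" for p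
  proof (rule ccontr)
    assume "p \<notin> H"
    then have "dv T (insert p H) Bot" using H(3)[OF that(1)] by (simp add: con_def)
    from dv_cut[OF that(2) this] show False using H(2) by (simp add: con_def)
  qed
  have neg: "\<^bold>\<not> p \<in> H \<longleftrightarrow> p \<notin> H" if "fm_in L_PA p" for p
  proof
    assume "p \<notin> H"
    then have "dv T H (\<^bold>\<not> p)" using H(3)[OF that] dv_ded by (metis con_def)
    then show "\<^bold>\<not> p \<in> H" using that by (intro cl) auto
  next
    assume "\<^bold>\<not> p \<in> H"
    then show "p \<notin> H" using H(2) by (metis con_def dv.hyp dv.dmp)
  qed
  have imp: "p \<^bold>\<rightarrow> q \<in> H \<longleftrightarrow> (p \<in> H \<longrightarrow> q \<in> H)" if "fm_in L_PA p" "fm_in L_PA q" for p q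
  proof
    assume "p \<^bold>\<rightarrow> q \<in> H"
    then show "p \<in> H \<longrightarrow> q \<in> H" using cl[OF that(2)] by (metis dv.hyp dv.dmp)
  next
    assume a: "p \<in> H \<longrightarrow> q \<in> H"
    have "dv T H (p \<^bold>\<rightarrow> q)"
    proof (cases "p \<in> H")
      case True with a show ?thesis by (simp add: dv_K dv.hyp)
    next
      case False
      then have "\<^bold>\<not> p \<in> H" using neg that by blast
      then have "dv T (insert p H) Bot" by (metis dv.hyp dv.dmp insertI1 insertI2)
      then show ?thesis using dv_bot dv_ded by metis
    qed
    then show "p \<^bold>\<rightarrow> q \<in> H" using that by (intro cl) auto
  qed
  define eq where "eq m n \<longleftrightarrow> Var m \<doteq> Var n \<in> H" for m n
  have eqI: "dv T H (Var m \<doteq> Var n) \<Longrightarrow> eq m n" for m n by (simp add: eq_def cl)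
  have eqD: "eq m n \<Longrightarrow> dv T H (Var m \<doteq> Var n)" for m n by (simp add: eq_def dv.hyp)
  \<comment> \<open>The least provably equal variable represents its class, so that equality in the
    model is genuine equality.\<close>
  define rep where "rep n = (LEAST m. eq n m)" for n
  have rep: "eq n (rep n)" for n unfolding rep_def by (rule LeastI[of _ n]) (simp add: eqI)
  have repc: "rep m = rep n" if "eq m n" for m n
  proof -
    have "eq m k = eq n k" for k using that eqI eqD dv_sym dv_trans by metis
    then show ?thesis by (simp add: rep_def)
  qed
  have witn: "\<exists>N. inst (Var N) r \<in> H" if "fm_in L_PA r" "Ex r \<in> H" for r
  proof -
    from H(4)[of "\<^bold>\<not> r"] that obtain N where "\<^bold>\<not> (inst (Var N) (\<^bold>\<not> r)) \<in> H" by auto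
    then have "inst (Var N) (\<^bold>\<not> r) \<notin> H" using neg that fm_in_inst[of L_PA "\<^bold>\<not> r" "Var N"] by auto
    then show ?thesis using neg[of "inst (Var N) r"] that fm_in_inst[of L_PA r "Var N"] by (auto simp: inst_def)
  qed
  \<comment> \<open>Terms need no elements of their own: that some element equals \<open>t\<close>
    is derivable, and the witness property supplies a variable for it.\<close>
  have named: "\<exists>N. dv T H (Var N \<doteq> t)" if "tm_in L_PA t" for t
  proof -
    let ?r = "Var 0 \<doteq> lift_tm t"
    have r: "fm_in L_PA ?r" using that by (simp add: tm_in_ren)
    have "Ex ?r \<in> H"
    proof (rule ccontr)
      assume "Ex ?r \<notin> H"
      then have "All (\<^bold>\<not> ?r) \<in> H" using neg[of "All (\<^bold>\<not> ?r)"] r by auto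
      then have "dv T H (inst t (\<^bold>\<not> ?r))" by (metis dv.base dv.hyp dv.dmp provable.All_inst)
      then have "dv T H Bot" using dv.dmp[of T H "t \<doteq> t" Bot] by (simp add: inst_def inst_lift)
      then show False using H(2) by (simp add: con_def)
    qed
    with witn[OF r] obtain N where "inst (Var N) ?r \<in> H" by blast
    then show ?thesis by (intro exI[of _ N] dv.hyp) (simp add: inst_def inst_lift)
  qed
  define D where "D = range rep"
  define F where "F f xs = rep (SOME N. dv T H (Var N \<doteq> Fn f (map Var xs)))" for f xs
  define R where "R r xs \<longleftrightarrow> Rel r (map Var xs) \<in> H" for r xs
  have repD: "rep n = n" if "n \<in> D" for n
  proof -
    from that obtain x where "n = rep x" by (auto simp: D_def)
    then show ?thesis using repc[OF rep[of x]] by simp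
  qed
  have tmH: "dv T H (Var (ev F \<kappa> e t) \<doteq> subst_tm (\<lambda>n. Var (e n)) t) \<and> ev F \<kappa> e t \<in> D"
    if "tm_in L_PA t" "range e \<subseteq> D" for t e
    using that(1)
  proof (induction t)
    case (Var n) then show ?case using that(2) by auto
  next
    case (Fn f ts)
    let ?ts = "map (subst_tm (\<lambda>n. Var (e n))) ts" and ?vs = "map Var (map (ev F \<kappa> e) ts) :: 'a tm list"
    have "tm_in L_PA (Fn f ?vs)" using Fn(2) by (auto simp: list_all_iff)
    from someI_ex[OF named[OF this]] rep
    have "dv T H (Var (F f (map (ev F \<kappa> e) ts)) \<doteq> Fn f ?vs)"
      unfolding F_def by (blast intro: dv_trans[OF dv_sym[OF eqD[OF rep]]])
    moreover have "list_all2 (\<lambda>s t. dv T H (s \<doteq> t)) ?vs ?ts"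
      using Fn(1,2) by (simp add: list_all2_conv_all_nth list_all_iff)
    then have "dv T H (Fn f ?vs \<doteq> Fn f ?ts)" using dv_fun_cong[of T H ?vs ?ts f "[]"] by simp
    ultimately have "dv T H (Var (F f (map (ev F \<kappa> e) ts)) \<doteq> Fn f ?ts)" by (rule dv_trans)
    moreover have "F f (map (ev F \<kappa> e) ts) \<in> D" unfolding F_def D_def by (rule rangeI)
    ultimately show ?case by (simp only: ev.simps subst_tm.simps simp_thms)
  qed simp
  have fmH: "gs D F R \<kappa> e p \<longleftrightarrow> subst (\<lambda>n. Var (e n)) p \<in> H" if "fm_in L_PA p" "range e \<subseteq> D" for p e
    using that
  proof (induction p arbitrary: e)
    case Bot
    have "Bot \<notin> H" using H(2) dv.hyp[of Bot H T] by (auto simp: con_def)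
    then show ?case by simp
  next
    case (Eq s t)
    let ?u = "ev F \<kappa> e s" and ?v = "ev F \<kappa> e t"
    have L: "tm_in L_PA s" "tm_in L_PA t" using Eq(1) by auto
    note u = tmH[OF L(1) Eq(2)] and v = tmH[OF L(2) Eq(2)]
    have "?u = ?v \<longleftrightarrow> eq ?u ?v"
    proof
      assume "eq ?u ?v"
      from repc[OF this] show "?u = ?v" using repD u v by simp
    qed (simp add: eqI)
    also have "\<dots> \<longleftrightarrow> dv T H (subst (\<lambda>n. Var (e n)) (Eq s t))"
      unfolding subst.simps
    proof
      assume "eq ?u ?v"
      show "dv T H (subst_tm (\<lambda>n. Var (e n)) s \<doteq> subst_tm (\<lambda>n. Var (e n)) t)"
        by (rule dv_trans[OF dv_sym[OF conjunct1[OF u]] dv_trans[OF eqD[OF \<open>eq ?u ?v\<close>] conjunct1[OF v]]])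
    next
      assume "dv T H (subst_tm (\<lambda>n. Var (e n)) s \<doteq> subst_tm (\<lambda>n. Var (e n)) t)"
      from dv_trans[OF conjunct1[OF u] dv_trans[OF this dv_sym[OF conjunct1[OF v]]]]
      show "eq ?u ?v" by (rule eqI)
    qed
    also have "\<dots> \<longleftrightarrow> subst (\<lambda>n. Var (e n)) (Eq s t) \<in> H"
    proof
      show "dv T H (subst (\<lambda>n. Var (e n)) (Eq s t)) \<Longrightarrow> subst (\<lambda>n. Var (e n)) (Eq s t) \<in> H"
        using L by (intro cl) (simp_all add: tm_in_ren)
    qed (rule dv.hyp)
    finally show ?case by simp
  next
    case (Rel r ts)
    let ?ts = "map (subst_tm (\<lambda>n. Var (e n))) ts" and ?vs = "map Var (map (ev F \<kappa> e) ts) :: 'a tm list"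
    have l: "list_all2 (\<lambda>s t. dv T H (s \<doteq> t)) ?vs ?ts" "list_all2 (\<lambda>s t. dv T H (s \<doteq> t)) ?ts ?vs"
      using Rel(1) tmH[OF _ Rel(2)] by (simp_all add: list_all2_conv_all_nth list_all_iff dv_sym)
    have in_iff: "p \<in> H \<longleftrightarrow> dv T H p" if "fm_in L_PA p" for p
      using cl[OF that] dv.hyp by blast
    have "Rel r ?vs \<in> H \<longleftrightarrow> dv T H (Rel r ?vs)"
      using Rel(1) by (intro in_iff) (simp add: list_all_iff)
    also have "\<dots> \<longleftrightarrow> dv T H (Rel r ?ts)"
      using dv_rel_cong[OF l(1), of r "[]"] dv_rel_cong[OF l(2), of r "[]"] by (simp only: append_Nil) blast
    also have "\<dots> \<longleftrightarrow> Rel r ?ts \<in> H"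
      using Rel(1) by (intro in_iff[symmetric]) (simp add: list_all_iff tm_in_ren)
    finally show ?case by (simp add: R_def)
  next
    case (Imp p q)
    then show ?case using imp[of "subst (\<lambda>n. Var (e n)) p" "subst (\<lambda>n. Var (e n)) q"]
      by (simp add: fm_in_subst)
  next
    case (All p)
    let ?p = "subst (up (\<lambda>n. Var (e n))) p"
    have L: "fm_in L_PA ?p" using All(2) by (auto intro!: fm_in_subst split: nat.split)
    have i: "inst (Var a) ?p = subst (\<lambda>n. Var (case_nat a e n)) p" for a
      unfolding inst_def subst_comp
      by (rule arg_cong[where f = "\<lambda>s. subst s p"]) (auto simp: fun_eq_iff split: nat.split)
    have IH: "gs D F R \<kappa> (case_nat a e) p \<longleftrightarrow> inst (Var a) ?p \<in> H" if "a \<in> D" for a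
    proof -
      have "range (case_nat a e) \<subseteq> D" using that All(3) by (auto simp: image_subset_iff split: nat.split)
      from All(1)[OF _ this] All(2) show ?thesis unfolding i by (simp only: fm_in.simps)
    qed
    have "All ?p \<in> H \<longleftrightarrow> (\<forall>a\<in>D. inst (Var a) ?p \<in> H)"
    proof
      assume "All ?p \<in> H"
      then have "dv T H (inst t ?p)" for t by (metis dv.base dv.hyp dv.dmp provable.All_inst)
      then show "\<forall>a\<in>D. inst (Var a) ?p \<in> H" using L by (auto intro!: cl fm_in_inst)
    next
      assume a: "\<forall>a\<in>D. inst (Var a) ?p \<in> H"
      show "All ?p \<in> H"
      proof (rule ccontr)
        assume "All ?p \<notin> H"
        then have "\<^bold>\<not> (All ?p) \<in> H" using neg L by auto
        from H(4)[OF L this] obtain N where N: "\<^bold>\<not> (inst (Var N) ?p) \<in> H" by blast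
        have "inst (Var (rep N)) ?p \<in> H" using a by (auto simp: D_def)
        then have "dv T H (inst (Var N) ?p)" using rep[of N] eqD dv_sym dv_Leibniz dv.hyp by metis
        then show False using N H(2) by (metis con_def dv.hyp dv.dmp)
      qed
    qed
    then show ?case using IH by simp
  qed
  have r: "range rep \<subseteq> D" by (simp add: D_def)
  show ?thesis
  proof (rule that[of rep D F R])
    fix q assume "q \<in> T \<union> G"
    then have q: "fm_in L_PA q" "fvb q \<le> 1" using T G by fastforce+
    have d: "dv T H q" using \<open>q \<in> T \<union> G\<close> H(1) by (blast intro: dv.hyp dv.base provable.Ax)
    \<comment> \<open>At most variable 0 is free in \<open>q\<close>, so exchanging it for its
      representative by the Leibniz scheme covers the whole assignment \<open>rep\<close>.\<close>
    have "inst (Var 0) q = q" unfolding inst_def using q(2) by (intro subst_id) (auto split: nat.split)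
    then have "dv T H (inst (Var (rep 0)) q)" by (intro dv_Leibniz[OF eqD[OF rep]]) (simp add: d)
    also have "inst (Var (rep 0)) q = subst (\<lambda>n. Var (rep n)) q"
      unfolding inst_def
    proof (rule subst_cong)
      fix n assume "n < fvb q"
      then have "n = 0" using q(2) by simp
      then show "case_nat (Var (rep 0)) Var n = Var (rep n)" by simp
    qed
    finally show "gs D F R \<kappa> rep q"
      using fmH[OF q(1) r] q(1) by (auto intro!: cl fm_in_subst)
  qed (auto simp: D_def F_def)
qed

lemma gs_univ_closureD:
  assumes "gs D F R k e (univ_closure p)" "\<And>n. e' n \<in> D"
  shows "gs D F R k e' p"
proof -
  define e2 where "e2 n = (if n < fvb p then e' n else e (n - fvb p))" for n
  have "gs D F R k e2 p"
  proof -
    have "(\<forall>n<fvb p. e2 n \<in> D) \<and> (\<forall>n. e2 (n + fvb p) = e n)" using assms(2) by (simp add: e2_def)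
    then show ?thesis using assms(1) unfolding univ_closure_def gs_All_pow by blast
  qed
  then show ?thesis using gs_cong[of p e2 e' D F R k] by (simp add: e2_def)
qed

section \<open>Transport of structures along a bijection\<close>

lemma ev_transfer:
  assumes "tm_in L_PA t" and F: "\<And>f xs. g (F' f xs) = F f (map g xs)"
  shows "ev F k (\<lambda>n. g (e n)) t = g (ev F' k' e t)"
  using assms(1)
proof (induction t)
  case (Fn f ts)
  then have "map (ev F k (\<lambda>n. g (e n))) ts = map g (map (ev F' k' e) ts)"
    by (auto simp: list_all_iff)
  then show ?case by (simp only: ev.simps F)
qed simp_all

lemma gs_transfer:
  assumes "fm_in L_PA p" and F: "\<And>f xs. g (F' f xs) = F f (map g xs)"
    and R: "\<And>r xs. R' r xs \<longleftrightarrow> R r (map g xs)" and g: "bij_betw g UNIV D"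
  shows "gs D F R k (\<lambda>n. g (e n)) p \<longleftrightarrow> gs UNIV F' R' k' e p"
  using assms(1)
proof (induction p arbitrary: e)
  case (Eq s t)
  then have st: "tm_in L_PA s" "tm_in L_PA t" by simp_all
  show ?case
    unfolding gs.simps ev_transfer[of s g F' F, OF st(1) F, where k' = k']
      ev_transfer[of t g F' F, OF st(2) F, where k' = k']
    using bij_betw_imp_inj_on[OF g] by (simp add: inj_eq)
next
  case (Rel r ts)
  have "ev F k (\<lambda>n. g (e n)) t = g (ev F' k' e t)" if "t \<in> set ts" for t
    using Rel that by (intro ev_transfer[of t g F' F, OF _ F]) (simp add: list_all_iff)
  then have "map (ev F k (\<lambda>n. g (e n))) ts = map g (map (ev F' k' e) ts)" by simp
  then show ?case by (simp only: gs.simps R)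
next
  case (All p)
  have *: "(case_nat (g a) (\<lambda>n. g (e n))) = (\<lambda>n. g (case_nat a e n))" for a
    by (rule ext) (simp split: nat.split)
  have D: "D = range g" using g by (simp add: bij_betw_def)
  have "fm_in L_PA p" using All(2) by simp
  from All(1)[OF this] show ?case unfolding gs.simps D by (simp add: *)
qed simp_all

text \<open>The axioms without their closures, to be evaluated directly at chosen
  assignments.\<close>

definition PA_base :: "'a fm set" where
  "PA_base = (let x = Var 0; y = Var 1; z = Var 2 in
    {(x \<oplus> y) \<oplus> z \<doteq> x \<oplus> (y \<oplus> z),
     x \<oplus> y \<doteq> y \<oplus> x,
     (x \<otimes> y) \<otimes> z \<doteq> x \<otimes> (y \<otimes> z),
     x \<otimes> y \<doteq> y \<otimes> x,
     x \<otimes> (y \<oplus> z) \<doteq> x \<otimes> y \<oplus> x \<otimes> z,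
     x \<oplus> \<zero> \<doteq> x,
     x \<otimes> \<zero> \<doteq> \<zero>,
     x \<otimes> \<one> \<doteq> x,
     x \<prec> y \<^bold>\<and> y \<prec> z \<^bold>\<rightarrow> x \<prec> z,
     \<^bold>\<not> (x \<prec> x),
     x \<prec> y \<^bold>\<or> x \<doteq> y \<^bold>\<or> y \<prec> x,
     x \<prec> y \<^bold>\<rightarrow> x \<oplus> z \<prec> y \<oplus> z,
     \<zero> \<prec> z \<^bold>\<and> x \<prec> y \<^bold>\<rightarrow> x \<otimes> z \<prec> y \<otimes> z,
     x \<prec> y \<^bold>\<rightarrow> Ex (Var 1 \<oplus> Var 0 \<doteq> Var 2),
     \<zero> \<prec> \<one>,
     \<zero> \<prec> x \<^bold>\<rightarrow> \<one> \<prec> x \<^bold>\<or> \<one> \<doteq> x,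
     \<zero> \<prec> x \<^bold>\<or> \<zero> \<doteq> x})"

lemma PA_minus_base: "PA_minus = univ_closure ` PA_base"
  by (simp only: PA_minus_def PA_base_def Let_def)

lemma PA_minus_of_base: "p \<in> PA_base \<Longrightarrow> univ_closure p \<in> PA_minus"
  unfolding PA_minus_base by (rule imageI)

text \<open>Everything that follows works with the full carrier. The order axioms make the iterated
  successors of zero distinct, so the Henkin universe is an infinite subset of \<open>nat\<close>
  and can be renumbered by \<open>enumerate\<close>.\<close>

theorem completeness_nat:
  fixes T G :: "'a fm set" and \<kappa> :: "'a \<Rightarrow> nat"
  assumes T: "\<And>q. q \<in> T \<Longrightarrow> fm_in L_PA q \<and> fvb q = 0"
    and G: "\<And>q. q \<in> G \<Longrightarrow> fm_in L_PA q \<and> fvb q \<le> 1"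
    and con: "\<not> dv T G Bot" and PA: "PA_minus \<subseteq> T"
  obtains F :: "fsym \<Rightarrow> nat list \<Rightarrow> nat" and R e where "\<And>q. q \<in> T \<union> G \<Longrightarrow> gs UNIV F R \<kappa> e q"
proof -
  obtain D :: "nat set" and F R e where D: "range e \<subseteq> D" "\<And>f xs. F f xs \<in> D"
    "\<And>q. q \<in> T \<union> G \<Longrightarrow> gs D F R \<kappa> e q"
  proof (rule completeness[of T G \<kappa>])
    show "\<not> dv T G Bot" by (rule con)
  qed (use T G in \<open>blast intro: that\<close>)+
  have ax: "gs D F R \<kappa> e' p" if "univ_closure p \<in> PA_minus" "\<And>n. e' n \<in> D" for p e'
    using gs_univ_closureD[OF D(3) that(2)] PA that(1) by (meson UnI1 subsetD)
  have ax2: "\<lbrakk>p \<in> PA_base; x \<in> D; y \<in> D; z \<in> D\<rbrakk> \<Longrightarrow>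
      gs D F R \<kappa> (case_nat x (case_nat y (\<lambda>_. z))) p" for p x y z
    by (rule ax[OF PA_minus_of_base]) (auto split: nat.split)
  let ?l = "\<lambda>x y. R Less [x, y]" and ?p = "\<lambda>x y. F Plus [x, y]"
  let ?z = "F Zero []" and ?o = "F One []"
  have trans: "?l x y \<Longrightarrow> ?l y z \<Longrightarrow> ?l x z" if "x \<in> D" "y \<in> D" "z \<in> D" for x y z
    using ax2[of "Var 0 \<prec> Var 1 \<^bold>\<and> Var 1 \<prec> Var 2 \<^bold>\<rightarrow> Var 0 \<prec> Var 2" x y z] that by (simp add: PA_base_def Let_def)
  have irr: "\<not> ?l x x" if "x \<in> D" for x
    using ax2[of "\<^bold>\<not> (Var 0 \<prec> Var 0)" x x x] that by (simp add: PA_base_def Let_def)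
  have mono: "?l x y \<Longrightarrow> ?l (?p x z) (?p y z)" if "x \<in> D" "y \<in> D" "z \<in> D" for x y z
    using ax2[of "Var 0 \<prec> Var 1 \<^bold>\<rightarrow> Var 0 \<oplus> Var 2 \<prec> Var 1 \<oplus> Var 2" x y z] that by (simp add: PA_base_def Let_def)
  have comm: "?p x y = ?p y x" if "x \<in> D" "y \<in> D" for x y
    using ax2[of "Var 0 \<oplus> Var 1 \<doteq> Var 1 \<oplus> Var 0" x y x] that by (simp add: PA_base_def Let_def)
  have zero: "?p x ?z = x" if "x \<in> D" for x
    using ax2[of "Var 0 \<oplus> \<zero> \<doteq> Var 0" x x x] that by (simp add: PA_base_def Let_def)
  have one: "?l ?z ?o" using ax2[of "\<zero> \<prec> \<one>" ?z ?z ?z] D(2) by (simp add: PA_base_def Let_def)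
  have inc: "?l x (?p ?o x)" if "x \<in> D" for x
    using mono[OF D(2) D(2) that one] comm[OF D(2) that, of Zero "[]"] zero[OF that] by simp
  define h where "h n = ((?p ?o) ^^ n) ?z" for n
  have hD: "h n \<in> D" for n unfolding h_def using D(2) by (cases n) auto
  have hl: "i < j \<Longrightarrow> ?l (h i) (h j)" for i j
  proof (induction j)
    case (Suc j)
    have "?l (h j) (h (Suc j))" using inc[OF hD[of j]] by (simp add: h_def)
    then show ?case using Suc trans[OF hD hD hD, of i j "Suc j"] by (cases "i = j") auto
  qed simp
  have "inj h" using hl irr hD by (metis injI nat_neq_iff)
  then have inf: "infinite D" using hD by (meson finite_subset image_subsetI range_inj_infinite)
  define g where "g = enumerate D"
  have g: "bij_betw g UNIV D" unfolding g_def by (rule bij_enumerate[OF inf])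
  define F' where "F' f xs = inv g (F f (map g xs))" for f xs
  define R' where "R' r xs = R r (map g xs)" for r xs
  define e' where "e' n = inv g (e n)" for n
  have gi: "g (inv g x) = x" if "x \<in> D" for x
    using that g by (metis bij_betw_def f_inv_into_f)
  have F': "g (F' f xs) = F f (map g xs)" for f xs using gi D(2) by (simp add: F'_def)
  have "(\<lambda>n. g (e' n)) = e" using D(1) by (auto simp: fun_eq_iff e'_def intro!: gi)
  then have "gs UNIV F' R' \<kappa> e' q" if "q \<in> T \<union> G" for q
    using gs_transfer[of q g F' F R' R D \<kappa> e' \<kappa>, OF _ F' _ g] D(3)[OF that] T G that by (auto simp: R'_def)
  then show ?thesis by (rule that)
qed

section \<open>Discretely ordered semirings\<close>

locale dosr =
  fixes pl :: "'u \<Rightarrow> 'u \<Rightarrow> 'u" (infixl "+." 65) and ml :: "'u \<Rightarrow> 'u \<Rightarrow> 'u" (infixl "*." 70)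
    and lt :: "'u \<Rightarrow> 'u \<Rightarrow> bool" (infix "<." 50) and zr :: 'u and un :: 'u
  assumes pl_assoc: "(x +. y) +. z = x +. (y +. z)" and pl_comm: "x +. y = y +. x"
    and ml_assoc: "(x *. y) *. z = x *. (y *. z)" and ml_comm: "x *. y = y *. x"
    and distr: "x *. (y +. z) = x *. y +. x *. z" and pl_zr: "x +. zr = x" and ml_zr: "x *. zr = zr"
    and ml_un: "x *. un = x" and lt_trans: "x <. y \<Longrightarrow> y <. z \<Longrightarrow> x <. z" and lt_irr: "\<not> x <. x"
    and lt_lin: "x <. y \<or> x = y \<or> y <. x" and pl_mono: "x <. y \<Longrightarrow> x +. z <. y +. z"
    and ml_mono: "zr <. z \<Longrightarrow> x <. y \<Longrightarrow> x *. z <. y *. z"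
    and lt_ex: "x <. y \<Longrightarrow> \<exists>z. x +. z = y" and zr_un: "zr <. un"
    and discr: "zr <. x \<Longrightarrow> un <. x \<or> un = x" and zr_least: "zr <. x \<or> zr = x"
begin

definition le (infix "<=." 50) where "x <=. y \<longleftrightarrow> x <. y \<or> x = y"

text \<open>Truncated subtraction is introduced because the class \<open>linordered_semidom\<close>
  demands it; that class provides the algebra and the order facts used from here on.\<close>

definition mn (infixl "-." 65) where "x -. y = (if y <=. x then THE z. z +. y = x else zr)"

lemma pl_cancel: "x +. z = y +. z \<longleftrightarrow> x = y"
  using lt_lin[of x y] pl_mono lt_irr by metis

lemma mn_eq: "z +. y = x \<Longrightarrow> x -. y = z"
proof -
  assume z: "z +. y = x"
  have "y <=. z +. y" using zr_least[of z] pl_mono[of zr z y] pl_zr pl_comm by (metis le_def)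
  then show ?thesis unfolding mn_def using z pl_cancel by (auto intro!: the_equality)
qed

lemma le_ex: "x <=. y \<Longrightarrow> \<exists>z. z +. x = y"
  using lt_ex pl_comm pl_zr unfolding le_def by metis

lemma le_pl: "x <=. z +. x"
  using zr_least[of z] pl_mono[of zr z x] pl_zr pl_comm by (metis le_def)

lemma mn_le: "\<not> y <=. x \<Longrightarrow> x -. y = zr"
  by (simp add: mn_def)

lemma zr_mn: "zr -. c = zr"
proof (cases "c <=. zr")
  case True
  then have "c = zr" using zr_least[of c] lt_trans lt_irr unfolding le_def by blast
  then show ?thesis using mn_eq[of zr zr zr] by (simp add: pl_zr)
qed (rule mn_le)

lemma mn_mn: "a -. b -. c = a -. (b +. c)"
proof (cases "b <=. a")
  case True
  then obtain z where z: "z +. b = a" using le_ex by blast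
  then have ab: "a -. b = z" by (rule mn_eq)
  show ?thesis
  proof (cases "c <=. z")
    case True
    then obtain w where w: "w +. c = z" using le_ex by blast
    have e: "w +. (b +. c) = a" unfolding z[symmetric] w[symmetric] by (simp only: pl_assoc pl_comm[of b c])
    then show ?thesis using ab mn_eq[OF w] mn_eq[OF e] by simp
  next
    case False
    have "\<not> b +. c <=. a"
    proof
      assume "b +. c <=. a"
      then obtain w where "w +. (b +. c) = a" using le_ex by blast
      then have "(w +. c) +. b = z +. b" unfolding z by (simp only: pl_assoc pl_comm[of b c])
      then have "w +. c = z" by (simp only: pl_cancel)
      then show False using False le_pl[of c w] by simp
    qed
    then show ?thesis using ab mn_le[OF False] mn_le by simp
  qed
next
  case False
  have "\<not> b +. c <=. a"
  proof
    assume "b +. c <=. a"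
    then obtain w where "w +. (b +. c) = a" using le_ex by blast
    then have "(w +. c) +. b = a" by (simp only: pl_assoc pl_comm[of b c])
    then show False using False le_pl[of b "w +. c"] by simp
  qed
  then show ?thesis using mn_le[OF False] mn_le zr_mn by simp
qed

lemma ml_mn: "a *. (b -. c) = a *. b -. a *. c"
proof (cases "c <=. b")
  case True
  then obtain z where z: "z +. c = b" using le_ex by blast
  have e: "a *. z +. a *. c = a *. b" unfolding z[symmetric] by (rule distr[symmetric])
  then show ?thesis using mn_eq[OF z] mn_eq[OF e] by simp
next
  case False
  then have bc: "b <. c" using lt_lin[of b c] unfolding le_def by blast
  have az: "a *. (b -. c) = zr" by (simp only: mn_le[OF False] ml_zr)
  show ?thesis
  proof (cases "a = zr")
    case True
    then show ?thesis using zr_mn ml_zr ml_comm[of zr] by simp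
  next
    case a: False
    then have "b *. a <. c *. a" using zr_least[of a] bc by (intro ml_mono) blast
    then have "\<not> a *. c <=. a *. b"
      using lt_trans lt_irr unfolding le_def ml_comm[of a] by metis
    then show ?thesis using mn_le az by simp
  qed
qed

sublocale Ar: linordered_semidom pl mn le lt zr ml un
proof
  show "a *. b *. c = a *. (b *. c)" for a b c by (rule ml_assoc)
  show "a *. b = b *. a" for a b by (rule ml_comm)
  show "(a +. b) *. c = a *. c +. b *. c" for a b c using distr ml_comm by metis
  show "a +. b +. c = a +. (b +. c)" for a b c by (rule pl_assoc)
  show "a +. b = b +. a" for a b by (rule pl_comm)
  show "zr +. a = a" for a using pl_zr pl_comm by metis
  show "a +. b -. a = b" for a b using mn_eq pl_comm by metis
  show "a -. b -. c = a -. (b +. c)" for a b c by (rule mn_mn)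
  show "zr *. a = zr" "a *. zr = zr" for a using ml_zr ml_comm by metis+
  show "a *. (b +. c) = a *. b +. a *. c" for a b c by (rule distr)
  show "zr \<noteq> un" using zr_un lt_irr by metis
  show "un *. a = a" for a using ml_un ml_comm by metis
  show "a *. (b -. c) = a *. b -. a *. c" for a b c by (rule ml_mn)
  show "a *. b \<noteq> zr" if "a \<noteq> zr" "b \<noteq> zr" for a b
    using that ml_mono[of b zr a] zr_least[of a] zr_least[of b] ml_zr ml_comm lt_irr by metis
  show "x <. y \<longleftrightarrow> x <=. y \<and> \<not> y <=. x" for x y unfolding le_def using lt_trans lt_irr by metis
  show "x <=. x" for x by (simp add: le_def)
  show "x <=. z" if "x <=. y" "y <=. z" for x y z using that lt_trans unfolding le_def by metis
  show "x = y" if "x <=. y" "y <=. x" for x y using that lt_trans lt_irr unfolding le_def by metis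
  show "c +. a <=. c +. b" if "a <=. b" for a b c using that pl_mono pl_comm unfolding le_def by metis
  show "x <=. y \<or> y <=. x" for x y using lt_lin unfolding le_def by metis
  show "c *. a <. c *. b" if "a <. b" "zr <. c" for a b c using that ml_mono ml_comm by metis
  show "zr <. un" by (rule zr_un)
  show "a -. b +. b = a" if "b <=. a" for a b using le_ex[OF that] mn_eq by metis
qed

lemma zr_le [simp]: "zr <=. x" using zr_least by (auto simp: le_def)

lemma not_lt_zr [simp]: "\<not> x <. zr" by (simp add: Ar.not_less)

lemma lt_succ: "x <. y +. un \<longleftrightarrow> x <=. y"
proof
  assume *: "x <. y +. un"
  show "x <=. y"
  proof (rule ccontr)
    assume "\<not> x <=. y"
    then have "y <. x" by simp
    then obtain z where z: "y +. z = x" using lt_ex by blast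
    then have "zr <. z" using \<open>y <. x\<close> zr_least[of z] by (metis lt_irr pl_zr)
    then have "un <=. z" using discr by (auto simp: le_def)
    then have "y +. un <=. x" using z Ar.add_left_mono by metis
    then show False using * by simp
  qed
next
  assume "x <=. y"
  then show "x <. y +. un" using zr_un by (metis Ar.add_strict_left_mono Ar.le_less_trans pl_zr)
qed

lemma succ_le: "x +. un <=. y \<longleftrightarrow> x <. y"
  by (metis Ar.not_le lt_succ)

lemma lt_succ_self [simp]: "x <. x +. un" by (simp add: lt_succ)

lemma lt_succ_cases: "x <. y +. un \<longleftrightarrow> x <. y \<or> x = y"
  by (simp add: lt_succ le_def)

lemma zr_or_succ: "x = zr \<or> (\<exists>y. x = y +. un)"
  by (metis le_ex succ_le pl_zr pl_comm zr_least)

lemma succ_not_zr [simp]: "x +. un \<noteq> zr" "zr \<noteq> x +. un"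
  using lt_succ_self[of x] not_lt_zr by metis+

lemma le_square: "x <=. x *. x"
proof (cases "x = zr")
  case False
  then have "un <=. x" using zr_or_succ[of x] by (metis succ_le pl_zr pl_comm zr_least)
  then show ?thesis using Ar.mult_left_mono[of un x x] by (simp add: ml_un)
qed simp

text \<open>Cantor's pairing would need a division by two; the square keeps the pair a term, which
  \<open>cdt\<close> later writes out.\<close>

definition pr :: "'u \<Rightarrow> 'u \<Rightarrow> 'u" where "pr u v = (u +. v) *. (u +. v) +. u"

lemma le_pl1: "x <=. x +. z" using le_pl pl_comm by metis

lemma fst_le: "u <=. pr u v" unfolding pr_def by (rule le_pl)

lemma snd_le: "v <=. pr u v"
  unfolding pr_def by (meson le_pl le_pl1 le_square Ar.order_trans)

lemma pr_mono_lt: "u <. a \<Longrightarrow> v <=. b \<Longrightarrow> pr u v <. pr a b"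
  unfolding pr_def by (intro Ar.add_le_less_mono Ar.mult_mono Ar.add_mono) auto

lemma square_gap: "s <. t \<Longrightarrow> u <=. s \<Longrightarrow> s *. s +. u <. t *. t"
proof -
  assume "s <. t" "u <=. s"
  then have st: "s +. un <=. t" by (simp add: succ_le)
  have "s *. s +. u <=. s *. s +. s" using \<open>u <=. s\<close> by (rule Ar.add_left_mono)
  also have "\<dots> = s *. (s +. un)" by (simp add: distr ml_un)
  also have "\<dots> <. (s +. un) *. (s +. un)"
    by (metis Ar.mult_strict_right_mono lt_succ_self Ar.le_less_trans zr_le)
  also have "\<dots> <=. t *. t" using st by (intro Ar.mult_mono) auto
  finally show ?thesis .
qed

text \<open>Since \<open>u\<close> is at most the sum \<open>u +. v\<close>, the code stays below
  the next square. It therefore determines the sum, and then \<open>u\<close>.\<close>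

lemma pr_inj [simp]: "pr u v = pr a b \<longleftrightarrow> u = a \<and> v = b"
proof
  assume e: "pr u v = pr a b"
  have "\<not> u +. v <. a +. b"
  proof
    assume "u +. v <. a +. b"
    from square_gap[OF this le_pl1] have "pr u v <. (a +. b) *. (a +. b)" by (simp add: pr_def)
    also have "\<dots> <=. pr a b" unfolding pr_def by (rule le_pl1)
    finally show False using e by simp
  qed
  moreover have "\<not> a +. b <. u +. v"
  proof
    assume "a +. b <. u +. v"
    from square_gap[OF this le_pl1] have "pr a b <. (u +. v) *. (u +. v)" by (simp add: pr_def)
    also have "\<dots> <=. pr u v" unfolding pr_def by (rule le_pl1)
    finally show False using e by simp
  qed
  ultimately have s: "u +. v = a +. b" using lt_lin by blast
  then have "u = a" using e by (simp add: pr_def)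
  then show "u = a \<and> v = b" using s by simp
qed simp

lemma div_unique:
  assumes "q *. m +. r = q' *. m +. r'" "r <. m" "r' <. m"
  shows "q = q' \<and> r = r'"
proof -
  have *: "\<not> q <. q'" if "q *. m +. r = q' *. m +. r'" "r <. m" for q r q' r'
  proof
    assume "q <. q'"
    then have "q +. un <=. q'" by (simp add: succ_le)
    have "q' *. m +. r' = q *. m +. r" using that by simp
    also have "\<dots> <. q *. m +. m" using that(2) by (rule Ar.add_strict_left_mono)
    also have "\<dots> = (q +. un) *. m" by (metis distr ml_comm ml_un)
    also have "\<dots> <=. q' *. m" using \<open>q +. un <=. q'\<close> by (rule Ar.mult_right_mono) simp
    also have "\<dots> <=. q' *. m +. r'" by (rule le_pl1)
    finally show False by simp
  qed
  have "q = q'" using *[OF assms(1,2)] *[OF assms(1)[symmetric] assms(3)] lt_lin by blast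
  then show ?thesis using assms(1) by simp
qed

end

section \<open>The arithmetical hierarchy in a structure\<close>

lemma ren_simps:
  "ren \<rho> Bot = Bot" "ren \<rho> (Imp p q) = Imp (ren \<rho> p) (ren \<rho> q)"
  "ren \<rho> (Eq s t) = Eq (subst_tm (\<lambda>n. Var (\<rho> n)) s) (subst_tm (\<lambda>n. Var (\<rho> n)) t)"
  "ren \<rho> (Rel r ts) = Rel r (map (subst_tm (\<lambda>n. Var (\<rho> n))) ts)"
  "ren \<rho> (All p) = All (ren (case_nat 0 (\<lambda>n. Suc (\<rho> n))) p)"
proof -
  have "(up (\<lambda>n. Var (\<rho> n))) = (\<lambda>n. Var (case_nat 0 (\<lambda>n. Suc (\<rho> n)) n))"
    by (rule ext) (simp split: nat.split)
  then show "ren \<rho> (All p) = All (ren (case_nat 0 (\<lambda>n. Suc (\<rho> n))) p)" unfolding ren_def subst.simps by (rule arg_cong[where f = "\<lambda>s. All (subst s p)"])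
qed (simp_all add: ren_def)

lemma Delta0_ren: "Delta0 p \<Longrightarrow> Delta0 (ren \<rho> p)"
proof (induction arbitrary: \<rho> rule: Delta0.induct)
  case (1 s t)
  then show ?case unfolding ren_simps by (intro Delta0.intros) (simp add: tm_in_ren)
next
  case (2 r ts)
  then show ?case unfolding ren_simps by (intro Delta0.intros) (simp add: tm_in_ren list_all_iff)
next
  case (5 t p)
  have "ren \<rho> (All (Var 0 \<prec> lift_tm t \<^bold>\<rightarrow> p)) = All (Var 0 \<prec> lift_tm (subst_tm (\<lambda>n. Var (\<rho> n)) t) \<^bold>\<rightarrow>
      ren (case_nat 0 (\<lambda>n. Suc (\<rho> n))) p)"
    by (simp add: ren_simps subst_tm_comp)
  then show ?case using 5 tm_in_ren[of L_PA t \<rho>] by (simp only: Delta0.intros)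
next
  case (6 t p)
  have "ren \<rho> (Ex (Var 0 \<prec> lift_tm t \<^bold>\<and> p)) = Ex (Var 0 \<prec> lift_tm (subst_tm (\<lambda>n. Var (\<rho> n)) t) \<^bold>\<and>
      ren (case_nat 0 (\<lambda>n. Suc (\<rho> n))) p)"
    by (simp add: ren_simps subst_tm_comp)
  then show ?case using 6 tm_in_ren[of L_PA t \<rho>] by (simp only: Delta0.intros)
qed (auto simp: ren_simps intro: Delta0.intros)

lemma Sigma_Pi_ren:
  fixes p q :: "'a fm"
  shows "Sigma_fm j p \<Longrightarrow> Sigma_fm j (ren \<rho> p)" "Pi_fm j q \<Longrightarrow> Pi_fm j (ren \<rho> q)"
  by (induction j p and j q arbitrary: \<rho> and \<rho> rule: Sigma_fm_Pi_fm.inducts)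
     (auto simp: ren_simps intro: Sigma_fm_Pi_fm.intros Delta0_ren)

lemma Sigma_Pi_Suc:
  fixes p q :: "'a fm"
  shows "Sigma_fm j p \<Longrightarrow> Sigma_fm (Suc j) p" "Pi_fm j q \<Longrightarrow> Pi_fm (Suc j) q"
  by (induction j p and j q rule: Sigma_fm_Pi_fm.inducts) (auto intro: Sigma_fm_Pi_fm.intros)

lemma Sigma_mono: "Sigma_fm i p \<Longrightarrow> i \<le> j \<Longrightarrow> Sigma_fm j p"
  by (induction j) (auto intro: Sigma_Pi_Suc elim: le_SucE)

lemma Delta0_fm_in: "Delta0 p \<Longrightarrow> fm_in L_PA p"
  by (induction rule: Delta0.induct) (auto simp: tm_in_ren)

lemma Sigma_fm_in:
  fixes p q :: "'a fm"
  shows "Sigma_fm j p \<Longrightarrow> fm_in L_PA p" "Pi_fm j q \<Longrightarrow> fm_in L_PA q"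
  by (induction j p and j q rule: Sigma_fm_Pi_fm.inducts) (auto simp: Delta0_fm_in)

text \<open>The prefix classes are not closed under syntactic negation, as the negation of
  \<open>Ex p\<close> is not of the form \<open>All q\<close>. The dual formula is therefore only
  equivalent to it in the structure.\<close>

lemma Sigma_Pi_dual:
  fixes p p' :: "'a fm"
  shows "Sigma_fm j p \<Longrightarrow> \<exists>q. Pi_fm j q \<and> (\<forall>e. gs UNIV F R k e q \<longleftrightarrow> \<not> gs UNIV F R k e p)"
  "Pi_fm j p' \<Longrightarrow> \<exists>q. Sigma_fm j q \<and> (\<forall>e. gs UNIV F R k e q \<longleftrightarrow> \<not> gs UNIV F R k e p')"
proof (induction j p and j p' rule: Sigma_fm_Pi_fm.inducts)
  case (1 p)
  then show ?case by (intro exI[of _ "\<^bold>\<not> p"]) (auto intro: Sigma_fm_Pi_fm.intros Delta0.intros)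
next
  case (2 p)
  then show ?case by (intro exI[of _ "\<^bold>\<not> p"]) (auto intro: Sigma_fm_Pi_fm.intros Delta0.intros)
next
  case (5 n p)
  then obtain q where "Pi_fm (Suc n) q" "\<forall>e. gs UNIV F R k e q \<longleftrightarrow> \<not> gs UNIV F R k e p" by blast
  then show ?case by (intro exI[of _ "All q"]) (auto intro: Sigma_fm_Pi_fm.intros)
next
  case (6 n p)
  then obtain q where "Sigma_fm (Suc n) q" "\<forall>e. gs UNIV F R k e q \<longleftrightarrow> \<not> gs UNIV F R k e p" by blast
  then show ?case by (intro exI[of _ "Ex q"]) (auto intro: Sigma_fm_Pi_fm.intros)
qed (blast intro: Sigma_fm_Pi_fm.intros)+

abbreviation cn :: "'u \<Rightarrow> (nat \<Rightarrow> 'u) \<Rightarrow> nat \<Rightarrow> 'u" (infixr "##" 65) where "x ## e \<equiv> case_nat x e"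

text \<open>The intended \<open>m\<close> is one below the first level at which induction fails; so
  collection reaches one level higher than induction.\<close>

locale arith = dosr pl ml lt zr un
  for pl :: "'u \<Rightarrow> 'u \<Rightarrow> 'u" (infixl "+." 65) and ml :: "'u \<Rightarrow> 'u \<Rightarrow> 'u" (infixl "*." 70)
    and lt :: "'u \<Rightarrow> 'u \<Rightarrow> bool" (infix "<." 50) and zr :: 'u and un :: 'u +
  fixes F :: "fsym \<Rightarrow> 'u list \<Rightarrow> 'u" and R :: "rsym \<Rightarrow> 'u list \<Rightarrow> bool" and \<kappa> :: "'a \<Rightarrow> 'u" and m :: nat
  assumes F_simps [simp]: "F Zero [] = zr" "F One [] = un" "F Plus [x, y] = x +. y" "F Times [x, y] = x *. y"
    and R_simps [simp]: "R Less [x, y] \<longleftrightarrow> x <. y"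
    and ind_ax: "Sigma_fm m p \<Longrightarrow> gs UNIV F R \<kappa> e (inst \<zero> p \<^bold>\<and> All (p \<^bold>\<rightarrow> repl (Var 0 \<oplus> \<one>) p) \<^bold>\<rightarrow> All p)"
    and coll_ax: "j \<le> Suc m \<Longrightarrow> Sigma_fm j p \<Longrightarrow> gs UNIV F R \<kappa> e (All (
     All (Var 0 \<prec> Var 1 \<^bold>\<rightarrow> Ex (ren (\<lambda>n. if n < 2 then n else n + 1) p))
     \<^bold>\<rightarrow> Ex (All (Var 0 \<prec> Var 2 \<^bold>\<rightarrow>
           Ex (Var 0 \<prec> Var 2 \<^bold>\<and> ren (\<lambda>n. if n < 2 then n else n + 2) p)))))"
begin

abbreviation sat :: "(nat \<Rightarrow> 'u) \<Rightarrow> 'a fm \<Rightarrow> bool" where "sat \<equiv> gs UNIV F R \<kappa>"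

text \<open>The parameter-free \<open>\<Sigma>\<^sub>j\<close> predicates.\<close>

definition RS :: "nat \<Rightarrow> ((nat \<Rightarrow> 'u) \<Rightarrow> bool) \<Rightarrow> bool" where
  "RS j P \<longleftrightarrow> (\<exists>p. Sigma_fm j p \<and> P = (\<lambda>e. sat e p))"

lemma RS_eq: "RS j P \<Longrightarrow> (\<And>e. P e = Q e) \<Longrightarrow> RS j Q"
  by (simp add: ext[of P Q])

lemma RS_ren: "RS j P \<Longrightarrow> RS j (\<lambda>e. P (\<lambda>n. e (\<rho> n)))"
  unfolding RS_def by (metis (no_types) Sigma_Pi_ren(1) gs_ren)

lemma RS_Suc: "RS j P \<Longrightarrow> RS (Suc j) P"
  unfolding RS_def using Sigma_Pi_Suc by blast

lemma RS_co_Suc: "RS j (\<lambda>e. \<not> P e) \<Longrightarrow> RS (Suc j) P"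
proof -
  assume "RS j (\<lambda>e. \<not> P e)"
  then obtain p where p: "Sigma_fm j p" "(\<lambda>e. \<not> P e) = (\<lambda>e. sat e p)" unfolding RS_def by blast
  obtain q where q: "Pi_fm j q" "\<forall>e. sat e q \<longleftrightarrow> \<not> sat e p" using Sigma_Pi_dual(1)[OF p(1), of F R \<kappa>] by blast
  have "P = (\<lambda>e. sat e q)" using fun_cong[OF p(2)] q(2) by auto
  then show ?thesis using q(1) unfolding RS_def by (blast intro: Sigma_fm_Pi_fm.intros)
qed

lemma RS_ex: "RS (Suc j) P \<Longrightarrow> RS (Suc j) (\<lambda>e. \<exists>a. P (a ## e))"
proof -
  assume "RS (Suc j) P"
  then obtain p where p: "Sigma_fm (Suc j) p" "P = (\<lambda>e. sat e p)" unfolding RS_def by blast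
  have "(\<lambda>e. \<exists>a. P (a ## e)) = (\<lambda>e. sat e (Ex p))" by (simp add: p(2))
  then show ?thesis using p(1) unfolding RS_def by (blast intro: Sigma_fm_Pi_fm.intros)
qed

lemma RS0_D: "RS 0 P \<Longrightarrow> \<exists>p. Delta0 p \<and> P = (\<lambda>e. sat e p)"
  unfolding RS_def by (auto elim: Sigma_fm.cases)

lemma RS0_I: "Delta0 p \<Longrightarrow> RS 0 (\<lambda>e. sat e p)"
  unfolding RS_def by (auto intro: Sigma_fm_Pi_fm.intros)

lemma RS0_imp: assumes "RS 0 P" "RS 0 Q" shows "RS 0 (\<lambda>e. P e \<longrightarrow> Q e)"
proof -
  from assms[THEN RS0_D] obtain p q where "Delta0 p" "P = (\<lambda>e. sat e p)" "Delta0 q" "Q = (\<lambda>e. sat e q)" by blast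
  then show ?thesis using RS0_I[of "p \<^bold>\<rightarrow> q"] by (simp add: Delta0.intros)
qed

lemma RS0_False: "RS 0 (\<lambda>e. False)"
  using RS0_I[of Bot] by (simp add: Delta0.intros)

lemma RS0_not: "RS 0 P \<Longrightarrow> RS 0 (\<lambda>e. \<not> P e)"
  using RS0_imp[OF _ RS0_False] by simp

lemma RS0_and: "RS 0 P \<Longrightarrow> RS 0 Q \<Longrightarrow> RS 0 (\<lambda>e. P e \<and> Q e)"
  using RS0_not[OF RS0_imp[of P "\<lambda>e. \<not> Q e"]] RS0_not by simp

lemma RS0_or: "RS 0 P \<Longrightarrow> RS 0 Q \<Longrightarrow> RS 0 (\<lambda>e. P e \<or> Q e)"
  using RS0_imp[OF RS0_not, of P Q] by (simp add: disj_imp)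

lemma RS0_ball: assumes "RS 0 P" shows "RS 0 (\<lambda>e. \<forall>a. a <. e k \<longrightarrow> P (a ## e))"
proof -
  from RS0_D[OF assms] obtain p where "Delta0 p" "P = (\<lambda>e. sat e p)" by blast
  then show ?thesis using RS0_I[OF Delta0.intros(5)[of "Var k" p]] by simp
qed

lemma RS0_bex: assumes "RS 0 P" shows "RS 0 (\<lambda>e. \<exists>a. a <. e k \<and> P (a ## e))"
  using RS0_not[OF RS0_ball[OF RS0_not[OF assms], of k]] by simp

lemma RS0_less: "RS 0 (\<lambda>e. e i <. e j)"
  using RS0_I[OF Delta0.intros(2)[of Less "[Var i, Var j]"]] by simp

lemma RS0_eqn: "tm_in L_PA s \<Longrightarrow> tm_in L_PA t \<Longrightarrow> RS 0 (\<lambda>e. ev F \<kappa> e s = ev F \<kappa> e t)"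
  using RS0_I[OF Delta0.intros(1)[of s t]] by simp

lemma RS_lift: "RS 0 P \<Longrightarrow> RS j P"
  by (induction j) (auto intro: RS_Suc)

lemma coll:
  assumes "j \<le> Suc m" "RS j P" "\<And>x. x <. a \<Longrightarrow> \<exists>y. P (y ## x ## e)"
  shows "\<exists>b. \<forall>x. x <. a \<longrightarrow> (\<exists>y. y <. b \<and> P (y ## x ## e))"
proof -
  from assms(2) obtain p where p: "Sigma_fm j p" "P = (\<lambda>e. sat e p)" unfolding RS_def by blast
  have e1: "(\<lambda>n. (y ## x ## a ## e) (if n < 2 then n else n + 1)) = y ## x ## e" for y x a
    by (rule ext) (auto simp: numeral_2_eq_2 less_Suc_eq split: nat.split)
  have e2: "(\<lambda>n. (y ## x ## b ## a ## e) (if n < 2 then n else n + 2)) = y ## x ## e" for y x a b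
    by (rule ext) (auto simp: numeral_2_eq_2 less_Suc_eq split: nat.split)
  from coll_ax[OF assms(1) p(1), of e] show ?thesis
    using assms(3) unfolding p(2) by (simp add: gs_ren e1 e2 del: One_nat_def) (simp add: numeral_2_eq_2)
qed

lemma ind_raw:
  assumes "RS m P" "P (zr ## e)" "\<And>x. P (x ## e) \<Longrightarrow> P ((x +. un) ## e)" shows "P (x ## e)"
proof -
  from assms(1) obtain p where p: "Sigma_fm m p" "P = (\<lambda>e. sat e p)" unfolding RS_def by blast
  from ind_ax[OF p(1), of e] assms(2,3) show ?thesis unfolding p(2) by (simp add: gs_inst gs_repl)
qed

lemma ex_gt2: "\<exists>b. x <. b \<and> y <. b"
  by (metis lt_succ_self lt_lin lt_trans)

text \<open>The induction on \<open>j\<close> that proves these closure properties is where collection is used: it moves a bounded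
  universal quantifier past an unbounded existential one.\<close>

definition CL :: "nat \<Rightarrow> bool" where
  "CL j \<longleftrightarrow> (\<forall>P Q. RS j P \<longrightarrow> RS j Q \<longrightarrow> RS j (\<lambda>e. P e \<and> Q e) \<and> RS j (\<lambda>e. P e \<or> Q e)) \<and>
    (\<forall>P k. RS j P \<longrightarrow> RS j (\<lambda>e. \<forall>a. a <. e k \<longrightarrow> P (a ## e)) \<and> RS j (\<lambda>e. \<exists>a. a <. e k \<and> P (a ## e)))"

text \<open>Adjacent existential quantifiers are contracted by a common bound for both witnesses,
  without pairing; the bounded quantifiers that remain are absorbed by \<open>CL j\<close>.\<close>

lemma RS_nf:
  assumes "CL j" "RS (Suc j) P"
  shows "\<exists>Q. RS j (\<lambda>e. \<not> Q e) \<and> P = (\<lambda>e. \<exists>u. Q (u ## e))"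
proof -
  have cl: "RS j P \<Longrightarrow> RS j (\<lambda>e. \<forall>a. a <. e k \<longrightarrow> P (a ## e))" for P k
    using assms(1) unfolding CL_def by blast
  have "i = Suc j \<Longrightarrow> \<exists>Q. RS j (\<lambda>e. \<not> Q e) \<and> (\<lambda>e. sat e p) = (\<lambda>e. \<exists>u. Q (u ## e))"
    if "Sigma_fm i p" for i p
    using that
  proof (induction rule: Sigma_fm_Pi_fm.inducts(1)[where ?P2.0 = "\<lambda>_ _. True"])
    case (3 n p)
    then obtain q where q: "Sigma_fm j q" "\<forall>e. sat e q \<longleftrightarrow> \<not> sat e p"
      using Sigma_Pi_dual(2)[of j p F R \<kappa>] by blast
    have "RS j (\<lambda>e. sat (\<lambda>n. e (Suc n)) q)" by (rule RS_ren) (use q(1) in \<open>auto simp: RS_def\<close>)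
    then show ?case by (intro exI[of _ "\<lambda>e. sat (\<lambda>n. e (Suc n)) p"]) (simp add: q(2))
  next
    case (5 n p)
    then obtain Q where Q: "RS j (\<lambda>e. \<not> Q e)" "(\<lambda>e. sat e p) = (\<lambda>e. \<exists>u. Q (u ## e))" by blast
    define Q' where "Q' e = (\<exists>a. a <. e 0 \<and> (\<exists>u. u <. e 0 \<and> Q (u ## a ## (\<lambda>n. e (Suc n)))))" for e
    have "RS j (\<lambda>e. \<not> Q (e 0 ## e 1 ## (\<lambda>n. e (n + 3))))"
      using RS_ren[OF Q(1), of "\<lambda>n. if n < 2 then n else n + 1"]
      by (rule RS_eq) (auto simp: fun_eq_iff numeral_2_eq_2 numeral_3_eq_3 intro!: arg_cong[where f = Q] split: nat.split)
    from cl[OF this, of 1] have "RS j (\<lambda>e. \<forall>u. u <. e 1 \<longrightarrow> \<not> Q (u ## e 0 ## (\<lambda>n. e (n + 2))))"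
      by (simp add: numeral_3_eq_3 numeral_2_eq_2)
    from cl[OF this, of 0] have "RS j (\<lambda>e. \<not> Q' e)" unfolding Q'_def by simp
    moreover have "sat e (Ex p) \<longleftrightarrow> (\<exists>b. Q' (b ## e))" for e
    proof -
      have "sat e (Ex p) \<longleftrightarrow> (\<exists>a u. Q (u ## a ## e))" using fun_cong[OF Q(2)] by simp
      also have "\<dots> \<longleftrightarrow> (\<exists>b. Q' (b ## e))" unfolding Q'_def using ex_gt2 by fastforce
      finally show ?thesis .
    qed
    ultimately show ?case by (intro exI[of _ Q'] conjI ext)
  qed auto
  then show ?thesis using assms(2) unfolding RS_def by blast
qed

lemma CL_0: "CL 0"
  unfolding CL_def using RS0_and RS0_or RS0_ball RS0_bex by blast

lemma CL_Suc:
  assumes C: "CL j" and j: "Suc j \<le> Suc m"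
  shows "CL (Suc j)"
proof -
  have cl: "RS j P \<Longrightarrow> RS j Q \<Longrightarrow> RS j (\<lambda>e. P e \<and> Q e)" "RS j P \<Longrightarrow> RS j Q \<Longrightarrow> RS j (\<lambda>e. P e \<or> Q e)"
    "RS j P \<Longrightarrow> RS j (\<lambda>e. \<forall>a. a <. e k \<longrightarrow> P (a ## e))" "RS j P \<Longrightarrow> RS j (\<lambda>e. \<exists>a. a <. e k \<and> P (a ## e))" for P Q k
    using C unfolding CL_def by blast+
  have r: "RS j (\<lambda>e. \<not> Q e) \<Longrightarrow> RS j (\<lambda>e. \<not> Q (e 0 ## (\<lambda>n. e (n + 2))))"
    "RS j (\<lambda>e. \<not> Q e) \<Longrightarrow> RS j (\<lambda>e. \<not> Q (\<lambda>n. e (Suc n)))" for Q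
  proof -
    assume Q: "RS j (\<lambda>e. \<not> Q e)"
    show "RS j (\<lambda>e. \<not> Q (e 0 ## (\<lambda>n. e (n + 2))))"
      using RS_ren[OF Q, of "case_nat 0 (\<lambda>n. n + 2)"]
      by (rule RS_eq) (auto simp: fun_eq_iff intro!: arg_cong[where f = Q] split: nat.split)
    show "RS j (\<lambda>e. \<not> Q (\<lambda>n. e (Suc n)))" by (rule RS_ren[OF Q])
  qed
  have eta: "e 0 ## (\<lambda>n. e (Suc n)) = e" for e :: "nat \<Rightarrow> 'u" by (auto split: nat.split)
  have junct: "RS (Suc j) (\<lambda>e. P1 e \<and> P2 e) \<and> RS (Suc j) (\<lambda>e. P1 e \<or> P2 e)" if "RS (Suc j) P1" "RS (Suc j) P2" for P1 P2
  proof -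
    from RS_nf[OF C that(1)] RS_nf[OF C that(2)] obtain Q1 Q2 where
      Q: "RS j (\<lambda>e. \<not> Q1 e)" "P1 = (\<lambda>e. \<exists>u. Q1 (u ## e))" "RS j (\<lambda>e. \<not> Q2 e)" "P2 = (\<lambda>e. \<exists>u. Q2 (u ## e))"
      by blast
    have "RS (Suc j) (\<lambda>e. Q1 (e 0 ## (\<lambda>n. e (n + 2))) \<and> Q2 (\<lambda>n. e (Suc n)))"
      using cl(2)[OF r(1)[OF Q(1)] r(2)[OF Q(3)]] by (intro RS_co_Suc) (simp add: de_Morgan_conj)
    from RS_ex[OF RS_ex[OF this]] have 1: "RS (Suc j) (\<lambda>e. P1 e \<and> P2 e)"
      unfolding Q(2,4) by (rule RS_eq) auto
    have "RS (Suc j) (\<lambda>e. Q1 (e 0 ## (\<lambda>n. e (n + 2))) \<or> Q2 (\<lambda>n. e (Suc n)))"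
      using cl(1)[OF r(1)[OF Q(1)] r(2)[OF Q(3)]] by (intro RS_co_Suc) (simp add: de_Morgan_conj)
    from RS_ex[OF RS_ex[OF this]] have 2: "RS (Suc j) (\<lambda>e. P1 e \<or> P2 e)"
      unfolding Q(2,4) by (rule RS_eq) auto
    from 1 2 show ?thesis ..
  qed
  have bex: "RS (Suc j) (\<lambda>e. \<exists>a. a <. e k \<and> P (a ## e))" if "RS (Suc j) P" for P k
    using RS_ex[OF conjunct1[OF junct[OF RS_lift[OF RS0_less[of 0 "Suc k"]] that]]] by simp
  have ball: "RS (Suc j) (\<lambda>e. \<forall>a. a <. e k \<longrightarrow> P (a ## e))" if P: "RS (Suc j) P" for P k
  proof -
    from RS_nf[OF C P] obtain Q where Q: "RS j (\<lambda>e. \<not> Q e)" "P = (\<lambda>e. \<exists>u. Q (u ## e))" by blast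
    have *: "(\<forall>a. a <. e k \<longrightarrow> P (a ## e)) \<longleftrightarrow> (\<exists>b. \<forall>a. a <. e k \<longrightarrow> (\<exists>u. u <. b \<and> Q (u ## a ## e)))" for e
      using coll[OF j RS_co_Suc[OF Q(1)], of "e k" e] unfolding Q(2) by blast
    have "RS j (\<lambda>e. \<not> Q (e 0 ## e 1 ## (\<lambda>n. e (n + 3))))"
      using RS_ren[OF Q(1), of "\<lambda>n. if n < 2 then n else n + 1"]
      by (rule RS_eq) (auto simp: fun_eq_iff numeral_2_eq_2 numeral_3_eq_3 intro!: arg_cong[where f = Q] split: nat.split)
    from cl(3)[OF this, of 1] have "RS j (\<lambda>e. \<forall>u. u <. e 1 \<longrightarrow> \<not> Q (u ## e 0 ## (\<lambda>n. e (n + 2))))"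
      by (simp add: numeral_3_eq_3 numeral_2_eq_2)
    from cl(4)[OF this, of "Suc k"]
    have "RS (Suc j) (\<lambda>e. \<forall>a. a <. e (Suc k) \<longrightarrow> (\<exists>u. u <. e 0 \<and> Q (u ## a ## (\<lambda>n. e (Suc n)))))"
      by (intro RS_co_Suc) simp
    from RS_ex[OF this] show ?thesis by (rule RS_eq) (simp add: *)
  qed
  show ?thesis unfolding CL_def using junct ball bex by blast
qed

lemma CL: "j \<le> Suc m \<Longrightarrow> CL j"
  by (induction j) (auto intro: CL_0 CL_Suc)

lemma RS_and: "j \<le> Suc m \<Longrightarrow> RS j P \<Longrightarrow> RS j Q \<Longrightarrow> RS j (\<lambda>e. P e \<and> Q e)"
  and RS_or: "j \<le> Suc m \<Longrightarrow> RS j P \<Longrightarrow> RS j Q \<Longrightarrow> RS j (\<lambda>e. P e \<or> Q e)"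
  and RS_ball: "j \<le> Suc m \<Longrightarrow> RS j P \<Longrightarrow> RS j (\<lambda>e. \<forall>a. a <. e k \<longrightarrow> P (a ## e))"
  and RS_bex: "j \<le> Suc m \<Longrightarrow> RS j P \<Longrightarrow> RS j (\<lambda>e. \<exists>a. a <. e k \<and> P (a ## e))"
  using CL[of j] unfolding CL_def by blast+

end

section \<open>The class Delta with parameters\<close>

text \<open>Even variables are arguments, odd variables are parameters.\<close>

definition mix :: "(nat \<Rightarrow> 'u) \<Rightarrow> (nat \<Rightarrow> 'u) \<Rightarrow> nat \<Rightarrow> 'u" where
  "mix e e0 n = (if even n then e (n div 2) else e0 (n div 2))"

lemma mix_simps [simp]: "mix e e0 (2 * n) = e n" "mix e e0 (Suc (2 * n)) = e0 n"
  by (simp_all add: mix_def)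

lemma even_odd_ext: "(\<And>n. f (2 * n) = g (2 * n)) \<Longrightarrow> (\<And>n. f (Suc (2 * n)) = g (Suc (2 * n))) \<Longrightarrow> f = (g :: nat \<Rightarrow> 'u)"
  by (rule ext) (metis evenE oddE Suc_eq_plus1)

context arith
begin

text \<open>\<open>\<Sigma>\<^sub>m\<^sub>+\<^sub>1\<close> and \<open>\<Delta>\<^sub>m\<^sub>+\<^sub>1\<close> predicates with parameters, and functions with a \<open>\<Delta>\<^sub>m\<^sub>+\<^sub>1\<close> graph.  Only
  \<open>\<Sigma>\<^sub>m\<close> induction and \<open>\<Sigma>\<^sub>m\<^sub>+\<^sub>1\<close> collection are available, but they give \<open>\<Delta>\<^sub>m\<^sub>+\<^sub>1\<close> induction.\<close>

definition Sg :: "((nat \<Rightarrow> 'u) \<Rightarrow> bool) \<Rightarrow> bool" where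
  "Sg P \<longleftrightarrow> (\<exists>Q e0. RS (Suc m) Q \<and> P = (\<lambda>e. Q (mix e e0)))"

definition Dl :: "((nat \<Rightarrow> 'u) \<Rightarrow> bool) \<Rightarrow> bool" where
  "Dl P \<longleftrightarrow> Sg P \<and> Sg (\<lambda>e. \<not> P e)"

definition Fu :: "((nat \<Rightarrow> 'u) \<Rightarrow> 'u) \<Rightarrow> bool" where
  "Fu t \<longleftrightarrow> Dl (\<lambda>e. e 0 = t (\<lambda>n. e (Suc n)))"

lemma Sg_eq: "Sg P \<Longrightarrow> (\<And>e. P e = Q e) \<Longrightarrow> Sg Q"
  by (simp add: ext[of P Q])

lemma Dl_eq: "Dl P \<Longrightarrow> (\<And>e. P e = Q e) \<Longrightarrow> Dl Q"
  by (simp add: ext[of P Q])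

lemma Sg_ren: assumes "Sg P" shows "Sg (\<lambda>e. P (\<lambda>n. e (\<rho> n)))"
proof -
  obtain Q e0 where Q: "RS (Suc m) Q" "P = (\<lambda>e. Q (mix e e0))" using assms unfolding Sg_def by blast
  have "mix (\<lambda>n. e (\<rho> n)) e0 = (\<lambda>n. mix e e0 (if even n then 2 * \<rho> (n div 2) else n))" for e :: "nat \<Rightarrow> 'u"
    by (rule even_odd_ext) simp_all
  then show ?thesis using RS_ren[OF Q(1), of "\<lambda>n. if even n then 2 * \<rho> (n div 2) else n"] Q(2)
    unfolding Sg_def by (intro exI[of _ "\<lambda>E. Q (\<lambda>n. E (if even n then 2 * \<rho> (n div 2) else n))"] exI[of _ e0]) simp
qed

lemma Dl_ren: "Dl P \<Longrightarrow> Dl (\<lambda>e. P (\<lambda>n. e (\<rho> n)))"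
  unfolding Dl_def using Sg_ren[of P \<rho>] Sg_ren[of "\<lambda>e. \<not> P e" \<rho>] by blast

text \<open>Two predicates come with two parameter sequences, which are merged into
  \<open>mix e1 e2\<close>: the parameters of the first then occupy the positions 4i + 1, those of
  the second the positions 4i + 3.\<close>

lemma Sg2:
  assumes "Sg P" "Sg Q"
  obtains P' Q' e0 where "RS (Suc m) P'" "P = (\<lambda>e. P' (mix e e0))" "RS (Suc m) Q'" "Q = (\<lambda>e. Q' (mix e e0))"
proof -
  obtain P1 e1 where P: "RS (Suc m) P1" "P = (\<lambda>e. P1 (mix e e1))" using assms(1) unfolding Sg_def by blast
  obtain Q1 e2 where Q: "RS (Suc m) Q1" "Q = (\<lambda>e. Q1 (mix e e2))" using assms(2) unfolding Sg_def by blast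
  have 1: "mix e e1 = (\<lambda>n. mix e (mix e1 e2) (if even n then n else 2 * n - 1))" for e :: "nat \<Rightarrow> 'u"
    by (rule even_odd_ext) (simp_all add: mix_def)
  have 2: "mix e e2 = (\<lambda>n. mix e (mix e1 e2) (if even n then n else 2 * n + 1))" for e :: "nat \<Rightarrow> 'u"
    by (rule even_odd_ext) (simp_all add: mix_def)
  show ?thesis
  proof (rule that)
    show "RS (Suc m) (\<lambda>E. P1 (\<lambda>n. E (if even n then n else 2 * n - 1)))" by (rule RS_ren[OF P(1)])
    show "RS (Suc m) (\<lambda>E. Q1 (\<lambda>n. E (if even n then n else 2 * n + 1)))" by (rule RS_ren[OF Q(1)])
    show "P = (\<lambda>e. P1 (\<lambda>n. mix e (mix e1 e2) (if even n then n else 2 * n - 1)))"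
      unfolding P(2) by (simp only: 1[symmetric])
    show "Q = (\<lambda>e. Q1 (\<lambda>n. mix e (mix e1 e2) (if even n then n else 2 * n + 1)))"
      unfolding Q(2) by (simp only: 2[symmetric])
  qed
qed

lemma Sg_and: assumes "Sg P" "Sg Q" shows "Sg (\<lambda>e. P e \<and> Q e)"
proof -
  from Sg2[OF assms] obtain P' Q' e0 where *: "RS (Suc m) P'" "P = (\<lambda>e. P' (mix e e0))" "RS (Suc m) Q'" "Q = (\<lambda>e. Q' (mix e e0))" .
  show ?thesis unfolding Sg_def *(2,4)
    by (rule exI[of _ "\<lambda>e. P' e \<and> Q' e"], rule exI[of _ e0]) (rule conjI[OF RS_and[OF order.refl *(1,3)] refl])
qed

lemma Sg_or: assumes "Sg P" "Sg Q" shows "Sg (\<lambda>e. P e \<or> Q e)"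
proof -
  from Sg2[OF assms] obtain P' Q' e0 where *: "RS (Suc m) P'" "P = (\<lambda>e. P' (mix e e0))" "RS (Suc m) Q'" "Q = (\<lambda>e. Q' (mix e e0))" .
  show ?thesis unfolding Sg_def *(2,4)
    by (rule exI[of _ "\<lambda>e. P' e \<or> Q' e"], rule exI[of _ e0]) (rule conjI[OF RS_or[OF order.refl *(1,3)] refl])
qed

text \<open>A new argument moves the other arguments up by two places and leaves the parameters
  where they are; the renaming corrects a plain push onto the interleaved sequence
  accordingly.\<close>

lemma mix_cn: "mix (a ## e) e0 = (\<lambda>n. (a ## mix e e0) (if n = 0 then 0 else if even n then n - 1 else n + 1))"
proof (rule even_odd_ext)
  fix n
  show "mix (a ## e) e0 (2 * n) = (a ## mix e e0) (if 2 * n = 0 then 0 else if even (2 * n) then 2 * n - 1 else 2 * n + 1)"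
    by (cases n) (simp_all add: mix_def)
qed simp

lemma Sg_ex0: assumes "Sg P" shows "Sg (\<lambda>e. \<exists>a. P (a ## e))"
proof -
  obtain Q e0 where Q: "RS (Suc m) Q" "P = (\<lambda>e. Q (mix e e0))" using assms unfolding Sg_def by blast
  let ?\<rho> = "\<lambda>n. if n = 0 then 0 else if even n then n - 1 else n + 1"
  show ?thesis unfolding Sg_def Q(2) mix_cn
    by (rule exI[of _ "\<lambda>E. \<exists>a. Q (\<lambda>n. (a ## E) (?\<rho> n))"], rule exI[of _ e0])
       (rule conjI[OF RS_ex[OF RS_ren[OF Q(1)]] refl])
qed

lemma Sg_ball0: assumes "Sg P" shows "Sg (\<lambda>e. \<forall>a. a <. e k \<longrightarrow> P (a ## e))"
proof -
  obtain Q e0 where Q: "RS (Suc m) Q" "P = (\<lambda>e. Q (mix e e0))" using assms unfolding Sg_def by blast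
  let ?\<rho> = "\<lambda>n. if n = 0 then 0 else if even n then n - 1 else n + 1"
  have "RS (Suc m) (\<lambda>E. \<forall>a. a <. E (2 * k) \<longrightarrow> Q (\<lambda>n. (a ## E) (?\<rho> n)))"
    by (rule RS_ball[OF order.refl RS_ren[OF Q(1)]])
  then show ?thesis unfolding Sg_def Q(2) mix_cn
    by (intro exI[of _ "\<lambda>E. \<forall>a. a <. E (2 * k) \<longrightarrow> Q (\<lambda>n. (a ## E) (?\<rho> n))"] exI[of _ e0]) simp
qed

lemma RS_Sg: "RS (Suc m) P \<Longrightarrow> Sg P"
proof -
  assume P: "RS (Suc m) P"
  have "(\<lambda>n. mix e e0 (2 * n)) = e" for e e0 :: "nat \<Rightarrow> 'u" by simp
  then show ?thesis unfolding Sg_def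
    by (intro exI[of _ "\<lambda>E. P (\<lambda>n. E (2 * n))"] exI[of _ "\<lambda>_. zr"] conjI RS_ren[OF P]) simp
qed

text \<open>Freezes all arguments but the first: the values \<open>e\<close> become parameters,
  interleaved with the old ones.\<close>

lemma Sg_fix: assumes "Sg P" shows "Sg (\<lambda>e'. P (e' 0 ## e))"
proof -
  obtain Q e0 where Q: "RS (Suc m) Q" "P = (\<lambda>e. Q (mix e e0))" using assms unfolding Sg_def by blast
  let ?\<rho> = "\<lambda>n. if n = 0 then 0 else if even n then 2 * (n - 2) + 1 else 2 * n + 1"
  have "mix (e' 0 ## e) e0 = (\<lambda>n. mix e' (mix e e0) (?\<rho> n))" for e'
  proof (rule even_odd_ext)
    fix n
    show "mix (e' 0 ## e) e0 (2 * n) = mix e' (mix e e0) (?\<rho> (2 * n))"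
      by (cases n) (simp_all add: mix_def)
  qed (simp add: mix_def)
  then have "(\<lambda>e'. Q (mix (e' 0 ## e) e0)) = (\<lambda>e'. Q (\<lambda>n. mix e' (mix e e0) (?\<rho> n)))" by presburger
  then show ?thesis unfolding Sg_def Q(2)
    by (intro exI[of _ "\<lambda>E. Q (\<lambda>n. E (?\<rho> n))"] exI[of _ "mix e e0"] conjI RS_ren[OF Q(1)])
qed

lemma Dl_fix: "Dl (\<lambda>e. P (e 0) (\<lambda>n. e (Suc n))) \<Longrightarrow> Dl (\<lambda>e'. P (e' 0) e)"
  unfolding Dl_def using Sg_fix[of "\<lambda>e. P (e 0) (\<lambda>n. e (Suc n))" e] Sg_fix[of "\<lambda>e. \<not> P (e 0) (\<lambda>n. e (Suc n))" e]
  by simp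

lemma Dl_Sg: "Dl P \<Longrightarrow> Sg P" and Dl_coSg: "Dl P \<Longrightarrow> Sg (\<lambda>e. \<not> P e)" by (simp_all add: Dl_def)

lemma Dl_not: "Dl P \<Longrightarrow> Dl (\<lambda>e. \<not> P e)" by (simp add: Dl_def)

lemma Dl_and: "Dl P \<Longrightarrow> Dl Q \<Longrightarrow> Dl (\<lambda>e. P e \<and> Q e)"
  unfolding Dl_def de_Morgan_conj by (elim conjE) (intro conjI Sg_and Sg_or)

lemma Dl_or: "Dl P \<Longrightarrow> Dl Q \<Longrightarrow> Dl (\<lambda>e. P e \<or> Q e)"
  unfolding Dl_def de_Morgan_disj by (elim conjE) (intro conjI Sg_and Sg_or)

lemma Dl_imp: "Dl P \<Longrightarrow> Dl Q \<Longrightarrow> Dl (\<lambda>e. P e \<longrightarrow> Q e)"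
  using Dl_or[OF Dl_not, of P Q] by (simp add: disj_imp)

lemma Dl_iff: "Dl P \<Longrightarrow> Dl Q \<Longrightarrow> Dl (\<lambda>e. P e \<longleftrightarrow> Q e)"
  using Dl_and[OF Dl_imp[of P Q] Dl_imp[of Q P]] by (rule Dl_eq) auto

lemma Dl_RS0: "RS 0 P \<Longrightarrow> Dl P"
  unfolding Dl_def by (simp add: RS_Sg RS_lift RS0_not)

lemma Dl_less0: "Dl (\<lambda>e. e i <. e j)"
  by (rule Dl_RS0[OF RS0_less])

lemma Dl_eq0: "Dl (\<lambda>e. e i = e j)"
  using Dl_RS0[OF RS0_eqn[of "Var i" "Var j"]] by simp

lemma Dl_pl0: "Dl (\<lambda>e. e i = e j +. e k)"
  using Dl_RS0[OF RS0_eqn[of "Var i" "Var j \<oplus> Var k"]] by simp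

lemma Dl_ml0: "Dl (\<lambda>e. e i = e j *. e k)"
  using Dl_RS0[OF RS0_eqn[of "Var i" "Var j \<otimes> Var k"]] by simp

lemma Dl_const0: "Dl (\<lambda>e. e i = c)"
proof -
  have "Dl (\<lambda>e'. (e' 0 ## (\<lambda>_. c)) 0 = (e' 0 ## (\<lambda>_. c)) 1)"
    using Sg_fix[OF Dl_Sg[OF Dl_eq0]] Sg_fix[OF Dl_coSg[OF Dl_eq0]] unfolding Dl_def by blast
  then have "Dl (\<lambda>e. e 0 = c)" by simp
  from Dl_ren[OF this, of "\<lambda>_. i"] show ?thesis .
qed

lemma Fu_const: "Fu (\<lambda>e. c)" unfolding Fu_def by (rule Dl_const0)

lemma Fu_var: "Fu (\<lambda>e. e n)" unfolding Fu_def by (rule Dl_eq0)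

lemma Dl_True: "Dl (\<lambda>e. True)" using Dl_eq0[of 0 0] by simp

lemma Dl_False: "Dl (\<lambda>e. False)" using Dl_not[OF Dl_True] by simp

lemma Fu_ren: "Fu t \<Longrightarrow> Fu (\<lambda>e. t (\<lambda>n. e (\<rho> n)))"
  unfolding Fu_def by (drule Dl_ren[where \<rho> = "case_nat 0 (\<lambda>n. Suc (\<rho> n))"]) simp

lemma Sg_ex: "Sg (\<lambda>e. P (e 0) (\<lambda>n. e (Suc n))) \<Longrightarrow> Sg (\<lambda>e. \<exists>a. P a e)"
  by (drule Sg_ex0) simp

text \<open>Substitution is replaced by an existential quantifier over the graph of
  \<open>t\<close>. As \<open>t\<close> is total, the same device serves the negation of
  \<open>P\<close>, and hence \<Delta> predicates.\<close>

lemma Sg_subst: assumes "Sg (\<lambda>e. P (e 0) (\<lambda>n. e (Suc n)))" "Fu t" shows "Sg (\<lambda>e. P (t e) e)"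
proof -
  have "Sg (\<lambda>e. e 0 = t (\<lambda>n. e (Suc n)) \<and> P (e 0) (\<lambda>n. e (Suc n)))"
    by (rule Sg_and[OF Dl_Sg[OF assms(2)[unfolded Fu_def]] assms(1)])
  from Sg_ex[where P = "\<lambda>a e. a = t e \<and> P a e", OF this] show ?thesis by simp
qed

lemma Dl_subst: "Dl (\<lambda>e. P (e 0) (\<lambda>n. e (Suc n))) \<Longrightarrow> Fu t \<Longrightarrow> Dl (\<lambda>e. P (t e) e)"
  unfolding Dl_def using Sg_subst[of P t] Sg_subst[of "\<lambda>a e. \<not> P a e" t] by blast

lemma Sg_ball: assumes "Sg (\<lambda>e. P (e 0) (\<lambda>n. e (Suc n)))" "Fu t" shows "Sg (\<lambda>e. \<forall>a. a <. t e \<longrightarrow> P a e)"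
proof -
  have "Sg (\<lambda>e. P (e 0) (\<lambda>n. e (Suc (Suc n))))" using Sg_ren[OF assms(1), of "case_nat 0 (\<lambda>n. Suc (Suc n))"] by simp
  from Sg_ball0[OF this, of 0] have "Sg (\<lambda>e. \<forall>a. a <. e 0 \<longrightarrow> P a (\<lambda>n. e (Suc n)))" by simp
  from Sg_subst[OF this assms(2)] show ?thesis .
qed

lemma Sg_bex: assumes "Sg (\<lambda>e. P (e 0) (\<lambda>n. e (Suc n)))" "Fu t" shows "Sg (\<lambda>e. \<exists>a. a <. t e \<and> P a e)"
proof (rule Sg_ex)
  have "Sg (\<lambda>e. e 1 <. e 0)" by (rule Dl_Sg[OF Dl_less0])
  then have "Sg (\<lambda>e. (e 0 ## (\<lambda>n. e (Suc n))) 1 <. (e 0 ## (\<lambda>n. e (Suc n))) 0)" by simp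
  from Sg_subst[of "\<lambda>a e. e 0 <. a" "\<lambda>e. t (\<lambda>n. e (Suc n))"] Dl_Sg[OF Dl_less0[of 1 0]]
  have "Sg (\<lambda>e. e 0 <. t (\<lambda>n. e (Suc n)))" using Fu_ren[OF assms(2), of Suc] by simp
  from Sg_and[OF this assms(1)] show "Sg (\<lambda>e. e 0 <. t (\<lambda>n. e (Suc n)) \<and> P (e 0) (\<lambda>n. e (Suc n)))" .
qed

lemma Dl_ball: "Dl (\<lambda>e. P (e 0) (\<lambda>n. e (Suc n))) \<Longrightarrow> Fu t \<Longrightarrow> Dl (\<lambda>e. \<forall>a. a <. t e \<longrightarrow> P a e)"
  unfolding Dl_def using Sg_ball[of P t] Sg_bex[of "\<lambda>a e. \<not> P a e" t] by simp

lemma Dl_bex: "Dl (\<lambda>e. P (e 0) (\<lambda>n. e (Suc n))) \<Longrightarrow> Fu t \<Longrightarrow> Dl (\<lambda>e. \<exists>a. a <. t e \<and> P a e)"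
  unfolding Dl_def using Sg_bex[of P t] Sg_ball[of "\<lambda>a e. \<not> P a e" t] by simp

lemma Dl_rel2: assumes "Dl (\<lambda>e. P (e 0) (e 1))" "Fu t" "Fu u" shows "Dl (\<lambda>e. P (t e) (u e))"
proof (rule Dl_subst[where P = "\<lambda>a e. P a (u e)", OF _ assms(2)])
  have "Dl (\<lambda>e. P (e 1) (e 0))" using Dl_ren[OF assms(1), of "\<lambda>n. if n = 0 then 1 else 0"] by simp
  then show "Dl (\<lambda>e. P (e 0) (u (\<lambda>n. e (Suc n))))"
    by (intro Dl_subst[where P = "\<lambda>b e. P (e 0) b", OF _ Fu_ren[OF assms(3)]]) simp
qed

lemma Fu_fun2: assumes "Dl (\<lambda>e. e 0 = f (e 1) (e 2))" "Fu t" "Fu u" shows "Fu (\<lambda>e. f (t e) (u e))"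
  unfolding Fu_def
proof (rule Dl_subst[where P = "\<lambda>a e. e 0 = f a (u (\<lambda>n. e (Suc n)))", OF _ Fu_ren[OF assms(2)]])
  have "Dl (\<lambda>e. e 2 = f (e 1) (e 0))"
    using Dl_ren[OF assms(1), of "\<lambda>n. if n = 0 then 2 else if n = 1 then 1 else 0"] by simp
  then show "Dl (\<lambda>e. e (Suc 0) = f (e 0) (u (\<lambda>n. e (Suc (Suc n)))))"
    by (intro Dl_subst[where P = "\<lambda>b e. e 1 = f (e 0) b" and t = "\<lambda>e. u (\<lambda>n. e (Suc (Suc n)))", simplified, OF _ Fu_ren[OF assms(3)]])
      (simp add: numeral_2_eq_2)
qed

lemma Fu_fun1: assumes "Dl (\<lambda>e. e 0 = f (e 1))" "Fu t" shows "Fu (\<lambda>e. f (t e))"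
  using Fu_fun2[of "\<lambda>x y. f x" t t] assms by simp

lemma Dl_less: "Fu t \<Longrightarrow> Fu u \<Longrightarrow> Dl (\<lambda>e. t e <. u e)" by (rule Dl_rel2[where P = "(<.)", OF Dl_less0])

lemma Dl_eqn: "Fu t \<Longrightarrow> Fu u \<Longrightarrow> Dl (\<lambda>e. t e = u e)" by (rule Dl_rel2[where P = "(=)", OF Dl_eq0])

lemma Dl_le: "Fu t \<Longrightarrow> Fu u \<Longrightarrow> Dl (\<lambda>e. t e <=. u e)"
  unfolding le_def by (intro Dl_or Dl_less Dl_eqn)

lemma Fu_pl: "Fu t \<Longrightarrow> Fu u \<Longrightarrow> Fu (\<lambda>e. t e +. u e)" by (rule Fu_fun2[where f = "(+.)", OF Dl_pl0])

lemma Fu_ml: "Fu t \<Longrightarrow> Fu u \<Longrightarrow> Fu (\<lambda>e. t e *. u e)" by (rule Fu_fun2[where f = ml, OF Dl_ml0])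

lemma Fu_pr: "Fu t \<Longrightarrow> Fu u \<Longrightarrow> Fu (\<lambda>e. pr (t e) (u e))"
  unfolding pr_def by (intro Fu_pl Fu_ml)

lemma Dl_ball_le: "Dl (\<lambda>e. P (e 0) (\<lambda>n. e (Suc n))) \<Longrightarrow> Fu t \<Longrightarrow> Dl (\<lambda>e. \<forall>a. a <=. t e \<longrightarrow> P a e)"
  unfolding lt_succ[symmetric] by (intro Dl_ball Fu_pl Fu_const)

lemma Dl_bex_le: "Dl (\<lambda>e. P (e 0) (\<lambda>n. e (Suc n))) \<Longrightarrow> Fu t \<Longrightarrow> Dl (\<lambda>e. \<exists>a. a <=. t e \<and> P a e)"
  unfolding lt_succ[symmetric] by (intro Dl_bex Fu_pl Fu_const)

lemmas dl = Dl_not Dl_and Dl_or Dl_imp Dl_iff Dl_ball Dl_bex Dl_ball_le Dl_bex_le Dl_less Dl_eqn Dl_le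
  Dl_True Dl_False Fu_var Fu_const Fu_pl Fu_ml Fu_pr

text \<open>If \<open>P\<close> fails at \<open>z\<close>, collection bounds the witnesses for
  \<open>P\<close> and for its negation at all numbers up to \<open>z\<close>. There the failure of
  \<open>P\<close> becomes a \<open>\<Sigma>\<^sub>m\<close> predicate, to which the available
  induction applies.\<close>

lemma Dl_ind:
  assumes D: "Dl (\<lambda>e. P (e 0))" and z: "P zr" and s: "\<And>x. P x \<Longrightarrow> P (x +. un)"
  shows "P z"
proof (rule ccontr)
  assume nz: "\<not> P z"
  have CLm: "CL m" by (rule CL) simp
  from Sg2[OF Dl_Sg[OF D] Dl_coSg[OF D]] obtain P1 P2 e0 where
    P: "RS (Suc m) P1" "(\<lambda>e. P (e 0)) = (\<lambda>e. P1 (mix e e0))" "RS (Suc m) P2" "(\<lambda>e. \<not> P (e 0)) = (\<lambda>e. P2 (mix e e0))" .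
  define E where "E x = mix (\<lambda>_. x) e0" for x
  from RS_nf[OF CLm P(1)] obtain Q1 where Q1: "RS m (\<lambda>e. \<not> Q1 e)" "P1 = (\<lambda>e. \<exists>u. Q1 (u ## e))" by blast
  from RS_nf[OF CLm P(3)] obtain Q2 where Q2: "RS m (\<lambda>e. \<not> Q2 e)" "P2 = (\<lambda>e. \<exists>u. Q2 (u ## e))" by blast
  have p1: "P x \<longleftrightarrow> (\<exists>u. Q1 (u ## mix (x ## g) e0))" for x g
    using fun_cong[OF P(2), of "x ## g"] Q1(2) by simp
  have p2: "\<not> P x \<longleftrightarrow> (\<exists>u. Q2 (u ## mix (x ## g) e0))" for x g
    using fun_cong[OF P(4), of "x ## g"] Q2(2) by simp
  let ?g = "\<lambda>_::nat. zr"
  let ?\<rho> = "\<lambda>n. if n = (0::nat) then 0 else if n = 1 then 1 else if even n then n + 1 else n"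
  define M where "M = mix ?g e0"
  define \<tau> where "\<tau> n = (if n = 0 then 0 else if even n then n - 1 else n + 1)" for n :: nat
  have mx: "mix (x ## ?g) e0 = (\<lambda>n. (x ## M) (\<tau> n))" for x unfolding mix_cn M_def \<tau>_def ..
  define \<sigma> where "\<sigma> = case_nat 0 (\<lambda>n. Suc (\<tau> n))"
  have sg: "u ## (\<lambda>n. (x ## M) (\<tau> n)) = (\<lambda>n. (u ## x ## M) (\<sigma> n))" for u x
    by (rule ext) (simp add: \<sigma>_def split: nat.split)
  have R1: "RS m (\<lambda>e. \<not> Q1 (\<lambda>n. e (\<sigma> n)))" by (rule RS_ren[OF Q1(1)])
  have R2: "RS m (\<lambda>e. \<not> Q2 (\<lambda>n. e (\<sigma> n)))" by (rule RS_ren[OF Q2(1)])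
  have q1: "P x \<longleftrightarrow> (\<exists>u. Q1 (\<lambda>n. (u ## x ## M) (\<sigma> n)))" for x using p1[of x ?g] unfolding mx sg .
  have q2: "\<not> P x \<longleftrightarrow> (\<exists>u. Q2 (\<lambda>n. (u ## x ## M) (\<sigma> n)))" for x using p2[of x ?g] unfolding mx sg .
  have "RS (Suc m) (\<lambda>e. Q1 (\<lambda>n. e (\<sigma> n)) \<or> Q2 (\<lambda>n. e (\<sigma> n)))"
    by (intro RS_or RS_co_Suc R1 R2) simp
  from coll[OF order.refl this, of "z +. un" M] q1 q2 obtain c where
    c: "\<forall>x. x <=. z \<longrightarrow> (\<exists>u. u <. c \<and> (Q1 (\<lambda>n. (u ## x ## M) (\<sigma> n)) \<or> Q2 (\<lambda>n. (u ## x ## M) (\<sigma> n))))"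
    unfolding lt_succ by blast
  \<comment> \<open>\<open>P\<close> has no witness below \<open>c\<close>: here the level drops
    from \<open>m + 1\<close> to \<open>m\<close>.\<close>
  define N where "N e = (\<forall>u. u <. e 1 \<longrightarrow> \<not> Q1 (\<lambda>n. (u ## e 0 ## (\<lambda>n. e (Suc (Suc n)))) (\<sigma> n)))" for e
  have RN: "RS m N"
  proof -
    have "RS m (\<lambda>e. \<not> Q1 (\<lambda>n. (e 0 ## e 1 ## (\<lambda>n. e (n + 3))) (\<sigma> n)))"
      using RS_ren[OF R1, of "\<lambda>n. if n < 2 then n else n + 1"]
      by (rule RS_eq) (auto simp: fun_eq_iff numeral_2_eq_2 numeral_3_eq_3 intro!: arg_cong[where f = Q1] split: nat.split)
    from RS_ball[OF _ this, of 1] show ?thesis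
      unfolding N_def by (simp add: numeral_3_eq_3 numeral_2_eq_2 cong del: nat.case_cong_weak)
  qed
  have N: "N (x ## c ## M) \<longleftrightarrow> \<not> P x" if "x <=. z" for x
  proof
    assume "N (x ## c ## M)"
    then have "\<forall>u. u <. c \<longrightarrow> \<not> Q1 (\<lambda>n. (u ## x ## M) (\<sigma> n))" by (simp add: N_def cong del: nat.case_cong_weak)
    then show "\<not> P x" using c that q2 by blast
  next
    assume "\<not> P x"
    then show "N (x ## c ## M)" using q1[of x] by (simp add: N_def cong del: nat.case_cong_weak)
  qed
  \<comment> \<open>Only the failure of \<open>P\<close> is known to be
    \<open>\<Sigma>\<^sub>m\<close>, so the induction has to descend from \<open>z\<close>, with
    \<open>y\<close> counting the distance. Variables 1, 2 and 3 carry \<open>z\<close>,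
    \<open>z + 1\<close> and \<open>c\<close>; the first disjunct keeps \<open>W\<close> true once
    \<open>y\<close> exceeds \<open>z\<close>.\<close>
  define W where "W e = (e 1 <. e 0 \<or> (\<exists>w. w <. e 2 \<and> w +. e 0 = e 1 \<and> N (w ## (\<lambda>n. e (n + 3)))))" for e
  have "RS m (\<lambda>e. N (e 0 ## (\<lambda>n. e (n + 4))))"
    using RS_ren[OF RN, of "case_nat 0 (\<lambda>n. n + 4)"]
    by (rule RS_eq) (auto simp: fun_eq_iff intro!: arg_cong[where f = N] split: nat.split)
  moreover have "RS m (\<lambda>e. e 0 +. e 1 = e 2)"
    using RS_lift[OF RS0_eqn[of "Var 0 \<oplus> Var 1" "Var 2"]] by simp
  ultimately have "RS m (\<lambda>e. e 0 +. e 1 = e 2 \<and> N (e 0 ## (\<lambda>n. e (n + 4))))"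
    by (intro RS_and) simp_all
  from RS_bex[OF _ this, of 2]
  have "RS m (\<lambda>e. \<exists>w. w <. e 2 \<and> w +. e 0 = e 1 \<and> N (w ## (\<lambda>n. e (n + 3))))"
    by (simp add: numeral_2_eq_2 eval_nat_numeral)
  then have RW: "RS m W" unfolding W_def by (intro RS_or RS_lift[OF RS0_less]) simp_all
  have W: "W (y ## z ## (z +. un) ## c ## M) \<longleftrightarrow> z <. y \<or> (\<exists>w. w <=. z \<and> w +. y = z \<and> N (w ## c ## M))" for y
    unfolding W_def by (simp add: lt_succ eval_nat_numeral cong del: nat.case_cong_weak)
  have "W (z ## z ## (z +. un) ## c ## M)"
  proof (rule ind_raw[OF RW])
    show "W (zr ## z ## (z +. un) ## c ## M)" unfolding W using N[of z] nz by (intro disjI2 exI[of _ z]) simp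
    fix y assume a: "W (y ## z ## (z +. un) ## c ## M)"
    show "W ((y +. un) ## z ## (z +. un) ## c ## M)"
    proof (cases "z <. y +. un")
      case False
      then have "y <. z" by (metis Ar.not_less succ_le)
      with a obtain w where w: "w <=. z" "w +. y = z" "N (w ## c ## M)" unfolding W by auto
      have "w \<noteq> zr" using w(2) \<open>y <. z\<close> by auto
      then obtain v where v: "w = v +. un" using zr_or_succ by blast
      have "v <=. z" using w(1) v by (meson Ar.order_trans le_pl1)
      moreover have "\<not> P v" using s[of v] v N[OF w(1)] w(3) by auto
      ultimately have "N (v ## c ## M)" using N by blast
      moreover have "v +. (y +. un) = z" using w(2) v by (simp add: Ar.add.assoc Ar.add.commute[of un])
      ultimately show ?thesis unfolding W using \<open>v <=. z\<close> by blast
    qed (simp add: W)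
  qed
  then obtain w where "w <=. z" "w +. z = z" "N (w ## c ## M)" unfolding W by auto
  then show False using N z by simp
qed

lemma Dl_least:
  assumes D: "Dl (\<lambda>e. P (e 0))" and "P x"
  shows "\<exists>y. P y \<and> (\<forall>z. z <. y \<longrightarrow> \<not> P z)"
proof (rule ccontr)
  assume *: "\<nexists>y. P y \<and> (\<forall>z. z <. y \<longrightarrow> \<not> P z)"
  have "\<forall>z. z <. y \<longrightarrow> \<not> P z" for y
  proof (rule Dl_ind[where P = "\<lambda>y. \<forall>z. z <. y \<longrightarrow> \<not> P z"])
    show "Dl (\<lambda>e. \<forall>z. z <. e 0 \<longrightarrow> \<not> P z)" by (intro dl D)
  qed (use * lt_succ_cases in auto)
  from this[of "x +. un"] show False using \<open>P x\<close> by auto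
qed

end

section \<open>Powers of two and coded sets\<close>

context dosr
begin

declare Ar.one_add_one [simp del]

text \<open>The graph of Goedel's beta function; \<open>ET\<close> built on it is the graph of
  exponentiation with base two.\<close>

definition bt :: "'u \<Rightarrow> 'u \<Rightarrow> 'u \<Rightarrow> 'u \<Rightarrow> bool" where
  "bt u v i w \<longleftrightarrow> w <. un +. (i +. un) *. v \<and> (\<exists>q. u = q *. (un +. (i +. un) *. v) +. w)"

definition ET :: "'u \<Rightarrow> 'u \<Rightarrow> bool" where
  "ET y z \<longleftrightarrow> (\<exists>u v. bt u v zr un \<and> bt u v y z \<and>
    (\<forall>i. i <. y \<longrightarrow> (\<exists>w. bt u v i w \<and> bt u v (i +. un) (w *. (un +. un)))))"

lemma bt_unique: "bt u v i w \<Longrightarrow> bt u v i w' \<Longrightarrow> w = w'"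
  unfolding bt_def using div_unique by blast

lemma le_ml: "zr <. d \<Longrightarrow> q <=. q *. d"
proof -
  assume "zr <. d"
  then have "un <=. d" using discr[of d] by (auto simp: le_def)
  from Ar.mult_left_mono[OF this zr_le, of q] show ?thesis by (simp only: ml_un)
qed

text \<open>The modulus is positive, so the quotient is at most \<open>u\<close>; with this bound
  the predicate is visibly \<Delta>.\<close>

lemma bt_bounded: "bt u v i w \<longleftrightarrow> w <. un +. (i +. un) *. v \<and>
    (\<exists>q. q <=. u \<and> u = q *. (un +. (i +. un) *. v) +. w)"
proof -
  have "zr <. un +. (i +. un) *. v" using zr_un le_pl1 by (rule Ar.less_le_trans)
  then have "q <=. q *. (un +. (i +. un) *. v) +. w" for q
    by (rule Ar.order_trans[OF le_ml le_pl1])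
  then have q: "u = q *. (un +. (i +. un) *. v) +. w \<Longrightarrow> q <=. u" for q by (simp only:)
  show ?thesis unfolding bt_def
    by (rule conj_cong[OF refl], rule ex_cong1, rule iffI, rule conjI, erule q, assumption, erule conjunct2)
qed

lemma half_unique: "h +. h \<noteq> k +. k +. un"
proof
  assume e: "h +. h = k +. k +. un"
  have d: "x +. x = x *. (un +. un)" for x by (simp only: distr ml_un)
  have "h *. (un +. un) +. zr = k *. (un +. un) +. un" using e by (simp only: d[of h, symmetric] d[of k, symmetric] pl_zr)
  from div_unique[OF this lt_trans[OF zr_un lt_succ_self] lt_succ_self] show False using zr_un lt_irr by simp
qed

end

locale arith_exp = arith pl ml lt zr un F R \<kappa> m
  for pl :: "'u \<Rightarrow> 'u \<Rightarrow> 'u" (infixl "+." 65) and ml :: "'u \<Rightarrow> 'u \<Rightarrow> 'u" (infixl "*." 70)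
    and lt :: "'u \<Rightarrow> 'u \<Rightarrow> bool" (infix "<." 50) and zr :: 'u and un :: 'u
    and F :: "fsym \<Rightarrow> 'u list \<Rightarrow> 'u" and R :: "rsym \<Rightarrow> 'u list \<Rightarrow> bool" and \<kappa> :: "'a \<Rightarrow> 'u" and m :: nat +
  assumes exp_ax: "\<exists>z. ET y z"
begin

text \<open>Two coded computations are compared step by step. The common value is at most the code
  \<open>u\<close>, which keeps the induction hypothesis \<Delta>.\<close>

lemma ET_unique: assumes "ET y z" "ET y z'" shows "z = z'"
proof -
  from assms obtain u v u' v' where b: "bt u v zr un" "bt u v y z"
    "\<And>i. i <. y \<Longrightarrow> \<exists>w. bt u v i w \<and> bt u v (i +. un) (w *. (un +. un))"
    "bt u' v' zr un" "bt u' v' y z'"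
    "\<And>i. i <. y \<Longrightarrow> \<exists>w. bt u' v' i w \<and> bt u' v' (i +. un) (w *. (un +. un))" unfolding ET_def by blast
  have "y <=. y \<longrightarrow> (\<exists>w. w <=. u \<and> bt u v y w \<and> bt u' v' y w)"
  proof (rule Dl_ind[where P = "\<lambda>i. i <=. y \<longrightarrow> (\<exists>w. w <=. u \<and> bt u v i w \<and> bt u' v' i w)"])
    show "Dl (\<lambda>e. e 0 <=. y \<longrightarrow> (\<exists>w. w <=. u \<and> bt u v (e 0) w \<and> bt u' v' (e 0) w))"
      unfolding bt_bounded by (intro dl)
    have le: "w <=. u" if "bt u v i w" for i w using that le_pl unfolding bt_def by auto
    show "zr <=. y \<longrightarrow> (\<exists>w. w <=. u \<and> bt u v zr w \<and> bt u' v' zr w)" using b(1,4) le by blast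
    fix i assume IH: "i <=. y \<longrightarrow> (\<exists>w. w <=. u \<and> bt u v i w \<and> bt u' v' i w)"
    show "i +. un <=. y \<longrightarrow> (\<exists>w. w <=. u \<and> bt u v (i +. un) w \<and> bt u' v' (i +. un) w)"
    proof
      assume "i +. un <=. y"
      then have i: "i <. y" by (simp add: succ_le)
      with IH obtain w where w: "bt u v i w" "bt u' v' i w" by (auto simp: le_def)
      from b(3)[OF i] obtain w1 where w1: "bt u v i w1" "bt u v (i +. un) (w1 *. (un +. un))" by blast
      from b(6)[OF i] obtain w2 where w2: "bt u' v' i w2" "bt u' v' (i +. un) (w2 *. (un +. un))" by blast
      have "w1 = w" "w2 = w" using bt_unique w w1 w2 by blast+
      then show "\<exists>w. w <=. u \<and> bt u v (i +. un) w \<and> bt u' v' (i +. un) w" using w1(2) w2(2) le by blast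
    qed
  qed
  then obtain w where "bt u v y w" "bt u' v' y w" by auto
  then have "w = z" "w = z'" using b(2,5) bt_unique by blast+
  then show ?thesis by simp
qed

definition pow :: "'u \<Rightarrow> 'u" where "pow y = (THE z. ET y z)"

lemma ET_pow: "ET y z \<longleftrightarrow> z = pow y"
  unfolding pow_def using exp_ax[of y] ET_unique by (metis the_equality)

lemma pow_zr [simp]: "pow zr = un"
proof -
  have "ET zr (pow zr)" by (simp add: ET_pow)
  then show ?thesis unfolding ET_def using bt_unique by blast
qed

lemma pow_succ [simp]: "pow (y +. un) = pow y *. (un +. un)"
proof -
  have "ET (y +. un) (pow (y +. un))" by (simp add: ET_pow)
  then obtain u v where b: "bt u v zr un" "bt u v (y +. un) (pow (y +. un))"
    "\<And>i. i <. y +. un \<Longrightarrow> \<exists>w. bt u v i w \<and> bt u v (i +. un) (w *. (un +. un))" unfolding ET_def by blast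
  from b(3)[of y] obtain w where w: "bt u v y w" "bt u v (y +. un) (w *. (un +. un))" by auto
  have "i <. y +. un" if "i <. y" for i by (rule lt_trans[OF that lt_succ_self])
  then have "ET y w" unfolding ET_def using b(1,3) w(1) by blast
  then have "w = pow y" by (simp add: ET_pow)
  then show ?thesis using bt_unique[OF b(2) w(2)] by simp
qed

text \<open>The coded computation makes the graph \<Sigma>. Its complement is \<Sigma> as well,
  because by totality and uniqueness a value is wrong exactly if some computation yields a different
  one.\<close>

lemma Fu_pow: "Fu t \<Longrightarrow> Fu (\<lambda>e. pow (t e))"
proof (rule Fu_fun1[where f = pow])
  have ET: "Sg (\<lambda>e. ET (e i) (e j))" for i j unfolding ET_def
  by (intro Sg_ex Sg_and Sg_ball Fu_var; rule Dl_Sg; unfold bt_bounded; intro dl)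
  have 1: "Sg (\<lambda>e. e 0 = pow (e 1))" using ET[of 1 0] by (simp add: ET_pow)
  have "Sg (\<lambda>e. \<exists>z. ET (e 1) z \<and> z \<noteq> e 0)"
    by (rule Sg_ex, rule Sg_and, rule ET[of "Suc 1" 0], rule Dl_Sg, intro dl)
  then have "Sg (\<lambda>e. \<not> e 0 = pow (e 1))" by (rule Sg_eq) (auto simp: ET_pow)
  with 1 show "Dl (\<lambda>e. e 0 = pow (e 1))" by (simp add: Dl_def)
qed

section \<open>Laws of powers and division with remainder\<close>

lemma pow_dbl: "pow (y +. un) = pow y +. pow y" by (simp add: distr ml_un)

lemma pow_pos: "zr <. pow x"
proof (rule Dl_ind[where P = "\<lambda>x. zr <. pow x"])
  show "Dl (\<lambda>e. zr <. pow (e 0))" by (intro dl Fu_pow)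
  fix x assume "zr <. pow x" then show "zr <. pow (x +. un)"
    unfolding pow_dbl using le_pl1 by (rule Ar.less_le_trans)
qed (simp add: zr_un)

lemma lt_pow: "x <. pow x"
proof (rule Dl_ind[where P = "\<lambda>x. x <. pow x"])
  show "Dl (\<lambda>e. e 0 <. pow (e 0))" by (intro dl Fu_pow)
  fix x assume "x <. pow x"
  then have "x +. un <=. pow x" by (simp add: succ_le)
  also have "pow x <. pow x +. pow x" using Ar.add_strict_left_mono[OF pow_pos, of "pow x"] by (simp add: pl_zr)
  finally show "x +. un <. pow (x +. un)" unfolding pow_dbl .
qed (simp add: zr_un)

lemma pow_add: "pow (x +. y) = pow x *. pow y"
proof (rule Dl_ind[where P = "\<lambda>y. pow (x +. y) = pow x *. pow y"])
  show "Dl (\<lambda>e. pow (x +. e 0) = pow x *. pow (e 0))" by (intro dl Fu_pow)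
  fix y assume *: "pow (x +. y) = pow x *. pow y"
  have "pow (x +. (y +. un)) = pow (x +. y) *. (un +. un)" unfolding Ar.add.assoc[symmetric] by (rule pow_succ)
  then show "pow (x +. (y +. un)) = pow x *. pow (y +. un)" unfolding * pow_succ by (simp only: Ar.mult.assoc)
qed (simp add: pl_zr ml_un)

lemma pow_mono: "x <=. y \<Longrightarrow> pow x <=. pow y"
proof -
  assume "x <=. y"
  then obtain z where "z +. x = y" using le_ex by blast
  then have "pow y = pow x *. pow z" using pow_add[of x z] by (simp only: pl_comm[of z])
  then show ?thesis using le_ml[OF pow_pos[of z], of "pow x"] by simp
qed

lemma Dl_divE: "zr <. d \<Longrightarrow> \<exists>q r. x = q *. d +. r \<and> r <. d"
proof -
  assume d: "zr <. d"
  have "\<exists>q. q <=. x \<and> (\<exists>r. r <. d \<and> x = q *. d +. r)"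
  proof (rule Dl_ind[where P = "\<lambda>x. \<exists>q. q <=. x \<and> (\<exists>r. r <. d \<and> x = q *. d +. r)"])
    show "Dl (\<lambda>e. \<exists>q. q <=. e 0 \<and> (\<exists>r. r <. d \<and> e 0 = q *. d +. r))" by (intro dl)
    show "\<exists>q. q <=. zr \<and> (\<exists>r. r <. d \<and> zr = q *. d +. r)" using d by (intro exI[of _ zr]) simp
    fix x assume "\<exists>q. q <=. x \<and> (\<exists>r. r <. d \<and> x = q *. d +. r)"
    then obtain q r where q: "q <=. x" "r <. d" "x = q *. d +. r" by blast
    show "\<exists>q. q <=. x +. un \<and> (\<exists>r. r <. d \<and> x +. un = q *. d +. r)"
    proof (cases "r +. un <. d")
      case True
      have "q <=. x +. un" using q(1) le_pl1 by (rule Ar.order_trans)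
      moreover have "x +. un = q *. d +. (r +. un)" using q(3) by (simp add: pl_assoc)
      ultimately show ?thesis using True by blast
    next
      case False
      then have "r +. un = d" using q(2) by (metis succ_le le_def)
      then have "x +. un = (q +. un) *. d +. zr" using q(3) by (simp add: pl_assoc Ar.distrib_right)
      moreover have "q +. un <=. x +. un" using q(1) by (rule Ar.add_right_mono)
      ultimately show ?thesis using d by blast
    qed
  qed
  then show ?thesis by blast
qed

lemma halfE: obtains h where "q = h +. h" | h where "q = h +. h +. un"
proof -
  have "zr <. un +. un" by (rule lt_trans[OF zr_un lt_succ_self])
  from Dl_divE[OF this, of q] obtain h r where h: "q = h *. (un +. un) +. r" "r <. un +. un" by blast
  have "r <. un \<or> r = un" using h(2) by (simp only: lt_succ_cases)
  moreover have "r = zr" if "r <. un"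
    using that zr_least[of r] discr[of r] lt_irr Ar.less_not_sym by blast
  ultimately have "r = zr \<or> r = un" by blast
  moreover have "h *. (un +. un) = h +. h" by (simp only: distr ml_un)
  ultimately show thesis using that h(1) by (auto simp: pl_zr)
qed

text \<open>The binary digit of \<open>y\<close> at position \<open>x\<close> is \<open>1\<close>.\<close>

definition mem :: "'u \<Rightarrow> 'u \<Rightarrow> bool" where
  "mem x y \<longleftrightarrow> (\<exists>q. q <=. y \<and> (\<exists>r. r <. pow x \<and> y = (q +. q +. un) *. pow x +. r))"

lemma memI: "r <. pow x \<Longrightarrow> y = (q +. q +. un) *. pow x +. r \<Longrightarrow> mem x y"
proof -
  assume r: "r <. pow x" and y: "y = (q +. q +. un) *. pow x +. r"
  have "q <=. q +. q +. un" by (rule Ar.order_trans[OF le_pl1 le_pl1])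
  also have "\<dots> <=. (q +. q +. un) *. pow x" by (rule le_ml[OF pow_pos])
  also have "\<dots> <=. y" unfolding y by (rule le_pl1)
  finally have q: "q <=. y" .
  show ?thesis unfolding mem_def
    by (rule exI[of _ q], rule conjI[OF q], rule exI[of _ r], rule conjI[OF r y])
qed

lemma Dl_mem: "Fu t \<Longrightarrow> Fu u \<Longrightarrow> Dl (\<lambda>e. mem (t e) (u e))"
proof (rule Dl_rel2[where P = mem])
  show "Dl (\<lambda>e. mem (e 0) (e 1))" unfolding mem_def by (intro dl Fu_pow)
qed

lemma mem_pow_le: "mem x y \<Longrightarrow> pow x <=. y"
proof -
  assume "mem x y"
  then obtain q r where "y = (q +. q +. un) *. pow x +. r" unfolding mem_def by blast
  moreover have "pow x <=. (q +. q +. un) *. pow x"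
    using Ar.mult_right_mono[OF le_pl[of un "q +. q"] zr_le, of "pow x"] by (simp only: Ar.mult_1_left)
  ultimately show ?thesis using Ar.order_trans[OF _ le_pl1] by simp
qed

lemma mem_lt: "mem x y \<Longrightarrow> x <. y"
  by (rule Ar.less_le_trans[OF lt_pow mem_pow_le])

lemma mem_bound: "mem x y \<Longrightarrow> y <. pow b \<Longrightarrow> x <. b"
proof (rule ccontr)
  assume "mem x y" "y <. pow b" "\<not> x <. b"
  from Ar.le_less_trans[OF mem_pow_le[OF this(1)] this(2)] \<open>\<not> x <. b\<close> pow_mono[of b x]
  show False by (simp add: Ar.not_less)
qed

lemma not_mem_zr [simp]: "\<not> mem x zr"
  using mem_lt[of x zr] by auto

text \<open>For a position below \<open>b\<close>, \<open>pow b\<close> is an even multiple of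
  \<open>pow x\<close>, so the parity that \<open>mem\<close> reads is unchanged; positions above
  \<open>b\<close> exceed the size of the sum.\<close>

lemma mem_add:
  assumes y: "y <. pow b"
  shows "mem x (y +. pow b) \<longleftrightarrow> x = b \<or> mem x y"
proof -
  consider "x = b" | "x <. b" | "b <. x" using lt_lin by blast
  then show ?thesis
  proof cases
    case 1
    have "mem b (y +. pow b)" by (rule memI[OF y, of _ zr]) (simp add: pl_comm)
    then show ?thesis using 1 by simp
  next
    case 2
    from lt_ex[OF 2] obtain d where d: "x +. d = b" by blast
    have "d \<noteq> zr" using d 2 lt_irr by (auto simp: pl_zr)
    with d obtain c where c: "b = x +. (c +. un)" using zr_or_succ[of d] by auto
    have pb: "pow b = (pow c +. pow c) *. pow x"
      unfolding c pow_add[of x] pow_dbl by (rule ml_comm)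
    show ?thesis
    proof
      assume "x = b \<or> mem x y"
      then have "mem x y" using 2 by auto
      then obtain q r where q: "r <. pow x" "y = (q +. q +. un) *. pow x +. r" unfolding mem_def by blast
      have "y +. pow b = ((q +. pow c) +. (q +. pow c) +. un) *. pow x +. r"
        unfolding q(2) pb by (simp only: Ar.distrib_right Ar.add_ac)
      then show "mem x (y +. pow b)" by (rule memI[OF q(1)])
    next
      assume "mem x (y +. pow b)"
      then obtain q r where q: "r <. pow x" "y +. pow b = (q +. q +. un) *. pow x +. r" unfolding mem_def by blast
      from Dl_divE[OF pow_pos, of y x] obtain q0 r0 where q0: "y = q0 *. pow x +. r0" "r0 <. pow x" by blast
      have "y +. pow b = (q0 +. (pow c +. pow c)) *. pow x +. r0"
        unfolding q0(1) pb by (simp only: Ar.distrib_right Ar.add_ac)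
      with q div_unique[OF _ q0(2) q(1)] have e: "q0 +. (pow c +. pow c) = q +. q +. un" by auto
      show "x = b \<or> mem x y"
      proof (cases rule: halfE[of q0])
        case (1 h)
        have "(h +. pow c) +. (h +. pow c) = q +. q +. un" using e unfolding 1 by (simp only: Ar.add_ac)
        then show ?thesis using half_unique by blast
      next
        case (2 h)
        then show ?thesis using memI[OF q0(2), of y h] q0(1) by simp
      qed
    qed
  next
    case 3
    have "\<not> mem x y"
      using mem_bound[OF _ y, of x] 3 Ar.less_not_sym by blast
    moreover have "y +. pow b <. pow (b +. un)" unfolding pow_dbl using y by (rule Ar.add_strict_right_mono)
    then have "\<not> mem x (y +. pow b)"
      using mem_bound[of x "y +. pow b" "b +. un"] 3 Ar.less_not_sym lt_irr unfolding lt_succ_cases by blast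
    ultimately show ?thesis using 3 lt_irr by auto
  qed
qed

text \<open>Digits are appended one at a time; the bound \<open>pow b\<close> on the code makes the
  statement fit for \<Delta> induction.\<close>

lemma comprehension:
  assumes P: "Dl (\<lambda>e. P (e 0))"
  shows "\<exists>y. y <. pow b \<and> (\<forall>x. mem x y \<longleftrightarrow> x <. b \<and> P x)"
proof -
  have "\<exists>y. y <. pow b \<and> (\<forall>x. x <. b \<longrightarrow> (mem x y \<longleftrightarrow> P x))"
  proof (rule Dl_ind[where P = "\<lambda>b. \<exists>y. y <. pow b \<and> (\<forall>x. x <. b \<longrightarrow> (mem x y \<longleftrightarrow> P x))"])
    have "Dl (\<lambda>e. P (e n))" for n using Dl_ren[OF P, of "\<lambda>_. n"] .
    then show "Dl (\<lambda>e. \<exists>y. y <. pow (e 0) \<and> (\<forall>x. x <. e 0 \<longrightarrow> (mem x y \<longleftrightarrow> P x)))"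
      by (intro dl Fu_pow Dl_mem)
    show "\<exists>y. y <. pow zr \<and> (\<forall>x. x <. zr \<longrightarrow> (mem x y \<longleftrightarrow> P x))" by (intro exI[of _ zr]) (simp add: zr_un)
    fix b assume "\<exists>y. y <. pow b \<and> (\<forall>x. x <. b \<longrightarrow> (mem x y \<longleftrightarrow> P x))"
    then obtain y where y: "y <. pow b" "\<And>x. x <. b \<Longrightarrow> mem x y \<longleftrightarrow> P x" by blast
    have nb: "\<not> mem b y" using mem_bound[OF _ y(1)] lt_irr by blast
    show "\<exists>y. y <. pow (b +. un) \<and> (\<forall>x. x <. b +. un \<longrightarrow> (mem x y \<longleftrightarrow> P x))"
    proof (cases "P b")
      case True
      have "y +. pow b <. pow (b +. un)" unfolding pow_dbl using y(1) by (rule Ar.add_strict_right_mono)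
      moreover have "mem x (y +. pow b) \<longleftrightarrow> P x" if "x <. b +. un" for x
        using that y(2) True unfolding mem_add[OF y(1)] lt_succ_cases by (cases "x = b") auto
      ultimately show ?thesis by blast
    next
      case False
      have "y <. pow (b +. un)" unfolding pow_dbl using y(1) le_pl1 by (rule Ar.less_le_trans)
      moreover have "mem x y \<longleftrightarrow> P x" if "x <. b +. un" for x
        using that y(2) False nb unfolding lt_succ_cases by (cases "x = b") auto
      ultimately show ?thesis by blast
    qed
  qed
  then obtain y where y: "y <. pow b" "\<And>x. x <. b \<Longrightarrow> mem x y \<longleftrightarrow> P x" by blast
  then show ?thesis using mem_bound[OF _ y(1)] by blast
qed

text \<open>Induction on the number of digits, comparing the leading ones. Apart from
  extensionality, it is the means to bound the code of a set by the code of a superset.\<close>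

lemma subset_le:
  assumes s: "\<And>x. mem x y \<Longrightarrow> mem x y'"
  shows "y <=. y'"
proof -
  let ?Q = "\<lambda>b y y'. (\<forall>x. x <. b \<longrightarrow> mem x y \<longrightarrow> mem x y') \<longrightarrow> y <=. y'"
  have "\<forall>y. y <. pow b \<longrightarrow> (\<forall>y'. y' <. pow b \<longrightarrow> ?Q b y y')" for b
  proof (rule Dl_ind[where P = "\<lambda>b. \<forall>y. y <. pow b \<longrightarrow> (\<forall>y'. y' <. pow b \<longrightarrow> ?Q b y y')"])
    show "Dl (\<lambda>e. \<forall>y. y <. pow (e 0) \<longrightarrow> (\<forall>y'. y' <. pow (e 0) \<longrightarrow> ?Q (e 0) y y'))"
      by (intro dl Fu_pow Dl_mem)
    show "\<forall>y. y <. pow zr \<longrightarrow> (\<forall>y'. y' <. pow zr \<longrightarrow> ?Q zr y y')"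
    proof (intro allI impI)
      fix y y' assume "y <. pow zr"
      then have "y = zr" using lt_succ_cases[of y zr] by simp
      then show "y <=. y'" by simp
    qed
    fix b assume IH: "\<forall>y. y <. pow b \<longrightarrow> (\<forall>y'. y' <. pow b \<longrightarrow> ?Q b y y')"
    have split: "(z <. pow b \<and> \<not> mem b z) \<or> (\<exists>z0. z0 <. pow b \<and> z = z0 +. pow b \<and> mem b z)" if "z <. pow (b +. un)" for z
    proof (cases "z <. pow b")
      case True then show ?thesis using mem_bound[OF _ True] lt_irr by blast
    next
      case False
      then have "pow b <=. z" by (simp only: Ar.not_less)
      then obtain z0 where z0: "z0 +. pow b = z" using le_ex by blast
      then have "z0 <. pow b" using that unfolding pow_dbl by auto
      then show ?thesis using z0 mem_add[of z0 b b] by auto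
    qed
    show "\<forall>y. y <. pow (b +. un) \<longrightarrow> (\<forall>y'. y' <. pow (b +. un) \<longrightarrow> ?Q (b +. un) y y')"
    proof (intro allI impI)
      fix y y' assume y: "y <. pow (b +. un)" "y' <. pow (b +. un)" and s: "\<forall>x. x <. b +. un \<longrightarrow> mem x y \<longrightarrow> mem x y'"
      have sb: "mem x y \<Longrightarrow> mem x y'" if "x <. b" for x using s that lt_succ_cases by blast
      have bb: "mem b y \<Longrightarrow> mem b y'" using s lt_succ_self by blast
      from split[OF y(1)] show "y <=. y'"
      proof (elim disjE exE conjE)
        assume a: "y <. pow b" "\<not> mem b y"
        from split[OF y(2)] show ?thesis
        proof (elim disjE exE conjE)
          assume "y' <. pow b" then show ?thesis using IH a sb by blast
        next
          fix z0 assume "z0 <. pow b" "y' = z0 +. pow b"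
          then show ?thesis using Ar.less_le_trans[OF a(1) le_pl[of "pow b" z0]] unfolding le_def by blast
        qed
      next
        fix y0 assume a: "y0 <. pow b" "y = y0 +. pow b" "mem b y"
        from split[OF y(2)] bb[OF a(3)] obtain z0 where z: "z0 <. pow b" "y' = z0 +. pow b" by blast
        have "mem x z0" if "x <. b" "mem x y0" for x
          using sb[OF that(1)] that mem_add[OF a(1), of x] mem_add[OF z(1), of x] lt_irr unfolding a(2) z(2) by auto
        then have "y0 <=. z0" using IH a(1) z(1) by blast
        then show ?thesis unfolding a(2) z(2) by (rule Ar.add_right_mono)
      qed
    qed
  qed
  \<comment> \<open>By \<open>lt_pow\<close>, this many digits suffice for both numbers.\<close>
  from this[of "y +. y'"] show ?thesis
    using s Ar.le_less_trans[OF le_pl1 lt_pow, of y y'] Ar.le_less_trans[OF le_pl lt_pow, of y' y] by blast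
qed

lemma mem_ext: "(\<And>x. mem x y \<longleftrightarrow> mem x y') \<Longrightarrow> y = y'"
  by (rule Ar.order_antisym) (auto intro: subset_le)

section \<open>Codes of definable bounded sets\<close>

definition coll :: "'u \<Rightarrow> ('u \<Rightarrow> bool) \<Rightarrow> 'u" where
  "coll b P = (THE y. \<forall>x. mem x y \<longleftrightarrow> x <. b \<and> P x)"

lemma coll_eq: "\<forall>x. mem x y \<longleftrightarrow> x <. b \<and> P x \<Longrightarrow> coll b P = y"
  unfolding coll_def by (rule the_equality) (auto intro: mem_ext)

lemma mem_coll: "Dl (\<lambda>e. P (e 0)) \<Longrightarrow> mem x (coll b P) \<longleftrightarrow> x <. b \<and> P x"
  using comprehension[of P b] coll_eq[of _ b P] by blast

lemma coll_lt: "Dl (\<lambda>e. P (e 0)) \<Longrightarrow> coll b P <. pow b"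
  using comprehension[of P b] coll_eq[of _ b P] by blast

lemma lt_pow_iff: "y <. pow b \<longleftrightarrow> (\<forall>x. mem x y \<longrightarrow> x <. b)"
proof
  assume *: "\<forall>x. mem x y \<longrightarrow> x <. b"
  from comprehension[of "\<lambda>_. True" b, OF Dl_True] obtain t where t: "t <. pow b" "\<And>x. mem x t \<longleftrightarrow> x <. b" by auto
  have "y <=. t" using * t(2) by (intro subset_le) blast
  then show "y <. pow b" using t(1) by (rule Ar.le_less_trans)
qed (use mem_bound in blast)

text \<open>The code is characterized by a size bound and a bounded quantifier over its elements, so
  forming it stays within \<Delta>. Types, which nest such codes, depend on this.\<close>

lemma Fu_coll:
  assumes P: "Dl (\<lambda>e. P (e 0) (\<lambda>n. e (Suc n)))" and b: "Fu b"
  shows "Fu (\<lambda>e. coll (b e) (\<lambda>x. P x e))"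
proof -
  have *: "c = coll (b e) (\<lambda>x. P x e) \<longleftrightarrow>
      c <. pow (b e) \<and> (\<forall>x. x <. b e \<longrightarrow> (mem x c \<longleftrightarrow> P x e))" for c e
  proof -
    have D: "Dl (\<lambda>e'. P (e' 0) e)" by (rule Dl_fix[OF P])
    show ?thesis using mem_coll[OF D, of _ "b e"] coll_lt[OF D, of "b e"] coll_eq[of c "b e" "\<lambda>x. P x e"] lt_pow_iff[of c "b e"]
      by blast
  qed
  have P2: "Dl (\<lambda>e. P (e 0) (\<lambda>n. e (Suc (Suc n))))"
    using Dl_ren[OF P, of "case_nat 0 (\<lambda>n. Suc (Suc n))"] by simp
  show ?thesis unfolding Fu_def *
    by (intro dl Fu_pow Dl_mem P2 Fu_ren[OF b])
qed

text \<open>Elements of \<open>y\<close> are smaller than \<open>y\<close>, so the bound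
  \<open>x +. y +. un\<close> cuts nothing off.\<close>

definition ins :: "'u \<Rightarrow> 'u \<Rightarrow> 'u" where "ins x y = coll (x +. y +. un) (\<lambda>z. z = x \<or> mem z y)"

lemma mem_ins [simp]: "mem z (ins x y) \<longleftrightarrow> z = x \<or> mem z y"
proof -
  have "Dl (\<lambda>e. e 0 = x \<or> mem (e 0) y)" by (intro dl Dl_mem)
  moreover have "z <. x +. y +. un" if "z = x \<or> mem z y"
    unfolding lt_succ using that le_pl1[of x y] Ar.order_trans[OF Ar.less_imp_le[OF mem_lt] le_pl[of y x], of z] by blast
  ultimately show ?thesis unfolding ins_def
    using mem_coll[where P = "\<lambda>z. z = x \<or> mem z y", of z "x +. y +. un"] by blast
qed

lemma Fu_ins: "Fu t \<Longrightarrow> Fu u \<Longrightarrow> Fu (\<lambda>e. ins (t e) (u e))"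
proof (rule Fu_fun2[where f = ins])
  have "Fu (\<lambda>e. ins (e 0) (e 1))" unfolding ins_def
    by (rule Fu_coll) (intro dl Dl_mem)+
  then show "Dl (\<lambda>e. e 0 = ins (e 1) (e 2))" unfolding Fu_def by (simp add: numeral_2_eq_2)
qed

lemmas dls = dl Dl_mem Fu_pow Fu_ins

end

section \<open>A back-and-forth system from a failure of induction\<close>

context arith
begin

lemma Sg_coll:
  assumes P: "Sg (\<lambda>e. P (e 0) (e 1))" and ex: "\<And>x. x <. a \<Longrightarrow> \<exists>y. P y x"
  shows "\<exists>b. \<forall>x. x <. a \<longrightarrow> (\<exists>y. y <. b \<and> P y x)"
proof -
  obtain Q e0 where Q: "RS (Suc m) Q" "(\<lambda>e. P (e 0) (e 1)) = (\<lambda>e. Q (mix e e0))"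
    using P unfolding Sg_def by blast
  define M where "M = mix (\<lambda>_. zr) e0"
  define \<rho> where "\<rho> n = (if n = 0 then 0 else if n = 2 then 1 else n + 2)" for n :: nat
  have "mix (y ## x ## (\<lambda>_. zr)) e0 = (\<lambda>n. (y ## x ## M) (\<rho> n))" for y x
  proof (rule even_odd_ext)
    fix n :: nat
    show "mix (y ## x ## (\<lambda>_. zr)) e0 (2 * n) = (y ## x ## M) (\<rho> (2 * n))"
    proof (cases n)
      case (Suc k)
      then show ?thesis by (cases k) (simp_all add: \<rho>_def M_def mix_def)
    qed (simp add: \<rho>_def M_def mix_def)
    show "mix (y ## x ## (\<lambda>_. zr)) e0 (Suc (2 * n)) = (y ## x ## M) (\<rho> (Suc (2 * n)))"
      unfolding \<rho>_def M_def mix_def by simp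
  qed
  then have Q2: "P y x \<longleftrightarrow> Q (\<lambda>n. (y ## x ## M) (\<rho> n))" for x y
    using fun_cong[OF Q(2), of "y ## x ## (\<lambda>_. zr)"] by simp
  from coll[OF order.refl RS_ren[OF Q(1), of \<rho>], of a M] ex show ?thesis unfolding Q2 by blast
qed

primrec std :: "nat \<Rightarrow> 'u" where "std 0 = zr" | "std (Suc n) = std n +. un"

text \<open>A binary code for lists of standard length; it turns the atomic type of a tuple into one
  number.\<close>

primrec bn :: "bool list \<Rightarrow> 'u" where
  "bn [] = zr" | "bn (b # bs) = (bn bs +. bn bs) +. (if b then un else zr)"

primrec pw :: "nat \<Rightarrow> 'u" where "pw 0 = un" | "pw (Suc n) = pw n +. pw n"

end

context arith_exp
begin

lemma bn_inj: "length bs = length cs \<Longrightarrow> bn bs = bn cs \<Longrightarrow> bs = cs"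
proof (induction bs cs rule: list_induct2)
  case (Cons b bs c cs)
  have "b = c" using Cons(3) half_unique[of "bn bs" "bn cs"] half_unique[of "bn cs" "bn bs"]
    by (cases b; cases c) (simp_all add: pl_zr)
  then have "bn bs +. bn bs = bn cs +. bn cs" using Cons(3) by simp
  then have "bn bs = bn cs"
    using Ar.add_strict_mono[of "bn bs" "bn cs" "bn bs" "bn cs"] Ar.add_strict_mono[of "bn cs" "bn bs" "bn cs" "bn bs"]
      lt_lin[of "bn bs" "bn cs"] lt_irr by auto
  then show ?case using Cons(2) \<open>b = c\<close> by simp
qed simp

lemma bn_lt: "bn bs <. pw (length bs)"
proof (induction bs)
  case (Cons b bs)
  then have *: "bn bs +. un <=. pw (length bs)" by (simp add: succ_le)
  have "bn (b # bs) <. (bn bs +. bn bs) +. (un +. un)"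
    using lt_trans[OF zr_un lt_succ_self] lt_succ_self[of un] by (cases b) (simp_all add: Ar.add_strict_left_mono)
  also have "\<dots> = (bn bs +. un) +. (bn bs +. un)" by (simp only: Ar.add_ac)
  also have "\<dots> <=. pw (length (b # bs))" using Ar.add_mono[OF * *] by simp
  finally show ?case .
qed (simp add: zr_un)

lemma Fu_if: "Dl P \<Longrightarrow> Fu (\<lambda>e. if P e then un else zr)"
proof -
  assume P: "Dl P"
  have "Dl (\<lambda>e. (P (\<lambda>n. e (Suc n)) \<and> e 0 = un) \<or> (\<not> P (\<lambda>n. e (Suc n)) \<and> e 0 = zr))"
    by (intro dl Dl_ren[OF P])
  then show ?thesis unfolding Fu_def by (rule Dl_eq) auto
qed

lemma Fu_bn: "(\<And>P. P \<in> set Ps \<Longrightarrow> Dl P) \<Longrightarrow> Fu (\<lambda>e. bn (map (\<lambda>P. P e) Ps))"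
proof (induction Ps)
  case (Cons P Ps)
  have "Fu (\<lambda>e. bn (map (\<lambda>P. P e) Ps))" using Cons by simp
  then show ?case using Fu_if[of P] Cons(2)[of P] by (simp only: list.map bn.simps) (intro Fu_pl; simp)
qed (simp add: Fu_const)

text \<open>A pigeonhole principle without counting: the numbers below \<open>pow N\<close> code the
  sets of numbers below \<open>N\<close>, and the diagonal set \<open>D\<close> refutes an injection
  of them into the numbers below \<open>N\<close>, by \<Delta> comprehension alone.\<close>

lemma cantor:
  assumes f: "Fu (\<lambda>e. f (e 0))" and N: "\<And>x. f x <. N"
  shows "\<exists>x x'. x <. pow N \<and> x' <. pow N \<and> x \<noteq> x' \<and> f x = f x'"
proof -
  let ?P = "\<lambda>v. \<exists>X. X <. pow N \<and> f X = v \<and> \<not> mem v X"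
  have P: "Dl (\<lambda>e. ?P (e 0))"
    by (intro dls Fu_ren[OF f, of "\<lambda>_. 0"])
  define D where "D = coll N ?P"
  have D: "D <. pow N" unfolding D_def by (rule coll_lt[OF P])
  have m: "mem v D \<longleftrightarrow> v <. N \<and> ?P v" for v unfolding D_def by (rule mem_coll[OF P])
  show ?thesis
  proof (cases "mem (f D) D")
    case True
    then obtain X where X: "X <. pow N" "f X = f D" "\<not> mem (f D) X" using m by blast
    then have "X \<noteq> D" using True by blast
    then show ?thesis using X D by blast
  next
    case False
    then show ?thesis using m[of "f D"] N[of D] D by blast
  qed
qed

section \<open>Games with bounded moves\<close>

definition at :: "'u \<Rightarrow> 'u \<Rightarrow> 'u \<Rightarrow> 'u \<Rightarrow> 'u \<Rightarrow> 'u \<Rightarrow> bool" where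
  "at x x' y y' z z' \<longleftrightarrow> (x = zr \<longleftrightarrow> x' = zr) \<and> (x = un \<longleftrightarrow> x' = un) \<and> (x = y \<longleftrightarrow> x' = y') \<and> (x <. y \<longleftrightarrow> x' <. y') \<and>
    (x +. y = z \<longleftrightarrow> x' +. y' = z') \<and> (x *. y = z \<longleftrightarrow> x' *. y' = z')"

text \<open>All quantifiers carry bounds, including those that decode the pairs, so that the
  predicate is visibly \<Delta>; \<open>atomic_iff\<close> removes the bounds again.\<close>

definition atomic :: "'u \<Rightarrow> bool" where
  "atomic q \<longleftrightarrow> (\<forall>a. a <. q \<longrightarrow> mem a q \<longrightarrow> (\<forall>b. b <. q \<longrightarrow> mem b q \<longrightarrow> (\<forall>c. c <. q \<longrightarrow> mem c q \<longrightarrow>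
    (\<forall>x. x <=. a \<longrightarrow> (\<forall>x'. x' <=. a \<longrightarrow> a = pr x x' \<longrightarrow>
    (\<forall>y. y <=. b \<longrightarrow> (\<forall>y'. y' <=. b \<longrightarrow> b = pr y y' \<longrightarrow>
    (\<forall>z. z <=. c \<longrightarrow> (\<forall>z'. z' <=. c \<longrightarrow> c = pr z z' \<longrightarrow> at x x' y y' z z')))))))))"

lemma atomic_iff: "atomic q \<longleftrightarrow> (\<forall>x x' y y' z z'. mem (pr x x') q \<longrightarrow> mem (pr y y') q \<longrightarrow> mem (pr z z') q \<longrightarrow>
    at x x' y y' z z')"
proof
  assume *: "atomic q"
  show "\<forall>x x' y y' z z'. mem (pr x x') q \<longrightarrow> mem (pr y y') q \<longrightarrow> mem (pr z z') q \<longrightarrow> at x x' y y' z z'"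
  proof (intro allI impI)
    fix x x' y y' z z' assume m: "mem (pr x x') q" "mem (pr y y') q" "mem (pr z z') q"
    from *[unfolded atomic_def, rule_format, OF mem_lt m(1) mem_lt m(2) mem_lt m(3) fst_le snd_le refl fst_le snd_le refl fst_le snd_le refl] m
    show "at x x' y y' z z'" by blast
  qed
next
  assume r: "\<forall>x x' y y' z z'. mem (pr x x') q \<longrightarrow> mem (pr y y') q \<longrightarrow> mem (pr z z') q \<longrightarrow> at x x' y y' z z'"
  show "atomic q" unfolding atomic_def
  proof (intro allI impI, goal_cases)
    case (1 a b c x x' y y' z z')
    then have "mem (pr x x') q" "mem (pr y y') q" "mem (pr z z') q" by (simp_all only:)
    then show ?case using r by blast
  qed
qed

lemma Dl_atomic: "Fu t \<Longrightarrow> Dl (\<lambda>e. atomic (t e))"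
proof (rule Dl_subst[where P = "\<lambda>a e. atomic a"])
  show "Dl (\<lambda>e. atomic (e 0))" unfolding atomic_def at_def by (intro dls)
qed

text \<open>\<open>T\<close> is a set of pairs of a number \<open>c\<close> of remaining moves and a position \<open>q\<close>, closed under answering every
  move below one of the bounds \<open>u\<close> listed in \<open>s\<close> by an element below the same bound.\<close>

definition sys :: "'u \<Rightarrow> 'u \<Rightarrow> bool" where
  "sys s T \<longleftrightarrow> (\<forall>p. p <. T \<longrightarrow> mem p T \<longrightarrow> (\<forall>c. c <=. p \<longrightarrow> (\<forall>q. q <=. p \<longrightarrow> p = pr c q \<longrightarrow>
    atomic q \<and> (\<forall>c'. c' <. c \<longrightarrow> c = c' +. un \<longrightarrow> (\<forall>w. w <. s \<longrightarrow> mem w s \<longrightarrow>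
      (\<forall>j. j <=. w \<longrightarrow> (\<forall>u. u <=. w \<longrightarrow> w = pr j u \<longrightarrow> (\<forall>y. y <. u \<longrightarrow>
        (\<exists>y'. y' <. u \<and> mem (pr c' (ins (pr y y') q)) T) \<and>
        (\<exists>y'. y' <. u \<and> mem (pr c' (ins (pr y' y) q)) T)))))))))"

lemma sys_iff: "sys s T \<longleftrightarrow> (\<forall>c q. mem (pr c q) T \<longrightarrow> atomic q \<and> (\<forall>c' j u y. c = c' +. un \<longrightarrow> mem (pr j u) s \<longrightarrow> y <. u \<longrightarrow>
    (\<exists>y'. y' <. u \<and> mem (pr c' (ins (pr y y') q)) T) \<and> (\<exists>y'. y' <. u \<and> mem (pr c' (ins (pr y' y) q)) T)))"
    (is "_ \<longleftrightarrow> ?r")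
proof
  assume *: "sys s T"
  show ?r
  proof (intro allI impI)
    fix c q assume m: "mem (pr c q) T"
    note a = *[unfolded sys_def, rule_format, OF mem_lt[OF m] m fst_le snd_le refl]
    show "atomic q \<and> (\<forall>c' j u y. c = c' +. un \<longrightarrow> mem (pr j u) s \<longrightarrow> y <. u \<longrightarrow>
      (\<exists>y'. y' <. u \<and> mem (pr c' (ins (pr y y') q)) T) \<and> (\<exists>y'. y' <. u \<and> mem (pr c' (ins (pr y' y) q)) T))"
    proof (intro conjI[of "atomic q"] allI impI)
      show "atomic q" using a by (rule conjunct1)
      fix c' j u y assume c: "c = c' +. un" and ju: "mem (pr j u) s" and y: "y <. u"
      have "c' <. c" unfolding c by (rule lt_succ_self)
      from conjunct2[OF a, rule_format, OF this c mem_lt[OF ju] ju fst_le snd_le refl y]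
      show "(\<exists>y'. y' <. u \<and> mem (pr c' (ins (pr y y') q)) T) \<and> (\<exists>y'. y' <. u \<and> mem (pr c' (ins (pr y' y) q)) T)" .
    qed
  qed
next
  assume r: ?r
  show "sys s T" unfolding sys_def
  proof (intro allI impI, goal_cases)
    case (1 p c q)
    then have "mem (pr c q) T" by simp
    from r[rule_format, OF this] show ?case by auto
  qed
qed

lemma sysD:
  assumes "sys s T" "mem (pr c q) T"
  shows "atomic q" "c = c' +. un \<Longrightarrow> mem (pr j u) s \<Longrightarrow> y <. u \<Longrightarrow> \<exists>y'. y' <. u \<and> mem (pr c' (ins (pr y y') q)) T"
    "c = c' +. un \<Longrightarrow> mem (pr j u) s \<Longrightarrow> y <. u \<Longrightarrow> \<exists>y'. y' <. u \<and> mem (pr c' (ins (pr y' y) q)) T"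
  using assms unfolding sys_iff by blast+

lemma Dl_sys: "Fu t \<Longrightarrow> Fu u \<Longrightarrow> Dl (\<lambda>e. sys (t e) (u e))"
proof (rule Dl_rel2[where P = sys])
  show "Dl (\<lambda>e. sys (e 0) (e 1))" unfolding sys_def by (intro dls Dl_atomic)
qed

text \<open>A position made of elements below \<open>s\<close> is a set of pairs below
  \<open>pr s s\<close>, hence a number below this bound.\<close>

definition bnd :: "'u \<Rightarrow> 'u" where "bnd s = pow (pr s s)"

text \<open>Correspondingly, a set of pairs of a level below \<open>s\<close> and a position below
  \<open>bnd s\<close> is a number below this bound.\<close>

definition bet :: "'u \<Rightarrow> 'u" where "bet s = pow (pr s (bnd s))"

definition E :: "'u \<Rightarrow> 'u \<Rightarrow> 'u \<Rightarrow> bool" where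
  "E s c q \<longleftrightarrow> (\<exists>T. T <. bet s \<and> sys s T \<and> mem (pr c q) T)"

lemma Dl_E0: "Dl (\<lambda>e. E (e i) (e j) (e k))"
  unfolding E_def bet_def bnd_def by (intro dls Dl_sys)

lemma Dl_E:
  assumes "Fu t" "Fu u" "Fu v"
  shows "Dl (\<lambda>e. E (t e) (u e) (v e))"
proof (rule Dl_subst[where P = "\<lambda>a e. E a (u e) (v e)", OF _ assms(1)])
  have "Dl (\<lambda>e. E (e 1) (e 0) (v (\<lambda>n. e (Suc (Suc n)))))"
    by (rule Dl_subst[where P = "\<lambda>a e. E (e 1) (e 0) a", OF _ Fu_ren[OF assms(3)]]) (simp add: Dl_E0)
  then show "Dl (\<lambda>e. E (e 0) (u (\<lambda>n. e (Suc n))) (v (\<lambda>n. e (Suc n))))"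
    by (intro Dl_subst[where P = "\<lambda>a e. E (e 0) a (v (\<lambda>n. e (Suc n)))", OF _ Fu_ren[OF assms(2)]]) simp
qed

lemma lt_bnd: "s <. bnd s" "q <. s \<Longrightarrow> q <. bnd s"
proof -
  show "s <. bnd s" unfolding bnd_def by (rule Ar.le_less_trans[OF fst_le lt_pow])
  then show "q <. s \<Longrightarrow> q <. bnd s" using lt_trans by blast
qed

lemma ins_bnd: "q <. bnd s \<Longrightarrow> x <. s \<Longrightarrow> x' <. s \<Longrightarrow> ins (pr x x') q <. bnd s"
  unfolding bnd_def lt_pow_iff using pr_mono_lt[of x s x' s] by (auto simp: le_def)

text \<open>With fewer bounds there are fewer moves, so the old system still wins, but it must be
  trimmed to fit below \<open>bet s\<close>. Trimming loses no needed answer, since answers stay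
  below a bound that is listed in \<open>s\<close>.\<close>

lemma E_restrict:
  assumes E: "E s2 c q" and sub: "\<And>w. mem w s \<Longrightarrow> mem w s2" and c: "c <. s" and q: "q <. bnd s"
  shows "E s c q"
proof -
  obtain T where T: "sys s2 T" "mem (pr c q) T" using E unfolding E_def by blast
  let ?P = "\<lambda>p. mem p T \<and> (\<exists>c. c <=. p \<and> (\<exists>q. q <=. p \<and> p = pr c q \<and> c <. s \<and> q <. bnd s))"
  have P: "Dl (\<lambda>e. ?P (e 0))" unfolding bnd_def by (intro dls)
  define T' where "T' = coll (pr s (bnd s)) ?P"
  have "mem p T' \<longleftrightarrow> p <. pr s (bnd s) \<and> ?P p" for p unfolding T'_def by (rule mem_coll[OF P])
  then have m: "mem (pr c q) T' \<longleftrightarrow> mem (pr c q) T \<and> c <. s \<and> q <. bnd s" for c q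
    using pr_mono_lt[of c s q "bnd s"] fst_le[of c q] snd_le[of q c] by (auto simp: le_def)
  have "sys s T'" unfolding sys_iff
  proof (intro allI impI)
    fix c q assume "mem (pr c q) T'"
    then have cq: "mem (pr c q) T" "c <. s" "q <. bnd s" using m by auto
    have *: "y <. u \<Longrightarrow> y' <. u \<Longrightarrow> mem (pr j u) s \<Longrightarrow> c = c' +. un \<Longrightarrow> mem (pr c' (ins (pr y y') q)) T \<Longrightarrow>
        mem (pr c' (ins (pr y y') q)) T'" for y y' u j c'
    proof -
      assume a: "y <. u" "y' <. u" "mem (pr j u) s" "c = c' +. un" "mem (pr c' (ins (pr y y') q)) T"
      have "u <. s" by (rule Ar.le_less_trans[OF snd_le mem_lt[OF a(3)]])
      then have "y <. s" "y' <. s" using lt_trans a(1,2) by blast+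
      moreover have "c' <. s" using cq(2) unfolding a(4) by (rule lt_trans[OF lt_succ_self])
      ultimately show ?thesis unfolding m using ins_bnd[OF cq(3)] a(5) by simp
    qed
    show "atomic q \<and> (\<forall>c' j u y. c = c' +. un \<longrightarrow> mem (pr j u) s \<longrightarrow> y <. u \<longrightarrow>
      (\<exists>y'. y' <. u \<and> mem (pr c' (ins (pr y y') q)) T') \<and> (\<exists>y'. y' <. u \<and> mem (pr c' (ins (pr y' y) q)) T'))"
    proof (intro conjI[of "atomic q"] allI impI)
      show "atomic q" by (rule sysD(1)[OF T(1) cq(1)])
      fix c' j u y assume a: "c = c' +. un" "mem (pr j u) s" "y <. u"
      from sysD(2)[OF T(1) cq(1) a(1) sub[OF a(2)] a(3)] obtain y1 where
        y1: "y1 <. u" "mem (pr c' (ins (pr y y1) q)) T" by blast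
      from sysD(3)[OF T(1) cq(1) a(1) sub[OF a(2)] a(3)] obtain y2 where
        y2: "y2 <. u" "mem (pr c' (ins (pr y2 y) q)) T" by blast
      show "(\<exists>y'. y' <. u \<and> mem (pr c' (ins (pr y y') q)) T') \<and> (\<exists>y'. y' <. u \<and> mem (pr c' (ins (pr y' y) q)) T')"
        using y1(1) y2(1) *[OF a(3) y1(1) a(2,1) y1(2)] *[OF y2(1) a(3) a(2,1) y2(2)] by blast
    qed
  qed
  moreover have "T' <. bet s" unfolding T'_def bet_def by (rule coll_lt[OF P])
  ultimately show ?thesis unfolding E_def using m T(2) c q by blast
qed

end

locale failing = arith_exp pl ml lt zr un F R \<kappa> m
  for pl :: "'u \<Rightarrow> 'u \<Rightarrow> 'u" (infixl "+." 65) and ml :: "'u \<Rightarrow> 'u \<Rightarrow> 'u" (infixl "*." 70)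
    and lt :: "'u \<Rightarrow> 'u \<Rightarrow> bool" (infix "<." 50) and zr :: 'u and un :: 'u
    and F :: "fsym \<Rightarrow> 'u list \<Rightarrow> 'u" and R :: "rsym \<Rightarrow> 'u list \<Rightarrow> bool" and \<kappa> :: "'a \<Rightarrow> 'u" and m :: nat +
  fixes Q :: "'u \<Rightarrow> 'u \<Rightarrow> bool" and d0 :: 'u
  assumes Dl_Q0: "Dl (\<lambda>e. Q (e 0) (e 1))" and Q_zr: "\<exists>u. Q u zr"
    and Q_succ: "\<exists>u. Q u x \<Longrightarrow> \<exists>u. Q u (x +. un)" and Q_d0: "\<not> Q u d0"
begin

lemma Dl_Q: "Fu t \<Longrightarrow> Fu u \<Longrightarrow> Dl (\<lambda>e. Q (t e) (u e))"
  by (rule Dl_rel2[where P = Q, OF Dl_Q0])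

text \<open>The failing instance says that \<open>\<exists>u. Q u x\<close> is inductive in \<open>x\<close>, but fails at \<open>d0\<close>.  Let \<open>W j u\<close> say that \<open>u\<close> is
  the least bound for witnesses up to \<open>j\<close>.  The graph \<open>W\<close> is cofinal, its domain is a proper cut below \<open>d0\<close>,
  and \<open>V\<close> consists of the codes of its proper initial segments.\<close>

definition th :: "'u \<Rightarrow> 'u \<Rightarrow> bool" where
  "th j u \<longleftrightarrow> (\<forall>j'. j' <=. j \<longrightarrow> (\<exists>u'. u' <=. u \<and> Q u' j'))"

definition W :: "'u \<Rightarrow> 'u \<Rightarrow> bool" where
  "W j u \<longleftrightarrow> th j u \<and> (\<forall>u'. u' <. u \<longrightarrow> \<not> th j u')"

lemma Dl_W: "Fu t \<Longrightarrow> Fu u \<Longrightarrow> Dl (\<lambda>e. W (t e) (u e))"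
proof (rule Dl_rel2[where P = W])
  show "Dl (\<lambda>e. W (e 0) (e 1))" unfolding W_def th_def by (intro dls Dl_Q)
qed

lemma W_unique: "W j u \<Longrightarrow> W j u' \<Longrightarrow> u = u'"
  unfolding W_def using lt_lin[of u u'] by blast

lemma W_ex: "th j u \<Longrightarrow> \<exists>u. W j u"
  using Dl_least[of "\<lambda>u. th j u" u] unfolding W_def
proof -
  have "Dl (\<lambda>e. th j (e 0))" unfolding th_def by (intro dls Dl_Q)
  then show "th j u \<Longrightarrow> (Dl (\<lambda>e. th j (e 0)) \<Longrightarrow> th j u \<Longrightarrow> \<exists>y. th j y \<and> (\<forall>z. z <. y \<longrightarrow> \<not> th j z)) \<Longrightarrow>
    \<exists>u. th j u \<and> (\<forall>u'. u' <. u \<longrightarrow> \<not> th j u')" by blast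
qed

lemma W_zr: "\<exists>u. W zr u"
proof -
  obtain u where "Q u zr" using Q_zr by blast
  then have "th zr u" unfolding th_def using Ar.order_antisym[OF _ zr_le] by blast
  then show ?thesis by (rule W_ex)
qed

lemma W_succ: assumes "W j u" shows "\<exists>u. W (j +. un) u"
proof -
  have t: "th j u" using assms by (simp add: W_def)
  then obtain u1 where "Q u1 j" unfolding th_def by blast
  then obtain u2 where u2: "Q u2 (j +. un)" using Q_succ by blast
  have "th (j +. un) (u +. u2)" unfolding th_def
  proof (intro allI impI)
    fix j' assume "j' <=. j +. un"
    then consider "j' <=. j" | "j' = j +. un" unfolding le_def using lt_succ_cases by blast
    then show "\<exists>u'. u' <=. u +. u2 \<and> Q u' j'"
    proof cases
      case 1
      then obtain u' where "u' <=. u" "Q u' j'" using t unfolding th_def by blast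
      then show ?thesis using Ar.order_trans[OF _ le_pl1] by blast
    next
      case 2 then show ?thesis using u2 le_pl by blast
    qed
  qed
  then show ?thesis by (rule W_ex)
qed

lemma W_d0: "W j u \<Longrightarrow> j <. d0"
  unfolding W_def th_def using Q_d0 by (meson Ar.not_less)

section \<open>Codes of initial segments of the cofinal sequence\<close>

definition Vi :: "'u \<Rightarrow> 'u \<Rightarrow> bool" where
  "Vi i s \<longleftrightarrow> (\<forall>x. x <. s \<longrightarrow> mem x s \<longrightarrow> (\<exists>j. j <=. i \<and> (\<exists>u. u <=. s \<and> x = pr j u \<and> W j u))) \<and>
    (\<forall>j. j <=. i \<longrightarrow> (\<exists>u. u <=. s \<and> W j u \<and> mem (pr j u) s))"

definition V :: "'u \<Rightarrow> bool" where "V s \<longleftrightarrow> (\<exists>i. i <. d0 \<and> Vi i s)"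

lemma Dl_Vi: "Fu t \<Longrightarrow> Fu u \<Longrightarrow> Dl (\<lambda>e. Vi (t e) (u e))"
proof (rule Dl_rel2[where P = Vi])
  show "Dl (\<lambda>e. Vi (e 0) (e 1))" unfolding Vi_def by (intro dls Dl_W)
qed

lemma Dl_V: "Fu t \<Longrightarrow> Dl (\<lambda>e. V (t e))"
proof (rule Dl_subst[where P = "\<lambda>a e. V a"])
  show "Dl (\<lambda>e. V (e 0))" unfolding V_def by (intro dls Dl_Vi)
qed

lemma Vi_mem: assumes "Vi i s" shows "mem x s \<longleftrightarrow> (\<exists>j u. j <=. i \<and> x = pr j u \<and> W j u)"
proof
  assume "mem x s"
  then show "\<exists>j u. j <=. i \<and> x = pr j u \<and> W j u"
    using assms mem_lt[of x s] unfolding Vi_def by meson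
next
  assume "\<exists>j u. j <=. i \<and> x = pr j u \<and> W j u"
  then obtain j u where j: "j <=. i" "x = pr j u" "W j u" by blast
  then obtain u' where "W j u'" "mem (pr j u') s" using assms unfolding Vi_def by blast
  then show "mem x s" using W_unique j by blast
qed

lemma Vi_W: "Vi i s \<Longrightarrow> j <=. i \<Longrightarrow> \<exists>u. W j u"
  unfolding Vi_def by blast

lemma ViI: assumes "\<And>x. mem x s \<longleftrightarrow> (\<exists>j u. j <=. i \<and> x = pr j u \<and> W j u)" "\<And>j. j <=. i \<Longrightarrow> \<exists>u. W j u" shows "Vi i s"
  unfolding Vi_def
proof (intro conjI allI impI)
  have le: "u <=. s" if "mem (pr j u) s" for j u
    using Ar.less_imp_le[OF mem_lt[OF that]] snd_le[of u j] by (rule Ar.order_trans[rotated])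
  fix x assume m: "mem x s"
  then obtain j u where "j <=. i" "x = pr j u" "W j u" using assms(1) by blast
  then show "\<exists>j. j <=. i \<and> (\<exists>u. u <=. s \<and> x = pr j u \<and> W j u)" using le m by blast
next
  have le: "u <=. s" if "mem (pr j u) s" for j u
    using Ar.less_imp_le[OF mem_lt[OF that]] snd_le[of u j] by (rule Ar.order_trans[rotated])
  fix j assume "j <=. i"
  then obtain u where "W j u" using assms(2) by blast
  then show "\<exists>u. u <=. s \<and> W j u \<and> mem (pr j u) s" using assms(1) \<open>j <=. i\<close> le by blast
qed

lemma Vi_zr: "\<exists>s. Vi zr s"
proof -
  obtain u where u: "W zr u" using W_zr by blast
  have "Vi zr (ins (pr zr u) zr)"
  proof (rule ViI)
    have z: "j <=. zr \<longleftrightarrow> j = zr" for j using Ar.order_antisym[OF _ zr_le] by blast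
    show "mem x (ins (pr zr u) zr) \<longleftrightarrow> (\<exists>j u. j <=. zr \<and> x = pr j u \<and> W j u)" for x
      using u W_unique unfolding z by auto
    show "\<exists>u. W j u" if "j <=. zr" for j using that u unfolding z by blast
  qed
  then show ?thesis by blast
qed

lemma Vi_succ: assumes "Vi i s" shows "\<exists>s. Vi (i +. un) s"
proof -
  obtain u where "W i u" using Vi_W[OF assms] by blast
  then obtain u where u: "W (i +. un) u" using W_succ by blast
  have z: "j <=. i +. un \<longleftrightarrow> j <=. i \<or> j = i +. un" for j
    unfolding le_def using lt_succ_cases by blast
  have "Vi (i +. un) (ins (pr (i +. un) u) s)"
  proof (rule ViI)
    show "mem x (ins (pr (i +. un) u) s) \<longleftrightarrow> (\<exists>j u. j <=. i +. un \<and> x = pr j u \<and> W j u)" for x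
      unfolding mem_ins Vi_mem[OF assms] z using u W_unique by blast
    show "\<exists>u. W j u" if "j <=. i +. un" for j using that u Vi_W[OF assms] unfolding z by blast
  qed
  then show ?thesis by blast
qed

lemma Vi_V: "Vi i s \<Longrightarrow> V s"
  unfolding V_def using Vi_W[of i s i] W_d0 by blast

text \<open>If \<open>B\<close> bounded all codes, their existence would be a \<Delta> predicate of
  the length \<open>i\<close>, and induction would carry it up to \<open>d0\<close>, where
  \<open>W\<close> is undefined.\<close>

lemma V_unb: "\<exists>s. V s \<and> B <. s"
proof (rule ccontr)
  assume *: "\<nexists>s. V s \<and> B <. s"
  have b: "s <=. B" if "Vi i s" for i s using Vi_V[OF that] * by (auto simp: Ar.not_less)
  have "\<exists>s. s <=. B \<and> Vi i s" for i
  proof (rule Dl_ind[where P = "\<lambda>i. \<exists>s. s <=. B \<and> Vi i s"])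
    show "Dl (\<lambda>e. \<exists>s. s <=. B \<and> Vi (e 0) s)" by (intro dls Dl_Vi)
    show "\<exists>s. s <=. B \<and> Vi zr s" using Vi_zr b by blast
    show "\<exists>s. s <=. B \<and> Vi (i +. un) s" if "\<exists>s. s <=. B \<and> Vi i s" for i using that Vi_succ b by blast
  qed
  then obtain s where "Vi d0 s" by blast
  from Vi_W[OF this, of d0] W_d0 lt_irr show False by blast
qed

lemma V_sub: assumes "V s" "V s'" "s <=. s'" "mem x s" shows "mem x s'"
proof -
  obtain i i' where i: "Vi i s" "Vi i' s'" using assms(1,2) unfolding V_def by blast
  show ?thesis
  proof (cases "i <=. i'")
    case True
    then show ?thesis using assms(4) Ar.order_trans[OF _ True] unfolding Vi_mem[OF i(1)] Vi_mem[OF i(2)] by blast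
  next
    case False
    then have le: "i' <=. i" by (simp add: Ar.not_le Ar.less_imp_le)
    have "s' <=. s"
      using Ar.order_trans[OF _ le] unfolding Vi_mem[OF i(1)] Vi_mem[OF i(2)]
      by (intro subset_le) (auto simp: Vi_mem[OF i(1)] Vi_mem[OF i(2)])
    then have "s' = s" using assms(3) by (rule Ar.order_antisym)
    then show ?thesis using assms(4) by simp
  qed
qed

lemma V_memD: "V s \<Longrightarrow> mem x s \<Longrightarrow> \<exists>j u. x = pr j u \<and> j <. d0 \<and> W j u"
proof -
  assume "V s" "mem x s"
  then obtain i where "Vi i s" unfolding V_def by blast
  from \<open>mem x s\<close>[unfolded Vi_mem[OF this]] W_d0 show ?thesis by blast
qed

lemma V_fun: assumes "V s" "mem (pr j u) s" "mem (pr j u') s" shows "u = u'"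
  using V_memD[OF assms(1,2)] V_memD[OF assms(1,3)] W_unique by auto

text \<open>If \<open>y\<close> bounded all entries, every code would describe a set of pairs below
  \<open>pr d0 y\<close> and thus be bounded itself. So moves of any size are eventually allowed,
  although the indices stay below \<open>d0\<close>.\<close>

lemma V_big: "\<exists>s j u. V s \<and> mem (pr j u) s \<and> y <. u"
proof (rule ccontr)
  assume *: "\<nexists>s j u. V s \<and> mem (pr j u) s \<and> y <. u"
  obtain s where s: "V s" "pow (pr d0 y) <. s" using V_unb by blast
  have "s <. pow (pr d0 y)" unfolding lt_pow_iff
  proof (intro allI impI)
    fix x assume m: "mem x s"
    from V_memD[OF s(1) m] obtain j u where x: "x = pr j u" "j <. d0" by blast
    then have "u <=. y" using * s(1) m Ar.not_less by blast
    then show "x <. pr d0 y" unfolding x using x(2) by (intro pr_mono_lt)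
  qed
  then show False using s(2) by (rule Ar.less_asym)
qed

lemma V_coll:
  assumes P: "Dl (\<lambda>e. P (e 0) (e 1))" and ex: "\<And>x. x <. b \<Longrightarrow> \<exists>s. V s \<and> P x s"
  shows "\<exists>B. \<forall>x. x <. b \<longrightarrow> (\<exists>s. s <. B \<and> V s \<and> P x s)"
proof (rule Sg_coll)
  have "Dl (\<lambda>e. P (e 1) (e 0))" using Dl_ren[OF P, of "\<lambda>n. if n = 0 then 1 else 0"] by simp
  then show "Sg (\<lambda>e. V (e 0) \<and> P (e 1) (e 0))" by (intro Dl_Sg dls Dl_V)
qed (use ex in blast)

text \<open>The bounded games of all sufficiently long initial segments of \<open>W\<close> are won; moves of any size are then allowed.\<close>

definition G :: "'u \<Rightarrow> 'u \<Rightarrow> bool" where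
  "G c q \<longleftrightarrow> (\<exists>s0. V s0 \<and> (\<forall>s. V s \<longrightarrow> s0 <=. s \<longrightarrow> E s c q))"

lemma G_atomic: "G c q \<Longrightarrow> atomic q"
  unfolding G_def E_def using sysD(1) by blast

text \<open>Suppose that every candidate below \<open>u\<close> is refuted by some \<open>s\<close>.
  Collection bounds these \<open>s\<close>; the game of a later \<open>s2\<close> has an answer, and
  \<open>E_restrict\<close> carries it back to the very \<open>s\<close> that refutes it. The
  function \<open>f\<close> orients the pair, so that forth and back are treated at once.\<close>

lemma G_step_gen:
  assumes Ff: "\<And>t u. Fu t \<Longrightarrow> Fu u \<Longrightarrow> Fu (\<lambda>e. f (t e) (u e))"
    and fb: "\<And>q s y y'. q <. bnd s \<Longrightarrow> y <. s \<Longrightarrow> y' <. s \<Longrightarrow> ins (f y y') q <. bnd s"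
    and sy: "\<And>s T c' q j u y. sys s T \<Longrightarrow> mem (pr (c' +. un) q) T \<Longrightarrow> mem (pr j u) s \<Longrightarrow> y <. u \<Longrightarrow>
      \<exists>y'. y' <. u \<and> mem (pr c' (ins (f y y') q)) T"
    and G: "G (c +. un) q"
  shows "\<exists>y'. G c (ins (f y y') q)"
proof -
  obtain s0 where s0: "V s0" "\<And>s. V s \<Longrightarrow> s0 <=. s \<Longrightarrow> E s (c +. un) q" using G unfolding G_def by blast
  obtain sB j u where sB: "V sB" "mem (pr j u) sB" "y <. u" using V_big by blast
  \<comment> \<open>From \<open>s1\<close> on the position is won, the bound \<open>u\<close> on the
    move is listed, and \<open>c\<close> and \<open>q\<close> are small enough for
    \<open>E_restrict\<close>.\<close>
  obtain s1 where s1: "V s1" "s0 +. sB +. c +. q <. s1" using V_unb by blast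
  have "s0 <=. s0 +. sB +. c +. q" "sB <=. s0 +. sB +. c +. q" "c <=. s0 +. sB +. c +. q" "q <=. s0 +. sB +. c +. q"
    by (metis le_pl le_pl1 Ar.order_trans)+
  from this[THEN Ar.le_less_trans, OF s1(2)] have le: "s0 <. s1" "sB <. s1" "c <. s1" "q <. s1" .
  have ju: "mem (pr j u) s1" using V_sub[OF sB(1) s1(1) Ar.less_imp_le[OF le(2)] sB(2)] .
  have us: "u <. s1" by (rule Ar.le_less_trans[OF snd_le mem_lt[OF ju]])
  have "\<exists>y'. y' <. u \<and> (\<forall>s. V s \<longrightarrow> s1 <=. s \<longrightarrow> E s c (ins (f y y') q))"
  proof (rule ccontr)
    assume no: "\<nexists>y'. y' <. u \<and> (\<forall>s. V s \<longrightarrow> s1 <=. s \<longrightarrow> E s c (ins (f y y') q))"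
    have D: "Dl (\<lambda>e. s1 <=. e 1 \<and> \<not> E (e 1) c (ins (f y (e 0)) q))" by (intro dls Dl_E Ff)
    from V_coll[where P = "\<lambda>y' s. s1 <=. s \<and> \<not> E s c (ins (f y y') q)", OF D, of u] no
    obtain B where B: "\<And>y'. y' <. u \<Longrightarrow> \<exists>s. s <. B \<and> V s \<and> s1 <=. s \<and> \<not> E s c (ins (f y y') q)" by blast
    obtain s2 where s2: "V s2" "B +. s1 <. s2" using V_unb by blast
    have s2': "B <. s2" "s1 <. s2" using Ar.le_less_trans[OF le_pl1 s2(2)] Ar.le_less_trans[OF le_pl s2(2)] .
    have "E s2 (c +. un) q" using s0(2)[OF s2(1)] lt_trans[OF le(1) s2'(2)] by (simp add: le_def)
    then obtain T where T: "T <. bet s2" "sys s2 T" "mem (pr (c +. un) q) T" unfolding E_def by blast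
    have "mem (pr j u) s2" using V_sub[OF s1(1) s2(1) Ar.less_imp_le[OF s2'(2)] ju] .
    from sy[OF T(2,3) this sB(3)] obtain y' where y': "y' <. u" "mem (pr c (ins (f y y') q)) T" by blast
    then have E2: "E s2 c (ins (f y y') q)" using T unfolding E_def by blast
    from B[OF y'(1)] obtain s where s: "s <. B" "V s" "s1 <=. s" "\<not> E s c (ins (f y y') q)" by blast
    have "s <=. s2" using lt_trans[OF s(1) s2'(1)] by (rule Ar.less_imp_le)
    moreover have "c <. s" "q <. s" "u <. s" using le(3,4) us s(3) by (auto intro: Ar.less_le_trans)
    moreover from this have "y <. s" "y' <. s" using sB(3) y'(1) by (auto intro: lt_trans)
    ultimately have "E s c (ins (f y y') q)"
      by (intro E_restrict[OF E2 V_sub[OF s(2) s2(1)]] fb lt_bnd(2))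
    then show False using s(4) by simp
  qed
  then show ?thesis unfolding G_def using s1(1) by blast
qed

lemma G_step: assumes "G (c +. un) q" shows "\<exists>y'. G c (ins (pr y y') q)" "\<exists>y'. G c (ins (pr y' y) q)"
proof -
  show "\<exists>y'. G c (ins (pr y y') q)"
    by (rule G_step_gen[where f = pr, OF Fu_pr ins_bnd sysD(2)[OF _ _ refl] assms])
  show "\<exists>y'. G c (ins (pr y' y) q)"
    by (rule G_step_gen[where f = "\<lambda>y y'. pr y' y", OF Fu_pr ins_bnd sysD(3)[OF _ _ refl] assms])
qed

end

section \<open>Types of tuples\<close>

context failing
begin

text \<open>Numbers the six atomic tests of \<open>at\<close>, so that \<open>atoms\<close> can list
  their values over all triples of indices.\<close>

primrec ato :: "nat \<Rightarrow> 'u \<Rightarrow> 'u \<Rightarrow> 'u \<Rightarrow> bool" where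
  "ato 0 x y z \<longleftrightarrow> x = zr"
| "ato (Suc o') x y z \<longleftrightarrow> (if o' = 0 then x = un else if o' = 1 then x = y else if o' = 2 then x <. y
     else if o' = 3 then x +. y = z else x *. y = z)"

definition idx :: "nat \<Rightarrow> (nat \<times> nat \<times> nat \<times> nat) list" where
  "idx L = List.product [0..<L] (List.product [0..<L] (List.product [0..<L] [0..<6]))"

definition atoms :: "'u list \<Rightarrow> bool list" where
  "atoms xs = map (\<lambda>(i, j, l, k). ato k (xs ! i) (xs ! j) (xs ! l)) (idx (length xs))"

definition Qs :: "'u list \<Rightarrow> 'u list \<Rightarrow> 'u" where
  "Qs xs xs' = foldr (\<lambda>(x, x') q. ins (pr x x') q) (zip xs xs') zr"

lemma mem_Qs: "mem w (Qs xs xs') \<longleftrightarrow> (\<exists>i < length xs. i < length xs' \<and> w = pr (xs ! i) (xs' ! i))"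
proof -
  have *: "mem w (foldr (\<lambda>(x, x') q. ins (pr x x') q) ps zr) \<longleftrightarrow> (\<exists>(x, x')\<in>set ps. w = pr x x')" for ps
    by (induction ps) auto
  show ?thesis unfolding Qs_def * set_zip by auto
qed

lemma atoms_atomic:
  assumes "length xs = length xs'" "atoms xs = atoms xs'"
  shows "atomic (Qs xs xs')"
proof -
  have a: "ato k (xs ! i) (xs ! j) (xs ! l) = ato k (xs' ! i) (xs' ! j) (xs' ! l)"
    if "i < length xs" "j < length xs" "l < length xs" "k < 6" for i j k l
  proof -
    have "(i, j, l, k) \<in> set (idx (length xs))" using that by (simp add: idx_def)
    then show ?thesis using assms unfolding atoms_def by (auto simp: map_eq_conv)
  qed
  have b: "at (xs ! i) (xs' ! i) (xs ! j) (xs' ! j) (xs ! l) (xs' ! l)"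
    if "i < length xs" "j < length xs" "l < length xs" for i j l
    using a[OF that, of 0] a[OF that, of 1] a[OF that, of 2] a[OF that, of 3] a[OF that, of 4] a[OF that, of 5]
    unfolding at_def by (simp add: eval_nat_numeral)
  show ?thesis unfolding atomic_iff mem_Qs pr_inj using b assms(1) by blast
qed

text \<open>\<open>ty k s xs\<close> codes the \<open>k\<close>-type of \<open>xs\<close> in the game with move bounds \<open>s\<close>.  The bound \<open>tb k L\<close> on the types of \<open>L\<close>-tuples
  does not depend on \<open>s\<close>, since the indices of the moves stay below \<open>d0\<close>.\<close>

primrec tb :: "nat \<Rightarrow> nat \<Rightarrow> 'u" where
  "tb 0 L = pw (length (idx L))"
| "tb (Suc k) L = pr (pw (length (idx L))) (pow (pr d0 (tb k (Suc L))))"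

primrec ty :: "nat \<Rightarrow> 'u \<Rightarrow> 'u list \<Rightarrow> 'u" where
  "ty 0 s xs = bn (atoms xs)"
| "ty (Suc k) s xs = pr (bn (atoms xs)) (coll (pr d0 (tb k (Suc (length xs))))
    (\<lambda>x. \<exists>w. w <. s \<and> mem w s \<and> (\<exists>j. j <=. w \<and> (\<exists>u. u <=. w \<and> w = pr j u \<and> (\<exists>y. y <. u \<and> x = pr j (ty k s (y # xs)))))))"

lemma Dl_ato: "Fu t \<Longrightarrow> Fu u \<Longrightarrow> Fu v \<Longrightarrow> Dl (\<lambda>e. ato k (t e) (u e) (v e))"
proof -
  have ifc: "Dl P \<Longrightarrow> Dl P' \<Longrightarrow> Dl (\<lambda>e. if b then P e else P' e)" for b P P' by (cases b) simp_all
  show "Fu t \<Longrightarrow> Fu u \<Longrightarrow> Fu v \<Longrightarrow> Dl (\<lambda>e. ato k (t e) (u e) (v e))"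
    by (cases k; simp only: ato.simps; intro ifc dl)
qed

lemma Fu_atoms: assumes "\<And>t. t \<in> set ts \<Longrightarrow> Fu t" shows "Fu (\<lambda>e. bn (atoms (map (\<lambda>t. t e) ts)))"
proof -
  have *: "atoms (map (\<lambda>t. t e) ts) = map (\<lambda>P. P e) (map (\<lambda>(i, j, l, k) e. ato k ((ts ! i) e) ((ts ! j) e) ((ts ! l) e)) (idx (length ts)))" for e
    unfolding atoms_def by (auto simp: idx_def)
  show ?thesis unfolding *
    by (rule Fu_bn) (auto simp: idx_def intro!: Dl_ato assms)
qed

lemma Fu_ty: "(\<And>t. t \<in> set ts \<Longrightarrow> Fu t) \<Longrightarrow> Fu \<sigma> \<Longrightarrow> Fu (\<lambda>e. ty k (\<sigma> e) (map (\<lambda>t. t e) ts))"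
proof (induction k arbitrary: ts \<sigma>)
  case 0
  then show ?case unfolding ty.simps by (intro Fu_atoms)
next
  case (Suc k)
  note s = Fu_ren[OF Suc(3)]
  have IH: "Fu (\<lambda>e. ty k (\<sigma> (\<lambda>n. e (\<rho> n))) (e 0 # map (\<lambda>t. t (\<lambda>n. e (\<rho> n))) ts))" for \<rho>
  proof -
    have "Fu (\<lambda>e. ty k (\<sigma> (\<lambda>n. e (\<rho> n))) (map (\<lambda>t. t e) ((\<lambda>e. e 0) # map (\<lambda>t e. t (\<lambda>n. e (\<rho> n))) ts)))"
      by (rule Suc(1)) (use Suc(2) s in \<open>auto intro: Fu_var Fu_ren\<close>)
    then show ?thesis by (simp add: comp_def)
  qed
  have at: "Fu (\<lambda>e. bn (atoms (map (\<lambda>t. t e) ts)))" by (rule Fu_atoms[OF Suc(2)])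
  show ?case unfolding ty.simps length_map
    by (rule Fu_pr[OF at], rule Fu_coll[OF _ Fu_const], intro dls s IH)
qed

lemma Fu_Qs:
  assumes "length ts = length us" "\<And>t. t \<in> set ts \<union> set us \<Longrightarrow> Fu t"
  shows "Fu (\<lambda>e. Qs (map (\<lambda>t. t e) ts) (map (\<lambda>t. t e) us))"
  using assms
proof (induction ts us rule: list_induct2)
  case Nil then show ?case by (simp add: Qs_def Fu_const)
next
  case (Cons t ts u us)
  have "Fu (\<lambda>e. Qs (map (\<lambda>t. t e) ts) (map (\<lambda>t. t e) us))" using Cons(3) by (intro Cons(2)) auto
  moreover have "Fu t" "Fu u" using Cons(3) by auto
  ultimately have "Fu (\<lambda>e. ins (pr (t e) (u e)) (Qs (map (\<lambda>t. t e) ts) (map (\<lambda>t. t e) us)))"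
    by (intro Fu_ins Fu_pr)
  then show ?case by (simp add: Qs_def)
qed

lemma atoms_len: "length (atoms xs) = length (idx (length xs))"
  by (simp add: atoms_def)

lemma bn_atoms_lt: "bn (atoms xs) <. pw (length (idx (length xs)))"
  using bn_lt[of "atoms xs"] by (simp only: atoms_len)

lemma Dl_tyset:
  "Dl (\<lambda>e. \<exists>w. w <. s \<and> mem w s \<and> (\<exists>j. j <=. w \<and> (\<exists>u. u <=. w \<and> w = pr j u \<and> (\<exists>y. y <. u \<and> e 0 = pr j (ty k s (y # xs))))))"
proof -
  have "Fu (\<lambda>e. ty k s (e 0 # xs))"
  proof -
    have "Fu (\<lambda>e. ty k s (map (\<lambda>t. t e) ((\<lambda>e. e 0) # map (\<lambda>x e. x) xs)))"
      by (rule Fu_ty) (auto intro: Fu_var Fu_const)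
    then show ?thesis by (simp add: comp_def)
  qed
  then show ?thesis by (intro dls)
qed

lemma ty_lt: "V s \<Longrightarrow> ty k s xs <. tb k (length xs)"
proof (cases k)
  case 0 then show ?thesis by (simp add: bn_atoms_lt)
next
  case (Suc k)
  have "coll (pr d0 (tb k (Suc (length xs))))
    (\<lambda>x. \<exists>w. w <. s \<and> mem w s \<and> (\<exists>j. j <=. w \<and> (\<exists>u. u <=. w \<and> w = pr j u \<and> (\<exists>y. y <. u \<and> x = pr j (ty k s (y # xs))))))
    <. pow (pr d0 (tb k (Suc (length xs))))"
    by (rule coll_lt[OF Dl_tyset])
  then show ?thesis unfolding Suc ty.simps tb.simps
    by (intro pr_mono_lt bn_atoms_lt Ar.less_imp_le)
qed

lemma ty_atoms: "length xs = length xs' \<Longrightarrow> ty k s xs = ty k s xs' \<Longrightarrow> atoms xs = atoms xs'"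
  by (cases k) (auto intro!: bn_inj simp: atoms_len)

text \<open>A type lists pairs of an index and the type of an extension. The equal list of
  \<open>xs'\<close> offers an extension with the same index, and the index determines the bound
  \<open>u\<close>, because \<open>s\<close> is single-valued by \<open>V_fun\<close>.\<close>

lemma ty_step:
  assumes V: "V s" and ty: "ty (Suc k) s xs = ty (Suc k) s xs'" and l: "length xs = length xs'"
    and ju: "mem (pr j u) s" and y: "y <. u"
  shows "\<exists>y'. y' <. u \<and> ty k s (y # xs) = ty k s (y' # xs')"
proof -
  let ?P = "\<lambda>xs x. \<exists>w. w <. s \<and> mem w s \<and> (\<exists>j. j <=. w \<and> (\<exists>u. u <=. w \<and> w = pr j u \<and> (\<exists>y. y <. u \<and> x = pr j (ty k s (y # xs)))))"
  let ?b = "pr d0 (tb k (Suc (length xs)))"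
  have m: "mem x (coll ?b (?P zs)) \<longleftrightarrow> x <. ?b \<and> ?P zs x" for x zs by (rule mem_coll[OF Dl_tyset])
  have e: "coll ?b (?P xs) = coll ?b (?P xs')" using ty l by simp
  let ?x = "pr j (ty k s (y # xs))"
  have jd: "j <. d0" using V_memD[OF V ju] by auto
  have "?x <. ?b" using ty_lt[OF V, of k "y # xs"] by (intro pr_mono_lt[OF jd Ar.less_imp_le]) simp
  moreover have "?P xs ?x"
    by (rule exI[of _ "pr j u"], intro conjI mem_lt[OF ju] ju, rule exI[of _ j], intro conjI fst_le,
        rule exI[of _ u], intro conjI snd_le refl exI[of _ y] y)
  ultimately have "mem ?x (coll ?b (?P xs))" unfolding m by (rule conjI)
  then have "mem ?x (coll ?b (?P xs'))" unfolding e .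
  then obtain w j' u' y' where w: "mem w s" "w = pr j' u'" "y' <. u'" "?x = pr j' (ty k s (y' # xs'))"
    unfolding m by blast
  then have "j' = j" "ty k s (y # xs) = ty k s (y' # xs')" by simp_all
  moreover from this have "u' = u" using V_fun[OF V, of j u' u] w(1,2) ju by simp
  ultimately show ?thesis using w(3) by blast
qed

text \<open>A list of standard length is quantified by that many bounded quantifiers. The hypothesis
  on \<open>P\<close> allows arbitrary \<Delta> functions as entries, so the induction can hand over
  a chosen element as one more argument in \<open>us\<close>.\<close>

lemma Dl_exlist:
  assumes "\<And>ts us. length ts = n \<Longrightarrow> length us = r \<Longrightarrow> (\<And>t. t \<in> set ts \<union> set us \<Longrightarrow> Fu t) \<Longrightarrow>
      Dl (\<lambda>e. P (map (\<lambda>t. t e) ts) (map (\<lambda>t. t e) us))"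
    "length us = r" "\<And>t. t \<in> set us \<Longrightarrow> Fu t"
  shows "Dl (\<lambda>e. \<exists>xs. length xs = n \<and> (\<forall>x\<in>set xs. x <. b) \<and> P xs (map (\<lambda>t. t e) us))"
  using assms
proof (induction n arbitrary: P r us)
  case 0
  from 0(1)[of "[]" us] 0(2,3) show ?case by simp
next
  case (Suc n)
  have IH: "Dl (\<lambda>e. \<exists>xs. length xs = n \<and> (\<forall>x\<in>set xs. x <. b) \<and> P (e 0 # xs) (map (\<lambda>t. t (\<lambda>n. e (Suc n))) us))"
  proof -
    have "Dl (\<lambda>e. \<exists>xs. length xs = n \<and> (\<forall>x\<in>set xs. x <. b) \<and>
        (\<lambda>xs vs. P (hd vs # xs) (tl vs)) xs (map (\<lambda>t. t e) ((\<lambda>e. e 0) # map (\<lambda>t e. t (\<lambda>n. e (Suc n))) us)))"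
    proof (rule Suc(1)[of "Suc r"])
      fix ts us' :: "((nat \<Rightarrow> 'u) \<Rightarrow> 'u) list"
      assume a: "length ts = n" "length us' = Suc r" "\<And>t. t \<in> set ts \<union> set us' \<Longrightarrow> Fu t"
      from a(2) obtain u us2 where u: "us' = u # us2" by (cases us') auto
      have "Dl (\<lambda>e. P (map (\<lambda>t. t e) (u # ts)) (map (\<lambda>t. t e) us2))"
        by (rule Suc(2)) (use a u in auto)
      then show "Dl (\<lambda>e. P (hd (map (\<lambda>t. t e) us') # map (\<lambda>t. t e) ts) (tl (map (\<lambda>t. t e) us')))"
        by (simp add: u)
    qed (use Suc(3,4) in \<open>auto intro: Fu_var Fu_ren\<close>)
    then show ?thesis by (simp add: comp_def)
  qed
  have "Dl (\<lambda>e. \<exists>x. x <. b \<and> (\<exists>xs. length xs = n \<and> (\<forall>x\<in>set xs. x <. b) \<and> P (x # xs) (map (\<lambda>t. t e) us)))"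
    by (rule Dl_bex[OF IH Fu_const])
  then show ?case
  proof (rule Dl_eq)
    fix e
    show "(\<exists>x. x <. b \<and> (\<exists>xs. length xs = n \<and> (\<forall>x\<in>set xs. x <. b) \<and> P (x # xs) (map (\<lambda>t. t e) us))) =
      (\<exists>xs. length xs = Suc n \<and> (\<forall>x\<in>set xs. x <. b) \<and> P xs (map (\<lambda>t. t e) us))"
    proof
      assume "\<exists>x. x <. b \<and> (\<exists>xs. length xs = n \<and> (\<forall>x\<in>set xs. x <. b) \<and> P (x # xs) (map (\<lambda>t. t e) us))"
      then obtain x xs where "x <. b" "length xs = n" "\<forall>x\<in>set xs. x <. b" "P (x # xs) (map (\<lambda>t. t e) us)" by blast
      then show "\<exists>xs. length xs = Suc n \<and> (\<forall>x\<in>set xs. x <. b) \<and> P xs (map (\<lambda>t. t e) us)"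
        by (intro exI[of _ "x # xs"]) simp
    next
      assume "\<exists>xs. length xs = Suc n \<and> (\<forall>x\<in>set xs. x <. b) \<and> P xs (map (\<lambda>t. t e) us)"
      then obtain xs where xs: "length xs = Suc n" "\<forall>x\<in>set xs. x <. b" "P xs (map (\<lambda>t. t e) us)" by blast
      then obtain x ys where "xs = x # ys" by (cases xs) auto
      with xs show "\<exists>x. x <. b \<and> (\<exists>xs. length xs = n \<and> (\<forall>x\<in>set xs. x <. b) \<and> P (x # xs) (map (\<lambda>t. t e) us))"
        by (intro exI[of _ x] conjI exI[of _ ys]) simp_all
    qed
  qed
qed

text \<open>The level \<open>i\<close> is a number outside the model, so there is one such predicate
  for each level and not a single one in which the level is a variable.\<close>

definition RP :: "nat \<Rightarrow> 'u \<Rightarrow> nat \<Rightarrow> 'u \<Rightarrow> bool" where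
  "RP L s i p \<longleftrightarrow> (\<exists>xs. length xs = L \<and> (\<forall>x\<in>set xs. x <. s) \<and>
    (\<exists>xs'. length xs' = L \<and> (\<forall>x\<in>set xs'. x <. s) \<and> p = pr (std i) (Qs xs xs') \<and> ty i s xs = ty i s xs'))"

lemma Dl_RP: "Dl (\<lambda>e. RP L s i (e 0))"
proof -
  let ?B = "\<lambda>xs xs' p. p = pr (std i) (Qs xs xs') \<and> ty i s xs = ty i s xs'"
  let ?A = "\<lambda>xs vs. \<exists>xs'. length xs' = L \<and> (\<forall>x\<in>set xs'. x <. s) \<and> ?B xs xs' (hd vs)"
  have "Dl (\<lambda>e. \<exists>xs. length xs = L \<and> (\<forall>x\<in>set xs. x <. s) \<and> ?A xs (map (\<lambda>t. t e) [\<lambda>e. e 0]))"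
  proof (rule Dl_exlist[where r = 1])
    fix ts us :: "((nat \<Rightarrow> 'u) \<Rightarrow> 'u) list"
    assume a: "length ts = L" "length us = 1" "\<And>t. t \<in> set ts \<union> set us \<Longrightarrow> Fu t"
    from a(2) obtain u where u: "us = [u]" by (auto simp: length_Suc_conv)
    have "Dl (\<lambda>e. \<exists>xs'. length xs' = L \<and> (\<forall>x\<in>set xs'. x <. s) \<and>
        (\<lambda>xs' vs. ?B (tl vs) xs' (hd vs)) xs' (map (\<lambda>t. t e) (u # ts)))"
    proof (rule Dl_exlist[where r = "Suc L"])
      fix ts' vs :: "((nat \<Rightarrow> 'u) \<Rightarrow> 'u) list"
      assume b: "length ts' = L" "length vs = Suc L" "\<And>t. t \<in> set ts' \<union> set vs \<Longrightarrow> Fu t"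
      from b(2) obtain v vs2 where v: "vs = v # vs2" by (cases vs) auto
      have l: "length vs2 = length ts'" using b v by simp
      have "Fu (\<lambda>e. Qs (map (\<lambda>t. t e) vs2) (map (\<lambda>t. t e) ts'))"
        by (rule Fu_Qs[OF l]) (use b(3) v in auto)
      moreover have "Fu (\<lambda>e. ty i s (map (\<lambda>t. t e) ts'))" "Fu (\<lambda>e. ty i s (map (\<lambda>t. t e) vs2))"
        by (rule Fu_ty; use b(3) v in \<open>auto intro: Fu_const\<close>)+
      moreover have "Fu v" using b(3) v by auto
      ultimately have "Dl (\<lambda>e. ?B (map (\<lambda>t. t e) vs2) (map (\<lambda>t. t e) ts') (v e))" by (intro dls)
      then show "Dl (\<lambda>e. ?B (tl (map (\<lambda>t. t e) vs)) (map (\<lambda>t. t e) ts') (hd (map (\<lambda>t. t e) vs)))"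
        by (simp add: v)
    qed (use a u in auto)
    then show "Dl (\<lambda>e. ?A (map (\<lambda>t. t e) ts) (map (\<lambda>t. t e) us))" by (simp add: u)
  qed (auto intro: Fu_var)
  then show ?thesis by (simp add: RP_def)
qed

lemma Dl_fin: "(\<And>i. i \<in> set is \<Longrightarrow> Dl (\<lambda>e. P i e)) \<Longrightarrow> Dl (\<lambda>e. \<exists>i\<in>set is. P i e)"
  by (induction "is") (simp_all add: Dl_False Dl_or)

text \<open>Pairs of tuples with equal types form a winning system: at level \<open>i\<close> the
  tuples have grown by \<open>k - i\<close> elements and their \<open>i\<close>-types agree, and
  \<open>ty_step\<close> answers the next move. The levels up to \<open>k\<close> are standard, so a
  finite disjunction describes the system.\<close>

lemma E_types:
  assumes V: "V s" and k: "std k <. s" and xs: "length xs = L" "length xs' = L" "\<forall>x\<in>set xs. x <. s" "\<forall>x\<in>set xs'. x <. s"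
    and ty: "ty k s xs = ty k s xs'"
  shows "E s (std k) (Qs xs xs')"
proof -
  let ?P = "\<lambda>p. \<exists>i\<in>set [0..<Suc k]. RP (L + (k - i)) s i p"
  have P: "Dl (\<lambda>e. ?P (e 0))" by (intro Dl_fin Dl_RP)
  define T where "T = coll (pr s (bnd s)) ?P"
  have m0: "mem p T \<longleftrightarrow> p <. pr s (bnd s) \<and> ?P p" for p unfolding T_def by (rule mem_coll[OF P])
  have sk: "std i <. s" if "i \<le> k" for i
  proof -
    have "std i <=. std k" using that
      by (induction k) (auto simp: le_Suc_eq intro: Ar.order_trans[OF _ le_pl1])
    then show ?thesis using k by (rule Ar.le_less_trans)
  qed
  have Qb: "Qs ys ys' <. bnd s" if "\<forall>x\<in>set ys. x <. s" "\<forall>x\<in>set ys'. x <. s" for ys ys'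
    unfolding bnd_def lt_pow_iff mem_Qs using that by (auto intro!: pr_mono_lt Ar.less_imp_le)
  have m: "mem p T \<longleftrightarrow> ?P p" for p
  proof -
    have "p <. pr s (bnd s)" if P: "?P p"
    proof -
      from P obtain i where i0: "i \<in> set [0..<Suc k]" and i2: "RP (L + (k - i)) s i p" by blast
      from i0 have i: "i \<le> k" by auto
      from i2 obtain ys ys' where "\<forall>x\<in>set ys. x <. s" "\<forall>x\<in>set ys'. x <. s" "p = pr (std i) (Qs ys ys')"
        unfolding RP_def by blast
      then show ?thesis using pr_mono_lt[OF sk[OF i] Ar.less_imp_le[OF Qb]] by blast
    qed
    then show ?thesis unfolding m0 by blast
  qed
  have "sys s T" unfolding sys_iff
  proof (intro allI impI)
    fix c q assume "mem (pr c q) T"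
    then obtain i where i0: "i \<in> set [0..<Suc k]" and iRP: "RP (L + (k - i)) s i (pr c q)" unfolding m by blast
    have i: "i \<le> k" "RP (L + (k - i)) s i (pr c q)" using i0 iRP by auto
    from i(2) obtain ys ys' where ys: "length ys = L + (k - i)" "\<forall>x\<in>set ys. x <. s" "length ys' = L + (k - i)"
      "\<forall>x\<in>set ys'. x <. s" "c = std i" "q = Qs ys ys'" "ty i s ys = ty i s ys'" unfolding RP_def by auto
    have l: "length ys = length ys'" using ys by simp
    show "atomic q \<and> (\<forall>c' j u y. c = c' +. un \<longrightarrow> mem (pr j u) s \<longrightarrow> y <. u \<longrightarrow>
      (\<exists>y'. y' <. u \<and> mem (pr c' (ins (pr y y') q)) T) \<and> (\<exists>y'. y' <. u \<and> mem (pr c' (ins (pr y' y) q)) T))"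
    proof (intro conjI[of "atomic q"] allI impI)
      show "atomic q" unfolding ys(6) using l ty_atoms[OF l ys(7)] by (rule atoms_atomic)
      fix c' j u y assume c: "c = c' +. un" and ju: "mem (pr j u) s" and y: "y <. u"
      from c obtain i' where i': "i = Suc i'" "c' = std i'" using ys(5) by (cases i) auto
      have us: "u <. s" by (rule Ar.le_less_trans[OF snd_le mem_lt[OF ju]])
      have R: "mem (pr c' (ins (pr z z') q)) T" if z: "z <. u" "z' <. u" "ty i' s (z # ys) = ty i' s (z' # ys')" for z z'
      proof -
        have "RP (L + (k - i')) s i' (pr c' (Qs (z # ys) (z' # ys')))" unfolding RP_def
        proof (rule exI[of _ "z # ys"], intro conjI, goal_cases)
          case 3
          show ?case
            by (rule exI[of _ "z' # ys'"]) (use i' i(1) ys z us in \<open>auto intro: lt_trans\<close>)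
        qed (use i' i(1) ys z us in \<open>auto intro: lt_trans\<close>)
        moreover have "Qs (z # ys) (z' # ys') = ins (pr z z') q" by (simp add: Qs_def ys(6))
        moreover have "i' \<in> set [0..<Suc k]" using i' i(1) by auto
        ultimately show ?thesis unfolding m by metis
      qed
      from ty_step[OF V ys(7)[unfolded i'(1)] l ju y] obtain y1 where
        y1: "y1 <. u" "ty i' s (y # ys) = ty i' s (y1 # ys')" by blast
      from ty_step[OF V ys(7)[unfolded i'(1), symmetric] l[symmetric] ju y] obtain y2 where
        y2: "y2 <. u" "ty i' s (y # ys') = ty i' s (y2 # ys)" by blast
      show "(\<exists>y'. y' <. u \<and> mem (pr c' (ins (pr y y') q)) T) \<and> (\<exists>y'. y' <. u \<and> mem (pr c' (ins (pr y' y) q)) T)"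
        using R[OF y y1] R[OF y2(1) y y2(2)[symmetric]] y1(1) y2(1) by blast
    qed
  qed
  moreover have "T <. bet s" unfolding T_def bet_def by (rule coll_lt[OF P])
  moreover have "RP (L + (k - k)) s k (pr (std k) (Qs xs xs'))"
    unfolding RP_def using xs ty by (intro exI[of _ xs] conjI exI[of _ xs']) simp_all
  then have "mem (pr (std k) (Qs xs xs')) T" unfolding m by (intro bexI[of _ k]) auto
  ultimately show ?thesis unfolding E_def by blast
qed

text \<open>There are \<open>2\<^sup>N\<close> candidates and only \<open>N\<close> types of pairs \<open>(x, a)\<close>, hence two candidates of the same type for each \<open>s\<close>;
  collection yields two that work for all \<open>s\<close>.\<close>

lemma indiscernible:
  "\<exists>x x' q. x \<noteq> x' \<and> G (std k) q \<and> mem (pr a a) q \<and> mem (pr x x') q"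
proof -
  define N where "N = tb k 2"
  obtain s1 where s1: "V s1" "std k +. a +. pow N <. s1" using V_unb by blast
  have "std k <=. std k +. a +. pow N" "a <=. std k +. a +. pow N" "pow N <=. std k +. a +. pow N"
    by (metis le_pl le_pl1 Ar.order_trans)+
  from this[THEN Ar.le_less_trans, OF s1(2)] have le: "std k <. s1" "a <. s1" "pow N <. s1" .
  have q: "Fu t \<Longrightarrow> Fu u \<Longrightarrow> Fu (\<lambda>e. Qs [t e, a] [u e, a])" for t u
    using Fu_Qs[of "[t, \<lambda>_. a]" "[u, \<lambda>_. a]"] by (auto intro: Fu_const)
  have "\<exists>x x'. x <. pow N \<and> x' <. pow N \<and> x \<noteq> x' \<and> (\<forall>s. V s \<longrightarrow> s1 <=. s \<longrightarrow> E s (std k) (Qs [x, a] [x', a]))"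
  proof (rule ccontr)
    assume no: "\<nexists>x x'. x <. pow N \<and> x' <. pow N \<and> x \<noteq> x' \<and> (\<forall>s. V s \<longrightarrow> s1 <=. s \<longrightarrow> E s (std k) (Qs [x, a] [x', a]))"
    \<comment> \<open>Collection handles one variable, so the two candidates are coded by
      \<open>w\<close>; for a \<open>w\<close> that codes no admissible pair, \<open>s1\<close> will
      do.\<close>
    let ?P = "\<lambda>w s. s1 <=. s \<and> (\<forall>x. x <=. w \<longrightarrow> (\<forall>x'. x' <=. w \<longrightarrow> w = pr x x' \<longrightarrow> x <. pow N \<longrightarrow> x' <. pow N \<longrightarrow> x \<noteq> x' \<longrightarrow>
      \<not> E s (std k) (Qs [x, a] [x', a])))"
    have D: "Dl (\<lambda>e. ?P (e 0) (e 1))" by (intro dls Dl_E q)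
    have "\<exists>s. V s \<and> ?P w s" for w
    proof (cases "\<exists>x x'. w = pr x x' \<and> x <. pow N \<and> x' <. pow N \<and> x \<noteq> x'")
      case True
      then obtain x x' where w: "w = pr x x'" "x <. pow N" "x' <. pow N" "x \<noteq> x'" by blast
      with no obtain s where "V s" "s1 <=. s" "\<not> E s (std k) (Qs [x, a] [x', a])" by blast
      then show ?thesis using w(1) by (intro exI[of _ s]) auto
    next
      case False
      then show ?thesis using s1(1) by (intro exI[of _ s1]) auto
    qed
    from V_coll[where P = ?P, OF D, of "pr (pow N) (pow N)"] this obtain B where
      B: "\<And>w. w <. pr (pow N) (pow N) \<Longrightarrow> \<exists>s. s <. B \<and> V s \<and> ?P w s" by blast
    obtain s2 where s2: "V s2" "B +. s1 <. s2" using V_unb by blast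
    have s2': "B <. s2" "s1 <. s2" using Ar.le_less_trans[OF le_pl1 s2(2)] Ar.le_less_trans[OF le_pl s2(2)] .
    \<comment> \<open>\<open>s2\<close> depends on \<open>B\<close>, and \<open>B\<close> on the
      candidates below \<open>pow N\<close>. This is not circular because \<open>N\<close> bounds
      the number of types uniformly in \<open>s\<close> and was fixed first.\<close>
    have "Fu (\<lambda>e. ty k s2 [e 0, a])"
      using Fu_ty[of "[\<lambda>e. e 0, \<lambda>_. a]" "\<lambda>_. s2" k] by (auto intro: Fu_const Fu_var)
    moreover have "ty k s2 [x, a] <. N" for x
      using ty_lt[OF s2(1), of k "[x, a]"] by (simp add: N_def numeral_2_eq_2)
    ultimately obtain x x' where x: "x <. pow N" "x' <. pow N" "x \<noteq> x'" "ty k s2 [x, a] = ty k s2 [x', a]"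
      using cantor[of "\<lambda>x. ty k s2 [x, a]" N] by blast
    have l2: "std k <. s2" "a <. s2" "x <. s2" "x' <. s2"
      using lt_trans[OF le(1) s2'(2)] lt_trans[OF le(2) s2'(2)] lt_trans[OF x(1) lt_trans[OF le(3) s2'(2)]]
        lt_trans[OF x(2) lt_trans[OF le(3) s2'(2)]] .
    have E2: "E s2 (std k) (Qs [x, a] [x', a])"
      by (rule E_types[OF s2(1) l2(1), where L = 2]) (use l2 x(4) in auto)
    from B[OF pr_mono_lt[OF x(1) Ar.less_imp_le[OF x(2)]]] obtain s where
      s: "s <. B" "V s" "s1 <=. s" "\<not> E s (std k) (Qs [x, a] [x', a])" using x fst_le snd_le by blast
    have l: "std k <. s" "a <. s" "x <. s" "x' <. s"
      using Ar.less_le_trans[OF le(1) s(3)] Ar.less_le_trans[OF le(2) s(3)]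
        Ar.less_le_trans[OF lt_trans[OF x(1) le(3)] s(3)] Ar.less_le_trans[OF lt_trans[OF x(2) le(3)] s(3)] .
    have "Qs [x, a] [x', a] <. bnd s"
      using ins_bnd[OF ins_bnd[OF _ l(2,2)] l(3,4), of zr] unfolding Qs_def by (simp add: bnd_def pow_pos)
    from E_restrict[OF E2 V_sub[OF s(2) s2(1) Ar.less_imp_le[OF lt_trans[OF s(1) s2'(1)]]] l(1) this]
    show False using s(4) by simp
  qed
  then obtain x x' where "x \<noteq> x'" "G (std k) (Qs [x, a] [x', a])" unfolding G_def using s1(1) by blast
  moreover have "mem (pr a a) (Qs [x, a] [x', a])" "mem (pr x x') (Qs [x, a] [x', a])" by (simp_all add: Qs_def)
  ultimately show ?thesis by blast
qed

section \<open>Definability by formulae with parameters\<close>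

definition Fo :: "((nat \<Rightarrow> 'u) \<Rightarrow> bool) \<Rightarrow> bool" where
  "Fo P \<longleftrightarrow> (\<exists>(p::'a fm) e0. fm_in L_PA p \<and> P = (\<lambda>e. sat (mix e e0) p))"

lemma Fo_Dl: "Dl P \<Longrightarrow> Fo P"
  unfolding Dl_def Sg_def RS_def Fo_def using Sigma_fm_in by blast

lemma mix_cn2: "\<exists>\<rho>. \<forall>a e. mix (a ## e) e0 = (\<lambda>n. (a ## mix e e0) (\<rho> n))"
  by (rule exI[of _ "\<lambda>n. if n = 0 then 0 else if even n then n - 1 else n + 1"], intro allI, rule mix_cn)

lemma Fo_all: assumes "Fo P" shows "Fo (\<lambda>e. \<forall>a. P (a ## e))"
proof -
  obtain p e0 where p: "fm_in L_PA p" "P = (\<lambda>e. sat (mix e e0) p)" using assms unfolding Fo_def by blast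
  obtain \<rho> where \<rho>: "\<And>a e. mix (a ## e) e0 = (\<lambda>n. (a ## mix e e0) (\<rho> n))" using mix_cn2 by blast
  show ?thesis unfolding Fo_def p(2) \<rho>
    by (intro exI[of _ "All (ren \<rho> p)"] exI[of _ e0]) (simp add: p(1) gs_ren)
qed

lemma Fo_ex: assumes "Fo P" shows "Fo (\<lambda>e. \<exists>a. P (a ## e))"
proof -
  obtain p e0 where p: "fm_in L_PA p" "P = (\<lambda>e. sat (mix e e0) p)" using assms unfolding Fo_def by blast
  obtain \<rho> where \<rho>: "\<And>a e. mix (a ## e) e0 = (\<lambda>n. (a ## mix e e0) (\<rho> n))" using mix_cn2 by blast
  show ?thesis unfolding Fo_def p(2) \<rho>
    by (intro exI[of _ "Ex (ren \<rho> p)"] exI[of _ e0]) (simp add: p(1) gs_ren)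
qed

lemma Fo_G: "Fo (\<lambda>e. G (e 0) (e 1))"
proof -
  have "Dl (\<lambda>e. V (e 1) \<and> (V (e 0) \<longrightarrow> e 1 <=. e 0 \<longrightarrow> E (e 0) (e 2) (e 3)))"
    by (intro dls Dl_V Dl_E)
  from Fo_ex[OF Fo_all[OF Fo_Dl[OF this]]] show ?thesis
    by (simp add: G_def numeral_2_eq_2 numeral_3_eq_3)
qed

text \<open>Exports only what a formula can express for each \<open>k\<close>, with \<open>G\<close>
  and membership as unspecified definable predicates; nothing about cuts or \<Delta> predicates has
  to survive in the later model.\<close>

theorem game:
  "\<exists>G \<mu>. Fo (\<lambda>e. G (e 0) (e 1)) \<and> Fo (\<lambda>e. \<mu> (e 0) (e 1) (e 2)) \<and>
    (\<forall>c q y. G (c +. un) q \<longrightarrow>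
      (\<exists>y' q'. G c q' \<and> \<mu> y y' q' \<and> (\<forall>x x'. \<mu> x x' q \<longrightarrow> \<mu> x x' q')) \<and>
      (\<exists>y' q'. G c q' \<and> \<mu> y' y q' \<and> (\<forall>x x'. \<mu> x x' q \<longrightarrow> \<mu> x x' q'))) \<and>
    (\<forall>c q x x' y y' z z'. G c q \<longrightarrow> \<mu> x x' q \<longrightarrow> \<mu> y y' q \<longrightarrow> \<mu> z z' q \<longrightarrow> at x x' y y' z z') \<and>
    (\<forall>k a. \<exists>x x' q. x \<noteq> x' \<and> G (std k) q \<and> \<mu> a a q \<and> \<mu> x x' q)"
proof (rule exI[of _ G], rule exI[of _ "\<lambda>x x' q. mem (pr x x') q"], intro conjI)
  show "Fo (\<lambda>e. mem (pr (e 0) (e 1)) (e 2))" by (intro Fo_Dl dls)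
  show "\<forall>c q x x' y y' z z'. G c q \<longrightarrow> mem (pr x x') q \<longrightarrow> mem (pr y y') q \<longrightarrow> mem (pr z z') q \<longrightarrow> at x x' y y' z z'"
    using G_atomic unfolding atomic_iff by blast
  show "\<forall>k a. \<exists>x x' q. x \<noteq> x' \<and> G (std k) q \<and> mem (pr a a) q \<and> mem (pr x x') q"
    using indiscernible by blast
  show "\<forall>c q y. G (c +. un) q \<longrightarrow>
      (\<exists>y' q'. G c q' \<and> mem (pr y y') q' \<and> (\<forall>x x'. mem (pr x x') q \<longrightarrow> mem (pr x x') q')) \<and>
      (\<exists>y' q'. G c q' \<and> mem (pr y' y) q' \<and> (\<forall>x x'. mem (pr x x') q \<longrightarrow> mem (pr x x') q'))"
  proof (intro allI impI)
    fix c q y assume "G (c +. un) q"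
    from G_step[OF this, of y] obtain y1 y2 where "G c (ins (pr y y1) q)" "G c (ins (pr y2 y) q)" by blast
    then show "(\<exists>y' q'. G c q' \<and> mem (pr y y') q' \<and> (\<forall>x x'. mem (pr x x') q \<longrightarrow> mem (pr x x') q')) \<and>
      (\<exists>y' q'. G c q' \<and> mem (pr y' y) q' \<and> (\<forall>x x'. mem (pr x x') q \<longrightarrow> mem (pr x x') q'))"
      by (intro conjI exI[of _ y1] exI[of _ y2] exI[of _ "ins (pr y y1) q"] exI[of _ "ins (pr y2 y) q"]) auto
  qed
qed (rule Fo_G)

end

section \<open>Translations, expansions and back-and-forth systems\<close>

lemma dosr_of_PA:
  assumes PA: "\<And>p e. p \<in> PA_base \<Longrightarrow> gs UNIV F R \<kappa> e (p :: 'a fm)"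
  shows "dosr (\<lambda>x y. F Plus [x, y]) (\<lambda>x y. F Times [x, y]) (\<lambda>x y. R Less [x, y]) (F Zero []) (F One [])"
proof -
  note e = PA[where e = "x ## y ## z ## (\<lambda>_. z)" for x y z]
  show ?thesis
  proof
    fix x y z
    let ?x = "Var 0 :: 'a tm" and ?y = "Var 1 :: 'a tm" and ?z = "Var 2 :: 'a tm"
    note m = PA_base_def Let_def
    show "F Plus [F Plus [x, y], z] = F Plus [x, F Plus [y, z]]"
      using e[of "(?x \<oplus> ?y) \<oplus> ?z \<doteq> ?x \<oplus> (?y \<oplus> ?z)" x y z] by (simp add: m)
    show "F Plus [x, y] = F Plus [y, x]" using e[of "?x \<oplus> ?y \<doteq> ?y \<oplus> ?x" x y z] by (simp add: m)
    show "F Times [F Times [x, y], z] = F Times [x, F Times [y, z]]"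
      using e[of "(?x \<otimes> ?y) \<otimes> ?z \<doteq> ?x \<otimes> (?y \<otimes> ?z)" x y z] by (simp add: m)
    show "F Times [x, y] = F Times [y, x]" using e[of "?x \<otimes> ?y \<doteq> ?y \<otimes> ?x" x y z] by (simp add: m)
    show "F Times [x, F Plus [y, z]] = F Plus [F Times [x, y], F Times [x, z]]"
      using e[of "?x \<otimes> (?y \<oplus> ?z) \<doteq> ?x \<otimes> ?y \<oplus> ?x \<otimes> ?z" x y z] by (simp add: m)
    show "F Plus [x, F Zero []] = x" using e[of "?x \<oplus> \<zero> \<doteq> ?x" x y z] by (simp add: m)
    show "F Times [x, F Zero []] = F Zero []" using e[of "?x \<otimes> \<zero> \<doteq> \<zero>" x y z] by (simp add: m)
    show "F Times [x, F One []] = x" using e[of "?x \<otimes> \<one> \<doteq> ?x" x y z] by (simp add: m)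
    show "R Less [x, y] \<Longrightarrow> R Less [y, z] \<Longrightarrow> R Less [x, z]"
      using e[of "?x \<prec> ?y \<^bold>\<and> ?y \<prec> ?z \<^bold>\<rightarrow> ?x \<prec> ?z" x y z] by (simp add: m)
    show "\<not> R Less [x, x]" using e[of "\<^bold>\<not> (?x \<prec> ?x)" x y z] by (simp add: m)
    show "R Less [x, y] \<or> x = y \<or> R Less [y, x]"
      using e[of "?x \<prec> ?y \<^bold>\<or> ?x \<doteq> ?y \<^bold>\<or> ?y \<prec> ?x" x y z] by (simp add: m) blast
    show "R Less [x, y] \<Longrightarrow> R Less [F Plus [x, z], F Plus [y, z]]"
      using e[of "?x \<prec> ?y \<^bold>\<rightarrow> ?x \<oplus> ?z \<prec> ?y \<oplus> ?z" x y z] by (simp add: m)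
    show "R Less [F Zero [], z] \<Longrightarrow> R Less [x, y] \<Longrightarrow> R Less [F Times [x, z], F Times [y, z]]"
      using e[of "\<zero> \<prec> ?z \<^bold>\<and> ?x \<prec> ?y \<^bold>\<rightarrow> ?x \<otimes> ?z \<prec> ?y \<otimes> ?z" x y z] by (simp add: m)
    show "R Less [x, y] \<Longrightarrow> \<exists>z. F Plus [x, z] = y"
      using e[of "?x \<prec> ?y \<^bold>\<rightarrow> Ex (Var 1 \<oplus> Var 0 \<doteq> Var 2)" x y z] by (simp add: m numeral_2_eq_2)
    show "R Less [F Zero [], F One []]" using e[of "\<zero> \<prec> \<one>" x y z] by (simp add: m)
    show "R Less [F Zero [], x] \<Longrightarrow> R Less [F One [], x] \<or> F One [] = x"
      using e[of "\<zero> \<prec> ?x \<^bold>\<rightarrow> \<one> \<prec> ?x \<^bold>\<or> \<one> \<doteq> ?x" x y z] by (simp add: m) blast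
    show "R Less [F Zero [], x] \<or> F Zero [] = x"
      using e[of "\<zero> \<prec> ?x \<^bold>\<or> \<zero> \<doteq> ?x" x y z] by (simp add: m) blast
  qed
qed

section \<open>Structures that agree on a language\<close>

lemma ev_cong_struct:
  "tm_in L t \<Longrightarrow> (\<And>f xs. f \<in> funs L \<Longrightarrow> F f xs = F' f xs) \<Longrightarrow> ev F k e t = ev F' k e t"
proof (induction t)
  case (Fn f ts)
  then have "map (ev F k e) ts = map (ev F' k e) ts" by (auto simp: list_all_iff)
  then show ?case using Fn(2,3) by (simp only: ev.simps) simp
qed simp_all

lemma gs_cong_struct:
  "fm_in L p \<Longrightarrow> (\<And>f xs. f \<in> funs L \<Longrightarrow> F f xs = F' f xs) \<Longrightarrow> (\<And>r xs. r \<in> rels L \<Longrightarrow> R r xs = R' r xs) \<Longrightarrow>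
    gs D F R k e p = gs D F' R' k e p"
proof (induction p arbitrary: e)
  case (Eq s t)
  then show ?case using ev_cong_struct[of L s F F' k e] ev_cong_struct[of L t F F' k e] by simp
next
  case (Rel r ts)
  have "map (ev F k e) ts = map (ev F' k e) ts"
    using Rel(1) by (auto simp: list_all_iff intro!: ev_cong_struct[OF _ Rel(2)])
  then show ?case using Rel(1,3) by (simp only: gs.simps) simp
next
  case (Imp p q)
  have "fm_in L p" "fm_in L q" using Imp(3) by simp_all
  from Imp(1)[OF this(1) Imp(4,5)] Imp(2)[OF this(2) Imp(4,5)] show ?case by simp
next
  case (All p)
  have "fm_in L p" using All(2) by simp
  from All(1)[OF this All(3,4)] show ?case by simp
qed simp

lemma gs_conj_list: "gs D F R k e (conj_list ps) \<longleftrightarrow> (\<forall>p\<in>set ps. gs D F R k e p)"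
  by (induction ps) (auto simp: conj_list_def)

lemma gs_unnest:
  "gs UNIV F R k e (unnest d gl p) \<longleftrightarrow> (\<exists>e'. (\<forall>n. e' (n + length gl) = e n) \<and>
    (\<forall>i<length gl. gs UNIV F R k (e' i ## (\<lambda>n. e' (n + length gl + d))) (gl ! i)) \<and> gs UNIV F R k e' p)"
proof -
  have c: "(\<lambda>n. e' (case_nat i (\<lambda>n. n + length gl + d) n)) = e' i ## (\<lambda>n. e' (n + length gl + d))" for i and e' :: "nat \<Rightarrow> 'a"
    by (rule ext) (simp split: nat.split)
  have "(\<forall>p\<in>set (map2 (\<lambda>i g. ren (case_nat i (\<lambda>n. n + length gl + d)) g) [0..<length gl] gl). gs UNIV F R k e' p) \<longleftrightarrow>
      (\<forall>i<length gl. gs UNIV F R k (e' i ## (\<lambda>n. e' (n + length gl + d))) (gl ! i))" for e'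
  proof -
    have "set (zip [0..<length gl] gl) = (\<lambda>i. (i, gl ! i)) ` {..<length gl}" by (force simp: set_zip)
    then show ?thesis by (auto simp: gs_ren c[of e'])
  qed
  then show ?thesis unfolding unnest_def Let_def gs_Ex_pow by (simp add: gs_conj_list)
qed

text \<open>\<open>F'\<close> adds to \<open>F\<close> the function \<open>H\<close> whose graph the
  translation assigns to \<open>HSym\<close>; evaluating a translated formula then amounts to
  evaluating the original one with \<open>F'\<close>.\<close>

locale expansion =
  fixes F :: "fsym \<Rightarrow> 'u list \<Rightarrow> 'u" and R k and LP :: "'a lang" and \<tau> :: "'a translation" and H F'
  assumes LP: "funs LP = {Zero, One, Plus, Times}" "rels LP = {Less}"
    and H: "\<And>v c y e. gs UNIV F R k (v ## c ## y ## e) (tfun \<tau> HSym) \<longleftrightarrow> v = H c y"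
    and F': "\<And>f xs. f \<noteq> HSym \<Longrightarrow> F' f xs = F f xs" "\<And>c y. F' HSym [c, y] = H c y"
begin

lemma tr_tm_correct:
  "tm_in L_PA_H t \<Longrightarrow> gs UNIV F R k (v ## e) (tr_tm LP \<tau> t) \<longleftrightarrow> v = ev F' k e t"
proof (induction t arbitrary: v)
  case (Fn f ts)
  show ?case
  proof (cases "tm_in LP (Fn f ts)")
    case True
    have "ev F k e (Fn f ts) = ev F' k e (Fn f ts)"
      by (rule ev_cong_struct[OF True]) (auto simp: LP F')
    then have "gs UNIV F R k (v ## e) (Var 0 \<doteq> lift_tm (Fn f ts)) \<longleftrightarrow> v = ev F' k e (Fn f ts)"
      by (simp only: gs.simps ev_subst ev.simps) simp
    then show ?thesis using True by (simp only: tr_tm.simps Let_def if_True)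
  next
    case False
    let ?n = "length ts"
    have f: "f \<in> {Zero, One, Plus, Times, HSym}" "length ts = far f" "\<And>t. t \<in> set ts \<Longrightarrow> tm_in L_PA_H t"
      using Fn(2) by (auto simp: L_PA_H_def list_all_iff)
    define p where "p = (if f \<in> funs LP then Var ?n \<doteq> Fn f (map Var [0..<?n]) else ren (case_nat ?n (\<lambda>i. i)) (tfun \<tau> f))"
    have tr: "tr_tm LP \<tau> (Fn f ts) = unnest 1 (map (tr_tm LP \<tau>) ts) p"
      using False by (simp only: tr_tm.simps Let_def if_False p_def)
    have p: "gs UNIV F R k e' p \<longleftrightarrow> v = F' f (map e' [0..<?n])" if "e' ?n = v" for e'
    proof (cases "f = HSym")
      case True
      then have n: "?n = 2" using f(2) by simp
      \<comment> \<open>\<open>unnest\<close> leaves the arguments at 0 and 1 and the value at 2,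
        whereas the graph formula expects the value first.\<close>
      have "(\<lambda>n. e' (case_nat 2 (\<lambda>i. i) n)) = e' 2 ## e' 0 ## e' 1 ## (\<lambda>n. e' (n + 2))"
        by (rule ext) (simp add: numeral_2_eq_2 split: nat.split)
      then show ?thesis using True n that LP H[of v "e' 0" "e' 1" "\<lambda>n. e' (n + 2)"] F'(2)
        by (simp add: p_def gs_ren upt_rec)
    next
      case False
      then show ?thesis using f(1) that by (auto simp: p_def LP F'(1) comp_def)
    qed
    have "gs UNIV F R k (v ## e) (tr_tm LP \<tau> (Fn f ts)) \<longleftrightarrow> (\<exists>e'. (\<forall>n. e' (n + ?n) = (v ## e) n) \<and>
        (\<forall>i<?n. gs UNIV F R k (e' i ## e) (tr_tm LP \<tau> (ts ! i))) \<and> gs UNIV F R k e' p)" (is "_ \<longleftrightarrow> (\<exists>e'. ?A e')")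
    proof -
      have "(\<lambda>n. e' (n + ?n + 1)) = e" if "\<forall>n. e' (n + ?n) = (v ## e) n" for e'
      proof
        fix n show "e' (n + ?n + 1) = e n" using that[rule_format, of "Suc n"] by simp
      qed
      then show ?thesis unfolding tr gs_unnest length_map by (simp cong: conj_cong) 
    qed
    also have "\<dots> \<longleftrightarrow> v = F' f (map (ev F' k e) ts)"
    proof
      assume "\<exists>e'. ?A e'"
      then obtain e' where e': "\<forall>n. e' (n + ?n) = (v ## e) n" "\<forall>i<?n. gs UNIV F R k (e' i ## e) (tr_tm LP \<tau> (ts ! i))"
        "gs UNIV F R k e' p" by blast
      have "e' i = ev F' k e (ts ! i)" if "i < ?n" for i
        using Fn(1)[of "ts ! i" "e' i"] e'(2) that f(3)[of "ts ! i"] by simp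
      then have "map e' [0..<?n] = map (ev F' k e) ts" by (auto intro: nth_equalityI)
      then show "v = F' f (map (ev F' k e) ts)" using p[of e'] e'(1,3) spec[OF e'(1), of 0] by simp
    next
      assume v: "v = F' f (map (ev F' k e) ts)"
      define e' where "e' n = (if n < ?n then ev F' k e (ts ! n) else (v ## e) (n - ?n))" for n
      have "map e' [0..<?n] = map (ev F' k e) ts" by (auto intro: nth_equalityI simp: e'_def)
      then have "gs UNIV F R k e' p" using p[of e'] v by (simp add: e'_def)
      moreover have "gs UNIV F R k (e' i ## e) (tr_tm LP \<tau> (ts ! i))" if "i < ?n" for i
        using Fn(1)[of "ts ! i" "e' i"] that f(3)[of "ts ! i"] by (simp add: e'_def)
      ultimately show "\<exists>e'. ?A e'" by (intro exI[of _ e']) (simp add: e'_def)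
    qed
    finally show ?thesis by simp
  qed
qed simp_all

lemma tr_correct:
  "fm_in L_PA_H p \<Longrightarrow> gs UNIV F R k e (tr LP \<tau> p) \<longleftrightarrow> gs UNIV F' R k e p"
proof (induction p arbitrary: e)
  case (Eq s t)
  show ?case
  proof (cases "fm_in LP (Eq s t)")
    case True
    have "gs UNIV F R k e p = gs UNIV F' R k e p" if "fm_in LP p" for p
      by (rule gs_cong_struct[OF that]) (auto simp: LP F'(1))
    from this[OF True] show ?thesis using True by (simp only: tr.simps if_True)
  next
    case False
    have st: "tm_in L_PA_H s" "tm_in L_PA_H t" using Eq by simp_all
    have *: "gs UNIV F R k e (tr LP \<tau> (Eq s t)) \<longleftrightarrow> gs UNIV F R k e (unnest 0 [tr_tm LP \<tau> s, tr_tm LP \<tau> t] (Var 0 \<doteq> Var 1))"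
      using False by (simp only: tr.simps if_False)
    also have "\<dots> \<longleftrightarrow> (\<exists>e'. (\<forall>n. e' (n + 2) = e n) \<and> e' 0 = ev F' k e s \<and> e' 1 = ev F' k e t \<and> e' 0 = e' 1)"
      unfolding gs_unnest
      by (intro ex_cong1, rule conj_cong)
         (auto simp: tr_tm_correct[OF st(1)] tr_tm_correct[OF st(2)] less_Suc_eq numeral_2_eq_2 all_conj_distrib)
    also have "\<dots> \<longleftrightarrow> ev F' k e s = ev F' k e t"
    proof
      assume "ev F' k e s = ev F' k e t"
      then show "\<exists>e'. (\<forall>n. e' (n + 2) = e n) \<and> e' 0 = ev F' k e s \<and> e' 1 = ev F' k e t \<and> e' 0 = e' 1"
        by (intro exI[of _ "ev F' k e s ## ev F' k e t ## e"]) simp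
    qed auto
    finally show ?thesis by simp
  qed
next
  case (Rel r ts)
  show ?case
  proof (cases "fm_in LP (Rel r ts)")
    case True
    have "gs UNIV F R k e p = gs UNIV F' R k e p" if "fm_in LP p" for p
      by (rule gs_cong_struct[OF that]) (auto simp: LP F'(1))
    from this[OF True] show ?thesis using True by (simp only: tr.simps if_True)
  next
    case False
    have r: "r = Less" using Rel by (simp add: L_PA_H_def)
    have "length ts = 2" using Rel r by simp
    then obtain s t where ts: "ts = [s, t]" by (auto simp: length_2)
    have st: "tm_in L_PA_H s" "tm_in L_PA_H t" using Rel ts by simp_all
    have *: "gs UNIV F R k e (tr LP \<tau> (Rel r ts)) \<longleftrightarrow> gs UNIV F R k e (unnest 0 [tr_tm LP \<tau> s, tr_tm LP \<tau> t] (Rel Less [Var 0, Var 1]))"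
      using False by (auto simp: r ts LP upt_rec)
    also have "\<dots> \<longleftrightarrow> (\<exists>e'. (\<forall>n. e' (n + 2) = e n) \<and> e' 0 = ev F' k e s \<and> e' 1 = ev F' k e t \<and> R Less [e' 0, e' 1])"
      unfolding gs_unnest
      by (intro ex_cong1, rule conj_cong)
         (auto simp: tr_tm_correct[OF st(1)] tr_tm_correct[OF st(2)] less_Suc_eq numeral_2_eq_2 all_conj_distrib)
    also have "\<dots> \<longleftrightarrow> R Less [ev F' k e s, ev F' k e t]"
    proof
      assume "R Less [ev F' k e s, ev F' k e t]"
      then show "\<exists>e'. (\<forall>n. e' (n + 2) = e n) \<and> e' 0 = ev F' k e s \<and> e' 1 = ev F' k e t \<and> R Less [e' 0, e' 1]"
        by (intro exI[of _ "ev F' k e s ## ev F' k e t ## e"]) simp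
    qed auto
    finally show ?thesis by (simp add: r ts)
  qed
qed simp_all

end

lemma gs_total_functional:
  assumes "\<And>e. gs UNIV F R k e (total_functional n g)"
  shows "\<exists>v. gs UNIV F R k (v ## e) g" "gs UNIV F R k (v ## e) g \<Longrightarrow> gs UNIV F R k (w ## e) g \<Longrightarrow> v = w"
proof -
  let ?X = "Ex g \<^bold>\<and> All (All (ren (case_nat 1 (\<lambda>i. i + 2)) g \<^bold>\<and> ren (case_nat 0 (\<lambda>i. i + 2)) g \<^bold>\<rightarrow> Var 1 \<doteq> Var 0))"
  have X: "gs UNIV F R k e ?X"
    using assms[of "\<lambda>i. e (i + n)"] unfolding total_functional_def gs_All_pow by blast
  have 1: "(\<lambda>i. (b ## a ## e) (case_nat 1 (\<lambda>i. i + 2) i)) = a ## e" for a b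
    by (rule ext) (simp split: nat.split)
  have 0: "(\<lambda>i. (b ## a ## e) (case_nat 0 (\<lambda>i. i + 2) i)) = b ## e" for a b
    by (rule ext) (simp split: nat.split)
  show "\<exists>v. gs UNIV F R k (v ## e) g" using X by auto
  show "gs UNIV F R k (v ## e) g \<Longrightarrow> gs UNIV F R k (w ## e) g \<Longrightarrow> v = w"
    using X unfolding gs.simps ev.simps gs_ren 0 1 by auto
qed

lemma finite_set_fm: "finite (set_fm p)"
  by (induction p) auto

text \<open>The clauses for constants and operations speak of graphs, because the domain of a
  position is not closed under the operations.\<close>

locale bf_system =
  fixes F :: "fsym \<Rightarrow> 'u list \<Rightarrow> 'u" and R :: "rsym \<Rightarrow> 'u list \<Rightarrow> bool" and BB :: "('u \<times> 'u) set set"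
  assumes forth: "Q \<in> BB \<Longrightarrow> \<exists>Q'\<in>BB. Q \<subseteq> Q' \<and> (\<exists>y'. (y, y') \<in> Q')"
    and recede: "Q \<in> BB \<Longrightarrow> \<exists>Q'\<in>BB. Q \<subseteq> Q' \<and> (\<exists>y'. (y', y) \<in> Q')"
    and eq: "Q \<in> BB \<Longrightarrow> (x, x') \<in> Q \<Longrightarrow> (y, y') \<in> Q \<Longrightarrow> x = y \<longleftrightarrow> x' = y'"
    and const: "Q \<in> BB \<Longrightarrow> (x, x') \<in> Q \<Longrightarrow> f \<in> {Zero, One} \<Longrightarrow> x = F f [] \<longleftrightarrow> x' = F f []"
    and less: "Q \<in> BB \<Longrightarrow> (x, x') \<in> Q \<Longrightarrow> (y, y') \<in> Q \<Longrightarrow> R Less [x, y] \<longleftrightarrow> R Less [x', y']"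
    and oper: "Q \<in> BB \<Longrightarrow> (x, x') \<in> Q \<Longrightarrow> (y, y') \<in> Q \<Longrightarrow> (z, z') \<in> Q \<Longrightarrow> f \<in> {Plus, Times} \<Longrightarrow>
      F f [x, y] = z \<longleftrightarrow> F f [x', y'] = z'"
begin

text \<open>Forth moves bring the values of the subterms into the position, and the clauses for
  constants and operations force each answer to be the value on the other side.\<close>

lemma term_ext:
  assumes "tm_in L t" "funs L \<subseteq> {Zero, One, Plus, Times}"
  shows "Q \<in> BB \<Longrightarrow> (\<And>n. (e n, e' n) \<in> Q) \<Longrightarrow> (\<And>a. a \<in> set_tm t \<Longrightarrow> (k a, k a) \<in> Q) \<Longrightarrow>
    \<exists>Q'\<in>BB. Q \<subseteq> Q' \<and> (ev F k e t, ev F k e' t) \<in> Q'"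
  using assms(1)
proof (induction t arbitrary: Q)
  case (Fn f ts)
  have f: "f \<in> {Zero, One, Plus, Times}" "length ts = far f" "\<And>t. t \<in> set ts \<Longrightarrow> tm_in L t"
    using Fn(5) assms(2) by (auto simp: list_all_iff)
  consider "f \<in> {Zero, One}" "ts = []" | s t where "f \<in> {Plus, Times}" "ts = [s, t]"
    using f(1,2) by (auto simp: length_2)
  then show ?case
  proof cases
    case 1
    obtain Q' y' where Q': "Q' \<in> BB" "Q \<subseteq> Q'" "(F f [], y') \<in> Q'" using forth[OF Fn(2)] by blast
    then have "y' = F f []" using const[OF Q'(1,3) 1(1)] by simp
    then show ?thesis using Q' 1 by auto
  next
    case (2 s t)
    have st: "s \<in> set ts" "t \<in> set ts" using 2 by simp_all
    have pr: "\<And>a. a \<in> set_tm s \<Longrightarrow> (k a, k a) \<in> Q" "\<And>a. a \<in> set_tm t \<Longrightarrow> (k a, k a) \<in> Q"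
      using Fn(4) 2(2) by simp_all
    from Fn(1)[OF st(1) Fn(2,3) pr(1) f(3)[OF st(1)]] obtain Q1 where
      Q1: "Q1 \<in> BB" "Q \<subseteq> Q1" "(ev F k e s, ev F k e' s) \<in> Q1" by blast
    have "\<And>n. (e n, e' n) \<in> Q1" "\<And>a. a \<in> set_tm t \<Longrightarrow> (k a, k a) \<in> Q1" using Fn(3) pr(2) Q1(2) by blast+
    from Fn(1)[OF st(2) Q1(1) this f(3)[OF st(2)]] obtain Q2 where
      Q2: "Q2 \<in> BB" "Q1 \<subseteq> Q2" "(ev F k e t, ev F k e' t) \<in> Q2" by blast
    from forth[OF Q2(1)] obtain Q3 y' where Q3: "Q3 \<in> BB" "Q2 \<subseteq> Q3" "(F f [ev F k e s, ev F k e t], y') \<in> Q3" by blast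
    have "F f [ev F k e' s, ev F k e' t] = y'"
      using oper[OF Q3(1) _ _ Q3(3) 2(1)] Q1(3) Q2(2,3) Q3(2) by blast
    then show ?thesis using Q3 Q2(2) Q1(2) 2(2) by auto
  qed
qed auto

lemma preserve:
  assumes "fm_in L p" "funs L \<subseteq> {Zero, One, Plus, Times}"
    and rels: "\<And>r Q x x' y y'. r \<in> rels L \<Longrightarrow> Q \<in> BB \<Longrightarrow> (x, x') \<in> Q \<Longrightarrow> (y, y') \<in> Q \<Longrightarrow> R r [x, y] \<longleftrightarrow> R r [x', y']"
  shows "Q \<in> BB \<Longrightarrow> (\<And>n. (e n, e' n) \<in> Q) \<Longrightarrow> (\<And>a. a \<in> set_fm p \<Longrightarrow> (k a, k a) \<in> Q) \<Longrightarrow>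
    gs UNIV F R k e p \<longleftrightarrow> gs UNIV F R k e' p"
  using assms(1)
proof (induction p arbitrary: Q e e')
  have two: "\<exists>Q'\<in>BB. (ev F k e s, ev F k e' s) \<in> Q' \<and> (ev F k e t, ev F k e' t) \<in> Q'"
    if a: "Q \<in> BB" "\<And>n. (e n, e' n) \<in> Q" "\<And>a. a \<in> set_tm s \<union> set_tm t \<Longrightarrow> (k a, k a) \<in> Q" "tm_in L s" "tm_in L t"
    for Q e e' s t
  proof -
    have p1: "\<And>a. a \<in> set_tm s \<Longrightarrow> (k a, k a) \<in> Q" using a(3) by simp
    obtain Q1 where Q1: "Q1 \<in> BB" "Q \<subseteq> Q1" "(ev F k e s, ev F k e' s) \<in> Q1"
      using term_ext[OF a(4) assms(2) a(1), of e e' k] a(2) p1 by blast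
    have "\<And>n. (e n, e' n) \<in> Q1" "\<And>a. a \<in> set_tm t \<Longrightarrow> (k a, k a) \<in> Q1" using a(2,3) Q1(2) by blast+
    with term_ext[OF a(5) assms(2) Q1(1), of e e' k] Q1(3) show ?thesis by blast
  qed
  {
    case (Eq s t)
    have st: "tm_in L s" "tm_in L t" using Eq(4) by simp_all
    have "\<And>a. a \<in> set_tm s \<union> set_tm t \<Longrightarrow> (k a, k a) \<in> Q" using Eq(3) by simp
    with two[of Q e e' s t] Eq(1,2) st obtain Q1 where
      "Q1 \<in> BB" "(ev F k e s, ev F k e' s) \<in> Q1" "(ev F k e t, ev F k e' t) \<in> Q1" by blast
    from eq[OF this] show ?case unfolding gs.simps .
  next
    case (Rel r ts)
    have r: "r \<in> rels L" "length ts = 2" using Rel(4) by (auto, cases r, auto)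
    then obtain s t where ts: "ts = [s, t]" by (auto simp: length_2)
    have st: "tm_in L s" "tm_in L t" using Rel(4) ts by simp_all
    have "\<And>a. a \<in> set_tm s \<union> set_tm t \<Longrightarrow> (k a, k a) \<in> Q" using Rel(3) ts by auto
    with two[of Q e e' s t] Rel(1,2) st obtain Q1 where
      "Q1 \<in> BB" "(ev F k e s, ev F k e' s) \<in> Q1" "(ev F k e t, ev F k e' t) \<in> Q1" by blast
    from rels[OF r(1) this] show ?case unfolding ts gs.simps list.map .
  next
    case (Imp p q)
    have "fm_in L p" "fm_in L q" using Imp(6) by simp_all
    moreover have "\<And>a. a \<in> set_fm p \<Longrightarrow> (k a, k a) \<in> Q" "\<And>a. a \<in> set_fm q \<Longrightarrow> (k a, k a) \<in> Q" using Imp(5) by simp_all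
    ultimately show ?case using Imp(1)[OF Imp(3,4)] Imp(2)[OF Imp(3,4)] by simp
  next
    case (All p)
    have L: "fm_in L p" using All(5) by simp
    have s: "gs UNIV F R k (y ## e) p \<longleftrightarrow> gs UNIV F R k (y' ## e') p" if "Q' \<in> BB" "Q \<subseteq> Q'" "(y, y') \<in> Q'" for Q' y y'
    proof (rule All(1)[OF that(1) _ _ L])
      show "((y ## e) n, (y' ## e') n) \<in> Q'" for n using All(3) that(2,3) by (auto split: nat.split)
      show "\<And>a. a \<in> set_fm p \<Longrightarrow> (k a, k a) \<in> Q'" using All(4) that(2) by auto
    qed
    show ?case unfolding gs.simps
    proof (intro iffI ballI)
      fix y' assume *: "\<forall>y\<in>UNIV. gs UNIV F R k (y ## e) p"
      from recede[OF All(2), of y'] obtain Q' y where "Q' \<in> BB" "Q \<subseteq> Q'" "(y, y') \<in> Q'" by blast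
      from s[OF this] * show "gs UNIV F R k (y' ## e') p" by simp
    next
      fix y assume *: "\<forall>y\<in>UNIV. gs UNIV F R k (y ## e') p"
      from forth[OF All(2), of y] obtain Q' y' where "Q' \<in> BB" "Q \<subseteq> Q'" "(y, y') \<in> Q'" by blast
      from s[OF this] * show "gs UNIV F R k (y ## e) p" by simp
    qed
  }
qed simp

lemma forth_list: "Q \<in> BB \<Longrightarrow> \<exists>Q'\<in>BB. Q \<subseteq> Q' \<and> (\<exists>f'. \<forall>i<(n::nat). (f i, f' i) \<in> Q')"
proof (induction n)
  case (Suc n)
  then obtain Q1 f1 where 1: "Q1 \<in> BB" "Q \<subseteq> Q1" "\<forall>i<n. (f i, f1 i) \<in> Q1" by blast
  from forth[OF 1(1), of "f n"] obtain Q2 y where 2: "Q2 \<in> BB" "Q1 \<subseteq> Q2" "(f n, y) \<in> Q2" by blast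
  have "\<forall>i<Suc n. (f i, (f1(n := y)) i) \<in> Q2" using 1(3) 2(2,3) by (auto simp: less_Suc_eq)
  moreover have "Q \<subseteq> Q2" using 1(2) 2(2) by blast
  ultimately show ?case using 2(1) by blast
qed auto

end

section \<open>The game as a formula\<close>

primrec stdv :: "(fsym \<Rightarrow> 'u list \<Rightarrow> 'u) \<Rightarrow> nat \<Rightarrow> 'u" where
  "stdv F 0 = F Zero []" | "stdv F (Suc k) = F Plus [stdv F k, F One []]"

text \<open>The arguments sit at \<open>i\<close> and \<open>j\<close>, and the parameters start at
  \<open>b\<close>. Only variables can be plugged in, which is why \<open>psi\<close> has a
  quantified variable for \<open>c + 1\<close>.\<close>

definition gF :: "'a fm \<Rightarrow> nat \<Rightarrow> nat \<Rightarrow> nat \<Rightarrow> 'a fm" where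
  "gF p i j b = ren (case_nat i (case_nat j (\<lambda>n. n + b))) p"

definition mF :: "'a fm \<Rightarrow> nat \<Rightarrow> nat \<Rightarrow> nat \<Rightarrow> nat \<Rightarrow> 'a fm" where
  "mF p i j l b = ren (case_nat i (case_nat j (case_nat l (\<lambda>n. n + b)))) p"

lemma gs_gF: "gs D F R k e (gF p i j b) \<longleftrightarrow> gs D F R k (e i ## e j ## (\<lambda>n. e (n + b))) p"
  unfolding gF_def gs_ren
  by (rule arg_cong[where f = "\<lambda>e. gs D F R k e p"]) (auto simp: fun_eq_iff split: nat.split)

lemma gs_mF: "gs D F R k e (mF p i j l b) \<longleftrightarrow> gs D F R k (e i ## e j ## e l ## (\<lambda>n. e (n + b))) p"
  unfolding mF_def gs_ren
  by (rule arg_cong[where f = "\<lambda>e. gs D F R k e p"]) (auto simp: fun_eq_iff split: nat.split)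

lemma gs_connectives:
  "gs D F R k e (p \<^bold>\<and> q) \<longleftrightarrow> gs D F R k e p \<and> gs D F R k e q"
  "gs D F R k e (p \<^bold>\<leftrightarrow> q) \<longleftrightarrow> (gs D F R k e p \<longleftrightarrow> gs D F R k e q)"
  by auto

definition atf :: "'a fm" where
  "atf = (Var 5 \<doteq> \<zero> \<^bold>\<leftrightarrow> Var 4 \<doteq> \<zero>) \<^bold>\<and> (Var 5 \<doteq> \<one> \<^bold>\<leftrightarrow> Var 4 \<doteq> \<one>) \<^bold>\<and> (Var 5 \<doteq> Var 3 \<^bold>\<leftrightarrow> Var 4 \<doteq> Var 2) \<^bold>\<and>
       (Var 5 \<prec> Var 3 \<^bold>\<leftrightarrow> Var 4 \<prec> Var 2) \<^bold>\<and> (Var 5 \<oplus> Var 3 \<doteq> Var 1 \<^bold>\<leftrightarrow> Var 4 \<oplus> Var 2 \<doteq> Var 0) \<^bold>\<and>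
       (Var 5 \<otimes> Var 3 \<doteq> Var 1 \<^bold>\<leftrightarrow> Var 4 \<otimes> Var 2 \<doteq> Var 0)"

definition AT :: "(fsym \<Rightarrow> 'u list \<Rightarrow> 'u) \<Rightarrow> (rsym \<Rightarrow> 'u list \<Rightarrow> bool) \<Rightarrow> 'u \<Rightarrow> 'u \<Rightarrow> 'u \<Rightarrow> 'u \<Rightarrow> 'u \<Rightarrow> 'u \<Rightarrow> bool" where
  "AT F R x x' y y' z z' \<longleftrightarrow> (x = F Zero [] \<longleftrightarrow> x' = F Zero []) \<and> (x = F One [] \<longleftrightarrow> x' = F One []) \<and> (x = y \<longleftrightarrow> x' = y') \<and>
      (R Less [x, y] \<longleftrightarrow> R Less [x', y']) \<and> (F Plus [x, y] = z \<longleftrightarrow> F Plus [x', y'] = z') \<and>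
      (F Times [x, y] = z \<longleftrightarrow> F Times [x', y'] = z')"

lemma gs_atf: "gs D F R k e atf \<longleftrightarrow> AT F R (e 5) (e 4) (e 3) (e 2) (e 1) (e 0)"
  unfolding atf_def gs_connectives(2) gs_connectives(1) AT_def by simp argo

text \<open>Variable \<open>0\<close> is the level; the parameters of \<open>g\<close> and \<open>m\<close> follow from variable \<open>1\<close> on.\<close>

definition psi :: "'a fm \<Rightarrow> 'a fm \<Rightarrow> 'a fm" where
  "psi g m =
    (All (All (All (All (Var 2 \<doteq> Var 3 \<oplus> \<one> \<^bold>\<rightarrow> gF g 2 1 5 \<^bold>\<rightarrow>
       Ex (Ex (gF g 5 0 7 \<^bold>\<and> mF m 2 1 0 7 \<^bold>\<and> All (All (mF m 1 0 5 9 \<^bold>\<rightarrow> mF m 1 0 2 9))))))))) \<^bold>\<and>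
    (All (All (All (All (Var 2 \<doteq> Var 3 \<oplus> \<one> \<^bold>\<rightarrow> gF g 2 1 5 \<^bold>\<rightarrow>
       Ex (Ex (gF g 5 0 7 \<^bold>\<and> mF m 1 2 0 7 \<^bold>\<and> All (All (mF m 1 0 5 9 \<^bold>\<rightarrow> mF m 1 0 2 9))))))))) \<^bold>\<and>
    (All (All (All (All (All (All (All (All (gF g 7 6 9 \<^bold>\<rightarrow> mF m 5 4 6 9 \<^bold>\<rightarrow> mF m 3 2 6 9 \<^bold>\<rightarrow> mF m 1 0 6 9 \<^bold>\<rightarrow> atf))))))))) \<^bold>\<and>
    (All (Ex (Ex (Ex (\<^bold>\<not> (Var 2 \<doteq> Var 1) \<^bold>\<and> gF g 4 0 5 \<^bold>\<and> mF m 3 3 0 5 \<^bold>\<and> mF m 2 1 0 5)))))"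

lemma gs_psi:
  fixes F R k E g m
  defines "G \<equiv> \<lambda>c q. gs UNIV F R k (c ## q ## E) g" and "M \<equiv> \<lambda>x x' q. gs UNIV F R k (x ## x' ## q ## E) m"
  shows "gs UNIV F R k (\<gamma> ## E) (psi g m) \<longleftrightarrow>
    (\<forall>c q y. G (F Plus [c, F One []]) q \<longrightarrow>
      (\<exists>y' q'. G c q' \<and> M y y' q' \<and> (\<forall>x x'. M x x' q \<longrightarrow> M x x' q'))) \<and>
    (\<forall>c q y. G (F Plus [c, F One []]) q \<longrightarrow>
      (\<exists>y' q'. G c q' \<and> M y' y q' \<and> (\<forall>x x'. M x x' q \<longrightarrow> M x x' q'))) \<and>
    (\<forall>c q x x' y y' z z'. G c q \<longrightarrow> M x x' q \<longrightarrow> M y y' q \<longrightarrow> M z z' q \<longrightarrow>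
      AT F R x x' y y' z z') \<and>
    (\<forall>a. \<exists>x x' q. x \<noteq> x' \<and> G \<gamma> q \<and> M a a q \<and> M x x' q)"
  (is "?l \<longleftrightarrow> ?r1 \<and> ?r2 \<and> ?r3 \<and> ?r4")
proof -
  let ?e = "\<gamma> ## E"
  have 1: "gs UNIV F R k ?e (All (All (All (All (Var 2 \<doteq> Var 3 \<oplus> \<one> \<^bold>\<rightarrow> gF g 2 1 5 \<^bold>\<rightarrow>
       Ex (Ex (gF g 5 0 7 \<^bold>\<and> mF m 2 1 0 7 \<^bold>\<and> All (All (mF m 1 0 5 9 \<^bold>\<rightarrow> mF m 1 0 2 9))))))))) \<longleftrightarrow> ?r1"
    unfolding G_def M_def by (simp add: gs_gF gs_mF eval_nat_numeral)
  have 2: "gs UNIV F R k ?e (All (All (All (All (Var 2 \<doteq> Var 3 \<oplus> \<one> \<^bold>\<rightarrow> gF g 2 1 5 \<^bold>\<rightarrow>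
       Ex (Ex (gF g 5 0 7 \<^bold>\<and> mF m 1 2 0 7 \<^bold>\<and> All (All (mF m 1 0 5 9 \<^bold>\<rightarrow> mF m 1 0 2 9))))))))) \<longleftrightarrow> ?r2"
    unfolding G_def M_def by (simp add: gs_gF gs_mF eval_nat_numeral)
  have 3: "gs UNIV F R k ?e (All (All (All (All (All (All (All (All (gF g 7 6 9 \<^bold>\<rightarrow> mF m 5 4 6 9 \<^bold>\<rightarrow> mF m 3 2 6 9 \<^bold>\<rightarrow> mF m 1 0 6 9 \<^bold>\<rightarrow> atf))))))))) \<longleftrightarrow> ?r3"
    unfolding G_def M_def by (simp add: gs_gF gs_mF gs_atf eval_nat_numeral)
  have 4: "gs UNIV F R k ?e (All (Ex (Ex (Ex (\<^bold>\<not> (Var 2 \<doteq> Var 1) \<^bold>\<and> gF g 4 0 5 \<^bold>\<and> mF m 3 3 0 5 \<^bold>\<and> mF m 2 1 0 5))))) \<longleftrightarrow> ?r4"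
    unfolding G_def M_def by (simp add: gs_gF gs_mF eval_nat_numeral) blast
  show ?thesis unfolding psi_def using 1 2 3 4 by (simp only: gs_connectives)
qed

lemma fm_in_gF: "fm_in L p \<Longrightarrow> fm_in L (gF p i j b)" and fm_in_mF: "fm_in L p \<Longrightarrow> fm_in L (mF p i j l b)"
  by (simp_all add: gF_def mF_def)

lemma fm_in_psi: "fm_in L_PA g \<Longrightarrow> fm_in L_PA m \<Longrightarrow> fm_in L_PA (psi g m)"
  by (simp add: psi_def fm_in_gF fm_in_mF atf_def)

theorem game_model:
  fixes F :: "fsym \<Rightarrow> 'u list \<Rightarrow> 'u" and \<kappa> :: "'a \<Rightarrow> 'u" and \<phi> :: "'a fm"
  assumes B: "\<And>p e. p \<in> B_Sigma n \<Longrightarrow> gs UNIV F R \<kappa> e (p :: 'a fm)"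
    and ex: "\<And>e. gs UNIV F R \<kappa> e exp_axiom"
    and \<phi>: "Sigma_fm n \<phi>" "\<not> (\<forall>e. gs UNIV F R \<kappa> e (induction_axiom \<phi>))"
  shows "\<exists>(g::'a fm) m E0. fm_in L_PA g \<and> fm_in L_PA m \<and> (\<forall>k. gs UNIV F R \<kappa> (stdv F k ## E0) (psi g m))"
proof -
  let ?s = "gs UNIV F R \<kappa>"
  have PA: "?s e p" if "p \<in> PA_base" for p e
  proof -
    have "univ_closure p \<in> B_Sigma n" using PA_minus_of_base[OF that] by (simp add: B_Sigma_def I_Sigma_def)
    then show ?thesis using B gs_univ_closure by blast
  qed
  define pl ml lt zr un where ops: "pl = (\<lambda>x y. F Plus [x, y])" "ml = (\<lambda>x y. F Times [x, y])"
    "lt = (\<lambda>x y. R Less [x, y])" "zr = F Zero []" "un = F One []"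
  interpret ds: dosr pl ml lt zr un
    unfolding ops by (rule dosr_of_PA[OF PA])
  define bad where "bad j \<longleftrightarrow> (\<exists>\<phi>::'a fm. Sigma_fm j \<phi> \<and> \<not> (\<forall>e. ?s e (induction_axiom \<phi>)))" for j
  have "bad n" using \<phi> by (auto simp: bad_def)
  \<comment> \<open>Level 0 is never bad, because \<open>B_Sigma n\<close> contains
    \<open>I_Sigma 0\<close>; below the least bad level all instances of induction hold.\<close>
  define j where "j = (LEAST j. bad j)"
  have j: "bad j" "j \<le> n" "\<And>i. i < j \<Longrightarrow> \<not> bad i"
    unfolding j_def by (rule LeastI[of bad, OF \<open>bad n\<close>], rule Least_le[of bad, OF \<open>bad n\<close>], rule not_less_Least)
  have "\<not> bad 0" using B by (auto simp: bad_def B_Sigma_def I_Sigma_def)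
  then obtain m where m: "j = Suc m" using j(1) by (cases j) auto
  interpret ar: arith pl ml lt zr un F R \<kappa> m
  proof
    fix p :: "'a fm" and e assume p: "Sigma_fm m p"
    then have "\<forall>e. ?s e (induction_axiom p)" using j(3)[of m] m by (auto simp: bad_def)
    then show "?s e (inst \<zero> p \<^bold>\<and> All (p \<^bold>\<rightarrow> repl (Var 0 \<oplus> \<one>) p) \<^bold>\<rightarrow> All p)"
      unfolding induction_axiom_def gs_univ_closure by (rule spec)
  next
    fix i and p :: "'a fm" and e assume i: "i \<le> Suc m" "Sigma_fm i p"
    then have "Sigma_fm n p" using Sigma_mono j(2) m by (metis le_trans)
    then have "\<forall>e. ?s e (collection_axiom p)" using B by (auto simp: B_Sigma_def)
    then show "?s e (All (All (Var 0 \<prec> Var 1 \<^bold>\<rightarrow> Ex (ren (\<lambda>n. if n < 2 then n else n + 1) p)) \<^bold>\<rightarrow>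
      Ex (All (Var 0 \<prec> Var 2 \<^bold>\<rightarrow> Ex (Var 0 \<prec> Var 2 \<^bold>\<and> ren (\<lambda>n. if n < 2 then n else n + 2) p)))))"
      unfolding collection_axiom_def gs_univ_closure by (rule spec)
  qed (simp_all add: ops)
  interpret ax: arith_exp pl ml lt zr un F R \<kappa> m
  proof
    fix y
    have "\<forall>x y. \<exists>z u v. ds.bt u v zr un \<and> ds.bt u v y z \<and>
      (\<forall>i. lt i y \<longrightarrow> (\<exists>w. ds.bt u v i w \<and> ds.bt u v (pl i un) (ml w x)))"
      using ex[of "\<lambda>_. y"] unfolding exp_axiom_def beta_fm_def Let_def ds.bt_def
      by (simp add: eval_nat_numeral) (elim all_forward ex_forward, blast)
    from spec[OF spec[OF this, of "pl un un"], of y] show "\<exists>z. ds.ET y z" unfolding ds.ET_def .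
  qed
  obtain \<phi>' :: "'a fm" where \<phi>': "Sigma_fm (Suc m) \<phi>'" "\<not> (\<forall>e. ?s e (induction_axiom \<phi>'))"
    using j(1) unfolding bad_def m by blast
  obtain e where "\<not> ?s e (inst \<zero> \<phi>' \<^bold>\<and> All (\<phi>' \<^bold>\<rightarrow> repl (Var 0 \<oplus> \<one>) \<phi>') \<^bold>\<rightarrow> All \<phi>')"
    using \<phi>'(2) unfolding induction_axiom_def gs_univ_closure by blast
  then obtain d0 where f: "?s (zr ## e) \<phi>'" "\<And>x. ?s (x ## e) \<phi>' \<Longrightarrow> ?s (pl x un ## e) \<phi>'" "\<not> ?s (d0 ## e) \<phi>'"
    by (auto simp: gs_inst gs_repl)
  have RS: "ar.RS (Suc m) (\<lambda>e. ?s e \<phi>')" unfolding ar.RS_def using \<phi>'(1) by blast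
  \<comment> \<open>In normal form the failing formula is an existential quantifier over a
    \<open>\<Pi>\<^sub>m\<close> matrix, and such a matrix is \<Delta> at level
    \<open>m + 1\<close>.\<close>
  obtain Q where Q: "ar.RS m (\<lambda>e. \<not> Q e)" "(\<lambda>e. ?s e \<phi>') = (\<lambda>e. \<exists>u. Q (u ## e))"
    using ar.RS_nf[OF ar.CL RS] by auto
  have Q2: "?s (x ## e) \<phi>' \<longleftrightarrow> (\<exists>u. Q (u ## x ## e))" for x using fun_cong[OF Q(2)] by simp
  let ?\<rho> = "\<lambda>n. if n = 0 then 0 else if n = 1 then 2 else 2 * (n - 2) + 1"
  have mx: "E 0 ## E 1 ## e = (\<lambda>n. mix E e (?\<rho> n))" for E
  proof
    fix n
    consider "n = 0" | "n = 1" | i where "n = Suc (Suc i)" by (metis One_nat_def not0_implies_Suc)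
    then show "(E 0 ## E 1 ## e) n = mix E e (?\<rho> n)" by cases (simp_all add: mix_def)
  qed
  have "ar.RS (Suc m) Q" "ar.RS (Suc m) (\<lambda>E. \<not> Q E)" by (rule ar.RS_co_Suc[OF Q(1)], rule ar.RS_Suc[OF Q(1)])
  from this[THEN ar.RS_ren[where \<rho> = ?\<rho>]] have DQ: "ar.Dl (\<lambda>E. Q (E 0 ## E 1 ## e))"
    unfolding ar.Dl_def ar.Sg_def mx by blast
  interpret fl: failing pl ml lt zr un F R \<kappa> m
    "\<lambda>u x. Q (u ## x ## e)" d0
    by unfold_locales (use DQ f Q2 in blast)+
  obtain G M where GM: "fl.Fo (\<lambda>e. G (e 0) (e 1))" "fl.Fo (\<lambda>e. M (e 0) (e 1) (e 2))"
    "\<forall>c q y. G (pl c un) q \<longrightarrow>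
      (\<exists>y' q'. G c q' \<and> M y y' q' \<and> (\<forall>x x'. M x x' q \<longrightarrow> M x x' q')) \<and>
      (\<exists>y' q'. G c q' \<and> M y' y q' \<and> (\<forall>x x'. M x x' q \<longrightarrow> M x x' q'))"
    "\<forall>c q x x' y y' z z'. G c q \<longrightarrow> M x x' q \<longrightarrow> M y y' q \<longrightarrow> M z z' q \<longrightarrow> ax.at x x' y y' z z'"
    "\<forall>k a. \<exists>x x' q. x \<noteq> x' \<and> G (ar.std k) q \<and> M a a q \<and> M x x' q"
    using fl.game by (elim exE conjE)
  obtain g :: "'a fm" and eg where g: "fm_in L_PA g" "(\<lambda>e. G (e 0) (e 1)) = (\<lambda>e. ?s (mix e eg) g)"
    using GM(1) unfolding fl.Fo_def by blast
  obtain p :: "'a fm" and ep where p: "fm_in L_PA p" "(\<lambda>e. M (e 0) (e 1) (e 2)) = (\<lambda>e. ?s (mix e ep) p)"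
    using GM(2) unfolding fl.Fo_def by blast
  \<comment> \<open>One parameter sequence for both formulae, with \<open>eg\<close> at the even and
    \<open>ep\<close> at the odd positions; the renamings below also put the arguments in
    front.\<close>
  define E0 where "E0 = mix eg ep"
  define g' where "g' = ren (\<lambda>n. if odd n then n + 1 else if n = 2 then 1 else 0) g"
  define p' where "p' = ren (\<lambda>n. if odd n then n + 3 else if n = 4 then 2 else if n = 2 then 1 else 0) p"
  have g': "?s (c ## q ## E0) g' \<longleftrightarrow> G c q" for c q
  proof -
    have "(\<lambda>n. (c ## q ## E0) (if odd n then n + 1 else if n = 2 then 1 else 0)) = mix (c ## q ## (\<lambda>_. c)) eg"
    proof (rule even_odd_ext)
      fix n
      show "(c ## q ## E0) (if odd (2 * n) then 2 * n + 1 else if 2 * n = 2 then 1 else 0) = mix (c ## q ## (\<lambda>_. c)) eg (2 * n)"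
        by (cases n; cases "n - 1") (simp_all add: mix_def)
    qed (simp add: E0_def)
    then show ?thesis using fun_cong[OF g(2), of "c ## q ## (\<lambda>_. c)"] by (simp add: g'_def gs_ren)
  qed
  have p': "?s (x ## x' ## q ## E0) p' \<longleftrightarrow> M x x' q" for x x' q
  proof -
    have "(\<lambda>n. (x ## x' ## q ## E0) (if odd n then n + 3 else if n = 4 then 2 else if n = 2 then 1 else 0)) = mix (x ## x' ## q ## (\<lambda>_. x)) ep"
    proof (rule even_odd_ext)
      fix n
      consider "n = 0" | "n = 1" | "n = 2" | i where "n = Suc (Suc (Suc i))" by (metis One_nat_def numeral_2_eq_2 not0_implies_Suc)
      then show "(x ## x' ## q ## E0) (if odd (2 * n) then 2 * n + 3 else if 2 * n = 4 then 2 else if 2 * n = 2 then 1 else 0) = mix (x ## x' ## q ## (\<lambda>_. x)) ep (2 * n)"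
        by cases (simp_all add: mix_def)
    next
      fix n
      have "(x ## x' ## q ## E0) (Suc (2 * n) + 3) = E0 (Suc (2 * n))" by (simp add: eval_nat_numeral)
      then show "(x ## x' ## q ## E0) (if odd (Suc (2 * n)) then Suc (2 * n) + 3 else if Suc (2 * n) = 4 then 2 else if Suc (2 * n) = 2 then 1 else 0) =
        mix (x ## x' ## q ## (\<lambda>_. x)) ep (Suc (2 * n))" by (simp add: E0_def)
    qed
    then show ?thesis using fun_cong[OF p(2), of "x ## x' ## q ## (\<lambda>_. x)"] by (simp add: p'_def gs_ren numeral_2_eq_2)
  qed
  have st: "ar.std k = stdv F k" for k by (induction k) simp_all
  have "?s (stdv F k ## E0) (psi g' p')" for k
    unfolding gs_psi g' p' AT_def ar.F_simps ar.R_simps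
  proof (intro conjI)
    show "\<forall>c q y. G (pl c un) q \<longrightarrow> (\<exists>y' q'. G c q' \<and> M y y' q' \<and> (\<forall>x x'. M x x' q \<longrightarrow> M x x' q'))"
      by (intro allI impI) (rule conjunct1[OF mp[OF spec[OF spec[OF spec[OF GM(3)]]]]])
    show "\<forall>c q y. G (pl c un) q \<longrightarrow> (\<exists>y' q'. G c q' \<and> M y' y q' \<and> (\<forall>x x'. M x x' q \<longrightarrow> M x x' q'))"
      by (intro allI impI) (rule conjunct2[OF mp[OF spec[OF spec[OF spec[OF GM(3)]]]]])
  qed (rule GM(4)[unfolded ax.at_def], rule spec[OF GM(5)[unfolded st]])
  moreover have "fm_in L_PA g'" "fm_in L_PA p'" using g(1) p(1) by (simp_all add: g'_def p'_def)
  ultimately show ?thesis by blast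
qed

section \<open>A game of nonstandard length\<close>

lemma tm_in_bin_numeral: "tm_in L_PA (bin_numeral k)"
  by (induction k rule: less_induct) (subst bin_numeral.simps, simp)

lemma fvb_bin_numeral: "fvb_tm (bin_numeral k) = 0"
  by (induction k rule: less_induct) (subst bin_numeral.simps, simp)

lemma set_tm_pars: "tm_in L t \<Longrightarrow> set_tm t \<subseteq> pars L"
  by (induction t) (auto simp: list_all_iff)

lemma set_fm_pars: "fm_in L p \<Longrightarrow> set_fm p \<subseteq> pars L"
  by (induction p) (use set_tm_pars in \<open>fastforce simp: list_all_iff\<close>)+

lemma gs_foldr_Imp: "gs D F R k e (foldr Imp qs p) \<longleftrightarrow> ((\<forall>q\<in>set qs. gs D F R k e q) \<longrightarrow> gs D F R k e p)"
  by (induction qs) auto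

primrec cdt :: "nat \<Rightarrow> 'a tm" where
  "cdt 0 = \<zero>" | "cdt (Suc i) = (cdt i \<oplus> Var i) \<otimes> (cdt i \<oplus> Var i) \<oplus> cdt i"

lemma tm_in_cdt: "tm_in L_PA (cdt K)"
  by (induction K) auto

lemma fvb_cdt: "fvb_tm (cdt K :: 'a tm) \<le> K"
  by (induction K) auto

text \<open>\<open>\<chi>(x, y)\<close>: \<open>y\<close> codes a \<open>K\<close>-tuple that starts with the level and the parameters of the game, and a position of
  this level fixes \<open>y\<close> and moves \<open>x\<close>.  The code \<open>y\<close> supplies the parameters, so \<open>\<chi>\<close> itself has none.\<close>

definition chi :: "'a fm \<Rightarrow> 'a fm \<Rightarrow> nat \<Rightarrow> 'a fm" where
  "chi g m K = (Ex ^^ K) (Var (Suc K) \<doteq> cdt K \<^bold>\<and> Ex (Ex (\<^bold>\<not> (Var (Suc (Suc K)) \<doteq> Var 1) \<^bold>\<and> gF g 2 0 3 \<^bold>\<and>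
     mF m (Suc (Suc (Suc K))) (Suc (Suc (Suc K))) 0 3 \<^bold>\<and> mF m (Suc (Suc K)) 1 0 3)))"

lemma fm_in_chi: "fm_in L_PA g \<Longrightarrow> fm_in L_PA m \<Longrightarrow> fm_in L_PA (chi g m K)"
  by (simp add: chi_def fm_in_gF fm_in_mF tm_in_cdt)

lemma fvb_chi:
  fixes g m :: "'a fm"
  assumes "fvb g \<le> K" "fvb m \<le> K"
  shows "fvb (chi g m K) \<le> 2"
proof -
  have "fvb (gF g 2 0 3) \<le> Suc (Suc (Suc (Suc K)))"
    unfolding gF_def by (rule fvb_ren[OF assms(1)]) (auto split: nat.split)
  moreover have "fvb (mF m i j 0 3) \<le> Suc (Suc (Suc (Suc K)))" if "i \<le> K + 3" "j \<le> K + 3" for i j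
    unfolding mF_def by (rule fvb_ren[OF assms(2)]) (use that in \<open>auto split: nat.split\<close>)
  from this[of "Suc (Suc (Suc K))" "Suc (Suc (Suc K))"] this[of "Suc (Suc K)" 1]
  have "fvb (mF m (Suc (Suc (Suc K))) (Suc (Suc (Suc K))) 0 3) \<le> Suc (Suc (Suc (Suc K)))"
    "fvb (mF m (Suc (Suc K)) 1 0 3) \<le> Suc (Suc (Suc (Suc K)))" by simp_all
  ultimately show ?thesis unfolding chi_def fvb_Ex_pow using fvb_cdt[where ?'a = 'a, of K] by (simp add: le_diff_conv)
qed

lemma gs_chi: "gs UNIV F R k e (chi g m K) \<longleftrightarrow> (\<exists>d. (\<forall>n. d (n + K) = e n) \<and> e 1 = ev F k d (cdt K) \<and>
    (\<exists>x' q. e 0 \<noteq> x' \<and> gs UNIV F R k (d 0 ## q ## (\<lambda>n. d (Suc n))) g \<and>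
      gs UNIV F R k (e 1 ## e 1 ## q ## (\<lambda>n. d (Suc n))) m \<and> gs UNIV F R k (e 0 ## x' ## q ## (\<lambda>n. d (Suc n))) m))"
proof -
  let ?p = "Var (Suc K) \<doteq> cdt K \<^bold>\<and> Ex (Ex (\<^bold>\<not> (Var (Suc (Suc K)) \<doteq> Var 1) \<^bold>\<and> gF g 2 0 3 \<^bold>\<and>
     mF m (Suc (Suc (Suc K))) (Suc (Suc (Suc K))) 0 3 \<^bold>\<and> mF m (Suc (Suc K)) 1 0 3))"
  have "gs UNIV F R k d ?p \<longleftrightarrow> e 1 = ev F k d (cdt K) \<and>
    (\<exists>x' q. e 0 \<noteq> x' \<and> gs UNIV F R k (d 0 ## q ## (\<lambda>n. d (Suc n))) g \<and>
      gs UNIV F R k (e 1 ## e 1 ## q ## (\<lambda>n. d (Suc n))) m \<and> gs UNIV F R k (e 0 ## x' ## q ## (\<lambda>n. d (Suc n))) m)"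
    if d: "\<forall>n. d (n + K) = e n" for d
  proof -
    have "d K = e 0" "d (Suc K) = e 1" using d[rule_format, of 0] d[rule_format, of 1] by simp_all
    then show ?thesis by (simp add: gs_gF gs_mF eval_nat_numeral) (rule conj_cong[OF refl], simp, blast)
  qed
  then show ?thesis unfolding chi_def gs_Ex_pow by (simp cong: conj_cong)
qed

section \<open>Tuple codes and standard numerals\<close>

context dosr
begin

primrec cd :: "nat \<Rightarrow> (nat \<Rightarrow> 'u) \<Rightarrow> 'u" where
  "cd 0 d = zr" | "cd (Suc i) d = pr (cd i d) (d i)"

lemma cd_inj: "cd K d = cd K d' \<Longrightarrow> i < K \<Longrightarrow> d i = d' i"
  by (induction K) (auto simp: less_Suc_eq)

lemma cd_cong: "(\<And>i. i < K \<Longrightarrow> d i = d' i) \<Longrightarrow> cd K d = cd K d'"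
  by (induction K) auto

end

locale dosr_structure = dosr pl ml lt zr un
  for pl :: "'u \<Rightarrow> 'u \<Rightarrow> 'u" (infixl "+." 65) and ml :: "'u \<Rightarrow> 'u \<Rightarrow> 'u" (infixl "*." 70)
    and lt :: "'u \<Rightarrow> 'u \<Rightarrow> bool" (infix "<." 50) and zr :: 'u and un :: 'u +
  fixes F :: "fsym \<Rightarrow> 'u list \<Rightarrow> 'u" and R :: "rsym \<Rightarrow> 'u list \<Rightarrow> bool"
  assumes F_simps [simp]: "F Zero [] = zr" "F One [] = un" "F Plus [x, y] = x +. y" "F Times [x, y] = x *. y"
    and R_simps [simp]: "R Less [x, y] \<longleftrightarrow> x <. y"
begin

lemma stdv_add: "stdv F a +. stdv F b = stdv F (a + b)"
  by (induction b) (simp_all add: pl_zr flip: pl_assoc)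

lemma ev_bin_numeral: "ev F k e (bin_numeral n) = stdv F n"
proof (induction n rule: less_induct)
  case (less n)
  have d: "(un +. un) *. s = s +. s" for s by (metis ml_comm distr ml_un)
  consider "n = 0" | "n = 1" | "n > 1" "even n" | "n > 1" "odd n" by (metis One_nat_def less_one nat_neq_iff)
  then show ?case
  proof cases
    case 1 then show ?thesis by (subst bin_numeral.simps) simp
  next
    case 2 then show ?thesis by (subst bin_numeral.simps) simp
  next
    case 3
    then have "ev F k e (bin_numeral n) = stdv F (n div 2 + n div 2)"
      using less[of "n div 2"] by (subst bin_numeral.simps) (simp add: d stdv_add)
    also have "n div 2 + n div 2 = n" using 3 by auto
    finally show ?thesis .
  next
    case 4
    then have "ev F k e (bin_numeral n) = stdv F (Suc (n div 2 + n div 2))"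
      using less[of "n div 2"] by (subst bin_numeral.simps) (simp add: d stdv_add)
    also have "Suc (n div 2 + n div 2) = n" using 4 by (auto elim!: oddE)
    finally show ?thesis .
  qed
qed

lemma stdv_less: "i < j \<Longrightarrow> stdv F i <. stdv F j"
proof (induction j)
  case (Suc j)
  then show ?case by (cases "i = j") (auto intro: lt_trans)
qed simp

lemma stdv_inj: "stdv F i = stdv F j \<longleftrightarrow> i = j"
  using stdv_less[of i j] stdv_less[of j i] lt_irr by (metis nat_neq_iff)

end

locale nonstd_game = dosr_structure pl ml lt zr un F R
  for pl :: "'u \<Rightarrow> 'u \<Rightarrow> 'u" (infixl "+." 65) and ml :: "'u \<Rightarrow> 'u \<Rightarrow> 'u" (infixl "*." 70)
    and lt :: "'u \<Rightarrow> 'u \<Rightarrow> bool" (infix "<." 50) and zr :: 'u and un :: 'u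
    and F :: "fsym \<Rightarrow> 'u list \<Rightarrow> 'u" and R :: "rsym \<Rightarrow> 'u list \<Rightarrow> bool" +
  fixes \<kappa> :: "'a \<Rightarrow> 'u" and \<gamma> :: 'u and E :: "nat \<Rightarrow> 'u" and g m :: "'a fm"
  assumes g_in: "fm_in L_PA g" and m_in: "fm_in L_PA m"
    and nonstd: "stdv F k <. \<gamma>"
    and psi: "gs UNIV F R \<kappa> (\<gamma> ## E) (psi g m)"
begin

text \<open>A nonstandard level has a nonstandard predecessor, so positions with a nonstandard number of moves left form a
  back-and-forth system.  \<open>R2\<close> interprets \<open>S\<close> as satisfaction of standard formulae.\<close>

definition lv :: "'u \<Rightarrow> 'u \<Rightarrow> bool" where "lv c q \<longleftrightarrow> gs UNIV F R \<kappa> (c ## q ## E) g"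
definition mt :: "'u \<Rightarrow> 'u \<Rightarrow> 'u \<Rightarrow> bool" where "mt x x' q \<longleftrightarrow> gs UNIV F R \<kappa> (x ## x' ## q ## E) m"
definition BB :: "('u \<times> 'u) set set" where
  "BB = {{(x, x'). mt x x' q} | q. \<exists>c. (\<forall>k. stdv F k <. c) \<and> lv c q}"
definition R2 :: "rsym \<Rightarrow> 'u list \<Rightarrow> bool" where
  "R2 r xs \<longleftrightarrow> (if r = SSym then \<exists>p :: 'a fm. fm_in L_PA p \<and> fvb p \<le> 1 \<and> xs ! 0 = stdv F (goedel p) \<and>
     gs UNIV F R \<kappa> (\<lambda>_. xs ! 1) p else R r xs)"

lemma R2_Less [simp]: "R2 Less xs = R Less xs" by (simp add: R2_def)

lemma game:
  "\<And>c q y. lv (c +. un) q \<Longrightarrow> \<exists>y' q'. lv c q' \<and> mt y y' q' \<and> (\<forall>x x'. mt x x' q \<longrightarrow> mt x x' q')"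
  "\<And>c q y. lv (c +. un) q \<Longrightarrow> \<exists>y' q'. lv c q' \<and> mt y' y q' \<and> (\<forall>x x'. mt x x' q \<longrightarrow> mt x x' q')"
  "\<And>c q x x' y y' z z'. lv c q \<Longrightarrow> mt x x' q \<Longrightarrow> mt y y' q \<Longrightarrow> mt z z' q \<Longrightarrow> AT F R x x' y y' z z'"
  "\<And>a. \<exists>x x' q. x \<noteq> x' \<and> lv \<gamma> q \<and> mt a a q \<and> mt x x' q"
proof -
  note p = psi[unfolded gs_psi F_simps lv_def[symmetric] mt_def[symmetric]]
  note p1 = conjunct1[OF p] and p2 = conjunct1[OF conjunct2[OF p]]
    and p3 = conjunct1[OF conjunct2[OF conjunct2[OF p]]] and p4 = conjunct2[OF conjunct2[OF conjunct2[OF p]]]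
  show "lv (c +. un) q \<Longrightarrow> \<exists>y' q'. lv c q' \<and> mt y y' q' \<and> (\<forall>x x'. mt x x' q \<longrightarrow> mt x x' q')" for c q y
    by (rule p1[rule_format])
  show "lv (c +. un) q \<Longrightarrow> \<exists>y' q'. lv c q' \<and> mt y' y q' \<and> (\<forall>x x'. mt x x' q \<longrightarrow> mt x x' q')" for c q y
    by (rule p2[rule_format])
  show "lv c q \<Longrightarrow> mt x x' q \<Longrightarrow> mt y y' q \<Longrightarrow> mt z z' q \<Longrightarrow> AT F R x x' y y' z z'" for c q x x' y y' z z'
    by (rule p3[rule_format])
  show "\<exists>x x' q. x \<noteq> x' \<and> lv \<gamma> q \<and> mt a a q \<and> mt x x' q" for a by (rule p4[rule_format])
qed

lemma pred_level:
  assumes "\<forall>k. stdv F k <. c"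
  shows "\<exists>c'. c = c' +. un \<and> (\<forall>k. stdv F k <. c')"
proof -
  have "c \<noteq> zr" using assms[rule_format, of 0] lt_irr by auto
  then obtain c' where c': "c = c' +. un" using zr_or_succ by blast
  have "stdv F k <. c'" for k using assms[rule_format, of "Suc k"] unfolding c' by simp
  then show ?thesis using c' by blast
qed

lemma BB_AT:
  assumes "Q \<in> BB" "(x, x') \<in> Q" "(y, y') \<in> Q" "(z, z') \<in> Q"
  shows "AT F R x x' y y' z z'"
  using assms unfolding BB_def by (auto intro: game(3))

sublocale bf: bf_system F R2 BB
proof
  fix Q y assume "Q \<in> BB"
  then obtain q c where q: "Q = {(x, x'). mt x x' q}" "\<forall>k. stdv F k <. c" "lv c q" unfolding BB_def by blast
  obtain c' where c': "c = c' +. un" "\<forall>k. stdv F k <. c'" using pred_level[OF q(2)] by blast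
  have ext: "\<exists>Q'\<in>BB. Q \<subseteq> Q' \<and> (u, v) \<in> Q'" if "lv c' q'" "mt u v q'" "\<forall>x x'. mt x x' q \<longrightarrow> mt x x' q'" for u v q'
    by (rule bexI[of _ "{(x, x'). mt x x' q'}"]) (use that c'(2) in \<open>auto simp: BB_def q(1)\<close>)
  show "\<exists>Q'\<in>BB. Q \<subseteq> Q' \<and> (\<exists>y'. (y, y') \<in> Q')"
  proof -
    obtain y' q' where y': "lv c' q'" "mt y y' q'" "\<forall>x x'. mt x x' q \<longrightarrow> mt x x' q'"
      using game(1)[OF q(3)[unfolded c'(1)], of y] by (elim exE conjE)
    from ext[OF this] show ?thesis by blast
  qed
  show "\<exists>Q'\<in>BB. Q \<subseteq> Q' \<and> (\<exists>y'. (y', y) \<in> Q')"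
  proof -
    obtain y' q' where y': "lv c' q'" "mt y' y q'" "\<forall>x x'. mt x x' q \<longrightarrow> mt x x' q'"
      using game(2)[OF q(3)[unfolded c'(1)], of y] by (elim exE conjE)
    from ext[OF this] show ?thesis by blast
  qed
next
  fix Q x x' y y' assume Q: "Q \<in> BB" "(x, x') \<in> Q" "(y, y') \<in> Q"
  note a = BB_AT[OF Q Q(3), unfolded AT_def]
  show "x = y \<longleftrightarrow> x' = y'" using a by blast
  show "R2 Less [x, y] \<longleftrightarrow> R2 Less [x', y']" using a by simp
next
  fix Q x x' f assume Q: "Q \<in> BB" "(x, x') \<in> Q" "f \<in> {Zero, One}"
  show "x = F f [] \<longleftrightarrow> x' = F f []" using BB_AT[OF Q(1,2,2,2), unfolded AT_def] Q(3) by auto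
next
  fix Q x x' y y' z z' f assume Q: "Q \<in> BB" "(x, x') \<in> Q" "(y, y') \<in> Q" "(z, z') \<in> Q" "f \<in> {Plus, Times}"
  show "F f [x, y] = z \<longleftrightarrow> F f [x', y'] = z'" using BB_AT[OF Q(1-4), unfolded AT_def] Q(5) by auto
qed

lemma gs_R2: "fm_in L_PA p \<Longrightarrow> gs UNIV F R2 k e p \<longleftrightarrow> gs UNIV F R k e p"
  by (rule gs_cong_struct) auto

lemma preserve_L_PA:
  assumes "fm_in L_PA p" "Q \<in> BB" "\<And>n. (e n, e' n) \<in> Q"
  shows "gs UNIV F R \<kappa> e p \<longleftrightarrow> gs UNIV F R \<kappa> e' p"
proof -
  have "gs UNIV F R2 \<kappa> e p \<longleftrightarrow> gs UNIV F R2 \<kappa> e' p"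
    by (rule bf.preserve[OF assms(1) _ _ assms(2,3)]) (use bf.less set_fm_pars[OF assms(1)] in auto)
  then show ?thesis by (simp add: gs_R2[OF assms(1)])
qed

text \<open>A standard number is the value of a closed term, so being equal to it is an invariant
  formula.\<close>

lemma preserve_stdv: "Q \<in> BB \<Longrightarrow> (x, x') \<in> Q \<Longrightarrow> x = stdv F k \<longleftrightarrow> x' = stdv F k"
  using preserve_L_PA[of "Var 0 \<doteq> bin_numeral k" Q "\<lambda>_. x" "\<lambda>_. x'"] by (simp add: tm_in_bin_numeral ev_bin_numeral)

text \<open>\<open>S\<close> holds only at codes of actual formulae. Such a code is standard and
  hence preserved; what remains is the satisfaction of one formula without parameters.\<close>

lemma preserve_S:
  assumes "Q \<in> BB" "(x, x') \<in> Q" "(y, y') \<in> Q"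
  shows "R2 SSym [x, y] \<longleftrightarrow> R2 SSym [x', y']"
  unfolding R2_def
  using preserve_stdv[OF assms(1,2)] preserve_L_PA[OF _ assms(1), of _ "\<lambda>_. y" "\<lambda>_. y'"] assms(3) by auto

text \<open>Distinct standard numbers differ in the model and Goedel numbering is injective, so the
  formula found by \<open>R2\<close> for this code can only be \<open>p\<close>.\<close>

lemma S_correct:
  assumes "fm_in L_PA (p :: 'a fm)" "fvb p \<le> 1"
  shows "R2 SSym [stdv F (goedel p), x] \<longleftrightarrow> gs UNIV F R \<kappa> (x ## e) p"
proof -
  have "gs UNIV F R \<kappa> (\<lambda>_. x) p \<longleftrightarrow> gs UNIV F R \<kappa> (x ## e) p" by (rule gs_cong) (use assms(2) in \<open>auto split: nat.split\<close>)
  moreover have "p' = p" if "fm_in L_PA p'" "goedel p = goedel p'" for p' :: "'a fm"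
    using goedel_inj that assms(1) by metis
  ultimately show ?thesis using assms by (auto simp: R2_def stdv_inj)
qed

lemma ev_cdt: "ev F k d (cdt K) = cd K d"
  by (induction K) (simp_all add: pr_def)

text \<open>By \<open>cd_inj\<close> the tuple decoded from \<open>y\<close> is unique, and
  \<open>g\<close> and \<open>m\<close> look at no more than \<open>r\<close> parameters, so the
  decoded ones serve as well as \<open>E\<close>.\<close>

lemma chi_iff:
  assumes r: "fvb g \<le> r" "fvb m \<le> r" "r < K" and d: "d 0 = \<gamma>" "\<And>i. i < r \<Longrightarrow> d (Suc i) = E i"
  shows "gs UNIV F R \<kappa> (x ## cd K d ## e) (chi g m K) \<longleftrightarrow>
    (\<exists>x' q. x \<noteq> x' \<and> lv \<gamma> q \<and> mt (cd K d) (cd K d) q \<and> mt x x' q)" (is "_ \<longleftrightarrow> ?r")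
proof -
  have G: "gs UNIV F R \<kappa> (d' 0 ## q ## (\<lambda>n. d' (Suc n))) g \<longleftrightarrow> lv \<gamma> q"
    and M: "gs UNIV F R \<kappa> (u ## v ## q ## (\<lambda>n. d' (Suc n))) m \<longleftrightarrow> mt u v q"
    if d': "\<And>i. i < K \<Longrightarrow> d' i = d i" for d' q u v
    unfolding lv_def mt_def by (rule gs_cong; use d' d r in \<open>auto split: nat.split\<close>)+
  show ?thesis
  proof
    assume "gs UNIV F R \<kappa> (x ## cd K d ## e) (chi g m K)"
    then have "\<exists>d'. cd K d = cd K d' \<and> (\<exists>x' q. x \<noteq> x' \<and> gs UNIV F R \<kappa> (d' 0 ## q ## (\<lambda>n. d' (Suc n))) g \<and>
      gs UNIV F R \<kappa> (cd K d ## cd K d ## q ## (\<lambda>n. d' (Suc n))) m \<and> gs UNIV F R \<kappa> (x ## x' ## q ## (\<lambda>n. d' (Suc n))) m)"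
      unfolding gs_chi ev_cdt by (elim ex_forward conjE, intro conjI, simp, simp)
    then obtain d' where "cd K d = cd K d' \<and> (\<exists>x' q. x \<noteq> x' \<and> gs UNIV F R \<kappa> (d' 0 ## q ## (\<lambda>n. d' (Suc n))) g \<and>
      gs UNIV F R \<kappa> (cd K d ## cd K d ## q ## (\<lambda>n. d' (Suc n))) m \<and> gs UNIV F R \<kappa> (x ## x' ## q ## (\<lambda>n. d' (Suc n))) m)"
      by (elim exE)
    note d' = conjunct1[OF this] conjunct2[OF this]
    have "d' i = d i" if "i < K" for i using cd_inj[OF d'(1) that] by simp
    then show ?r using d'(2) G[of d'] M[of d'] by simp
  next
    assume r: ?r
    define d' where "d' n = (if n < K then d n else (x ## cd K d ## e) (n - K))" for n
    have *: "d' i = d i" if "i < K" for i using that by (simp add: d'_def)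
    have "cd K d' = cd K d" by (rule cd_cong) (rule *)
    then show "gs UNIV F R \<kappa> (x ## cd K d ## e) (chi g m K)"
      unfolding gs_chi ev_cdt using r G[of d', OF *] M[of d', OF *]
      by (intro exI[of _ d']) (simp add: d'_def)
  qed
qed

theorem no_skolem_function:
  assumes \<theta>: "fm_in L \<theta>" "funs L \<subseteq> {Zero, One, Plus, Times}" "rels L \<subseteq> {Less, SSym}"
    and H: "\<And>v c y e. gs UNIV F R2 \<kappa> (v ## c ## y ## e) \<theta> \<longleftrightarrow> v = H c y"
  shows "\<exists>\<chi> y. fm_in L_PA \<chi> \<and> fvb \<chi> \<le> 2 \<and> (\<forall>e. (\<exists>x. gs UNIV F R \<kappa> (x ## y ## e) \<chi>) \<and>
    \<not> gs UNIV F R \<kappa> (H (stdv F (goedel \<chi>)) y ## y ## e) (\<chi> :: 'a fm))"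
proof -
  obtain as where as: "set as = set_fm \<theta>" using finite_list[OF finite_set_fm[of \<theta>]] by blast
  define r where "r = max (fvb g) (fvb m)"
  define K where "K = Suc (r + length as)"
  \<comment> \<open>Component 0 is the level, components 1 to \<open>r\<close> are the parameters of
    the game, and the rest are the parameters of \<theta>.\<close>
  define d where "d i = (if i = 0 then \<gamma> else if i \<le> r then E (i - 1) else \<kappa> (as ! (i - 1 - r)))" for i
  define a where "a = cd K d"
  define \<chi> where "\<chi> = chi g m K"
  define c where "c = stdv F (goedel \<chi>)"
  have chi: "gs UNIV F R \<kappa> (x ## a ## e) \<chi> \<longleftrightarrow> (\<exists>x' q. x \<noteq> x' \<and> lv \<gamma> q \<and> mt a a q \<and> mt x x' q)" for x e
    unfolding \<chi>_def a_def by (rule chi_iff[of r]) (auto simp: r_def K_def d_def)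
  have "\<exists>x. gs UNIV F R \<kappa> (x ## a ## e) \<chi>" for e unfolding chi using game(4)[of a] by blast
  moreover have "\<not> gs UNIV F R \<kappa> (H c a ## a ## e) \<chi>" for e
  proof
    assume "gs UNIV F R \<kappa> (H c a ## a ## e) \<chi>"
    then obtain x' q where q: "H c a \<noteq> x'" "lv \<gamma> q" "mt a a q" "mt (H c a) x' q" unfolding chi by blast
    define Q where "Q = {(x, x'). mt x x' q}"
    have Q: "Q \<in> BB" "(a, a) \<in> Q" "(H c a, x') \<in> Q" using q nonstd by (auto simp: Q_def BB_def)
    \<comment> \<open>\<open>d'\<close> lists answers to the components of \<open>a\<close>. As
      \<open>a\<close> is fixed and being the code of a tuple is invariant, \<open>d'\<close> has
      the same code as \<open>d\<close>, so the components are fixed themselves.\<close>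
    obtain Q1 d' where Q1: "Q1 \<in> BB" "Q \<subseteq> Q1" "\<forall>i<K. (d i, d' i) \<in> Q1" using bf.forth_list[OF Q(1), of K d] by blast
    have "gs UNIV F R \<kappa> (\<lambda>n. if n < K then d n else a) (Var K \<doteq> cdt K) \<longleftrightarrow>
      gs UNIV F R \<kappa> (\<lambda>n. if n < K then d' n else a) (Var K \<doteq> cdt K)"
      by (rule preserve_L_PA[OF _ Q1(1)]) (use Q1(2,3) Q(2) in \<open>auto simp: tm_in_cdt\<close>)
    then have "a = cd K (\<lambda>n. if n < K then d n else a) \<longleftrightarrow> a = cd K (\<lambda>n. if n < K then d' n else a)"
      by (simp add: ev_cdt)
    moreover have "cd K (\<lambda>n. if n < K then f n else a) = cd K f" for f by (rule cd_cong) simp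
    ultimately have dd: "cd K d = cd K d'" by (simp add: a_def)
    have d: "(d i, d i) \<in> Q1" if "i < K" for i using cd_inj[OF dd that] Q1(3)[rule_format, OF that] by simp
    \<comment> \<open>The Goedel number of \<chi> is standard, so it can only be answered by
      itself.\<close>
    obtain Q2 c' where Q2: "Q2 \<in> BB" "Q1 \<subseteq> Q2" "(c, c') \<in> Q2" using bf.forth[OF Q1(1), of c] by blast
    have "c' = c" using preserve_stdv[OF Q2(1,3), of "goedel \<chi>"] by (simp add: c_def)
    then have cc: "(c, c) \<in> Q2" using Q2(3) by simp
    have par: "(\<kappa> b, \<kappa> b) \<in> Q2" if "b \<in> set_fm \<theta>" for b
    proof -
      have "b \<in> set as" using that as by simp
      then obtain i where i: "i < length as" "b = as ! i" unfolding in_set_conv_nth by blast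
      have "d (Suc (r + i)) = \<kappa> b" by (simp add: d_def i(2))
      then show ?thesis using subsetD[OF Q2(2) d[of "Suc (r + i)"]] i(1) by (simp add: K_def)
    qed
    \<comment> \<open>Code, argument and parameters are all fixed by now, so \<theta> cannot
      separate \<open>H c a\<close> from \<open>x'\<close>, although it holds of one value
      only.\<close>
    have "gs UNIV F R2 \<kappa> (H c a ## c ## a ## (\<lambda>_. a)) \<theta> \<longleftrightarrow> gs UNIV F R2 \<kappa> (x' ## c ## a ## (\<lambda>_. a)) \<theta>"
    proof (rule bf.preserve[OF \<theta>(1,2) _ Q2(1) _ par])
      show "((H c a ## c ## a ## (\<lambda>_. a)) n, (x' ## c ## a ## (\<lambda>_. a)) n) \<in> Q2" for n
        using Q(2,3) Q1(2) Q2(2) cc by (auto split: nat.split)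
      show "R2 r [x, y] \<longleftrightarrow> R2 r [x', y']" if "r \<in> rels L" "Q \<in> BB" "(x, x') \<in> Q" "(y, y') \<in> Q" for r Q x x' y y'
        using that(1) \<theta>(3) bf.less[OF that(2-4)] preserve_S[OF that(2-4)] by auto
    qed
    then show False using q(1) unfolding H by simp
  qed
  moreover have "fm_in L_PA \<chi>" "fvb \<chi> \<le> 2" unfolding \<chi>_def
    by (rule fm_in_chi[OF g_in m_in], rule fvb_chi) (auto simp: K_def r_def)
  ultimately show ?thesis unfolding c_def by blast
qed

end

section \<open>Compactness and the main theorem\<close>

lemma PA_base_in: "p \<in> PA_base \<Longrightarrow> fm_in L_PA p"
  unfolding PA_base_def Let_def by auto

lemma PA_minus_sentence: "p \<in> PA_minus \<Longrightarrow> fm_in L_PA p \<and> fvb p = 0"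
  unfolding PA_minus_base by (auto simp: PA_base_in)

lemma induction_axiom_sentence: "Sigma_fm n p \<Longrightarrow> fm_in L_PA (induction_axiom p) \<and> fvb (induction_axiom p) = 0"
  unfolding induction_axiom_def using Sigma_fm_in(1)[of n p] by (simp add: fm_in_inst fm_in_repl)

lemma collection_axiom_sentence: "Sigma_fm n p \<Longrightarrow> fm_in L_PA (collection_axiom p) \<and> fvb (collection_axiom p) = 0"
  unfolding collection_axiom_def using Sigma_fm_in(1)[of n p] by simp

lemma B_Sigma_sentence: "p \<in> B_Sigma n \<Longrightarrow> fm_in L_PA p \<and> fvb p = 0"
proof -
  assume "p \<in> B_Sigma n"
  then consider "p \<in> PA_minus" | q where "p = induction_axiom q" "Sigma_fm 0 q" | q where "p = collection_axiom q" "Sigma_fm n q"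
    unfolding B_Sigma_def I_Sigma_def by auto
  then show ?thesis
    by cases (use PA_minus_sentence induction_axiom_sentence collection_axiom_sentence in metis)+
qed

lemma exp_axiom_sentence: "fm_in L_PA exp_axiom \<and> fvb exp_axiom = 0"
  by (simp add: exp_axiom_def beta_fm_def Let_def)

lemma gs_sentence: "fvb p = 0 \<Longrightarrow> gs D F R k e p \<longleftrightarrow> gs D F R k e' p"
  by (rule gs_cong) simp

lemma game_model_of_consistency:
  fixes U :: "'a fm set" and \<kappa> :: "'a \<Rightarrow> nat"
  assumes U: "theory_in L_PA U" and p: "p \<in> I_Sigma n" "consistent (U \<union> B_Sigma n \<union> {\<^bold>\<not> p, exp_axiom})"
  shows "\<exists>F R E (g :: 'a fm) m. (\<forall>q\<in>U \<union> PA_minus. \<forall>e. gs UNIV F R \<kappa> e q) \<and> fm_in L_PA g \<and> fm_in L_PA m \<and>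
    (\<forall>k. gs UNIV F R \<kappa> (stdv F k ## E) (psi g m))"
proof -
  let ?T = "U \<union> B_Sigma n \<union> {\<^bold>\<not> p, exp_axiom}"
  have T: "fm_in L_PA q \<and> fvb q = 0" if "q \<in> ?T" for q
  proof -
    have "fm_in L_PA p \<and> fvb p = 0"
      using p(1) PA_minus_sentence induction_axiom_sentence unfolding I_Sigma_def by auto
    then show ?thesis using that U B_Sigma_sentence exp_axiom_sentence
      unfolding theory_in_def sentence_in_def by auto
  qed
  have PA: "PA_minus \<subseteq> B_Sigma n" unfolding B_Sigma_def I_Sigma_def by blast
  obtain F :: "fsym \<Rightarrow> nat list \<Rightarrow> nat" and R e0 where FR: "\<And>q. q \<in> ?T \<union> {} \<Longrightarrow> gs UNIV F R \<kappa> e0 q"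
  proof (rule completeness_nat[of ?T "{}" \<kappa>])
    show "\<not> dv ?T {} Bot" using p(2) by (simp add: dv_empty consistent_def)
  qed (use T PA in auto)
  have gT: "gs UNIV F R \<kappa> e q" if "q \<in> ?T" for q e
    using FR[of q] gs_sentence[of q UNIV F R \<kappa> e e0] T[OF that] that by simp
  have np: "\<not> gs UNIV F R \<kappa> e p" for e using gT[of "\<^bold>\<not> p" e] by simp
  \<comment> \<open>\<open>B_Sigma n\<close> contains \<open>PA_minus\<close>, so the refuted axiom
    must be an instance of induction.\<close>
  then have "p \<notin> PA_minus" using gT PA by blast
  then obtain \<phi> where \<phi>: "p = induction_axiom \<phi>" "Sigma_fm n \<phi>" using p(1) unfolding I_Sigma_def by blast
  have "\<exists>(g::'a fm) m E0. fm_in L_PA g \<and> fm_in L_PA m \<and> (\<forall>k. gs UNIV F R \<kappa> (stdv F k ## E0) (psi g m))"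
    by (rule game_model[where n = n and \<phi> = \<phi>]) (use gT np \<phi> in auto)
  then obtain g m :: "'a fm" and E where "fm_in L_PA g" "fm_in L_PA m" "\<forall>k. gs UNIV F R \<kappa> (stdv F k ## E) (psi g m)"
    by (elim exE conjE)
  moreover have "\<forall>q\<in>U \<union> PA_minus. \<forall>e. gs UNIV F R \<kappa> e q" using gT PA by blast
  ultimately show ?thesis by (intro exI conjI)
qed

lemma dosr_structure_of_PA:
  assumes "\<And>p e. p \<in> PA_base \<Longrightarrow> gs UNIV F R \<kappa> e (p :: 'a fm)"
  obtains pl ml lt zr un where "dosr_structure pl ml lt zr un F R"
proof -
  have "dosr_structure (\<lambda>x y. F Plus [x, y]) (\<lambda>x y. F Times [x, y]) (\<lambda>x y. R Less [x, y]) (F Zero []) (F One []) F R"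
    by (intro dosr_structure.intro dosr_of_PA dosr_structure_axioms.intro) (use assms in auto)
  then show thesis by (rule that)
qed

text \<open>The new model need satisfy only \<open>U\<close>, \<open>PA_minus\<close> and the
  formula \<open>psi\<close>, in which collection has already done its work. The parameters may
  change from one model to the other, so they are quantified away and the level is the only free
  variable left.\<close>

lemma nonstandard_game:
  fixes U :: "'a fm set" and \<kappa> :: "'a \<Rightarrow> nat"
  assumes U: "theory_in L_PA U" and p: "p \<in> I_Sigma n" "consistent (U \<union> B_Sigma n \<union> {\<^bold>\<not> p, exp_axiom})"
  shows "\<exists>F R \<gamma> E (g :: 'a fm) m pl ml lt zr un. (\<forall>q\<in>U. \<forall>e. gs UNIV F R \<kappa> e q) \<and>
    nonstd_game pl ml lt zr un F R \<kappa> \<gamma> E g m"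
proof -
  obtain F0 :: "fsym \<Rightarrow> nat list \<Rightarrow> nat" and R0 E0 and g m :: "'a fm" where M0:
    "\<forall>q\<in>U \<union> PA_minus. \<forall>e. gs UNIV F0 R0 \<kappa> e q" "fm_in L_PA g" "fm_in L_PA m"
    "\<forall>k. gs UNIV F0 R0 \<kappa> (stdv F0 k ## E0) (psi g m)"
    using game_model_of_consistency[OF U p, where \<kappa> = \<kappa>] by (elim exE conjE)
  have PA: "gs UNIV F R \<kappa> e q" if "\<And>q e. q \<in> PA_minus \<Longrightarrow> gs UNIV F R \<kappa> e q" "q \<in> PA_base"
    for F :: "fsym \<Rightarrow> nat list \<Rightarrow> nat" and R e q
    using that(1)[OF PA_minus_of_base[OF that(2)]] gs_univ_closure[of F R \<kappa> q] by blast
  define r where "r = fvb (psi g m)"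
  \<comment> \<open>The level is renamed to \<open>r\<close>, behind the quantified parameters, and
    so becomes variable 0 of the quantified formula.\<close>
  define \<Psi> where "\<Psi> = (Ex ^^ r) (ren (case_nat r (\<lambda>n. n)) (psi g m))"
  have \<Psi>: "gs UNIV F R \<kappa> e \<Psi> \<longleftrightarrow> (\<exists>E. gs UNIV F R \<kappa> (e 0 ## E) (psi g m))" for F R and e :: "nat \<Rightarrow> nat"
  proof -
    have c: "(\<lambda>n. d (case_nat r (\<lambda>n. n) n)) = d r ## d" for d :: "nat \<Rightarrow> nat"
      by (rule ext) (simp split: nat.split)
    have "gs UNIV F R \<kappa> e \<Psi> \<longleftrightarrow> (\<exists>d. (\<forall>n. d (n + r) = e n) \<and> gs UNIV F R \<kappa> (e 0 ## d) (psi g m))"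
      unfolding \<Psi>_def gs_Ex_pow gs_ren c by (metis UNIV_I add_0)
    also have "\<dots> \<longleftrightarrow> (\<exists>E. gs UNIV F R \<kappa> (e 0 ## E) (psi g m))"
    proof
      assume "\<exists>E. gs UNIV F R \<kappa> (e 0 ## E) (psi g m)"
      then obtain E where E: "gs UNIV F R \<kappa> (e 0 ## E) (psi g m)" by (elim exE)
      define d where "d n = (if n < r then E n else e (n - r))" for n
      have "gs UNIV F R \<kappa> (e 0 ## d) (psi g m) \<longleftrightarrow> gs UNIV F R \<kappa> (e 0 ## E) (psi g m)"
        by (rule gs_cong) (auto simp: d_def r_def split: nat.split)
      then show "\<exists>d. (\<forall>n. d (n + r) = e n) \<and> gs UNIV F R \<kappa> (e 0 ## d) (psi g m)"
        by (intro exI[of _ d]) (simp add: E, simp add: d_def)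
    next
      assume "\<exists>d. (\<forall>n. d (n + r) = e n) \<and> gs UNIV F R \<kappa> (e 0 ## d) (psi g m)"
      then show "\<exists>E. gs UNIV F R \<kappa> (e 0 ## E) (psi g m)" by (elim ex_forward conjE)
    qed
    finally show ?thesis .
  qed
  have \<Psi>_in: "fm_in L_PA \<Psi>" "fvb \<Psi> \<le> 1"
  proof -
    have "fvb (ren (case_nat r (\<lambda>n. n)) (psi g m)) \<le> Suc r"
      by (rule fvb_ren[of _ r]) (auto simp: r_def split: nat.split)
    then show "fvb \<Psi> \<le> 1" unfolding \<Psi>_def fvb_Ex_pow by simp
    show "fm_in L_PA \<Psi>" unfolding \<Psi>_def using fm_in_psi[OF M0(2,3)] by simp
  qed
  define G where "G = insert \<Psi> (range (\<lambda>k. bin_numeral k \<prec> Var 0))"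
  obtain pl0 ml0 lt0 zr0 un0 where "dosr_structure pl0 ml0 lt0 zr0 un0 F0 R0"
    by (rule dosr_structure_of_PA[where \<kappa> = \<kappa>, OF PA]) (use M0(1) in auto)
  then interpret M0: dosr_structure pl0 ml0 lt0 zr0 un0 F0 R0 .
  have con: "\<not> dv (U \<union> PA_minus) G Bot"
  proof
    assume "dv (U \<union> PA_minus) G Bot"
    then obtain qs where qs: "set qs \<subseteq> G" "U \<union> PA_minus \<turnstile> foldr Imp qs Bot" using dv_finite by blast
    \<comment> \<open>Each hypothesis holds at all sufficiently large standard levels, so finitely
      many of them hold at a common one.\<close>
    have "\<exists>k0. \<forall>k\<ge>k0. \<forall>q\<in>set qs. gs UNIV F0 R0 \<kappa> (\<lambda>_. stdv F0 k) q"
      using qs(1)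
    proof (induction qs)
      case (Cons q qs)
      then obtain k0 where k0: "\<forall>k\<ge>k0. \<forall>q\<in>set qs. gs UNIV F0 R0 \<kappa> (\<lambda>_. stdv F0 k) q" by auto
      obtain k1 where k1: "\<forall>k\<ge>k1. gs UNIV F0 R0 \<kappa> (\<lambda>_. stdv F0 k) q"
      proof (cases "q = \<Psi>")
        case True
        show thesis by (rule that[of 0]) (use True \<Psi> spec[OF M0(4)] in \<open>auto intro!: exI[of _ E0]\<close>)
      next
        case False
        then obtain k where "q = bin_numeral k \<prec> Var 0" using Cons(2) by (auto simp: G_def)
        then show thesis by (intro that[of "Suc k"]) (simp add: M0.ev_bin_numeral M0.stdv_less)
      qed
      show ?case by (rule exI[of _ "max k0 k1"]) (use k0 k1 in auto)
    qed simp
    then obtain k where k: "\<forall>q\<in>set qs. gs UNIV F0 R0 \<kappa> (\<lambda>_. stdv F0 k) q" by blast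
    have "gs UNIV F0 R0 \<kappa> (\<lambda>_. stdv F0 k) (foldr Imp qs Bot)" by (rule soundness[OF qs(2)]) (use M0(1) in blast)
    then show False using k by (simp add: gs_foldr_Imp)
  qed
  have T: "fm_in L_PA q \<and> fvb q = 0" if "q \<in> U \<union> PA_minus" for q
    using that U PA_minus_sentence unfolding theory_in_def sentence_in_def by auto
  have G: "fm_in L_PA q \<and> fvb q \<le> 1" if "q \<in> G" for q
    using that \<Psi>_in unfolding G_def by (auto simp: tm_in_bin_numeral fvb_bin_numeral)
  obtain F :: "fsym \<Rightarrow> nat list \<Rightarrow> nat" and R e where M:
    "\<And>q. q \<in> (U \<union> PA_minus) \<union> G \<Longrightarrow> gs UNIV F R \<kappa> e q"
    by (rule completeness_nat[OF T G con, where \<kappa> = \<kappa>]) auto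
  have U': "gs UNIV F R \<kappa> e' q" if "q \<in> U \<union> PA_minus" for e' q
    using M[of q] gs_sentence[of q UNIV F R \<kappa> e e'] T[OF that] that by auto
  have "\<exists>E. gs UNIV F R \<kappa> (e 0 ## E) (psi g m)" using M[of \<Psi>] unfolding \<Psi> G_def by simp
  then obtain E where E: "gs UNIV F R \<kappa> (e 0 ## E) (psi g m)" by (elim exE)
  have "gs UNIV F R \<kappa> e' q" if "q \<in> PA_minus" for e' q using U' that by blast
  then obtain pl ml lt zr un where "dosr_structure pl ml lt zr un F R"
    by (rule dosr_structure_of_PA[where \<kappa> = \<kappa>, OF PA])
  then interpret N: dosr_structure pl ml lt zr un F R .
  have "lt (stdv F k) (e 0)" for k
    using M[of "bin_numeral k \<prec> Var 0"] by (simp add: G_def N.ev_bin_numeral)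
  then have N: "nonstd_game pl ml lt zr un F R \<kappa> (e 0) E g m"
    by unfold_locales (use M0(2,3) E in auto)
  have "\<forall>q\<in>U. \<forall>e. gs UNIV F R \<kappa> e q" using U' by blast
  with N show ?thesis by (intro exI conjI)
qed

section \<open>From structures on \<open>nat\<close> to models inside the type
  \<open>'a\<close>\<close>

lemma gs_of_sat:
  assumes h: "inj h" and M: "univ M = range h" "\<And>f as. fint M f as = h (F f (map (inv h) as))" "\<And>r as. rint M r as = R r (map (inv h) as)"
  shows "set_fm p \<subseteq> range h \<Longrightarrow> sat M (\<lambda>n. h (e n)) p \<longleftrightarrow> gs UNIV F R (inv h) e p"
proof (induction p arbitrary: e)
  have ev: "set_tm t \<subseteq> range h \<Longrightarrow> eval M (\<lambda>n. h (e n)) t = h (ev F (inv h) e t)" for t e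
  proof (induction t)
    case (Par a)
    then show ?case using h by auto
  next
    case (Fn f ts)
    have "map (inv h) (map (eval M (\<lambda>n. h (e n))) ts) = map (ev F (inv h) e) ts"
      using Fn h by (auto simp: UN_subset_iff)
    then show ?case by (simp only: eval.simps ev.simps M)
  qed simp
  {
    case (Eq s t)
    then show ?case using ev h by (simp add: inj_eq)
  next
    case (Rel r ts)
    have "map (inv h) (map (eval M (\<lambda>n. h (e n))) ts) = map (ev F (inv h) e) ts"
      using Rel ev h by (auto simp: UN_subset_iff)
    then show ?case by (simp only: sat.simps gs.simps M)
  next
    case (All p)
    have "case_nat (h a) (\<lambda>n. h (e n)) = (\<lambda>n. h ((a ## e) n))" for a by (rule ext) (simp split: nat.split)
    then show ?case using All by (simp add: M)
  }
qed auto

lemma true_in_iff_gs: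
  assumes h: "inj h" and M: "univ M = range h" "\<And>f as. fint M f as = h (F f (map (inv h) as))" "\<And>r as. rint M r as = R r (map (inv h) as)"
    and p: "set_fm p \<subseteq> range h"
  shows "true_in M p \<longleftrightarrow> (\<forall>e. gs UNIV F R (inv h) e p)"
proof
  assume t: "true_in M p"
  show "\<forall>e. gs UNIV F R (inv h) e p"
  proof
    fix e :: "nat \<Rightarrow> _"
    have "range (\<lambda>n. h (e n)) \<subseteq> univ M" by (auto simp: M(1))
    then have "sat M (\<lambda>n. h (e n)) p" using t unfolding true_in_def by simp
    then show "gs UNIV F R (inv h) e p" using gs_of_sat[OF h M p, of e] by simp
  qed
next
  assume t: "\<forall>e. gs UNIV F R (inv h) e p"
  show "true_in M p" unfolding true_in_def
  proof (intro allI impI)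
    fix e :: "nat \<Rightarrow> _" assume e: "range e \<subseteq> univ M"
    have "(\<lambda>n. h (inv h (e n))) = e"
      by (rule ext) (rule f_inv_into_f[OF subsetD[OF e[unfolded M(1)] rangeI]])
    then show "sat M e p" using gs_of_sat[OF h M p, of "\<lambda>n. inv h (e n)"] t by simp
  qed
qed

theorem theorem46:
  fixes n :: nat and U :: "'a fm set"
  assumes "infinite (UNIV :: 'a set)"
    and "theory_in L_PA U"
    and "sequential L_PA U"
    and "interprets_S12_by_id U"
    and "\<exists>p \<in> I_Sigma n. consistent (U \<union> B_Sigma n \<union> {\<^bold>\<not> p, exp_axiom})"
  shows "\<not> semantically_defines L_PA_S (USB U) L_PA_H (US U) L_PA"
proof
  assume sd: "semantically_defines L_PA_S (USB U) L_PA_H (US U) L_PA"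
  \<comment> \<open>A copy of \<open>nat\<close> inside \<open>'a\<close> carries the model, and
    \<open>inv h\<close> reads the names of its elements.\<close>
  obtain h :: "nat \<Rightarrow> 'a" where h: "inj h" using infinite_countable_subset[OF assms(1)] by blast
  obtain p where p: "p \<in> I_Sigma n" "consistent (U \<union> B_Sigma n \<union> {\<^bold>\<not> p, exp_axiom})" using assms(5) by blast
  obtain F :: "fsym \<Rightarrow> nat list \<Rightarrow> nat" and R \<gamma> E and g m :: "'a fm" and pl ml lt zr un where
    U: "\<forall>q\<in>U. \<forall>e. gs UNIV F R (inv h) e q" and N: "nonstd_game pl ml lt zr un F R (inv h) \<gamma> E g m"
    using nonstandard_game[OF assms(2) p, where \<kappa> = "inv h"] by (elim exE conjE)
  interpret N: nonstd_game pl ml lt zr un F R "inv h" \<gamma> E g m by (rule N)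
  define M where "M = \<lparr>univ = range h, fint = \<lambda>f as. h (F f (map (inv h) as)), rint = \<lambda>r as. N.R2 r (map (inv h) as)\<rparr>"
  have M: "univ M = range h" "\<And>f as. fint M f as = h (F f (map (inv h) as))" "\<And>r as. rint M r as = N.R2 r (map (inv h) as)"
    by (simp_all add: M_def)
  note true = true_in_iff_gs[OF h M]
  let ?s = "gs UNIV F N.R2 (inv h)"
  have UF: "fm_in L_PA q" if "q \<in> U" for q using that assms(2) unfolding theory_in_def sentence_in_def by blast
  have "true_in M q" if q: "q \<in> USB U" for q
  proof (cases "q \<in> U")
    case True
    then show ?thesis using true[of q] set_fm_pars[OF UF[OF True]] N.gs_R2[OF UF[OF True]] U by simp
  next
    case False
    then obtain p where p: "q = All (Rel SSym [bin_numeral (goedel p), Var 0] \<^bold>\<leftrightarrow> p)" "fm_in L_PA p" "fvb p \<le> 1"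
      using q unfolding USB_def by blast
    have "?s e q" for e
      unfolding p(1) gs.simps gs_connectives using N.S_correct[OF p(2,3)] N.gs_R2[OF p(2)] by (simp add: N.ev_bin_numeral)
    moreover have "set_fm q \<subseteq> range h"
      using set_fm_pars[OF p(2)] set_tm_pars[OF tm_in_bin_numeral[where ?'a = 'a, of "goedel p"]] by (simp add: p(1))
    ultimately show ?thesis using true[of q] by blast
  qed
  moreover have "model_of_lang L_PA_S M" by (auto simp: model_of_lang_def M)
  ultimately have "models L_PA_S M (USB U)" by (simp add: models_def)
  then have "syntactically_defines (with_pars L_PA_S M) (ElDiag L_PA_S M) L_PA_H (US U) (with_pars L_PA M)"
    using sd unfolding semantically_defines_def by blast
  then obtain \<tau> where \<tau>: "translation_into (with_pars L_PA_S M) L_PA_H (with_pars L_PA M) \<tau>"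
    "\<forall>f\<in>funs (L_PA_H :: 'a lang) - funs (with_pars L_PA M). ElDiag L_PA_S M \<turnstile> total_functional (far f) (tfun \<tau> f)"
    "\<forall>p\<in>US U. ElDiag L_PA_S M \<turnstile> tr (with_pars L_PA M) \<tau> p"
    unfolding syntactically_defines_def by (elim exE conjE) (rule that)
  define \<theta> where "\<theta> = tfun \<tau> HSym"
  have HS: "HSym \<in> funs (L_PA_H :: 'a lang) - funs (with_pars L_PA M)" by (simp add: L_PA_H_def with_pars_def)
  have "fm_in (with_pars L_PA_S M) \<theta> \<and> fvb \<theta> \<le> far HSym + 1"
    using \<tau>(1) HS unfolding translation_into_def \<theta>_def by blast
  then have \<theta>: "fm_in (with_pars L_PA_S M) \<theta>" "fvb \<theta> \<le> 3" by simp_all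
  have ElD: "?s e q" if "ElDiag L_PA_S M \<turnstile> q" for q e
  proof (rule soundness[OF that])
    fix q e assume "q \<in> ElDiag L_PA_S M"
    then have q: "fm_in (with_pars L_PA_S M) q" "true_in M q" by (auto simp: ElDiag_def sentence_in_def)
    have "set_fm q \<subseteq> range h" using set_fm_pars[OF q(1)] by (simp add: with_pars_def M)
    then show "?s e q" using true q(2) by blast
  qed
  have tf: "?s e (total_functional 2 \<theta>)" for e using ElD[OF bspec[OF \<tau>(2) HS]] by (simp add: \<theta>_def)
  \<comment> \<open>Only the variables 0, 1 and 2 occur in \<theta>, so the tail of the assignment
    is arbitrary; \<open>y\<close> merely fills it.\<close>
  define H where "H c y = (THE v. ?s (v ## c ## y ## (\<lambda>_. y)) \<theta>)" for c y
  have H: "?s (v ## c ## y ## e) \<theta> \<longleftrightarrow> v = H c y" for v c y e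
  proof -
    have "?s (v ## c ## y ## e) \<theta> \<longleftrightarrow> ?s (v ## c ## y ## (\<lambda>_. y)) \<theta>"
      by (rule gs_cong) (use \<theta>(2) in \<open>auto split: nat.split\<close>)
    moreover have "\<exists>!v. ?s (v ## c ## y ## (\<lambda>_. y)) \<theta>"
      using gs_total_functional[OF tf] by blast
    from theI'[OF this] this have "?s (v ## c ## y ## (\<lambda>_. y)) \<theta> \<longleftrightarrow> v = H c y"
      unfolding H_def by blast
    ultimately show ?thesis by simp
  qed
  \<comment> \<open>The expansion in which the translated axioms of \<open>US U\<close> are to be
    read.\<close>
  define F' where "F' f xs = (if f = HSym then H (xs ! 0) (xs ! 1) else F f xs)" for f xs
  interpret X: expansion F N.R2 "inv h" "with_pars L_PA M" \<tau> H F'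
    by unfold_locales (simp_all add: with_pars_def F'_def H[unfolded \<theta>_def])
  have "\<exists>\<chi> y. fm_in L_PA \<chi> \<and> fvb \<chi> \<le> 2 \<and> (\<forall>e. (\<exists>x. gs UNIV F R (inv h) (x ## y ## e) \<chi>) \<and>
    \<not> gs UNIV F R (inv h) (H (stdv F (goedel \<chi>)) y ## y ## e) \<chi>)"
    by (rule N.no_skolem_function[OF \<theta>(1) _ _ H]) (simp_all add: with_pars_def L_PA_S_def)
  then obtain \<chi> y where \<chi>: "fm_in L_PA \<chi>" "fvb \<chi> \<le> 2" "\<forall>e. (\<exists>x. gs UNIV F R (inv h) (x ## y ## e) \<chi>) \<and>
    \<not> gs UNIV F R (inv h) (H (stdv F (goedel \<chi>)) y ## y ## e) \<chi>" by (elim exE conjE)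
  let ?q = "All (Ex \<chi> \<^bold>\<rightarrow> inst (Fn HSym [bin_numeral (goedel \<chi>), Var 0]) \<chi>)"
  have q: "?q \<in> US U" unfolding US_def using \<chi>(1,2) by blast
  have mono: "tm_in L_PA t \<Longrightarrow> tm_in L_PA_H t" for t :: "'a tm"
    by (induction t) (auto simp: L_PA_H_def list_all_iff)
  have mono': "fm_in L_PA q \<Longrightarrow> fm_in L_PA_H q" for q :: "'a fm"
    by (induction q) (use mono in \<open>auto simp: L_PA_H_def list_all_iff\<close>)
  have "fm_in L_PA_H ?q"
    using mono'[OF \<chi>(1)] mono[OF tm_in_bin_numeral] by (auto intro!: fm_in_inst simp: L_PA_H_def)
  then have "gs UNIV F' N.R2 (inv h) (\<lambda>_. y) ?q"
    using X.tr_correct ElD[OF bspec[OF \<tau>(3) q]] by blast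
  moreover have "gs UNIV F' N.R2 (inv h) e \<chi> \<longleftrightarrow> gs UNIV F R (inv h) e \<chi>" for e
    by (rule gs_cong_struct[OF \<chi>(1)]) (auto simp: F'_def)
  moreover have "ev F' (inv h) e (bin_numeral k :: 'a tm) = stdv F k" for e k
  proof -
    have "ev F' (inv h) e (bin_numeral k :: 'a tm) = ev F (inv h) e (bin_numeral k)"
      by (rule ev_cong_struct[OF tm_in_bin_numeral]) (auto simp: F'_def)
    then show ?thesis by (simp add: N.ev_bin_numeral)
  qed
  ultimately show False using spec[OF \<chi>(3), of "\<lambda>_. y"] by (simp add: gs_inst F'_def) blast
qed

end
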